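(* There is an $(\mathcal H,\mathcal F_{\mathcal H})$-valued random variable $\bar W$ whose distribution $\mu$ is uniquely determined by the following two properties (that is, there exists exactly one probability measure $\mu$ on $(\mathcal H,\mathcal F_{\mathcal H})$ such that an $(\mathcal H,\mathcal F_{\mathcal H})$-valued random variable with distribution $\mu$ has both properties): (i) its finite-dimensional distributions are those of coalescing Brownian motions (with unit diffusion constant); (ii) for all $-\infty<t_0<\infty$, $0<t<\infty$ and $-\infty<a\le b<\infty$, $$E_\mu\bigl(\eta(t_0,t;a,b)\bigr)=1+\frac{b-a}{\sqrt{\pi t}}.$$
   Context: **Path space.** For $x,t\in[-\infty,\infty]$ put $\Phi(x,t)=\frac{\tanh(x)}{1+|t|}$ and $\Psi(t)=\tanh(t)$, with $\tanh(\pm\infty)=\pm1$ and $\Phi(x,\pm\infty)=0$. For $t_0\in[-\infty,\infty]$ let $C[t_0]$ be the set of functions $f:[t_0,\infty]\to[-\infty,\infty]$ such that $t\mapsto\Phi(f(t),t)$ is continuous. Let $\Pi=\bigcup_{t_0\in[-\infty,\infty]}C[t_0]\times\{t_0\}$; an element $(f,t_0)$ is a path starting at the space-time point $(f(t_0),t_0)$. For $(f,t_0)\in\Pi$ let $\hat f:[-\infty,\infty]\to[-\infty,\infty]$ be the extension of $f$ with $\hat f(t)=f(t_0)$ for $t<t_0$. Define $$d((f_1,t_1),(f_2,t_2))=\Bigl(\sup_t|\Phi(\hat f_1(t),t)-\Phi(\hat f_2(t),t)|\Bigr)\vee|\Psi(t_1)-\Psi(t_2)|,$$ where elements of $\Pi$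 at $d$-distance $0$ are identified. $(\Pi,d)$ is a complete separable metric space. **The space $\mathcal H$.** $\mathcal H$ is the set of (nonempty) compact subsets of $(\Pi,d)$ with the Hausdorff metric $d_{\mathcal H}$ induced by $d$, and $\mathcal F_{\mathcal H}$ is its Borel $\sigma$-field. **Touching and counting variable.** A path $(f,t_* )$ touches a point $(x,s)\in\mathbb R^2$ if $s\ge t_*$ and $f(s)=x$. For $t_0\in\mathbb R$, $t>0$, $a\le b$, the $\{0,1,\ldots,\infty\}$-valued random variable $\eta(t_0,t;a,b)$ is the number of distinct points in $\mathbb R\times\{t_0+t\}$ that are touched by paths in $\bar W$ which also touch some point of $[a,b]\times\{t_0\}$. **Finite-dimensional distributions and coalescing Brownian motions.** The finite-dimensional distributions of $\bar W$ are the induced probability measures $\mu_{(x_1,t_1;\ldots;x_n,t_n)}$ on the subsets of paths of $\bar W$ starting from any finite deterministic set of points $(x_1,t_1),\ldots,(x_n,t_n)\in\mathbb R^2$. Coalescing Brownian motions (unit diffusion constant) starting from $(x_1,t_1),\ldots,(x_n,t_n)$ are the paths $\tilde W_1,\ldots,\tilde W_n\in\Pi$ obtained as follows: let $B_1,\dots,B_n$ be independent standard Brownian motions, let $W_j$ be the path $t\mapsto x_j+B_j(t-t_j)$ started at time $t_j$, and inductively let $\tilde W_j$ follow $W_j$ until it first meets some $\tilde W_k$ with $k<j$, after which it follows $\tilde W_k$. Property (i) thus means: for every finite deterministic set of points $(x_1,t_1),\ldots,(x_n,t_n)\in\mathbb R^2$, almost surely $\bar W$ contains exactly one path starting from each $(x_i,t_i)$,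 and these $n$ paths are jointly distributed as coalescing Brownian motions starting from these points. *)

theory Defs
  imports "HOL-Probability.Probability"
begin

section \<open>Path space\<close>

definition tanh_ereal :: "ereal \<Rightarrow> real" where
  "tanh_ereal x = (case x of ereal r \<Rightarrow> tanh r | PInfty \<Rightarrow> 1 | MInfty \<Rightarrow> - 1)"

definition Phi :: "ereal \<Rightarrow> ereal \<Rightarrow> real" where
  "Phi x t = (case t of ereal r \<Rightarrow> tanh_ereal x / (1 + \<bar>r\<bar>) | PInfty \<Rightarrow> 0 | MInfty \<Rightarrow> 0)"

definition Psi :: "ereal \<Rightarrow> real" where
  "Psi t = tanh_ereal t"

text \<open>
  A function on the interval from \<open>t0\<close> to \<open>\<infinity>\<close> is represented by a total function. Its values below
  \<open>t0\<close> are never inspected: neither the continuity condition nor \<open>path_hat\<close> depends on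
  them, so the quotient below discards them.
\<close>

definition raw_paths :: "((ereal \<Rightarrow> ereal) \<times> ereal) set" where
  "raw_paths = {(f, t0). continuous_on {t0..\<infinity>} (\<lambda>t. Phi (f t) t)}"

fun path_hat :: "(ereal \<Rightarrow> ereal) \<times> ereal \<Rightarrow> ereal \<Rightarrow> ereal" where
  "path_hat (f, t0) t = (if t < t0 then f t0 else f t)"

definition raw_dist :: "(ereal \<Rightarrow> ereal) \<times> ereal \<Rightarrow> (ereal \<Rightarrow> ereal) \<times> ereal \<Rightarrow> real" where
  "raw_dist p q =
     max (SUP t. \<bar>Phi (path_hat p t) t - Phi (path_hat q t) t\<bar>) \<bar>Psi (snd p) - Psi (snd q)\<bar>"

definition path_eq :: "(ereal \<Rightarrow> ereal) \<times> ereal \<Rightarrow> (ereal \<Rightarrow> ereal) \<times> ereal \<Rightarrow> bool" where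
  "path_eq p q \<longleftrightarrow> p \<in> raw_paths \<and> q \<in> raw_paths \<and> raw_dist p q = 0"

lemma tanh_ereal_simps [simp]:
  "tanh_ereal (ereal r) = tanh r" "tanh_ereal \<infinity> = 1" "tanh_ereal (- \<infinity>) = - 1"
  by (simp_all add: tanh_ereal_def)

lemma tanh_real_bounds': "- 1 < tanh (r::real)" "tanh (r::real) < 1"
  using tanh_real_bounds[of r] by auto

lemma abs_tanh_ereal_le: "\<bar>tanh_ereal x\<bar> \<le> 1"
  using tanh_real_bounds'[of "real_of_ereal x"] by (cases x) auto

lemma tanh_ereal_inject: "tanh_ereal x = tanh_ereal y \<longleftrightarrow> x = y"
proof -
  have "tanh r \<noteq> 1" "tanh r \<noteq> - 1" "1 \<noteq> tanh r" "- 1 \<noteq> tanh r" for r :: real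
    using tanh_real_bounds'[of r] by linarith+
  then show ?thesis
    by (cases x; cases y) (auto simp: inj_eq[OF strict_mono_imp_inj_on[OF tanh_real_strict_mono]])
qed

lemma abs_Phi_le: "\<bar>Phi x t\<bar> \<le> 1"
proof (cases t)
  case (real r)
  have "\<bar>tanh_ereal x\<bar> \<le> 1 + \<bar>r\<bar>"
    using abs_tanh_ereal_le[of x] by linarith
  then show ?thesis
    using real by (simp add: Phi_def divide_le_eq)
qed (auto simp: Phi_def)

lemma Phi_real_inject: "Phi x (ereal r) = Phi y (ereal r) \<longleftrightarrow> x = y"
proof -
  have "1 + \<bar>r\<bar> \<noteq> 0" by linarith
  then show ?thesis by (simp add: Phi_def tanh_ereal_inject)
qed

lemma bdd_Phi: "bdd_above (range (\<lambda>t. \<bar>Phi (path_hat p t) t - Phi (path_hat q t) t\<bar>))"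
proof (rule bdd_aboveI2)
  fix t
  show "\<bar>Phi (path_hat p t) t - Phi (path_hat q t) t\<bar> \<le> 2"
    using abs_Phi_le[of "path_hat p t" t] abs_Phi_le[of "path_hat q t" t] by linarith
qed

lemma raw_dist_ge:
  "\<bar>Phi (path_hat p t) t - Phi (path_hat q t) t\<bar> \<le> raw_dist p q"
  "\<bar>Psi (snd p) - Psi (snd q)\<bar> \<le> raw_dist p q"
  using cSUP_upper[OF UNIV_I bdd_Phi, of p t q] unfolding raw_dist_def by auto

lemma raw_dist_leI:
  assumes "\<And>t. \<bar>Phi (path_hat p t) t - Phi (path_hat q t) t\<bar> \<le> c"
    and "\<bar>Psi (snd p) - Psi (snd q)\<bar> \<le> c"
  shows "raw_dist p q \<le> c"
  unfolding raw_dist_def using assms by (auto intro: cSUP_least)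

lemma raw_dist_nonneg: "0 \<le> raw_dist p q"
  using raw_dist_ge(2)[of p q] by linarith

lemma raw_dist_self: "raw_dist p p = 0"
  by (rule antisym[OF raw_dist_leI raw_dist_nonneg]) auto

lemma raw_dist_commute: "raw_dist p q = raw_dist q p"
  unfolding raw_dist_def by (simp add: abs_minus_commute)

lemma raw_dist_triangle: "raw_dist p r \<le> raw_dist p q + raw_dist q r"
proof (rule raw_dist_leI)
  show "\<bar>Phi (path_hat p t) t - Phi (path_hat r t) t\<bar> \<le> raw_dist p q + raw_dist q r" for t
    using raw_dist_ge(1)[of p t q] raw_dist_ge(1)[of q t r] by linarith
  show "\<bar>Psi (snd p) - Psi (snd r)\<bar> \<le> raw_dist p q + raw_dist q r"
    using raw_dist_ge(2)[of p q] raw_dist_ge(2)[of q r] by linarith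
qed

lemma raw_dist_cong:
  assumes "raw_dist p p' = 0" "raw_dist q q' = 0"
  shows "raw_dist p q = raw_dist p' q'"
  using raw_dist_triangle[of p q p'] raw_dist_triangle[of p' q q']
    raw_dist_triangle[of p' q' p] raw_dist_triangle[of p q' q]
    raw_dist_commute[of p p'] raw_dist_commute[of q q'] assms
  by linarith

lemma path_eq_start: "path_eq p q \<Longrightarrow> snd p = snd q"
  using raw_dist_ge(2)[of p q] by (auto simp: path_eq_def Psi_def tanh_ereal_inject)

lemma path_eq_hat: "path_eq p q \<Longrightarrow> path_hat p (ereal s) = path_hat q (ereal s)"
  using raw_dist_ge(1)[of p "ereal s" q] by (auto simp: path_eq_def Phi_real_inject)

quotient_type bw_path = "(ereal \<Rightarrow> ereal) \<times> ereal" / partial: path_eq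
proof (rule part_equivpI)
  have "(\<lambda>_. 0, \<infinity>) \<in> raw_paths"
    by (simp add: raw_paths_def)
  then show "\<exists>p. path_eq p p"
    by (auto simp: path_eq_def raw_dist_self)
  show "symp path_eq"
    by (auto intro!: sympI simp: path_eq_def raw_dist_commute)
  show "transp path_eq"
  proof (rule transpI)
    fix p q r
    assume "path_eq p q" "path_eq q r"
    then show "path_eq p r"
      using raw_dist_triangle[of p r q] raw_dist_nonneg[of p r] by (auto simp: path_eq_def)
  qed
qed

instantiation bw_path :: metric_space
begin

lift_definition dist_bw_path :: "bw_path \<Rightarrow> bw_path \<Rightarrow> real" is raw_dist
  by (simp add: path_eq_def raw_dist_cong)

definition uniformity_bw_path :: "(bw_path \<times> bw_path) filter" where
  "uniformity_bw_path = (INF e\<in>{0<..}. principal {(x, y). dist x y < e})"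

definition open_bw_path :: "bw_path set \<Rightarrow> bool" where
  "open_bw_path U \<longleftrightarrow> (\<forall>x\<in>U. eventually (\<lambda>(x', y). x' = x \<longrightarrow> y \<in> U) uniformity)"

instance
proof
  show "(uniformity :: (bw_path \<times> bw_path) filter)
      = (INF e\<in>{0<..}. principal {(x, y). dist x y < e})"
    by (rule uniformity_bw_path_def)
  show "open U \<longleftrightarrow> (\<forall>x\<in>U. eventually (\<lambda>(x', y). x' = x \<longrightarrow> y \<in> U) uniformity)"
    for U :: "bw_path set"
    by (rule open_bw_path_def)
  show "dist x y = 0 \<longleftrightarrow> x = y" for x y :: bw_path
    by transfer (simp add: path_eq_def)
  show "dist x y \<le> dist x z + dist y z" for x y z :: bw_path
    by transfer (metis raw_dist_triangle raw_dist_commute)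
qed

end

lift_definition path_start :: "bw_path \<Rightarrow> ereal" is snd
  by (rule path_eq_start)

lift_definition touches :: "bw_path \<Rightarrow> real \<times> real \<Rightarrow> bool" is
  "\<lambda>(f, t0) (x, s). t0 \<le> ereal s \<and> f (ereal s) = ereal x"
proof (rule ext, clarsimp)
  fix f g t0 t1 x s
  assume *: "path_eq (f, t0) (g, t1)"
  then have "t0 = t1" using path_eq_start by fastforce
  then show "(t0 \<le> ereal s \<and> f (ereal s) = ereal x) = (t1 \<le> ereal s \<and> g (ereal s) = ereal x)"
    using path_eq_hat[OF *, of s] by (auto simp: leD split: if_splits)
qed

definition starts_at :: "bw_path \<Rightarrow> real \<times> real \<Rightarrow> bool" where
  "starts_at p z \<longleftrightarrow> path_start p = ereal (snd z) \<and> touches p z"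

text \<open>
  The path with finite starting time \<open>t0\<close> that follows the real function \<open>g\<close>, which should be
  continuous from \<open>t0\<close> on. The value chosen at time \<open>\<infinity>\<close> is immaterial in the quotient.
\<close>

definition real_path :: "(real \<Rightarrow> real) \<Rightarrow> real \<Rightarrow> bw_path" where
  "real_path g t0 = abs_bw_path (\<lambda>s. ereal (g (real_of_ereal s)), ereal t0)"


section \<open>Nonempty compact sets with the Hausdorff metric\<close>

typedef (overloaded) 'a compacts = "{K :: 'a::metric_space set. compact K \<and> K \<noteq> {}}"
  morphisms set_of_compacts Abs_compacts
  by (rule exI[of _ "{undefined}"]) simp

definition hausdorff_dist :: "'a::metric_space set \<Rightarrow> 'a set \<Rightarrow> real" where
  "hausdorff_dist K L = max (SUP x\<in>K. infdist x L) (SUP y\<in>L. infdist y K)"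

lemma bdd_infdist:
  fixes K :: "'a::metric_space set"
  assumes "compact K"
  shows "bdd_above ((\<lambda>x. infdist x L) ` K)"
  using assms
  by (intro bounded_imp_bdd_above compact_imp_bounded compact_continuous_image continuous_intros)

lemma infdist_le_hausdorff:
  assumes "compact K" "compact L"
  shows "x \<in> K \<Longrightarrow> infdist x L \<le> hausdorff_dist K L"
    and "y \<in> L \<Longrightarrow> infdist y K \<le> hausdorff_dist K L"
  unfolding hausdorff_dist_def
  using cSUP_upper[OF _ bdd_infdist[OF assms(1)]] cSUP_upper[OF _ bdd_infdist[OF assms(2)]]
  by (auto intro: max.coboundedI1 max.coboundedI2)

lemma hausdorff_dist_commute: "hausdorff_dist K L = hausdorff_dist L K"
  by (simp add: hausdorff_dist_def max.commute)

lemma infdist_triangle_compact: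
  assumes "compact L" "L \<noteq> {}" "compact M" "M \<noteq> {}"
  shows "infdist x M \<le> infdist x L + hausdorff_dist L M"
proof -
  obtain y where y: "y \<in> L" "infdist x L = dist x y"
    using continuous_attains_inf[OF assms(1,2) continuous_on_dist[OF continuous_on_const continuous_on_id]]
    by (metis assms(2) cINF_greatest infdist_le infdist_notempty order_antisym)
  have "infdist x M \<le> infdist y M + dist x y"
    by (rule infdist_triangle)
  also have "infdist y M \<le> hausdorff_dist L M"
    using infdist_le_hausdorff(1)[OF assms(1,3) y(1)] .
  finally show ?thesis using y(2) by simp
qed

lemma hausdorff_dist_triangle:
  assumes "compact K" "K \<noteq> {}" "compact L" "L \<noteq> {}" "compact M" "M \<noteq> {}"
  shows "hausdorff_dist K M \<le> hausdorff_dist K L + hausdorff_dist L M"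
proof -
  have "infdist x M \<le> hausdorff_dist K L + hausdorff_dist L M" if "x \<in> K" for x
    using infdist_triangle_compact[OF assms(3-6), of x] infdist_le_hausdorff(1)[OF assms(1,3) that]
    by linarith
  moreover have "infdist x K \<le> hausdorff_dist K L + hausdorff_dist L M" if "x \<in> M" for x
    using infdist_triangle_compact[OF assms(3,4,1,2), of x]
      infdist_le_hausdorff(2)[OF assms(3,5) that] hausdorff_dist_commute[of K L]
    by linarith
  ultimately show ?thesis
    unfolding hausdorff_dist_def[of K M] using assms(2,6) by (auto intro!: cSUP_least)
qed

lemma hausdorff_dist_eq_0:
  assumes "compact K" "K \<noteq> {}" "compact L" "L \<noteq> {}" "hausdorff_dist K L = 0"
  shows "K \<subseteq> L"
proof
  fix x assume "x \<in> K"
  then have "infdist x L = 0"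
    using infdist_le_hausdorff(1)[OF assms(1,3), of x] infdist_nonneg[of x L] assms(5) by simp
  then show "x \<in> L"
    using in_closed_iff_infdist_zero[OF compact_imp_closed[OF assms(3)] assms(4)] by simp
qed

lemma hausdorff_dist_self: "K \<noteq> {} \<Longrightarrow> hausdorff_dist K K = 0"
  by (simp add: hausdorff_dist_def)

instantiation compacts :: (metric_space) metric_space
begin

definition dist_compacts :: "'a compacts \<Rightarrow> 'a compacts \<Rightarrow> real" where
  "dist_compacts K L = hausdorff_dist (set_of_compacts K) (set_of_compacts L)"

definition uniformity_compacts :: "('a compacts \<times> 'a compacts) filter" where
  "uniformity_compacts = (INF e\<in>{0<..}. principal {(x, y). dist x y < e})"

definition open_compacts :: "'a compacts set \<Rightarrow> bool" where
  "open_compacts U \<longleftrightarrow> (\<forall>x\<in>U. eventually (\<lambda>(x', y). x' = x \<longrightarrow> y \<in> U) uniformity)"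

instance
proof
  show "(uniformity :: ('a compacts \<times> 'a compacts) filter)
      = (INF e\<in>{0<..}. principal {(x, y). dist x y < e})"
    by (rule uniformity_compacts_def)
  show "open U \<longleftrightarrow> (\<forall>x\<in>U. eventually (\<lambda>(x', y). x' = x \<longrightarrow> y \<in> U) uniformity)"
    for U :: "'a compacts set"
    by (rule open_compacts_def)
  have K: "compact (set_of_compacts K)" "set_of_compacts K \<noteq> {}" for K :: "'a compacts"
    using set_of_compacts[of K] by auto
  show "dist x y = 0 \<longleftrightarrow> x = y" for x y :: "'a compacts"
  proof
    assume "dist x y = 0"
    then have "set_of_compacts x = set_of_compacts y"
      using hausdorff_dist_eq_0[OF K K, of x y] hausdorff_dist_eq_0[OF K K, of y x]
        hausdorff_dist_commute[of "set_of_compacts x" "set_of_compacts y"]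
      by (auto simp: dist_compacts_def)
    then show "x = y"
      by (simp add: set_of_compacts_inject)
  qed (simp add: dist_compacts_def hausdorff_dist_self K)
  show "dist x y \<le> dist x z + dist y z" for x y z :: "'a compacts"
    using hausdorff_dist_triangle[OF K K K, of x y z]
      hausdorff_dist_commute[of "set_of_compacts z" "set_of_compacts y"]
    by (simp add: dist_compacts_def)
qed

end


section \<open>The counting variable\<close>

definition eta :: "real \<Rightarrow> real \<Rightarrow> real \<Rightarrow> real \<Rightarrow> bw_path compacts \<Rightarrow> ennreal" where
  "eta t0 t a b K = emeasure (count_space UNIV)
     {z \<in> UNIV \<times> {t0 + t}. \<exists>p\<in>set_of_compacts K.
        touches p z \<and> (\<exists>y \<in> {a..b} \<times> {t0}. touches p y)}"


section \<open>Coalescing Brownian motions\<close>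

text \<open>Only the values \<open>B s\<close> for \<open>s \<ge> 0\<close> are constrained.\<close>

definition standard_BM :: "'b measure \<Rightarrow> (real \<Rightarrow> 'b \<Rightarrow> real) \<Rightarrow> bool" where
  "standard_BM M B \<longleftrightarrow>
     prob_space M \<and>
     (\<forall>s\<ge>0. B s \<in> borel_measurable M) \<and>
     (\<forall>\<omega>\<in>space M. B 0 \<omega> = 0 \<and> continuous_on {0..} (\<lambda>s. B s \<omega>)) \<and>
     (\<forall>r s. 0 \<le> r \<and> r < s \<longrightarrow>
        distributed M lborel (\<lambda>\<omega>. B s \<omega> - B r \<omega>) (normal_density 0 (sqrt (s - r)))) \<and>
     (\<forall>u :: nat \<Rightarrow> real. \<forall>m. 0 \<le> u 0 \<and> mono u \<longrightarrow>
        prob_space.indep_vars M (\<lambda>_. borel) (\<lambda>i \<omega>. B (u (Suc i)) \<omega> - B (u i) \<omega>) {..<m})"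

text \<open>
  \<open>t\<close> lists the starting times. \<open>meeting_times t j w v\<close> are the times at which a path \<open>w\<close> started
  at time \<open>t j\<close> sits on one of the paths \<open>v k\<close> with \<open>k < j\<close>, both having started. For continuous
  paths this set is closed, so its infimum is the first meeting time. If several \<open>k\<close> are met at
  that time, the corresponding paths have already coalesced, so the choice among them is immaterial.
\<close>

definition meeting_times ::
  "(nat \<Rightarrow> real) \<Rightarrow> nat \<Rightarrow> (real \<Rightarrow> real) \<Rightarrow> (nat \<Rightarrow> real \<Rightarrow> real) \<Rightarrow> real set" where
  "meeting_times t j w v = {s. t j \<le> s \<and> (\<exists>k<j. t k \<le> s \<and> w s = v k s)}"

definition follow_until_meeting ::
  "(nat \<Rightarrow> real) \<Rightarrow> nat \<Rightarrow> (real \<Rightarrow> real) \<Rightarrow> (nat \<Rightarrow> real \<Rightarrow> real) \<Rightarrow> real \<Rightarrow> real" where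
  "follow_until_meeting t j w v s =
     (let \<tau> = Inf (meeting_times t j w v)
      in if meeting_times t j w v = {} \<or> s < \<tau> then w s
         else v (LEAST k. k < j \<and> t k \<le> \<tau> \<and> w \<tau> = v k \<tau>) s)"

text \<open>In \<open>coalesce t w n\<close> the paths with index below \<open>n\<close> have been coalesced.\<close>

primrec coalesce ::
  "(nat \<Rightarrow> real) \<Rightarrow> (nat \<Rightarrow> real \<Rightarrow> real) \<Rightarrow> nat \<Rightarrow> nat \<Rightarrow> real \<Rightarrow> real" where
  "coalesce t w 0 = w"
| "coalesce t w (Suc j) =
     (coalesce t w j)(j := follow_until_meeting t j (w j) (coalesce t w j))"

text \<open>The points \<open>z i\<close> are pairs of a position and a starting time.\<close>

definition coalescing_BMs ::
  "'b measure \<Rightarrow> nat \<Rightarrow> (nat \<Rightarrow> real \<times> real) \<Rightarrow> (nat \<Rightarrow> 'b \<Rightarrow> bw_path) \<Rightarrow> bool" where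
  "coalescing_BMs N n z P \<longleftrightarrow> prob_space N \<and>
     (\<exists>B :: nat \<Rightarrow> real \<Rightarrow> 'b \<Rightarrow> real.
        (\<forall>i<n. standard_BM N (B i)) \<and>
        prob_space.indep_vars N (\<lambda>_. PiM {0..} (\<lambda>_. borel))
          (\<lambda>i \<omega>. \<lambda>s\<in>{0..}. B i s \<omega>) {..<n} \<and>
        (\<forall>j<n. \<forall>\<omega>\<in>space N. P j \<omega> =
           real_path
             (coalesce (\<lambda>i. snd (z i)) (\<lambda>i s. fst (z i) + B i (s - snd (z i)) \<omega>) n j)
             (snd (z j))))"


section \<open>Finite-dimensional distributions\<close>

text \<open>
  The fixed value in the second branch (rather than a bare definite description) makes
  \<open>path_from\<close> a Borel function of the compact set.
\<close>

definition path_from :: "bw_path compacts \<Rightarrow> real \<times> real \<Rightarrow> bw_path" where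
  "path_from K z =
     (if \<exists>!p. p \<in> set_of_compacts K \<and> starts_at p z
      then THE p. p \<in> set_of_compacts K \<and> starts_at p z
      else undefined)"

text \<open>
  The law of coalescing Brownian motions does not depend on the probability space carrying the
  driving Brownian motions. The type \<open>nat \<Rightarrow> real \<Rightarrow> real\<close> of sample points is large
  enough for the canonical construction of any finite number of them.
\<close>

definition coalescing_fdds :: "'a measure \<Rightarrow> ('a \<Rightarrow> bw_path compacts) \<Rightarrow> bool" where
  "coalescing_fdds \<Omega> W \<longleftrightarrow>
     (\<forall>n z. inj_on z {..<n} \<longrightarrow>
        (AE \<omega> in \<Omega>. \<forall>i<n. \<exists>!p. p \<in> set_of_compacts (W \<omega>) \<and> starts_at p (z i)) \<and>
        (\<exists>(N :: (nat \<Rightarrow> real \<Rightarrow> real) measure) P. coalescing_BMs N n z P \<and>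
           distr \<Omega> (PiM {..<n} (\<lambda>_. borel)) (\<lambda>\<omega>. \<lambda>i\<in>{..<n}. path_from (W \<omega>) (z i)) =
           distr N (PiM {..<n} (\<lambda>_. borel)) (\<lambda>\<omega>. \<lambda>i\<in>{..<n}. P i \<omega>)))"

end

theory Submission
 imports Defs "HOL-Complex_Analysis.Great_Picard" "HOL-Real_Asymp.Real_Asymp"
begin

text \<open>
 The coalescing Brownian motions are driven by a countable product of Wiener measures and start from an
 enumeration of the rational space-time points (the skeleton). Two neighbouring paths may exchange their
 increments after their first meeting without changing the law of the driving family, so the law of the
 coalescing family does not depend on the order of the starting points. By reflection, two paths at
 distance \<open>d\<close> have not met after time \<open>t\<close> with probability about \<open>d / sqrt (pi * t)\<close>; summing over
 neighbours yields the expected counts. Ottaviani's inequality on a fine grid confines the skeleton and makes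
 it equicontinuous, so its closure is compact, and skeleton paths squeeze the path from any given point.

 For uniqueness, a compact set with the right finite-dimensional distributions contains a closed skeleton
 of the same law. Both have the same finite expected counts, hence they touch the same points for all
 rational parameters, and this determines every path of the larger set as a limit of skeleton paths.
\<close>

text \<open>Exchanging increments at a random meeting time would ordinarily rest on the strong
  Markov property. Only splicing at deterministic times is used instead: the meeting time is rounded
  up to a dyadic grid, the choice among the countably many resulting exchanges is itself invariant
  under them, and a pointwise limit removes the rounding.

  The second obstacle is measurability. Almost sure properties are phrased for the sequence of
  skeleton paths at rational times and thus become events of sequence space; they hold for every
  sequence with the same law, which is how they reach the compact set considered in the uniqueness
  part. A deterministic point off the skeleton is put in front of the enumeration, and order
  invariance says that the remaining paths still have the law of the skeleton.

  The third is that positions and starting times may be infinite. Positions are compressed by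
  \<open>tanh\<close>, and a path at an infinite position is caught by skeleton paths from far out.
  Tails are estimated by fourth moments, because a quadratic dependence on the time step survives a
  union bound over many steps.\<close>

abbreviation (input) "pts == set_of_compacts"
abbreviation (input) "st == path_start"
abbreviation (input) "cnt == emeasure (count_space UNIV)"
abbreviation (input) "PB I == PiM I (%_. borel)"
abbreviation (input) iff_ascii (infixr "<->" 25) where "A <-> B == (A :: bool) = B"
abbreviation (input) pairM (infixr "XM" 80) where "A XM B == pair_measure A B"
abbreviation (input) LIMSEQ_ascii ("((_)/ ----> (_))" [60, 60] 60) where "f ----> l == LIMSEQ f l"

section \<open>Paths as bounded continuous functions\<close>

definition artanh_ereal :: "real => ereal" where "artanh_ereal y = (if y >= 1 then \<infinity> else if y <= - 1 then - \<infinity> else ereal (artanh y))"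

lemma tanh_artanh_real: "abs y < 1 ==> tanh (artanh y) = (y::real)"
proof -
 assume y: "abs y < 1"
 have "exp (- 2 * artanh y) = inverse (exp (ln ((1 + y) / (1 - y))))" by (simp add: artanh_def exp_minus)
 also have "... = (1 - y) / (1 + y)" using y by (subst exp_ln) (auto simp: field_simps)
 finally have *: "exp (- 2 * artanh y) = (1 - y) / (1 + y)" .
 show ?thesis unfolding tanh_real_altdef using y by (simp only: *) (simp add: field_simps)
qed

lemma tanh_artanh_ereal: "abs y <= 1 ==> tanh_ereal (artanh_ereal y) = y" unfolding artanh_ereal_def using tanh_artanh_real[of y] by (auto simp: abs_if split: if_splits)

lemma tanh_ereal_le_iff: "tanh_ereal x <= tanh_ereal y <-> x <= y"
proof -
 have "\<not> 1 <= tanh r" "\<not> tanh r <= - 1" "tanh r <= 1" "- 1 <= tanh r" for r :: real using tanh_real_bounds'[of r] by linarith+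
 thus ?thesis by (cases x; cases y) auto
qed

lemma tanh_ereal_less_iff: "tanh_ereal x < tanh_ereal y <-> x < y" using tanh_ereal_le_iff[of y x] by (simp add: not_le[symmetric])

lemma at_ereal_infty: "at (\<infinity>::ereal) = filtermap ereal at_top" "at (- \<infinity>::ereal) = filtermap ereal at_bot"
proof -
 have "UNIV - {\<infinity>} = {..<(\<infinity>::ereal)} - {\<infinity>}" "UNIV - {- \<infinity>} = {(- \<infinity>::ereal)<..} - {- \<infinity>}" by auto
 thus "at (\<infinity>::ereal) = filtermap ereal at_top" "at (- \<infinity>::ereal) = filtermap ereal at_bot"
  unfolding at_left_PInf[symmetric] at_right_MInf[symmetric] by (simp_all add: at_within_def)
qed

lemma isCont_Psi: "isCont Psi t"
proof (cases t)
 case (real r)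
 have "((%x. tanh x) \<longlongrightarrow> tanh r) (at r)" by (intro tendsto_intros) auto
 thus ?thesis unfolding real isCont_def unfolding at_ereal filterlim_filtermap by (simp add: Psi_def)
next
 case PInf
 thus ?thesis using tanh_real_at_top unfolding PInf isCont_def unfolding at_ereal_infty filterlim_filtermap by (simp add: Psi_def)
next
 case MInf
 thus ?thesis using tanh_real_at_bot unfolding MInf isCont_def unfolding at_ereal_infty filterlim_filtermap by (simp add: Psi_def)
qed

text \<open>Only real times are evaluated: \<open>Phi\<close> vanishes at infinite times, so the
  value there is not invariant under \<open>path_eq\<close>. Before its start a path is frozen at
  its initial value.\<close>

lift_definition pval :: "bw_path => real => ereal" is "%p s. path_hat p (ereal s)" by (rule ext, rule path_eq_hat)

text \<open>The compressed value is a real number in [-1, 1], so limits and differences avoid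
  extended arithmetic.\<close>

definition tval :: "bw_path => real => real" where "tval p s = tanh_ereal (pval p s)"

lemma abs_tval_le: "abs (tval p s) <= 1" by (simp add: tval_def abs_tanh_ereal_le)

text \<open>Clearing the denominator \<open>1 + abs s\<close> turns the distance into a weighted
  uniform bound at real times. At infinite times both values of \<open>Phi\<close> vanish, which is
  where \<open>0 <= c\<close> enters.\<close>

lemma raw_dist_le_iff:
 assumes "0 <= c"
 shows "raw_dist p q <= c <->
  (ALL s. abs (tanh_ereal (path_hat p (ereal s)) - tanh_ereal (path_hat q (ereal s))) <= c * (1 + abs s))
  & abs (Psi (snd p) - Psi (snd q)) <= c"
proof -
 have *: "abs (Phi x (ereal s) - Phi y (ereal s)) = abs (tanh_ereal x - tanh_ereal y) / (1 + abs s)" for x y s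
  by (simp add: Phi_def diff_divide_distrib[symmetric] abs_divide)
 have **: "0 < 1 + abs s" for s :: real by linarith
 show ?thesis
 proof safe
  assume le: "raw_dist p q <= c"
  show "abs (Psi (snd p) - Psi (snd q)) <= c" using raw_dist_ge(2) le order_trans by blast
  fix s
  have "abs (tanh_ereal (path_hat p (ereal s)) - tanh_ereal (path_hat q (ereal s))) / (1 + abs s) <= c" using raw_dist_ge(1)[of p "ereal s" q] le unfolding * by linarith
  thus "abs (tanh_ereal (path_hat p (ereal s)) - tanh_ereal (path_hat q (ereal s))) <= c * (1 + abs s)" by (simp add: divide_le_eq **)
 next
  assume A: "ALL s. abs (tanh_ereal (path_hat p (ereal s)) - tanh_ereal (path_hat q (ereal s))) <= c * (1 + abs s)" and B: "abs (Psi (snd p) - Psi (snd q)) <= c"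
  show "raw_dist p q <= c"
  proof (rule raw_dist_leI[OF _ B])
   fix t :: ereal
   show "abs (Phi (path_hat p t) t - Phi (path_hat q t) t) <= c"
   proof (cases t)
    case (real r)
    thus ?thesis using A[rule_format, of r] **[of r] by (simp add: * divide_le_eq)
   qed (use assms in \<open>auto simp: Phi_def\<close>)
  qed
 qed
qed

lemma dist_le_iff: "0 <= c ==> dist p q <= c <-> (ALL s. abs (tval p s - tval q s) <= c * (1 + abs s)) &
  abs (Psi (st p) - Psi (st q)) <= c" unfolding tval_def by transfer (rule raw_dist_le_iff)

lemma tval_dist: "abs (tval p s - tval q s) <= dist p q * (1 + abs s)" using dist_le_iff[of "dist p q" p q] by auto

lemma start_dist: "abs (Psi (st p) - Psi (st q)) <= dist p q" using dist_le_iff[of "dist p q" p q] by auto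

lemma path_eqI:
 assumes "st p = st q" "!!s. tval p s = tval q s"
 shows "p = q" using dist_le_iff[of 0 p q] assms by simp

lemma touches_iff: "touches p (x, s) <-> st p <= ereal s & pval p s = ereal x" by transfer (auto simp: leD)

lemma starts_at_iff: "starts_at p (x, s) <-> st p = ereal s & pval p s = ereal x" by (auto simp: starts_at_def touches_iff)

lemma pval_before: "ereal s <= st p ==> ereal s' <= st p ==> pval p s = pval p s'" by transfer (auto simp: not_less)

text \<open>The bound on \<open>g\<close> makes the quotient tend to 0 at both ends, so continuity
  on the extended line reduces to continuity of \<open>g\<close> on the reals.\<close>

lemma continuous_ereal_div:
 assumes "continuous_on UNIV g" "!!s. abs (g s) <= (1::real)" "!!r. h (ereal r) = g r / (1 + abs r)" "h \<infinity> = 0" "h (- \<infinity>) = 0"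
 shows "continuous_on UNIV h" unfolding continuous_on_eq_continuous_at[OF open_UNIV]
proof
 fix t :: ereal
 have b: "eventually (%s. norm (g s / (1 + abs s)) <= 1 / (1 + abs s)) F" for F using assms(2) by (intro always_eventually allI) (simp add: abs_divide divide_right_mono)
 have top: "((%s::real. 1 / (1 + abs s)) \<longlongrightarrow> 0) at_top" by real_asymp
 have bot: "((%s::real. 1 / (1 + abs s)) \<longlongrightarrow> 0) at_bot" by real_asymp
 show "isCont h t"
 proof (cases t)
  case (real r)
  have "isCont (%s. g s / (1 + abs s)) r" using assms(1) by (intro continuous_intros) (auto simp: continuous_on_eq_continuous_at)
  thus ?thesis unfolding real isCont_def unfolding at_ereal filterlim_filtermap assms(3) by simp
 next
  case PInf
  thus ?thesis using Lim_null_comparison[OF b top] unfolding PInf isCont_def unfolding at_ereal_infty filterlim_filtermap assms by simp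
 next
  case MInf
  thus ?thesis using Lim_null_comparison[OF b bot] unfolding MInf isCont_def unfolding at_ereal_infty filterlim_filtermap assms by simp
 qed
qed

lemma raw_pathsI:
 assumes "continuous_on UNIV g" "!!s. ereal s >= t0 ==> tanh_ereal (f (ereal s)) = g s" "!!s. abs (g s) <= 1"
 shows "(f, t0) : raw_paths"
proof -
 define h where "h t = (case t of ereal r => g r / (1 + abs r) | PInfty => 0 | MInfty => 0)" for t
 have "continuous_on UNIV h" by (rule continuous_ereal_div[OF assms(1,3)]) (auto simp: h_def)
 hence "continuous_on {t0..\<infinity>} h" by (rule continuous_on_subset) auto
 moreover have "Phi (f t) t = h t" if "t : {t0..\<infinity>}" for t using that assms(2) by (cases t) (auto simp: Phi_def h_def)
 ultimately have "continuous_on {t0..\<infinity>} (%t. Phi (f t) t)" by (subst continuous_on_cong[OF refl, of _ _ h]) auto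
 thus ?thesis by (simp add: raw_paths_def)
qed

lemma abs_path:
 assumes "(f, t0) : raw_paths"
 shows "st (abs_bw_path (f, t0)) = t0" "pval (abs_bw_path (f, t0)) s = (if ereal s < t0 then f t0 else f (ereal s))"
proof -
 have "path_eq (f, t0) (f, t0)" using assms by (simp add: path_eq_def raw_dist_self)
 thus "st (abs_bw_path (f, t0)) = t0" "pval (abs_bw_path (f, t0)) s = (if ereal s < t0 then f t0 else f (ereal s))" by (simp_all add: path_start.abs_eq pval.abs_eq)
qed

text \<open>Converse of the description of a path by its start and \<open>tval\<close>; it produces
  limit paths without returning to representatives. The values 1 and -1 become infinite
  positions.\<close>

lemma path_exists:
 assumes "continuous_on UNIV g" "!!s. abs (g s) <= (1::real)" "!!s s'. ereal s <= t0 ==> ereal s' <= t0 ==> g s = g s'"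
 shows "EX p. st p = t0 & tval p = g"
proof -
 define f where "f t = artanh_ereal (g (real_of_ereal t))" for t
 have raw: "(f, t0) : raw_paths" by (rule raw_pathsI[OF assms(1) _ assms(2)]) (simp add: f_def tanh_artanh_ereal assms(2))
 have "tval (abs_bw_path (f, t0)) s = g s" for s
 proof (cases "ereal s < t0")
  case True
  \<comment> \<open>For \<open>t0\<close> equal to positive infinity the value is read at time 0,
    which is harmless: then \<open>g\<close> is constant on the whole line.\<close>
  have "g (real_of_ereal t0) = g s" using True by (intro assms(3)) (cases t0; auto)+
  thus ?thesis using True by (simp add: tval_def abs_path[OF raw] f_def tanh_artanh_ereal assms(2))
 next
  case False
  thus ?thesis by (simp add: tval_def abs_path[OF raw] f_def tanh_artanh_ereal assms(2))
 qed
 thus ?thesis using abs_path(1)[OF raw] by blast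
qed

lemma continuous_on_max_start:
 fixes g :: "real => real"
 assumes "continuous_on {t0..} g"
 shows "continuous_on UNIV (%s. g (max s t0))" by (rule continuous_on_compose2[OF assms]) (auto intro!: continuous_intros)

lemma real_path_vals:
 assumes "continuous_on {t0..} g"
 shows "st (real_path g t0) = ereal t0" "pval (real_path g t0) s = ereal (g (max s t0))" "tval (real_path g t0) s = tanh (g (max s t0))"
proof -
 have raw: "(%s. ereal (g (real_of_ereal s)), ereal t0) : raw_paths"
 proof (rule raw_pathsI)
  show "continuous_on UNIV (%s. tanh (g (max s t0)))" by (intro continuous_intros continuous_on_max_start[OF assms]) auto
  show "abs (tanh (g (max s t0))) <= 1" for s using tanh_real_bounds'[of "g (max s t0)"] by linarith
 qed (simp add: max_def)
 show "st (real_path g t0) = ereal t0" by (simp add: real_path_def abs_path[OF raw])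
 show *: "pval (real_path g t0) s = ereal (g (max s t0))" by (auto simp: real_path_def abs_path[OF raw] max_def)
 show "tval (real_path g t0) s = tanh (g (max s t0))" by (simp add: tval_def *)
qed

lemma continuous_hat:
 assumes "(f, t0) : raw_paths"
 shows "continuous_on UNIV (%s. tanh_ereal (path_hat (f, t0) (ereal s)))"
proof -
 define h where "h s = tanh_ereal (path_hat (f, t0) (ereal s))" for s
 have c: "continuous_on {t0..\<infinity>} (%t. Phi (f t) t)" using assms by (simp add: raw_paths_def)
 have "continuous_on {s. t0 <= ereal s} (%s. Phi (f (ereal s)) (ereal s) * (1 + abs s))"
  by (intro continuous_intros continuous_on_compose2[OF c]) (auto intro!: continuous_intros)
 moreover have "Phi (f (ereal s)) (ereal s) * (1 + abs s) = h s" if "t0 <= ereal s" for s using that add_pos_nonneg[of 1 "abs s"] by (simp add: Phi_def h_def leD)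
 ultimately have 1: "continuous_on {s. t0 <= ereal s} h" by (subst (asm) continuous_on_cong[OF refl, of _ _ h]) auto
 have "h s = tanh_ereal (f t0)" if "ereal s <= t0" for s using that by (cases "ereal s = t0") (auto simp: h_def)
 hence 2: "continuous_on {s. ereal s <= t0} h" by (subst continuous_on_cong[OF refl, of _ _ "%_. tanh_ereal (f t0)"]) auto
 have "closed {s. ereal s <= t0}" "closed {s. t0 <= ereal s}" by (intro closed_Collect_le continuous_intros continuous_on_ereal)+
 hence "continuous_on ({s. ereal s <= t0} Un {s. t0 <= ereal s}) h" using 1 2 by (intro continuous_on_closed_Un)
 moreover have "{s. ereal s <= t0} Un {s. t0 <= ereal s} = UNIV" by auto
 ultimately show ?thesis by (simp add: h_def)
qed

lemma continuous_tval: "continuous_on UNIV (tval p)"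
proof -
 have "continuous_on UNIV (%s. tanh_ereal (pval p s))"
 proof (transfer, goal_cases)
  case (1 p)
  thus ?case using continuous_hat[of "fst p" "snd p"] by (simp add: path_eq_def)
 qed
 thus ?thesis by (simp add: tval_def[abs_def])
qed

section \<open>Compactness criterion and separability of path space\<close>

lemma path_tendstoI:
 assumes "!!e. e > 0 ==> eventually (%n. ALL s. abs (tval (P n) s - tval p s) <= e * (1 + abs s)) F" "((%n. st (P n)) \<longlongrightarrow> st p) F"
 shows "(P \<longlongrightarrow> p) F"
proof (rule tendstoI)
 fix e :: real assume e: "e > 0"
 have "((%n. Psi (st (P n))) \<longlongrightarrow> Psi (st p)) F" by (rule isCont_tendsto_compose[OF isCont_Psi assms(2)])
 hence "eventually (%n. dist (Psi (st (P n))) (Psi (st p)) < e / 2) F" using e by (intro tendstoD) auto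
 with assms(1)[OF half_gt_zero[OF e]] show "eventually (%n. dist (P n) p < e) F"
 proof eventually_elim
  case (elim n)
  hence "dist (P n) p <= e / 2" using e by (subst dist_le_iff) (auto simp: dist_real_def)
  thus ?case using e by simp
 qed
qed

text \<open>Arzela-Ascoli on a compactified time axis. The map \<open>s / (1 + abs s)\<close> sends
  the line onto (-1, 1), and the weight \<open>1 - abs y\<close> forces all functions to vanish at
  the end points, so equicontinuity on bounded time intervals is enough. Starting times converge
  along a subsequence because the extended line is compact.\<close>

lemma path_subseq:
 fixes P :: "nat => bw_path"
 assumes equi: "!!L e. 0 < e ==> EX h>0. ALL n s s'. abs s <= L & abs s' <= L & abs (s - s') < h -->
  abs (tval (P n) s - tval (P n) s') <= e"
 shows "EX p k. strict_mono (k :: nat => nat) & (%n. P (k n)) ----> p"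
proof -
 obtain t0 k1 where k1: "strict_mono (k1 :: nat => nat)" "(%n. st (P (k1 n))) ----> t0"
 proof -
  have "seq_compact (UNIV :: ereal set)" by (rule compact_imp_seq_compact[OF compact_UNIV])
  then obtain l r where "strict_mono (r :: nat => nat)" "((%n. st (P n)) o r) ----> l" by (rule seq_compactE) auto
  thus ?thesis using that by (simp add: comp_def)
 qed
 \<comment> \<open>Inverse of the map \<open>v\<close> below; its value at the end points is
   immaterial because the weight vanishes there.\<close>
 define u where "u y = y / (1 - abs y)" for y :: real
 define F where "F n y = (1 - abs y) * tval (P (k1 n)) (u y)" for n y
 have F1: "abs (F n y) <= 1 - abs y" if "abs y <= 1" for n y using mult_left_mono[OF abs_tval_le[of "P (k1 n)" "u y"], of "1 - abs y"] that by (simp add: F_def abs_mult)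
 have Fbd: "norm (F n x) <= 1" if "x : {-1..1}" for n x using F1[of x n] that by (simp add: abs_le_iff) linarith
 have Fequi: "EX d>0. ALL n y. y : {-1..1} & norm (x - y) < d --> norm (F n x - F n y) < e"
  if x: "x : {-1..1}" and e: "0 < e" for x e
  proof (cases "abs x = 1")
   case True
   have "abs (F n x - F n y) < e" if "y : {-1..1}" "abs (x - y) < e" for n y using F1[of x n] F1[of y n] True that by (simp add: abs_le_iff) linarith
   thus ?thesis using e by (intro exI[of _ e]) auto
  next
   case False
   hence "isCont u x" unfolding u_def using x by (intro continuous_intros) auto
   hence cont: "ALL e>0. EX d>0. ALL y. abs (y - x) < d --> (abs (u y - u x)) < e" unfolding continuous_at_eps_delta dist_real_def by simp
   obtain h where h: "h > 0" "!!n s s'. abs s <= abs (u x) + 1 ==> (abs s') <= abs (u x) + 1 ==>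
     abs (s - s') < h ==> (abs (tval (P n) s - tval (P n) s')) <= e / 3" using equi[of "e / 3" "abs (u x) + 1"] e by auto
   obtain d where d: "d > 0" "ALL y. abs (y - x) < d --> (abs (u y - u x)) < min h 1" using cont[rule_format, of "min h 1"] h(1) by auto
   have "abs (F n x - F n y) < e" if y: "y : {-1..1}" "abs (x - y) < min d (e / 3)" for n y
   proof -
    have dd: "abs (u y - u x) < min h 1" using d(2)[rule_format, of y] y by (simp add: abs_minus_commute)
    have 1: "abs (tval (P (k1 n)) (u x) - tval (P (k1 n)) (u y)) <= e / 3" using dd by (intro h(2)) auto
    have "F n x - F n y = (1 - abs x) * (tval (P (k1 n)) (u x) - tval (P (k1 n)) (u y))
      + (abs y - abs x) * tval (P (k1 n)) (u y)" by (simp add: F_def algebra_simps)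
    also have "\<bar>...\<bar> <= 1 * (e / 3) + \<bar>\<bar>y\<bar> - \<bar>x\<bar>\<bar> * 1"
    proof (rule order_trans[OF abs_triangle_ineq add_mono])
     have "\<bar>1 - \<bar>x\<bar>\<bar> <= 1" using x by (auto simp: abs_le_iff)
     thus "\<bar>(1 - \<bar>x\<bar>) * (tval (P (k1 n)) (u x) - tval (P (k1 n)) (u y))\<bar> <= 1 * (e / 3)" unfolding abs_mult by (intro mult_mono 1) auto
     show "\<bar>(\<bar>y\<bar> - \<bar>x\<bar>) * tval (P (k1 n)) (u y)\<bar> <= \<bar>\<bar>y\<bar> - \<bar>x\<bar>\<bar> * 1"
      unfolding abs_mult by (intro mult_mono abs_tval_le) auto
    qed
    also have "... < e" using y e abs_triangle_ineq3[of y x] by (simp add: abs_minus_commute)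
    finally show ?thesis .
   qed
   thus ?thesis using d(1) e by (intro exI[of _ "min d (e / 3)"]) auto
  qed
 obtain g k2 where g: "continuous_on {-1..1::real} g" "strict_mono (k2 :: nat => nat)"
  and conv: "!!e. 0 < e ==> EX N. ALL n x. N <= n & x : {-1..1} --> norm (F (k2 n) x - g x) < e"
 proof (rule Arzela_Ascoli[OF compact_Icc Fbd Fequi])
  fix g k assume "continuous_on {-1..1::real} g" "strict_mono (k :: nat => nat)"
   "!!e. 0 < e ==> EX N. ALL n x. N <= n & x : {-1..1} --> norm (F (k n) x - g x) < e"
  thus thesis by (rule that)
 qed
 define k where "k n = k1 (k2 n)" for n
 have k: "strict_mono k" using k1(1) g(2) by (simp add: k_def strict_mono_def)
 have starts: "(%n. st (P (k n))) ----> t0" using LIMSEQ_subseq_LIMSEQ[OF k1(2) g(2)] by (simp add: k_def comp_def)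
 define v where "v s = s / (1 + abs s)" for s :: real
 have pos: "0 < 1 + abs s" for s :: real by linarith
 have absv: "abs (v s) = abs s / (1 + abs s)" for s by (simp add: v_def abs_divide)
 hence v1: "1 - abs (v s) = 1 / (1 + abs s)" for s using pos[of s] by (simp add: field_simps)
 have vin: "v s : {-1..1}" for s using v1[of s] divide_nonneg_pos[OF zero_le_one pos[of s]] abs_ge_self[of "v s"] abs_ge_minus_self[of "v s"]
  unfolding atLeastAtMost_iff by linarith
 have uv: "u (v s) = s" for s using pos[of s] by (simp add: u_def v1) (simp add: v_def)
 define G where "G s = g (v s) * (1 + abs s)" for s
 have conv': "EX N. ALL n>=N. ALL s. abs (tval (P (k n)) s - G s) <= e * (1 + abs s)" if "e > 0" for e
 proof -
  obtain N where N: "!!n x. N <= n ==> x : {-1..1} ==> norm (F (k2 n) x - g x) < e" using conv[OF \<open>e > 0\<close>] by blast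
  have "abs (tval (P (k n)) s - G s) <= e * (1 + abs s)" if "n >= N" for n s
  proof -
   have "F (k2 n) (v s) = tval (P (k n)) s / (1 + abs s)" by (simp add: F_def uv v1 k_def)
   hence "\<bar>tval (P (k n)) s / (1 + \<bar>s\<bar>) - g (v s)\<bar> <= e" using N[OF that vin[of s]] by simp
   moreover have "tval (P (k n)) s - G s = (tval (P (k n)) s / (1 + abs s) - g (v s)) * (1 + abs s)" using pos[of s] by (simp add: G_def field_simps)
   ultimately show ?thesis using pos[of s] by (simp add: abs_mult mult_right_mono)
  qed
  thus ?thesis by blast
 qed
 have lim: "(%n. tval (P (k n)) s) ----> G s" for s
 proof (rule LIMSEQ_I)
  fix e :: real assume "e > 0"
  hence "e / (2 * (1 + abs s)) > 0" using pos[of s] by simp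
  from conv'[OF this] obtain N
   where N: "!!n. n >= N ==> (abs (tval (P (k n)) s - G s)) <= e / (2 * (1 + abs s)) * (1 + abs s)" by blast
  have "e / (2 * (1 + abs s)) * (1 + abs s) = e / 2" using pos[of s] by (simp add: field_simps)
  hence "abs (tval (P (k n)) s - G s) < e" if "n >= N" for n using N[OF that] \<open>e > 0\<close> by linarith
  thus "EX N. ALL n>=N. norm (tval (P (k n)) s - G s) < e" by auto
 qed
 have ne: "1 + abs s ~= 0" for s :: real using pos[of s] by linarith
 have "continuous_on UNIV v" unfolding v_def by (intro continuous_intros ballI ne)
 hence "continuous_on UNIV (%s. g (v s))" by (rule continuous_on_compose2[OF g(1)]) (use vin in blast)
 hence Gc: "continuous_on UNIV G" unfolding G_def by (intro continuous_intros)
 have G1: "abs (G s) <= 1" for s by (rule LIMSEQ_le_const2[OF tendsto_rabs[OF lim]]) (auto simp: abs_tval_le)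
 \<comment> \<open>Times strictly before the limiting start precede almost all starts along the
   subsequence, where the paths are still constant.\<close>
 have const: "G s = G s'" if "ereal s < t0" "ereal s' < t0" for s s'
 proof -
  have "eventually (%n. tval (P (k n)) s = tval (P (k n)) s') sequentially" using order_tendstoD(1)[OF starts that(1)] order_tendstoD(1)[OF starts that(2)]
   by eventually_elim (auto simp: tval_def intro: arg_cong[OF pval_before] less_imp_le)
  hence "(%n. tval (P (k n)) s') ----> G s" using lim[of s] by (rule Lim_transform_eventually[rotated])
  thus ?thesis using lim[of s'] LIMSEQ_unique by blast
 qed
 \<comment> \<open>Continuity carries the constancy to the starting time itself.\<close>
 have const_end: "G s = G r" if "t0 = ereal r" "s < r" for s r
 proof -
  have "(G \<longlongrightarrow> G r) (at r)" using Gc unfolding continuous_on_def by blast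
  hence "(G \<longlongrightarrow> G r) (at_left r)" by (rule tendsto_within_subset) (rule subset_UNIV)
  moreover have "eventually (%x. G x = G s) (at_left r)" unfolding eventually_at_filter
  proof (intro always_eventually allI impI)
   fix x assume "x : {..<r}"
   hence "ereal x < t0" "ereal s < t0" unfolding that(1) using that(2) by simp_all
   thus "G x = G s" by (rule const)
  qed
  ultimately have "((%_. G s) \<longlongrightarrow> G r) (at_left r)" by (rule Lim_transform_eventually)
  thus ?thesis by (simp add: tendsto_const_iff)
 qed
 have const': "G s = G s'" if "ereal s <= t0" "ereal s' <= t0" for s s'
 proof -
  have at: "G x = G y" if x: "ereal x < t0" and y: "ereal y = t0" for x y using const_end[of y x] x unfolding y[symmetric] by simp
  show ?thesis
  proof (cases "ereal s = t0")
   case True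
   show ?thesis
   proof (cases "ereal s' = t0")
    case True
    hence "s = s'" using \<open>ereal s = t0\<close> by (metis ereal.inject)
    thus ?thesis by simp
   next
    case False
    thus ?thesis using at[of s' s] True that(2) by (metis order_le_less)
   qed
  next
   case False
   hence s: "ereal s < t0" using that(1) by (metis order_le_less)
   show ?thesis
   proof (cases "ereal s' = t0")
    case True
    show ?thesis by (rule at[OF s True])
   next
    case False
    hence "ereal s' < t0" using that(2) by (metis order_le_less)
    thus ?thesis by (rule const[OF s])
   qed
  qed
 qed
 obtain p where p: "st p = t0" "tval p = G" using path_exists[OF Gc G1 const'] by blast
 have "(%n. P (k n)) ----> p" by (rule path_tendstoI) (use conv' starts in \<open>auto simp: p eventually_sequentially\<close>)
 thus ?thesis using k by blast
qed

text \<open>There is no common modulus of continuity, so each path is labelled by its own modulus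
  together with rounded data on the grid that this modulus dictates. The labels form a countable
  set, and paths with equal labels are close.\<close>

lemma path_countable_net:
 assumes "e > 0"
 shows "EX A :: bw_path set. countable A & (ALL p. EX q:A. dist p q <= e)"
proof -
 \<comment> \<open>Beyond time \<open>M\<close> the weight in the metric absorbs the trivial bound 2
   on the difference of two compressed values.\<close>
 obtain M :: nat where M: "2 / (1 + real M) <= e" "M > 0"
 proof -
  obtain M :: nat where "2 / e < real M" using reals_Archimedean2 by blast
  hence "2 / (1 + real M) <= e" "M > 0" using assms divide_pos_pos[of 2 e] by (auto simp: field_simps intro!: Nat.gr0I)
  thus ?thesis using that by blast
 qed
 have "EX k::nat. k > 0 & (ALL (s::real) (s'::real). abs s <= M & abs s' <= M & abs (s - s') <= 1 / k -->
   abs (tval p s - tval p s') <= e / 4)" for p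
 proof -
  have "uniformly_continuous_on {- real M..M} (tval p)" by (intro compact_uniformly_continuous continuous_on_subset[OF continuous_tval]) auto
  then obtain d where d: "d > 0" "!!s s'. s : {- real M..M} ==> s' : {- real M..M} ==> dist s' s < d ==>
    dist (tval p s') (tval p s) < e / 4" unfolding uniformly_continuous_on_def using assms by (metis zero_less_divide_iff zero_less_numeral)
  obtain k :: nat where k: "k > 0" "1 / k < d" using d(1) by (metis nat_approx_posE zero_less_Suc)
  show ?thesis
  proof (intro exI[of _ k] conjI k(1) allI impI)
   fix s s' :: real assume "abs s <= real M & abs s' <= real M & abs (s - s') <= 1 / real k"
   thus "abs (tval p s - tval p s') <= e / 4" using d(2)[of s s'] k(2) abs_minus_commute[of s s'] abs_minus_commute[of "tval p s" "tval p s'"]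
    by (auto simp: dist_real_def abs_le_iff[of s] abs_le_iff[of s'])
  qed
 qed
 then obtain k where k: "!!p. k p > (0::nat)"
  "!!p (s::real) (s'::real). abs s <= M ==> (abs s') <= M ==> (abs (s - s')) <= 1 / k p ==> (abs (tval p s - tval p s')) <= e / 4" by metis
 define key where "key p = (k p, \<lfloor>Psi (st p) * 4 / e\<rfloor>,
  map (%i. \<lfloor>tval p (real_of_int i / k p) * 4 / e\<rfloor>) [- int (M * k p)..int (M * k p)])" for p
 have fl: "abs (x - y) <= e / 4" if "\<lfloor>x * 4 / e\<rfloor> = \<lfloor>y * 4 / e\<rfloor>" for x y
 proof -
  have "abs (x * 4 / e - y * 4 / e) < 1" using that by linarith
  moreover have "x * 4 / e - y * 4 / e = (x - y) * (4 / e)" by (simp only: left_diff_distrib diff_divide_distrib times_divide_eq_right)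
  ultimately have "abs (x - y) * (4 / e) < 1" using assms by (simp only: abs_mult) simp
  thus ?thesis using assms pos_less_divide_eq[of "4 / e" "abs (x - y)" 1] by simp
 qed
 have key: "dist p q <= e" if "key p = key q" for p q
 proof (subst dist_le_iff, use assms in simp, intro conjI allI)
  have kk: "k p = k q" and kPsi: "\<lfloor>Psi (st p) * 4 / e\<rfloor> = \<lfloor>Psi (st q) * 4 / e\<rfloor>"
   and kmap: "map (%i. \<lfloor>tval p (real_of_int i / k p) * 4 / e\<rfloor>) [- int (M * k p)..int (M * k p)] =
    map (%i. \<lfloor>tval q (real_of_int i / k q) * 4 / e\<rfloor>) [- int (M * k q)..int (M * k q)]" using that unfolding key_def prod.inject by auto
  show "abs (Psi (st p) - Psi (st q)) <= e" using fl[OF kPsi] assms by linarith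
  fix s :: real
  show "abs (tval p s - tval q s) <= e * (1 + abs s)"
  proof (cases "abs s <= M")
   case True
   define i where "i = \<lfloor>s * k p\<rfloor>"
   define s0 where "s0 = real_of_int i / k p"
   have kp: "real (k p) > 0" using k(1) by simp
   have sk: "- real (M * k p) <= s * k p" "s * k p <= real (M * k p)" using True mult_right_mono[of "- real M" s "k p"] mult_right_mono[of s "real M" "k p"] by auto
   hence i: "i : set [- int (M * k p)..int (M * k p)]" unfolding i_def by (auto simp: le_floor_iff floor_le_iff)
   have s0: "abs (s - s0) <= 1 / k p"
   proof -
    have "abs (s * k p - i) <= 1" unfolding i_def by linarith
    moreover have "s - s0 = (s * k p - i) / k p" using kp by (simp add: s0_def field_simps)
    ultimately show ?thesis using kp by (simp add: abs_divide divide_right_mono)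
   qed
   have s0M: "abs s0 <= M"
   proof -
    have "abs (real_of_int i) <= real M * k p"
     using i of_int_le_iff[where 'a=real, of i "int (M * k p)"] of_int_le_iff[where 'a=real, of "- int (M * k p)" i] by (simp add: abs_le_iff)
    thus ?thesis using kp by (simp add: s0_def abs_divide divide_le_eq)
   qed
   have "\<lfloor>tval p s0 * 4 / e\<rfloor> = \<lfloor>tval q s0 * 4 / e\<rfloor>" using kmap i unfolding kk[symmetric] map_eq_conv s0_def by blast
   from fl[OF this] have "abs (tval p s0 - tval q s0) <= e / 4" .
   moreover have "abs (tval p s - tval p s0) <= e / 4" using k(2)[OF True s0M] s0 by blast
   moreover have "abs (tval q s - tval q s0) <= e / 4" using k(2)[OF True s0M] s0 kk by simp
   ultimately have "abs (tval p s - tval q s) <= e" using assms by linarith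
   also have "... <= e * (1 + abs s)" using assms by (simp add: algebra_simps)
   finally show ?thesis .
  next
   case False
   have "abs (tval p s - tval q s) <= 2" using abs_tval_le[of p s] abs_tval_le[of q s] by linarith
   also have "2 <= e * (1 + real M)" using M by (simp add: field_simps)
   also have "... <= e * (1 + abs s)" using False assms by (intro mult_left_mono) auto
   finally show ?thesis .
  qed
 qed
 show ?thesis
 proof (intro exI conjI allI)
  show "countable (inv_into UNIV key ` range key)" by simp
  fix p
  have "key (inv_into UNIV key (key p)) = key p" by (simp add: f_inv_into_f)
  thus "EX q:inv_into UNIV key ` range key. dist p q <= e" using key[of p "inv_into UNIV key (key p)"] by auto
 qed
qed

text \<open>Balls of radius \<open>2 / Suc n\<close> around nets of mesh \<open>1 / Suc n\<close>
  form a countable basis. This identifies product Borel fields with the Borel field of the product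
  and makes open sets countable unions of balls.\<close>

instance bw_path :: second_countable_topology
proof
 obtain A :: "nat => bw_path set" where A: "!!n. countable (A n)" "!!n p. EX q:A n. dist p q <= 1 / Suc n"
 proof -
  have "ALL n. EX A :: bw_path set. countable A & (ALL p. EX q:A. dist p q <= 1 / Suc n)" by (intro allI path_countable_net) simp
  then obtain A where "ALL n. countable (A n :: bw_path set) & (ALL p. EX q:A n. dist p q <= 1 / Suc n)" unfolding choice_iff ..
  thus ?thesis using that[of A] by blast
 qed
 define B where "B = (\<Union>n. (%q. ball q (2 / Suc n)) ` A n)"
 have "topological_basis B"
 proof (rule topological_basisI)
  fix b assume "b : B" thus "open b" by (auto simp: B_def)
 next
  fix U :: "bw_path set" and p assume "open U" "p : U"
  then obtain e where e: "e > 0" "ball p e \<subseteq> U" by (meson openE)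
  obtain n where n: "3 / e < real n" using reals_Archimedean2 by blast
  obtain q where q: "q : A n" "dist p q <= 1 / Suc n" using A(2) by blast
  have "3 < e * real (Suc n)" using n e(1) by (simp add: divide_less_eq algebra_simps)
  hence n': "3 / real (Suc n) < e" by (simp add: divide_less_eq del: of_nat_Suc)
  have "ball q (2 / Suc n) \<subseteq> ball p e"
  proof
   fix x assume "x : ball q (2 / Suc n)"
   hence "dist p x < 1 / Suc n + 2 / Suc n" using q(2) dist_triangle[of p x q] by simp
   also have "... = 3 / real (Suc n)" unfolding add_divide_distrib[symmetric] by simp
   finally show "x : ball p e" using n' by simp
  qed
  moreover have "p : ball q (2 / Suc n)" using q(2) divide_strict_right_mono[of 1 2 "real (Suc n)"] by (simp add: dist_commute)
  ultimately show "EX b:B. p : b & b \<subseteq> U" using q(1) e(2) unfolding B_def by blast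
 qed
 moreover have "countable B" using A(1) by (auto simp: B_def)
 ultimately show "EX B::bw_path set set. countable B & open = generate_topology B" by (auto intro: topological_basis_imp_subbasis)
qed

section \<open>Measurability on the space of compact sets\<close>

lemma compact_set_of_compacts: "compact (pts K)" "pts K ~= {}" using set_of_compacts[of K] by auto

text \<open>A compact set disjoint from \<open>C\<close> has a positive distance to it, and no set
  closer than this in the Hausdorff metric can reach \<open>C\<close>. Hitting events are the raw
  material for the measurability of \<open>path_from\<close> and \<open>eta\<close>.\<close>

lemma closed_hits:
 fixes C :: "'a::metric_space set"
 assumes "closed C"
 shows "closed {K. pts K Int C ~= {}}"
proof -
 have "open {K. pts K Int C = {}}" unfolding open_dist
 proof (intro ballI)
  fix K assume "K : {K. pts K Int C = {}}"
  hence dj: "pts K Int C = {}" by simp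
  obtain d where d: "d > 0" "!!x y. x : pts K ==> y : C ==> d <= dist x y"
  proof (cases "C = {}")
   case True
   thus ?thesis using that[of 1] by simp
  next
   case False
   obtain x0 where x0: "x0 : pts K" "!!x. x : pts K ==> infdist x0 C <= infdist x C" using continuous_attains_inf[OF compact_set_of_compacts, of K "%x. infdist x C"]
     continuous_on_infdist[OF continuous_on_id, of "pts K" C] by auto
   have "infdist x0 C > 0" using dj x0(1) in_closed_iff_infdist_zero[OF assms False, of x0] infdist_nonneg[of x0 C] by auto
   moreover have "infdist x0 C <= dist x y" if "x : pts K" "y : C" for x y using x0(2)[OF that(1)] infdist_le[OF that(2), of x] by linarith
   ultimately show ?thesis by (rule that)
  qed
  have "pts L Int C = {}" if "dist L K < d" for L
  proof (rule ccontr)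
   assume "pts L Int C ~= {}"
   then obtain x where x: "x : pts L" "x : C" by blast
   have "infdist x (pts K) < d" using infdist_le_hausdorff(1)[OF compact_set_of_compacts(1) compact_set_of_compacts(1) x(1), of K] that by (simp add: dist_compacts_def)
   moreover have "d <= infdist x (pts K)" unfolding infdist_notempty[OF compact_set_of_compacts(2)]
    using d(2) x(2) by (intro cINF_greatest compact_set_of_compacts(2)) (simp add: dist_commute)
   ultimately show False by simp
  qed
  thus "EX e>0. ALL L. dist L K < e --> L : {K. pts K Int C = {}}" using d(1) by blast
 qed
 moreover have "- {K. pts K Int C ~= {}} = {K. pts K Int C = {}}" by auto
 ultimately show ?thesis by (simp add: closed_def)
qed

lemma hits_borel: "closed C ==> {K. pts K Int C ~= {}} : sets borel" by (rule borel_closed[OF closed_hits])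

section \<open>Continuous coordinates and closed sets of paths\<close>

lemma continuous_on_tval: "continuous_on UNIV (%p. tval p s)" unfolding continuous_on_iff
proof (intro ballI allI impI)
 fix p :: bw_path and e :: real assume "e > 0"
 have "dist (tval q s) (tval p s) < e" if "dist q p < e / (1 + abs s)" for q
 proof -
  have "dist q p * (1 + abs s) < e" using that by (simp add: pos_less_divide_eq add_pos_nonneg)
  thus ?thesis using tval_dist[of q s p] by (simp add: dist_real_def)
 qed
 moreover have "e / (1 + abs s) > 0" using \<open>e > 0\<close> by (simp add: add_pos_nonneg)
 ultimately show "EX d>0. ALL q:UNIV. dist q p < d --> dist (tval q s) (tval p s) < e" by blast
qed

lemma continuous_on_Psi_start: "continuous_on UNIV (%p. Psi (st p))" unfolding continuous_on_iff dist_real_def using start_dist by (metis order_le_less_trans)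

lemma start_le_iff: "st p <= t <-> Psi (st p) <= Psi t" by (simp add: Psi_def tanh_ereal_le_iff)

lemma start_eq_iff: "st p = t <-> Psi (st p) = Psi t" by (simp add: Psi_def tanh_ereal_inject)

lemma pval_le_iff: "pval p s <= y <-> tval p s <= tanh_ereal y" by (simp add: tval_def tanh_ereal_le_iff)

lemma pval_ge_iff: "y <= pval p s <-> tanh_ereal y <= tval p s" by (simp add: tval_def tanh_ereal_le_iff)

lemma pval_eq_iff': "pval p s = y <-> tval p s = tanh_ereal y" by (simp add: tval_def tanh_ereal_inject)

lemma closed_path_sets: "closed {p. st p <= t}" "closed {p. st p = t}" "closed {p. pval p s <= y}" "closed {p. y <= pval p s}" "closed {p. pval p s = y}"
 unfolding start_le_iff start_eq_iff pval_le_iff pval_ge_iff pval_eq_iff'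
 by (intro closed_Collect_le closed_Collect_eq continuous_on_tval continuous_on_Psi_start continuous_on_const)+

lemma closed_starts_at: "closed {p. starts_at p z}"
proof -
 have "{p. starts_at p z} = {p. st p = ereal (snd z)} Int {p. pval p (snd z) = ereal (fst z)}" using starts_at_iff[of _ "fst z" "snd z"] by auto
 thus ?thesis by (simp add: closed_Int closed_path_sets)
qed

text \<open>Two distinct points lie in basic sets with disjoint closures, so the event is a
  countable union of intersections of hitting events.\<close>

lemma two_points_borel:
 fixes S :: "'a::{metric_space,second_countable_topology} set"
 assumes "closed S"
 shows "{K. EX p:pts K Int S. EX q:pts K Int S. p ~= q} : sets borel"
proof -
 obtain B :: "'a set set" where B: "countable B" "topological_basis B" using ex_countable_basis by blast
 define I where "I = {(b, c). b : B & c : B & closure b Int closure c = {}}"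
 have "I \<subseteq> B \<times> B" by (auto simp: I_def)
 hence I: "countable I" using B(1) by (intro countable_subset[OF _ countable_SIGMA])
 have "{K. EX p:pts K Int S. EX q:pts K Int S. p ~= q} =
  (\<Union>(b, c)\<in>I. {K. pts K Int (S Int closure b) ~= {}} Int {K. pts K Int (S Int closure c) ~= {}})"
  (is "?L = ?R")
 proof (intro equalityI subsetI)
  fix K assume "K : ?L"
  then obtain p q where pq: "p : pts K Int S" "q : pts K Int S" "p ~= q" by blast
  define d where "d = dist p q / 3"
  have d: "d > 0" using pq(3) by (simp add: d_def)
  obtain b where b: "b : B" "p : b" "b \<subseteq> ball p d" using topological_basisE[OF B(2) open_ball, of p p d] d by auto
  obtain c where c: "c : B" "q : c" "c \<subseteq> ball q d" using topological_basisE[OF B(2) open_ball, of q q d] d by auto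
  have bc: "closure b \<subseteq> cball p d" "closure c \<subseteq> cball q d" using b(3) c(3) by (meson closed_cball closure_minimal ball_subset_cball subset_trans)+
  have "cball p d Int cball q d = {}"
  proof (rule ccontr)
   assume "cball p d Int cball q d ~= {}"
   then obtain x where "dist p x <= d" "dist q x <= d" by auto
   hence "dist p q <= 2 * d" using dist_triangle2[of p q x] by linarith
   thus False using d d_def by linarith
  qed
  hence "(b, c) : I" using b(1) c(1) bc by (auto simp: I_def)
  moreover have "p : closure b" "q : closure c" using b(2) c(2) closure_subset by blast+
  ultimately have "p : pts K Int (S Int closure b)" "q : pts K Int (S Int closure c)" using pq(1,2) by simp_all
  hence "pts K Int (S Int closure b) ~= {}" "pts K Int (S Int closure c) ~= {}" by (metis empty_iff)+
  thus "K : ?R" by (intro UN_I[OF \<open>(b, c) : I\<close>]) simp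
 next
  fix K assume "K : ?R"
  then obtain b c p q where "closure b Int closure c = {}" "p : pts K Int (S Int closure b)" "q : pts K Int (S Int closure c)" by (auto simp: I_def)
  hence "p : pts K Int S" "q : pts K Int S" "p ~= q" by auto
  thus "K : ?L" by blast
 qed
 also have "... : sets borel" using I by (intro sets.countable_UN') (auto intro!: sets.Int hits_borel closed_Int assms)
 finally show ?thesis .
qed

text \<open>On the event of a unique path from \<open>z\<close> the selected path lies in a closed
  \<open>C\<close> iff the compact set hits the closed set of paths in \<open>C\<close> that start
  at \<open>z\<close>. Off that event the value is the constant default.\<close>

lemma path_from_measurable: "(%K. path_from K z) : borel_measurable borel"
proof -
 define S where "S = {p. starts_at p z}"
 have S: "closed S" unfolding S_def by (rule closed_starts_at)
 define E where "E = {K. pts K Int S ~= {}} -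
   {K. EX p:pts K Int S. EX q:pts K Int S. p ~= q}"
 have E: "E : sets borel" unfolding E_def by (intro sets.Diff hits_borel two_points_borel S)
 have E_iff: "K : E <-> (\<exists>!p. p : pts K & starts_at p z)" for K
 proof
  assume "K : E"
  hence "pts K Int S ~= {}" and u: "\<not> (EX p:pts K Int S. EX q:pts K Int S. p ~= q)" unfolding E_def by simp_all
  then obtain p where p: "p : pts K Int S" by blast
  show "\<exists>!p. p : pts K & starts_at p z"
  proof (rule ex1I[of _ p])
   show "p : pts K & starts_at p z" using p by (simp add: S_def)
   fix q assume "q : pts K & starts_at q z"
   hence "q : pts K Int S" by (simp add: S_def)
   thus "q = p" using u p by blast
  qed
 next
  assume "\<exists>!p. p : pts K & starts_at p z"
  then obtain p where "pts K Int S = {p}" unfolding S_def by blast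
  thus "K : E" unfolding E_def by simp
 qed
 show ?thesis
 proof (rule measurableI)
  fix A :: "bw_path set" assume "A : sets borel"
  have sb: "sets (borel :: bw_path measure) = sigma_sets UNIV (Collect closed)" by (simp add: borel_eq_closed)
  from \<open>A : sets borel\<close>[unfolded sb] have "{K. path_from K z : A} : sets borel"
  proof induction
   case (Basic C)
   have "{K. path_from K z : C} =
    (E Int {K. pts K Int (S Int C) ~= {}}) Un (if undefined : C then - E else {})"
   proof (intro set_eqI)
    fix K show "K : {K. path_from K z : C} <-> K : (E Int {K. pts K Int (S Int C) ~= {}}) Un (if undefined : C then - E else {})"
    proof (cases "K : E")
     case True
     from True[unfolded E_iff] obtain p where p: "pts K Int S = {p}" unfolding S_def by blast
     hence "q : pts K & starts_at q z <-> q = p" for q unfolding S_def by blast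
     hence "path_from K z = p" unfolding path_from_def by simp
     moreover have "pts K Int (S Int C) ~= {} <-> p : C" unfolding Int_assoc[symmetric] p by simp
     ultimately show ?thesis using True by auto
    next
     case False
     thus ?thesis using E_iff[of K] by (auto simp: path_from_def)
    qed
   qed
   also have "... : sets borel" using Basic E S by (auto intro!: sets.Un sets.Int hits_borel closed_Int)
   finally show ?case .
  next
   case (Compl A)
   have "{K. path_from K z : UNIV - A} = UNIV - {K. path_from K z : A}" by auto
   thus ?case using Compl by auto
  next
   case (Union A)
   have "{K. path_from K z : \<Union> (range A)} = (\<Union>i. {K. path_from K z : A i})" by auto
   thus ?case using Union by auto
  qed auto
  thus "(%K. path_from K z) -` A Int space borel : sets borel" by (simp add: vimage_def)
 qed simp
qed

section \<open>Counting touched positions through rational boxes\<close>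

definition rat_boxes :: "real set set set" where "rat_boxes = {J. finite J & J \<subseteq> (%(c, d). {c..d}) ` (\<rat> \<times> \<rat>) & disjoint J}"

lemma countable_rat_boxes: "countable rat_boxes"
proof -
 have "countable {J. finite J & J \<subseteq> (%(c, d). {c..d::real}) ` (\<rat> \<times> \<rat>)}"
  by (intro countable_Collect_finite_subset countable_image countable_SIGMA countable_rat)
 thus ?thesis by (rule countable_subset[rotated]) (auto simp: rat_boxes_def)
qed

text \<open>Finitely many points are separated by disjoint rational intervals, and conversely each
  interval of a disjoint family that is hit contributes its own point. The supremum runs over a
  countable set, which makes counts measurable.\<close>

lemma emeasure_count_SUP_boxes: "cnt (Y :: real set) =
  (SUP J\<in>rat_boxes. SUM I:J. if Y Int I ~= {} then 1 else 0)"
proof (rule antisym)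
 have fin: "of_nat (card F) <= (SUP J\<in>rat_boxes. SUM I:J. if Y Int I ~= {} then 1 else (0::ennreal))"
  if F: "finite F" "F \<subseteq> Y" for F
 proof -
  obtain d where d: "d > 0" "!!x y. x : F ==> y : F ==> x ~= y ==> d <= abs (x - y)"
  proof -
   define D where "D = insert 1 ((%(x, y). abs (x - y)) ` {(x, y) : F \<times> F. x ~= y})"
   have "finite ((%(x, y). abs (x - y)) ` {(x, y) : F \<times> F. x ~= y})"
    using F(1) by (intro finite_imageI finite_subset[OF _ finite_cartesian_product[OF F(1) F(1)]]) auto
   hence D: "finite D" "D ~= {}" "ALL x:D. x > 0" by (auto simp: D_def)
   have "Min D > 0" using D Min_in by blast
   moreover have "Min D <= abs (x - y)" if "x : F" "y : F" "x ~= y" for x y using that by (intro Min_le D) (auto simp: D_def)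
   ultimately show ?thesis using that by blast
  qed
  have "EX c:\<rat>. x - d / 3 < c & c < x" "EX c:\<rat>. x < c & c < x + d / 3" for x
   using Rats_dense_in_real[of "x - d / 3" x] Rats_dense_in_real[of x "x + d / 3"] d(1) by auto
  then obtain l u where lu: "!!x. l x : \<rat>" "!!x. x - d / 3 < l x" "!!x. l x < x" "!!x. u x : \<rat>" "!!x. x < u x" "!!x. u x < x + d / 3" by metis
  define f where "f x = {l x..u x}" for x
  have xf: "x : f x" for x using lu[of x] by (simp add: f_def less_imp_le)
  have dis: "f x Int f y = {}" if "x : F" "y : F" "x ~= y" for x y
  proof (rule ccontr)
   assume "f x Int f y ~= {}"
   then obtain z where "z : f x" "z : f y" by blast
   hence "l x <= z" "z <= u x" "l y <= z" "z <= u y" unfolding f_def by auto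
   hence "abs (x - y) < d" using lu(2,6)[of x] lu(2,6)[of y] d(1) by linarith
   thus False using d(2)[OF that] by simp
  qed
  have inj: "inj_on f F" using dis xf by (intro inj_onI) (metis Int_iff empty_iff)
  have "f ` F : rat_boxes" unfolding rat_boxes_def disjoint_def using F(1) dis lu by (auto simp: f_def)
  moreover have "(SUM I:f ` F. if Y Int I ~= {} then 1 else 0) = (of_nat (card F) :: ennreal)"
  proof -
   have "(SUM I:f ` F. if Y Int I ~= {} then 1 else 0) = (SUM I:f ` F. (1::ennreal))" using F(2) xf by (intro sum.cong) auto
   thus ?thesis by (simp add: card_image inj)
  qed
  ultimately show ?thesis by (metis (no_types, lifting) SUP_upper)
 qed
 show "cnt Y <= (SUP J\<in>rat_boxes. SUM I:J. if Y Int I ~= {} then 1 else 0)"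
 proof (cases "finite Y")
  case True
  thus ?thesis using fin[OF True] by (simp add: emeasure_count_space)
 next
  case False
  have "of_nat n <= (SUP J\<in>rat_boxes. SUM I:J. if Y Int I ~= {} then 1 else (0::ennreal))" for n using infinite_arbitrarily_large[OF False, of n] fin by metis
  hence "(SUP n. of_nat n :: ennreal) <= (SUP J\<in>rat_boxes. SUM I:J. if Y Int I ~= {} then 1 else (0::ennreal))" by (rule SUP_least)
  thus ?thesis unfolding ennreal_SUP_of_nat_eq_top by (simp only: top.extremum_unique) simp
 qed
 show "(SUP J\<in>rat_boxes. SUM I:J. if Y Int I ~= {} then 1 else 0) <= cnt Y"
 proof (rule SUP_least)
  fix J assume J: "J : rat_boxes"
  define J' where "J' = {I:J. Y Int I ~= {}}"
  have J': "finite J'" using J by (auto simp: J'_def rat_boxes_def)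
  define g where "g I = (SOME y. y : Y Int I)" for I
  have g: "g I : Y Int I" if "I : J'" for I
  proof -
   have "EX y. y : Y Int I" using that unfolding J'_def by blast
   thus ?thesis unfolding g_def by (rule someI_ex)
  qed
  have "inj_on g J'"
  proof (rule inj_onI)
   fix A B assume "A : J'" "B : J'" "g A = g B"
   hence "g A : A Int B" using g[of A] g[of B] by simp
   moreover have "A : J" "B : J" "ALL A:J. ALL B:J. A ~= B --> A Int B = {}"
    using J \<open>A : J'\<close> \<open>B : J'\<close> unfolding rat_boxes_def disjoint_def J'_def by simp_all
   ultimately show "A = B" by (metis empty_iff)
  qed
  have "(SUM I:J. if Y Int I ~= {} then 1 else (0::ennreal)) = of_nat (card J')" using J by (simp add: sum.If_cases rat_boxes_def J'_def Int_def)
  also have "... = cnt (g ` J')" using J' by (simp add: emeasure_count_space card_image \<open>inj_on g J'\<close>)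
  also have "... <= cnt Y" using g by (intro emeasure_mono) auto
  finally show "(SUM I:J. if Y Int I ~= {} then 1 else 0) <= cnt Y" .
 qed
qed

text \<open>The set behind \<open>eta\<close>, for an arbitrary set of paths, so that a closure and
  a larger compact set can be compared. Being alive at \<open>r\<close> suffices, as it is used for
  \<open>r <= s\<close>.\<close>

definition touched :: "real => real => real => real => bw_path set => real set" where "touched r s a b S = {y. EX p:S. st p <= ereal r & pval p s = ereal y &
  (EX x:{a..b}. pval p r = ereal x)}"

lemma eta_eq_touched:
 assumes "0 <= t"
 shows "eta t0 t a b K = cnt (touched t0 (t0 + t) a b (pts K))"
proof -
 define Y where "Y = touched t0 (t0 + t) a b (pts K)"
 have "{z : UNIV \<times> {t0 + t}. EX p:pts K. touches p z & (EX y : {a..b} \<times> {t0}. touches p y)}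
  = (%y. (y, t0 + t)) ` Y" (is "?Z = _")
 proof (intro equalityI subsetI)
  fix z assume "z : ?Z"
  then obtain y p x where z: "z = (y, t0 + t)" and p: "p : pts K" "touches p (y, t0 + t)" "x : {a..b}" "touches p (x, t0)" by blast
  hence "y : Y" unfolding Y_def touched_def touches_iff by blast
  thus "z : (%y. (y, t0 + t)) ` Y" using z by blast
 next
  fix z assume "z : (%y. (y, t0 + t)) ` Y"
  then obtain y p x where z: "z = (y, t0 + t)" and p: "p : pts K" "st p <= ereal t0"
   "pval p (t0 + t) = ereal y" "x : {a..b}" "pval p t0 = ereal x" unfolding Y_def touched_def by blast
  have "st p <= ereal (t0 + t)" using p(2) assms order_trans by fastforce
  thus "z : ?Z" using p unfolding z by (auto simp: touches_iff)
 qed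
 thus ?thesis unfolding eta_def Y_def[symmetric] by (simp add: emeasure_count_space finite_image_iff inj_on_def card_image)
qed

text \<open>Meeting the window and then a closed box is a closed condition on a path, so the count
  becomes a countable supremum of sums of indicators of hitting events.\<close>

lemma eta_measurable:
 assumes "0 <= t"
 shows "eta t0 t a b : borel_measurable borel"
proof -
 define C where "C I = {p. st p <= ereal t0 & ereal a <= pval p t0 & pval p t0 <= ereal b
  & ereal (fst I) <= pval p (t0 + t) & pval p (t0 + t) <= ereal (snd I)}" for I
 have C: "closed (C I)" for I unfolding C_def by (intro closed_Collect_conj closed_path_sets)
 have hit: "touched t0 (t0 + t) a b S Int {c..d} ~= {} <-> S Int C (c, d) ~= {}" for S c d
 proof
  assume "S Int C (c, d) ~= {}"
  then obtain p where p: "p : S" "p : C (c, d)" by blast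
  then obtain x y where "pval p t0 = ereal x" "pval p (t0 + t) = ereal y" unfolding C_def by (cases "pval p t0"; cases "pval p (t0 + t)") auto
  hence "y : touched t0 (t0 + t) a b S Int {c..d}" using p unfolding C_def touched_def by auto
  thus "touched t0 (t0 + t) a b S Int {c..d} ~= {}" by blast
 next
  assume "touched t0 (t0 + t) a b S Int {c..d} ~= {}"
  thus "S Int C (c, d) ~= {}" unfolding C_def touched_def by fastforce
 qed
 have "(%K. SUM I:J. if touched t0 (t0 + t) a b (pts K) Int I ~= {} then 1 else (0::ennreal))
   : borel_measurable borel" if "J : rat_boxes" for J
 proof (intro borel_measurable_sum measurable_If)
  fix I assume "I : J"
  hence "I : (%(c, d). {c..d}) ` (\<rat> \<times> \<rat>)" using that unfolding rat_boxes_def by blast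
  then obtain c d where I: "I = {c..d}" by auto
  show "{K : space borel. touched t0 (t0 + t) a b (pts K) Int I ~= {}} : sets borel" unfolding I hit using hits_borel[OF C] by simp
 qed auto
 thus ?thesis unfolding eta_eq_touched[OF assms, abs_def] emeasure_count_SUP_boxes by (intro borel_measurable_SUP countable_rat_boxes)
qed

section \<open>Closures as Hausdorff limits of finite sets\<close>

lemma hausdorff_dist_leI:
 assumes "K ~= {}" "L ~= {}" "!!x. x : K ==> infdist x L <= e" "!!y. y : L ==> infdist y K <= e"
 shows "hausdorff_dist K L <= e" unfolding hausdorff_dist_def using assms by (auto intro!: cSUP_least)

definition fin_set :: "nat => (nat => bw_path) => bw_path compacts" where "fin_set n x = Abs_compacts (x ` {..n})"

definition cl_set :: "(nat => bw_path) => bw_path compacts" where "cl_set x = Abs_compacts (closure (range x))"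

lemma set_of_fin_set: "pts (fin_set n x) = x ` {..n}" unfolding fin_set_def by (rule Abs_compacts_inverse) (auto intro: finite_imp_compact)

lemma set_of_cl_set: "compact (closure (range x)) ==> pts (cl_set x) = closure (range x)" unfolding cl_set_def by (rule Abs_compacts_inverse) auto

lemma continuous_on_coord: "continuous_on UNIV (%x :: nat => 'a::topological_space. x i)" by (rule continuous_on_product_coordinates)

lemma fin_set_continuous: "continuous_on UNIV (fin_set n)" unfolding continuous_on_def
proof (intro ballI tendstoI)
 fix x :: "nat => bw_path" and e :: real assume e: "e > 0"
 have "eventually (%y. ALL i:{..n}. dist (y i) (x i) < e / 2) (at x)"
 proof (rule eventually_ball_finite)
  show "ALL i:{..n}. eventually (%y. dist (y i) (x i) < e / 2) (at x)"
  proof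
   fix i
   have "((%y. y i) \<longlongrightarrow> x i) (at x)" using continuous_on_coord[of i, where 'a = bw_path] unfolding continuous_on_def by simp
   thus "eventually (%y. dist (y i) (x i) < e / 2) (at x)" using e by (intro tendstoD) simp_all
  qed
 qed simp
 thus "eventually (%y. dist (fin_set n y) (fin_set n x) < e) (at x)"
 proof eventually_elim
  case (elim y)
  have "hausdorff_dist (y ` {..n}) (x ` {..n}) <= e / 2"
  proof (rule hausdorff_dist_leI)
   fix p assume "p : y ` {..n}"
   then obtain i where "i : {..n}" "p = y i" by blast
   thus "infdist p (x ` {..n}) <= e / 2" using elim by (intro infdist_le2[of "x i"]) (auto intro: less_imp_le)
  next
   fix p assume "p : x ` {..n}"
   then obtain i where "i : {..n}" "p = x i" by blast
   thus "infdist p (y ` {..n}) <= e / 2" using elim by (intro infdist_le2[of "y i"]) (auto intro: less_imp_le simp: dist_commute)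
  qed auto
  thus ?case using e by (simp add: dist_compacts_def set_of_fin_set)
 qed
qed

lemma fin_set_measurable [measurable]: "fin_set n : measurable (PB UNIV) borel"
 using borel_measurable_continuous_onI[OF fin_set_continuous[of n]] by (simp add: measurable_cong_sets[OF sets_PiM_equal_borel refl])

text \<open>By compactness finitely many small balls around members of the sequence cover the
  closure, so a long enough prefix is Hausdorff close to it.\<close>

lemma fin_set_tendsto:
 assumes "compact (closure (range x))"
 shows "(%n. fin_set n x) ----> cl_set x"
proof (rule tendstoI)
 fix e :: real assume e: "e > 0"
 have "closure (range x) \<subseteq> (\<Union>i. ball (x i) (e / 2))"
 proof
  fix p assume "p : closure (range x)"
  then obtain q where "q : range x" "dist q p < e / 2" using e by (meson closure_approachable half_gt_zero)
  thus "p : (\<Union>i. ball (x i) (e / 2))" by auto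
 qed
 then obtain F where F: "finite F" "closure (range x) \<subseteq> (\<Union>i\<in>F. ball (x i) (e / 2))" by (rule compactE_image[OF assms, rotated]) auto
 obtain N where N: "F \<subseteq> {..N}" using F(1) finite_nat_iff_bounded_le by blast
 have "dist (fin_set n x) (cl_set x) < e" if "n >= N" for n
 proof -
  have "hausdorff_dist (x ` {..n}) (closure (range x)) <= e / 2"
  proof (rule hausdorff_dist_leI)
   fix p assume "p : x ` {..n}"
   hence "p : range x" by blast
   hence "p : closure (range x)" by (rule subsetD[OF closure_subset])
   hence "infdist p (closure (range x)) = 0" by simp
   thus "infdist p (closure (range x)) <= e / 2" using e by linarith
  next
   fix p assume "p : closure (range x)"
   then obtain i where i: "i : F" "p : ball (x i) (e / 2)" using F(2) by blast
   hence "i : {..n}" using N that by auto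
   thus "infdist p (x ` {..n}) <= e / 2" using i(2) by (intro infdist_le2[of "x i"]) (auto simp: dist_commute intro: less_imp_le)
  qed auto
  thus ?thesis using e by (simp add: dist_compacts_def set_of_fin_set set_of_cl_set assms)
 qed
 thus "eventually (%n. dist (fin_set n x) (cl_set x) < e) sequentially" unfolding eventually_sequentially by blast
qed

text \<open>Pointwise limit of the prefix maps. A one-point prefix off \<open>G\<close> keeps the
  map total, as the closure need not be compact there.\<close>

lemma cl_set_measurable:
 assumes "G : sets (PB UNIV)" "!!x. x : G ==> compact (closure (range x))"
 shows "(%x. if x : G then cl_set x else fin_set 0 x) : measurable (PB UNIV) borel"
proof (rule borel_measurable_LIMSEQ_metric)
 show "(%x. if x : G then fin_set n x else fin_set 0 x) : measurable (PB UNIV) borel" for n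
  using assms(1) by (intro measurable_If fin_set_measurable) (auto simp: space_PiM Collect_mem_eq)
 show "(%n. if x : G then fin_set n x else fin_set 0 x) ----> (if x : G then cl_set x else fin_set 0 x)" for x using fin_set_tendsto[OF assms(2), of x] by auto
qed

section \<open>Gaussian increments\<close>

text \<open>Scaling a standard normal instead of writing a density admits \<open>v = 0\<close>, the
  point mass at 0, which arises from repeated grid times.\<close>

definition gauss :: "real => real measure" where "gauss v = distr (density lborel std_normal_density) borel (%x. sqrt v * x)"

lemma sets_gauss [simp, measurable_cong]: "sets (gauss v) = sets borel" by (simp add: gauss_def)

lemma space_gauss [simp]: "space (gauss v) = UNIV" by (simp add: gauss_def)

lemma prob_space_std_normal: "prob_space (density lborel std_normal_density)" using prob_space_normal_density[of 1 0] by simp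

lemma prob_space_gauss: "prob_space (gauss v)" unfolding gauss_def by (intro prob_space.prob_space_distr prob_space_std_normal) simp

lemma gauss_0: "gauss 0 = return borel 0"
proof -
 have "gauss 0 = distr (density lborel std_normal_density) borel (%_. 0)" by (simp add: gauss_def)
 also have "... = return borel 0" by (rule measure_eqI)
   (auto simp: emeasure_distr prob_space.emeasure_space_1[OF prob_space_std_normal, simplified] indicator_def)
 finally show ?thesis .
qed

lemma gauss_density:
 assumes "v > 0"
 shows "gauss v = density lborel (normal_density 0 (sqrt v))"
proof -
 interpret prob_space "density lborel std_normal_density" by (rule prob_space_std_normal)
 have "distributed (density lborel std_normal_density) lborel (%x. x) std_normal_density" by (auto simp: distributed_def distr_id2)
 from normal_density_affine[OF this, of "sqrt v" 0]
 have "distributed (density lborel std_normal_density) lborel (%x. sqrt v * x) (normal_density 0 (sqrt v))" using assms by simp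
 thus ?thesis unfolding gauss_def distributed_def by (metis distr_cong sets_lborel)
qed

lemma distributed_gauss_iff:
 assumes "v > 0"
 shows "distributed M lborel X (normal_density 0 (sqrt v)) <->
  X : borel_measurable M & distr M borel X = gauss v"
proof -
 have "distr M lborel X = distr M borel X" by (rule distr_cong) auto
 thus ?thesis unfolding distributed_def gauss_density[OF assms] by auto
qed

lemma integral_gauss:
 assumes "f : borel_measurable borel"
 shows "(\<integral>x. f x \<partial>gauss v) = (\<integral>x. (f (sqrt v * x) :: real) \<partial>density lborel std_normal_density)"
 unfolding gauss_def using assms by (subst integral_distr) auto

lemma gauss_uminus: "distr (gauss v) borel uminus = gauss v"
proof -
 have *: "distr (density lborel std_normal_density) borel uminus = density lborel std_normal_density"
 proof -
  interpret prob_space "density lborel std_normal_density" by (rule prob_space_std_normal)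
  have "distributed (density lborel std_normal_density) lborel (%x. x) std_normal_density" by (auto simp: distributed_def distr_id2)
  from normal_density_affine[OF this, of "-1" 0]
  have "distributed (density lborel std_normal_density) lborel (%x. - x) std_normal_density" by simp
  thus ?thesis unfolding distributed_def by (metis distr_cong sets_lborel)
 qed
 have "distr (gauss v) borel uminus =
   distr (distr (density lborel std_normal_density) borel uminus) borel (%x. sqrt v * x)" unfolding gauss_def by (simp add: distr_distr comp_def)
 thus ?thesis unfolding * gauss_def by (simp cong: distr_cong)
qed

text \<open>The functions \<open>1 - n * infdist\<close>, truncated at 0, decrease to the indicator
  of a closed set; dominated convergence transfers the equality of integrals. The empty set is
  separate because \<open>infdist\<close> to it is 0.\<close>

lemma law_eq_closed:
 fixes X :: "'i => 'a => real" and Y :: "'i => 'b => real"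
 assumes J: "finite J" and pM: "prob_space M" and pN: "prob_space N" and X[measurable]: "!!i. i : J ==> X i : borel_measurable M"
  and Y[measurable]: "!!i. i : J ==> Y i : borel_measurable N" and eq: "!!f. (!!i. continuous_on UNIV (f i)) ==> (!!i x. 0 <= f i x & f i x <= (1::real)) ==>
   (\<integral>u. (PROD i:J. f i (X i u)) \<partial>M) = (\<integral>u. (PROD i:J. f i (Y i u)) \<partial>N)" and A: "!!i. i : J ==> closed (A i)"
 shows "measure M {u:space M. ALL i:J. X i u : A i} = measure N {u:space N. ALL i:J. Y i u : A i}"
proof -
 define f where "f n i x = (if A i = {} then 0 else max 0 (1 - real n * infdist x (A i)))" for n :: nat and i x
 have f01: "0 <= f n i x & f n i x <= 1" for n i x by (simp add: f_def infdist_nonneg)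
 have fc: "continuous_on UNIV (f n i)" for n i unfolding f_def by (cases "A i = {}") (auto intro!: continuous_intros)
 have fm[measurable]: "f n i : borel_measurable borel" for n i by (rule borel_measurable_continuous_onI[OF fc])
 have flim: "(%n. f n i x) ----> indicator (A i) x" if "i : J" for i x
 proof (cases "x : A i")
  case True
  hence "f n i x = 1" for n by (auto simp: f_def)
  thus ?thesis using True by simp
 next
  case False
  show ?thesis
  proof (cases "A i = {}")
   case ne: False
   hence d: "infdist x (A i) > 0" using in_closed_iff_infdist_zero[OF A[OF that] ne, of x] False infdist_nonneg[of x "A i"] by auto
   obtain N :: nat where N: "1 / infdist x (A i) < N" using reals_Archimedean2 by blast
   have "f n i x = 0" if "n >= N" for n
   proof -
    have "1 / infdist x (A i) < real n" using N that by linarith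
    hence "1 < real n * infdist x (A i)" using d by (simp add: pos_divide_less_eq)
    thus ?thesis using ne by (simp add: f_def)
   qed
   thus ?thesis using False by (intro tendsto_eventually) (auto simp: eventually_sequentially)
  qed (simp add: f_def)
 qed
 have lim: "(%n. \<integral>u. (PROD i:J. f n i (Z i u)) \<partial>L) ----> measure L {u:space L. ALL i:J. Z i u : A i}"
  if L: "prob_space L" and Z[measurable]: "!!i. i : J ==> Z i : borel_measurable L" for L :: "'c measure" and Z
 proof -
  interpret prob_space L by fact
  have [measurable]: "A i : sets borel" if "i : J" for i using A[OF that] by simp
  have S: "{u:space L. ALL i:J. Z i u : A i} : sets L" using J by measurable
  have "(%n. \<integral>u. (PROD i:J. f n i (Z i u)) \<partial>L) ----> (\<integral>u. (PROD i:J. indicator (A i) (Z i u)) \<partial>L)"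
  proof (rule integral_dominated_convergence[where w="%_. 1"])
   show "AE u in L. (%n. PROD i:J. f n i (Z i u)) ----> (PROD i:J. indicator (A i) (Z i u))" by (intro AE_I2 tendsto_prod flim)
   show "AE u in L. norm (PROD i:J. f n i (Z i u)) <= 1" for n using f01 by (intro AE_I2) (simp add: abs_prod prod_le_1)
  qed auto
  also have "(\<integral>u. (PROD i:J. indicator (A i) (Z i u)) \<partial>L) =
    (\<integral>u. indicator {u:space L. ALL i:J. Z i u : A i} u \<partial>L :: real)"
  proof (rule Bochner_Integration.integral_cong[OF refl])
   fix u assume w: "u : space L"
   show "(PROD i:J. indicator (A i) (Z i u)) = (indicator {u:space L. ALL i:J. Z i u : A i} u :: real)"
   proof (cases "ALL i:J. Z i u : A i")
    case True thus ?thesis using w by simp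
   next
    case False
    then obtain i where "i : J" "Z i u ~: A i" by blast
    hence "(PROD i:J. indicator (A i) (Z i u)) = (0::real)" using J by (intro prod_zero) (auto intro!: bexI[of _ i])
    thus ?thesis using False by simp
   qed
  qed
  also have "... = measure L {u:space L. ALL i:J. Z i u : A i}" using S by simp
  finally show ?thesis .
 qed
 show ?thesis using LIMSEQ_unique[OF lim[OF pM, of X] lim[OF pN, of Y, folded eq[OF fc f01]]] X Y by blast
qed

text \<open>Closed sets are replaced by Borel sets one coordinate at a time: with the other
  coordinates frozen, the sets allowed in the new coordinate form a Dynkin system that contains the
  closed sets.\<close>

lemma law_eq_cont:
 fixes X :: "'i => 'a => real" and Y :: "'i => 'b => real"
 assumes J: "finite J" and pM: "prob_space M" and pN: "prob_space N" and X[measurable]: "!!i. i : J ==> X i : borel_measurable M"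
  and Y[measurable]: "!!i. i : J ==> Y i : borel_measurable N" and eq: "!!f. (!!i. continuous_on UNIV (f i)) ==> (!!i x. 0 <= f i x & f i x <= (1::real)) ==>
   (\<integral>v. (PROD i:J. f i (X i v)) \<partial>M) = (\<integral>v. (PROD i:J. f i (Y i v)) \<partial>N)" and A: "!!i. i : J ==> A i : sets borel"
 shows "measure M {v:space M. ALL i:J. X i v : A i} = measure N {v:space N. ALL i:J. Y i v : A i}"
proof -
 interpret M: prob_space M by fact
 interpret N: prob_space N by fact
 define E where "E A <-> measure M {v:space M. ALL i:J. X i v : A i} = measure N {v:space N. ALL i:J. Y i v : A i}"
  for A :: "'i => real set"
 have "ALL A. (ALL i:H. A i : sets borel) --> (ALL i:J - H. closed (A i)) --> E A" if "H \<subseteq> J" for H using finite_subset[OF that J] that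
 proof (induction H rule: finite_induct)
  case empty
  show ?case
  proof (intro allI impI)
   fix A assume "ALL i:J - {}. closed (A i :: real set)"
   thus "E A" unfolding E_def by (intro law_eq_closed[OF J pM pN X Y eq]) simp_all
  qed
 next
  case (insert h H)
  show ?case
  proof (intro allI impI)
   fix A :: "'i => real set" assume A1: "ALL i:insert h H. A i : sets borel" and A2: "ALL i:J - insert h H. closed (A i)"
   have h: "h : J" using insert.prems by simp
   have m: "B i : sets borel" if "i : J" "B h : sets borel" "!!j. j ~= h ==> B j = A j" for B i
    using A1 A2 that by (cases "i = h"; cases "i : H") (auto simp: borel_closed)
   have mX: "{v:space M. ALL i:J. X i v : (A(h := S)) i} : sets M" if "S : sets borel" for S
   proof -
    have [measurable]: "i : J ==> (A(h := S)) i : sets borel" for i using m[of i "A(h := S)"] that by simp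
    show ?thesis using J by measurable
   qed
   have mY: "{v:space N. ALL i:J. Y i v : (A(h := S)) i} : sets N" if "S : sets borel" for S
   proof -
    have [measurable]: "i : J ==> (A(h := S)) i : sets borel" for i using m[of i "A(h := S)"] that by simp
    show ?thesis using J by measurable
   qed
   have base: "E (A(h := S))" if "closed S" for S using insert.IH insert.prems A1 A2 that by simp
   have sb: "sets (borel :: real measure) = sigma_sets UNIV (Collect closed)" by (simp add: borel_eq_closed)
   have "E (A(h := S))" if "S : sigma_sets UNIV (Collect closed)" for S
   proof (rule sigma_sets_induct_disjoint[OF _ _ that, where P="%S. E (A(h := S))"])
    show "Int_stable (Collect closed :: real set set)" by (auto simp: Int_stable_def)
    show "Collect closed \<subseteq> Pow (UNIV :: real set)" by simp
    show "E (A(h := {}))" by (rule base) simp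
    show "E (A(h := S))" if "S : Collect closed" for S using base that by simp
   next
    fix S :: "real set" assume S: "S : sigma_sets UNIV (Collect closed)" and ES: "E (A(h := S))"
    have SB: "S : sets borel" using S by (simp add: sb)
    have d: "{v:space L. ALL i:J. Z i v : (A(h := UNIV - S)) i} =
     {v:space L. ALL i:J. Z i v : (A(h := UNIV)) i} - {v:space L. ALL i:J. Z i v : (A(h := S)) i}"
     for L :: "'c measure" and Z using h by auto
    have s: "{v:space L. ALL i:J. Z i v : (A(h := S)) i} \<subseteq> {v:space L. ALL i:J. Z i v : (A(h := UNIV)) i}"
     for L :: "'c measure" and Z by auto
    have EU: "E (A(h := UNIV))" by (rule base) simp
    show "E (A(h := UNIV - S))" unfolding E_def d by (subst M.finite_measure_Diff[OF mX[of UNIV] mX[OF SB] s], simp,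
       subst N.finite_measure_Diff[OF mY[of UNIV] mY[OF SB] s], simp)
      (use ES EU in \<open>simp add: E_def\<close>)
   next
    fix S :: "nat => real set"
    assume dj: "disjoint_family S" and S: "range S \<subseteq> sigma_sets UNIV (Collect closed)" and ES: "!!n. E (A(h := S n))"
    have SB: "S n : sets borel" for n using S by (auto simp: sb)
    have u: "{v:space L. ALL i:J. Z i v : (A(h := \<Union> (range S))) i} =
     (\<Union>n. {v:space L. ALL i:J. Z i v : (A(h := S n)) i})" for L :: "'c measure" and Z
    proof (intro set_eqI iffI)
     fix v :: 'c assume w: "v : {v:space L. ALL i:J. Z i v : (A(h := \<Union> (range S))) i}"
     hence "Z h v : (A(h := \<Union> (range S))) h" using h by blast
     then obtain n where "Z h v : S n" by auto
     thus "v : (\<Union>n. {v:space L. ALL i:J. Z i v : (A(h := S n)) i})" using w by (intro UN_I[of n]) (auto split: if_splits)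
    next
     fix v assume "v : (\<Union>n. {v:space L. ALL i:J. Z i v : (A(h := S n)) i})"
     then obtain n where "v : space L" "ALL i:J. Z i v : (A(h := S n)) i" by blast
     thus "v : {v:space L. ALL i:J. Z i v : (A(h := \<Union> (range S))) i}" by (auto split: if_splits)
    qed
    have d: "disjoint_family (%n. {v:space L. ALL i:J. Z i v : (A(h := S n)) i})" for L :: "'c measure" and Z unfolding disjoint_family_on_def
    proof (intro ballI impI)
     fix m n :: nat assume "m ~= n"
     hence "S m Int S n = {}" using dj by (simp add: disjoint_family_on_def)
     moreover have "Z h v : S m Int S n" if "v : {v:space L. ALL i:J. Z i v : (A(h := S m)) i} Int {v:space L. ALL i:J. Z i v : (A(h := S n)) i}" for v
      using that h by (auto dest!: bspec[OF _ h])
     ultimately show "{v:space L. ALL i:J. Z i v : (A(h := S m)) i} Int {v:space L. ALL i:J. Z i v : (A(h := S n)) i} = {}"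
      by (metis (no_types, lifting) empty_iff subsetI subset_empty)
    qed
    have "(%n. measure M {v:space M. ALL i:J. X i v : (A(h := S n)) i}) sums
      measure M (\<Union>n. {v:space M. ALL i:J. X i v : (A(h := S n)) i})" by (rule M.finite_measure_UNION[OF _ d]) (use mX[OF SB] in blast)
    moreover have "(%n. measure N {v:space N. ALL i:J. Y i v : (A(h := S n)) i}) sums
      measure N (\<Union>n. {v:space N. ALL i:J. Y i v : (A(h := S n)) i})" by (rule N.finite_measure_UNION[OF _ d]) (use mY[OF SB] in blast)
    ultimately show "E (A(h := \<Union> (range S)))" unfolding E_def u using ES[unfolded E_def] by (simp only: sums_unique2)
   qed
   moreover have "A h : sigma_sets UNIV (Collect closed)" using A1 by (simp add: sb)
   ultimately have "E (A(h := A h))" by blast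
   thus "E A" by simp
  qed
 qed
 from this[of J] show ?thesis using A unfolding E_def by blast
qed

text \<open>Independence and the Gaussian laws in one product formula; a repeated grid time
  contributes the point mass \<open>gauss 0\<close>.\<close>

definition inc_law :: "'a measure => (real => 'a => real) => (nat => real) => nat => bool" where "inc_law M X u m <-> (ALL A. (ALL i. A i : sets borel) -->
  measure M {w:space M. ALL i<m. X (u (Suc i)) w - X (u i) w : A i} =
  (PROD i<m. measure (gauss (u (Suc i) - u i)) (A i)))"

lemma inc_law_distr:
 assumes pM: "prob_space M" and X: "!!i. X (u i) : borel_measurable M" and law: "inc_law M X u m"
 shows "distr M (PB {..<m}) (%w. \<lambda>i\<in>{..<m}. X (u (Suc i)) w - X (u i) w) =
  PiM {..<m} (%i. gauss (u (Suc i) - u i))"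
proof -
 interpret M: prob_space M by fact
 interpret G: prob_space "gauss (u (Suc i) - u i)" for i by (rule prob_space_gauss)
 interpret P: product_prob_space "%i. gauss (u (Suc i) - u i)" "{..<m}" by unfold_locales
 note X[measurable]
 have sets: "sets (PiM {..<m} (%i. gauss (u (Suc i) - u i))) = sets (PB {..<m})" by (rule sets_PiM_cong) auto
 have meas: "(%w. \<lambda>i\<in>{..<m}. X (u (Suc i)) w - X (u i) w) : measurable M (PB {..<m})" by measurable
 show ?thesis
 proof (rule P.PiM_eqI)
  fix A assume A: "!!i. i : {..<m} ==> A i : sets (gauss (u (Suc i) - u i))"
  define A' where "A' i = (if i < m then A i else {})" for i
  have A': "A' i : sets borel" for i using A[of i] by (simp add: A'_def)
  have "Pi\<^sub>E {..<m} A : sets (PB {..<m})" using A by (intro sets_PiM_I_finite) auto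
  hence "emeasure (distr M (PB {..<m}) (%w. \<lambda>i\<in>{..<m}. X (u (Suc i)) w - X (u i) w)) (Pi\<^sub>E {..<m} A)
   = emeasure M ((%w. \<lambda>i\<in>{..<m}. X (u (Suc i)) w - X (u i) w) -` Pi\<^sub>E {..<m} A Int space M)" by (rule emeasure_distr[OF meas])
  also have "(%w. \<lambda>i\<in>{..<m}. X (u (Suc i)) w - X (u i) w) -` Pi\<^sub>E {..<m} A Int space M =
   {w:space M. ALL i<m. X (u (Suc i)) w - X (u i) w : A' i}"
  proof (intro set_eqI)
   fix w
   show "w : (%w. \<lambda>i\<in>{..<m}. X (u (Suc i)) w - X (u i) w) -` Pi\<^sub>E {..<m} A Int space M <->
    w : {w:space M. ALL i<m. X (u (Suc i)) w - X (u i) w : A' i}" unfolding vimage_def PiE_iff by (simp add: A'_def conj_commute Ball_def)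
  qed
  also have "emeasure M ... = ennreal (PROD i<m. measure (gauss (u (Suc i) - u i)) (A' i))" using law A' unfolding inc_law_def M.emeasure_eq_measure by simp
  also have "... = (PROD i<m. emeasure (gauss (u (Suc i) - u i)) (A i))" by (simp add: prod_ennreal G.emeasure_eq_measure A'_def)
  finally show "emeasure (distr M (PB {..<m}) (%w. \<lambda>i\<in>{..<m}. X (u (Suc i)) w - X (u i) w)) (Pi\<^sub>E {..<m} A)
   = (PROD i:{..<m}. emeasure (gauss (u (Suc i) - u i)) (A i))" .
 qed (simp_all add: sets)
qed

text \<open>Values at the times in \<open>J\<close> are partial sums of increments along a grid
  containing them, because everything starts from 0. The grid may depend on \<open>J\<close>, so one
  suitable grid per finite set is enough.\<close>

lemma inc_law_unique:
 assumes pM: "prob_space M" and pN: "prob_space N" and X: "!!s. 0 <= s ==> X s : borel_measurable M" "!!w. w : space M ==> X 0 w = 0"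
  and Y: "!!s. 0 <= s ==> Y s : borel_measurable N" "!!w. w : space N ==> Y 0 w = 0"
  and law: "!!J. finite J ==> J \<subseteq> {0..} ==> EX u m. u 0 = 0 & (ALL i. 0 <= u i) & J \<subseteq> u ` {..m} &
   inc_law M X u m & inc_law N Y u m"
 shows "distr M (PB {0..}) (%w. \<lambda>s\<in>{0..}. X s w) =
  distr N (PB {0..}) (%w. \<lambda>s\<in>{0..}. Y s w)"
proof (rule measure_eqI_PiM_infinite)
 interpret M: prob_space M by fact
 have mX: "(%w. \<lambda>s\<in>{0..}. X s w) : measurable M (PB {0..})" using X(1) by (intro measurable_restrict) auto
 have mY: "(%w. \<lambda>s\<in>{0..}. Y s w) : measurable N (PB {0..})" using Y(1) by (intro measurable_restrict) auto
 show "finite_measure (distr M (PB {0..}) (%w. \<lambda>s\<in>{0..}. X s w))" by (rule M.finite_measure_distr[OF mX])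
 fix A J assume J: "finite J" "J \<subseteq> {0..}" and A: "!!i::real. i : J ==> A i : sets (borel :: real measure)"
 obtain u m where u: "u 0 = 0" "!!i. 0 <= u i" "J \<subseteq> u ` {..m}" and lX: "inc_law M X u m" and lY: "inc_law N Y u m" using law[OF J] by auto
 have "ALL s:J. EX i<=m. u i = s" using u(3) by auto
 then obtain k where k: "!!s. s : J ==> k s <= m & u (k s) = s" by metis
 define E where "E = {y:space (PB {..<m}). ALL s:J. (SUM i<k s. y i :: real) : A s}"
 have E: "E : sets (PB {..<m})"
 proof -
  have "(%y. SUM i<k s. y i :: real) : measurable (PB {..<m}) borel" if "s : J" for s
   using k[OF that] by (intro borel_measurable_sum[where f="%i y. y i"] measurable_component_singleton) auto
  hence "(\<Inter>s\<in>J. (%y. SUM i<k s. y i) -` A s Int space (PB {..<m})) : sets (PB {..<m})"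
   if "J ~= {}" using that J(1) A by (intro sets.finite_INT measurable_sets) auto
  moreover have "E = (\<Inter>s\<in>J. (%y. SUM i<k s. y i) -` A s Int space (PB {..<m}))" if "J ~= {}" using that unfolding E_def by auto
  ultimately show ?thesis by (cases "J = {}") (auto simp: E_def)
 qed
 have key: "emeasure (distr L (PB {0..}) (%w. \<lambda>s\<in>{0..}. Z s w)) (prod_emb {0..} (%_. borel) J (Pi\<^sub>E J A))
  = emeasure (PiM {..<m} (%i. gauss (u (Suc i) - u i))) E"
  if L: "prob_space L" and Z: "!!s. 0 <= s ==> Z s : borel_measurable L" and Z0: "!!w. w : space L ==> Z 0 w = 0"
   and lZ: "inc_law L Z u m" and mZ: "(%w. \<lambda>s\<in>{0..}. Z s w) : measurable L (PB {0..})"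
  for L :: "'c measure" and Z
 proof -
  have Zu: "Z (u i) : borel_measurable L" for i using Z u(2) by blast
  have tele: "(SUM i<n. Z (u (Suc i)) w - Z (u i) w) = Z (u n) w" if "w : space L" for n w
   using Z0[OF that] u(1) by (simp add: sum_lessThan_telescope[of "%i. Z (u i) w"] del: sum_subtractf)
  have "emeasure (distr L (PB {0..}) (%w. \<lambda>s\<in>{0..}. Z s w)) (prod_emb {0..} (%_. borel) J (Pi\<^sub>E J A))
   = emeasure L ((%w. \<lambda>s\<in>{0..}. Z s w) -` prod_emb {0..} (%_. borel) J (Pi\<^sub>E J A) Int space L)" using J A by (intro emeasure_distr mZ sets_PiM_I) auto
  also have "(%w. \<lambda>s\<in>{0..}. Z s w) -` prod_emb {0..} (%_. borel) J (Pi\<^sub>E J A) Int space L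
   = {w:space L. ALL s:J. Z s w : A s}"
  proof (intro set_eqI)
   fix w
   have "0 <= s" if "s : J" for s using that J(2) by auto
   thus "w : (%w. \<lambda>s\<in>{0..}. Z s w) -` prod_emb {0..} (%_. borel) J (Pi\<^sub>E J A) Int space L <->
    w : {w:space L. ALL s:J. Z s w : A s}" unfolding prod_emb_def by (auto simp: PiE_iff)
  qed
  also have "... = (%w. \<lambda>i\<in>{..<m}. Z (u (Suc i)) w - Z (u i) w) -` E Int space L"
  proof -
   have "(SUM i<k s. (\<lambda>i\<in>{..<m}. Z (u (Suc i)) w - Z (u i) w) i) = Z s w" if "s : J" "w : space L" for s w
   proof -
    have "(SUM i<k s. (\<lambda>i\<in>{..<m}. Z (u (Suc i)) w - Z (u i) w) i) = (SUM i<k s. Z (u (Suc i)) w - Z (u i) w)" using k[OF that(1)] by (intro sum.cong) auto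
    thus ?thesis using tele[OF that(2)] k[OF that(1)] by simp
   qed
   thus ?thesis unfolding E_def by (auto simp: space_PiM)
  qed
  also have "emeasure L ... = emeasure (distr L (PB {..<m}) (%w. \<lambda>i\<in>{..<m}. Z (u (Suc i)) w - Z (u i) w)) E"
   using Zu by (intro emeasure_distr[symmetric] E measurable_restrict) auto
  finally show ?thesis unfolding inc_law_distr[where X=Z, OF L Zu lZ] .
 qed
 show "emeasure (distr M (PB {0..}) (%w. \<lambda>s\<in>{0..}. X s w)) (prod_emb {0..} (%_. borel) J (Pi\<^sub>E J A)) =
  emeasure (distr N (PB {0..}) (%w. \<lambda>s\<in>{0..}. Y s w)) (prod_emb {0..} (%_. borel) J (Pi\<^sub>E J A))" using key[OF pM X lX mX] key[OF pN Y lY mY] by simp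
qed simp_all

section \<open>Construction of Brownian motion\<close>

text \<open>Invariance of the planar standard Gaussian under rotation by 45 degrees. Two
  one-dimensional affine substitutions with Fubini in between replace a planar change of
  variables.\<close>

lemma std_normal_rotate:
 assumes f[measurable]: "f : borel_measurable (borel XM borel)"
 shows "(nn_integral lborel (%a. nn_integral lborel (%b. f ((b + a) / sqrt 2, (b - a) / sqrt 2) * (ennreal (std_normal_density a) * ennreal (std_normal_density b)))))
  = (nn_integral lborel (%a. nn_integral lborel (%b. f (a, b) * (ennreal (std_normal_density a) * ennreal (std_normal_density b)))))"
proof -
 let ?d = "std_normal_density"
 have d: "ennreal (?d x) * ennreal (?d y) = ennreal (1 / (2 * pi) * exp (- (x\<^sup>2 + y\<^sup>2) / 2))" for x y :: real
  by (simp add: ennreal_mult'[symmetric] std_normal_density_def exp_add[symmetric] real_sqrt_mult[symmetric]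
    mult_exp_exp add_divide_distrib[symmetric])
 have s2: "sqrt 2 * sqrt 2 = (2::real)" "sqrt 2 ~= (0::real)" by simp_all
 have "(nn_integral lborel (%a. nn_integral lborel (%b. f ((b + a) / sqrt 2, (b - a) / sqrt 2) * (ennreal (?d a) * ennreal (?d b)))))
  = (nn_integral lborel (%a. ennreal (sqrt 2) * (nn_integral lborel (%u. f (u, u - sqrt 2 * a) * (ennreal (?d a) * ennreal (?d (sqrt 2 * u - a)))))))"
 proof (rule nn_integral_cong)
  fix a :: real
  show "(nn_integral lborel (%b. f ((b + a) / sqrt 2, (b - a) / sqrt 2) * (ennreal (?d a) * ennreal (?d b))))
   = ennreal (sqrt 2) * (nn_integral lborel (%u. f (u, u - sqrt 2 * a) * (ennreal (?d a) * ennreal (?d (sqrt 2 * u - a)))))"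
  \<comment> \<open>Substitution \<open>b = sqrt 2 * u - a\<close>, which makes the first argument
    of \<open>f\<close> equal to \<open>u\<close>.\<close>
  proof (subst nn_integral_real_affine[where c="sqrt 2" and t="- a"])
   have "((- a + sqrt 2 * u + a) / sqrt 2) = u" "(- a + sqrt 2 * u - a) / sqrt 2 = u - sqrt 2 * a" for u using s2 by (simp_all add: field_simps)
   thus "ennreal (abs (sqrt 2)) * (nn_integral lborel (%x. f ((- a + sqrt 2 * x + a) / sqrt 2, (- a + sqrt 2 * x - a) / sqrt 2) *
     (ennreal (?d a) * ennreal (?d (- a + sqrt 2 * x))))) =
    ennreal (sqrt 2) * (nn_integral lborel (%u. f (u, u - sqrt 2 * a) * (ennreal (?d a) * ennreal (?d (sqrt 2 * u - a)))))"
    by (simp add: add.commute diff_conv_add_uminus[symmetric])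
  qed (auto intro!: borel_measurable_times_ennreal measurable_compose[OF _ f])
 qed
 also have "... = (nn_integral lborel (%a. nn_integral lborel (%u. ennreal (sqrt 2) * (f (u, u - sqrt 2 * a) * (ennreal (?d a) * ennreal (?d (sqrt 2 * u - a)))))))"
  by (intro nn_integral_cong nn_integral_cmult[symmetric]) measurable
 also have "... = (nn_integral lborel (%u. nn_integral lborel (%a. ennreal (sqrt 2) * (f (u, u - sqrt 2 * a) * (ennreal (?d a) * ennreal (?d (sqrt 2 * u - a)))))))"
  by (rule lborel_pair.Fubini') measurable
 also have "... = (nn_integral lborel (%u. nn_integral lborel (%w. f (u, w) * (ennreal (?d u) * ennreal (?d w)))))"
 proof (rule nn_integral_cong)
  fix u :: real
  have e: "(((u - w) / sqrt 2)\<^sup>2 + (sqrt 2 * u - (u - w) / sqrt 2)\<^sup>2) = u\<^sup>2 + w\<^sup>2" for w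
  proof -
   have "sqrt 2 * u - (u - w) / sqrt 2 = (u + w) / sqrt 2" using s2 by (simp add: field_simps)
   thus ?thesis by (simp add: power_divide power2_eq_square field_simps)
  qed
  have "(nn_integral lborel (%a. ennreal (sqrt 2) * (f (u, u - sqrt 2 * a) * (ennreal (?d a) * ennreal (?d (sqrt 2 * u - a))))))
   = ennreal (1 / sqrt 2) * (nn_integral lborel (%w. ennreal (sqrt 2) * (f (u, w) * (ennreal (?d u) * ennreal (?d w)))))"
  \<comment> \<open>Substitution \<open>a = (u - w) / sqrt 2\<close>, which makes the second
    argument equal to \<open>w\<close>; identity \<open>e\<close> restores the product
    density.\<close>
  proof (subst nn_integral_real_affine[where c="- (1 / sqrt 2)" and t="u / sqrt 2"])
   have *: "u / sqrt 2 + - (1 / sqrt 2) * w = (u - w) / sqrt 2" for w by (simp add: diff_divide_distrib)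
   have "u - sqrt 2 * ((u - w) / sqrt 2) = w" for w using s2 by simp
   thus "ennreal (abs (- (1 / sqrt 2))) * (nn_integral lborel (%x. ennreal (sqrt 2) * (f (u, u - sqrt 2 * (u / sqrt 2 + - (1 / sqrt 2) * x)) *
     (ennreal (?d (u / sqrt 2 + - (1 / sqrt 2) * x)) * ennreal (?d (sqrt 2 * u - (u / sqrt 2 + - (1 / sqrt 2) * x))))))) =
    ennreal (1 / sqrt 2) * (nn_integral lborel (%w. ennreal (sqrt 2) * (f (u, w) * (ennreal (?d u) * ennreal (?d w)))))" unfolding * d e by simp
  qed measurable
  also have "... = ennreal (1 / sqrt 2) * (ennreal (sqrt 2) * (nn_integral lborel (%w. f (u, w) * (ennreal (?d u) * ennreal (?d w)))))"
   by (subst nn_integral_cmult) measurable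
  also have "... = (nn_integral lborel (%w. f (u, w) * (ennreal (?d u) * ennreal (?d w))))" by (simp add: mult.assoc[symmetric] ennreal_mult'[symmetric])
  finally show "(nn_integral lborel (%a. ennreal (sqrt 2) * (f (u, u - sqrt 2 * a) * (ennreal (?d a) * ennreal (?d (sqrt 2 * u - a))))))
   = (nn_integral lborel (%w. f (u, w) * (ennreal (?d u) * ennreal (?d w))))" .
 qed
 finally show ?thesis .
qed


section \<open>Events in products of product measures\<close>

lemma nn_integral_PiM_prod:
 assumes M: "!!i. prob_space (M i)" and f: "!!i. i : J ==> f i : borel_measurable (M i)" and J: "finite J"
 shows "(nn_integral (PiM UNIV M) (%x. (PROD i:J. f i (x i)))) = (PROD i:J. integral\<^sup>N (M i) (f i))"
proof -
 interpret M: prob_space "M i" for i by (rule M)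
 interpret P: product_prob_space M UNIV by unfold_locales
 have meas: "(%x. PROD i:J. f i (x i)) : borel_measurable (PiM J M)"
  using f by (intro borel_measurable_prod_ennreal measurable_compose[OF measurable_component_singleton]) auto
 have "(nn_integral (PiM UNIV M) (%x. (PROD i:J. f i (x i)))) = (nn_integral (PiM UNIV M) (%x. (PROD i:J. f i (restrict x J i))))"
  by (intro nn_integral_cong prod.cong) auto
 also have "... = (nn_integral (distr (PiM UNIV M) (PiM J M) (%x. restrict x J)) (%x. (PROD i:J. f i (x i))))"
  using meas by (subst nn_integral_distr) (auto intro: measurable_restrict_subset)
 also have "... = (nn_integral (PiM J M) (%x. (PROD i:J. f i (x i))))" using J by (subst P.distr_PiM_restrict_finite) auto
 also have "... = (PROD i:J. integral\<^sup>N (M i) (f i))" by (rule P.product_nn_integral_prod[OF J f])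
 finally show ?thesis .
qed

lemma emeasure_PiM_UNIV_box:
 assumes M: "!!i. prob_space (M i)" and A: "!!i. i : J ==> A i : sets (M i)" and J: "finite J"
 shows "emeasure (PiM UNIV M) {x:space (PiM UNIV M). ALL i:J. x i : A i} = (PROD i:J. emeasure (M i) (A i))"
proof -
 have "{x:space (PiM UNIV M). ALL i:J. x i : A i} = prod_emb UNIV M J (Pi\<^sub>E J A)" by (auto simp: prod_emb_def space_PiM PiE_iff)
 thus ?thesis using emeasure_PiM_emb[OF M _ J A] by simp
qed

text \<open>With the first sequence fixed the event is a box of the second product, and the
  resulting integrand factorizes over the first. It computes laws of maps that combine two
  independent sequences index by index.\<close>

lemma emeasure_pair_PiM_box:
 fixes N1 :: "nat => 'a measure" and N2 :: "nat => 'b measure"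
 assumes N1: "!!i. prob_space (N1 i)" and N2: "!!i. prob_space (N2 i)" and E: "!!k. k : J ==> E k : sets (N1 k XM N2 k)" and J: "finite J"
 shows "emeasure (PiM UNIV N1 XM PiM UNIV N2)
   {z:space (PiM UNIV N1 XM PiM UNIV N2). ALL k:J. (fst z k, snd z k) : E k}
  = (PROD k:J. emeasure (N1 k XM N2 k) (E k))" (is "emeasure ?P ?S = _")
proof -
 interpret P1: prob_space "PiM UNIV N1" using N1 by (rule prob_space_PiM)
 interpret P2: prob_space "PiM UNIV N2" using N2 by (rule prob_space_PiM)
 interpret N2: prob_space "N2 k" for k by (rule N2)
 have m: "(%z. (fst z k, snd z k)) : measurable ?P (N1 k XM N2 k)" for k by measurable
 have S: "?S : sets ?P" using J E by (intro sets.sets_Collect_finite_All measurable_sets_Collect[OF m]) auto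
 have "emeasure ?P ?S = (nn_integral (PiM UNIV N1) (%x. emeasure (PiM UNIV N2) (Pair x -` ?S)))" by (rule P2.emeasure_pair_measure_alt[OF S])
 also have "... = (nn_integral (PiM UNIV N1) (%x. (PROD k:J. emeasure (N2 k) (Pair (x k) -` E k))))"
 proof (rule nn_integral_cong)
  fix x assume x: "x : space (PiM UNIV N1)"
  have "Pair x -` ?S = {y:space (PiM UNIV N2). ALL k:J. y k : Pair (x k) -` E k}" using x by (auto simp: space_pair_measure)
  also have "emeasure (PiM UNIV N2) ... = (PROD k:J. emeasure (N2 k) (Pair (x k) -` E k))" using E by (intro emeasure_PiM_UNIV_box N2 J sets_Pair1)
  finally show "emeasure (PiM UNIV N2) (Pair x -` ?S) = ..." .
 qed
 also have "... = (PROD k:J. nn_integral (N1 k) (%a. emeasure (N2 k) (Pair a -` E k)))" using E by (intro nn_integral_PiM_prod N1 J N2.measurable_emeasure_Pair) auto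
 also have "... = (PROD k:J. emeasure (N1 k XM N2 k) (E k))" using E by (intro prod.cong refl N2.emeasure_pair_measure_alt[symmetric]) auto
 finally show ?thesis .
qed

lemma PiM_resample:
 assumes "!!i. prob_space (M i)"
 shows "distr (M i XM PiM UNIV M) (PiM UNIV M) (%(x, X). X(i := x)) = PiM UNIV M" using distr_pair_PiM_eq_PiM[of UNIV M i] assms by simp

text \<open>Half an increment plus and minus an independent displacement gives two independent half
  increments: up to scaling, the pair is a rotation of two independent standard Gaussians.\<close>

lemma gauss_split:
 assumes v: "0 <= v" and A: "A : sets borel" and B: "B : sets borel"
 shows "emeasure (gauss 1 XM gauss v) {(a, b). b / 2 + sqrt v / 2 * a : A & b / 2 - sqrt v / 2 * a : B}
  = emeasure (gauss (v / 2)) A * emeasure (gauss (v / 2)) B"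
proof -
 note [measurable] = A B
 let ?S = "density lborel std_normal_density"
 let ?c = "sqrt (v / 2)"
 interpret S: prob_space ?S by (rule prob_space_std_normal)
 interpret G: prob_space "gauss r" for r by (rule prob_space_gauss)
 have c: "sqrt v / 2 = ?c / sqrt 2" by (simp add: real_sqrt_divide)
 define f where "f = (%(x, y). indicator A (?c * x) * indicator B (?c * y) :: ennreal)"
 have f[measurable]: "f : borel_measurable (borel XM borel)" unfolding f_def by measurable
 have "emeasure (gauss 1 XM gauss v) {(a, b). b / 2 + sqrt v / 2 * a : A & b / 2 - sqrt v / 2 * a : B}
  = (nn_integral (gauss 1) (%a. nn_integral (gauss v) (%b. indicator A (b / 2 + sqrt v / 2 * a) * indicator B (b / 2 - sqrt v / 2 * a))))"
 proof (subst G.emeasure_pair_measure)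
  show "{(a, b). b / 2 + sqrt v / 2 * a : A & b / 2 - sqrt v / 2 * a : B} : sets (gauss 1 XM gauss v)"
  proof -
   have "(%(a, b). b / 2 + sqrt v / 2 * a) : measurable (gauss 1 XM gauss v) borel"
    "(%(a, b). b / 2 - sqrt v / 2 * a) : measurable (gauss 1 XM gauss v) borel" by measurable
   from measurable_sets[OF this(1) A] measurable_sets[OF this(2) B]
   have "(%(a, b). b / 2 + sqrt v / 2 * a) -` A Int (%(a, b). b / 2 - sqrt v / 2 * a) -` B : sets (gauss 1 XM gauss v)" by (auto simp: space_pair_measure)
   also have "(%(a, b). b / 2 + sqrt v / 2 * a) -` A Int (%(a, b). b / 2 - sqrt v / 2 * a) -` B
    = {(a, b). b / 2 + sqrt v / 2 * a : A & b / 2 - sqrt v / 2 * a : B}" by auto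
   finally show ?thesis .
  qed
 qed (auto intro!: nn_integral_cong simp: indicator_def)
 also have "... = (nn_integral ?S (%a. nn_integral ?S (%b. indicator A (sqrt v * b / 2 + sqrt v / 2 * a) * indicator B (sqrt v * b / 2 - sqrt v / 2 * a))))"
  unfolding gauss_def by (subst nn_integral_distr; (subst nn_integral_distr)?) simp_all
 also have "... = (nn_integral ?S (%a. nn_integral ?S (%b. f ((b + a) / sqrt 2, (b - a) / sqrt 2))))"
 proof -
  have "sqrt v * b / 2 + sqrt v / 2 * a = ?c * ((b + a) / sqrt 2)" "sqrt v * b / 2 - sqrt v / 2 * a = ?c * ((b - a) / sqrt 2)" for a b
   using c by (simp_all add: field_simps)
  thus ?thesis by (simp add: f_def)
 qed
 also have "... = (nn_integral lborel (%a. nn_integral lborel (%b. f ((b + a) / sqrt 2, (b - a) / sqrt 2) * (ennreal (std_normal_density a) * ennreal (std_normal_density b)))))"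
  by (simp add: nn_integral_density nn_integral_cmult[symmetric] mult_ac)
 also have "... = (nn_integral lborel (%a. nn_integral lborel (%b. f (a, b) * (ennreal (std_normal_density a) * ennreal (std_normal_density b)))))"
  by (rule std_normal_rotate[OF f])
 also have "... = (nn_integral ?S (%a. nn_integral ?S (%b. f (a, b))))" by (simp add: nn_integral_density nn_integral_cmult[symmetric] mult_ac)
 also have "... = (nn_integral ?S (%a. indicator A (?c * a))) * (nn_integral ?S (%b. indicator B (?c * b)))"
  unfolding f_def by (simp add: nn_integral_cmult nn_integral_multc)
 also have "... = emeasure (gauss (v / 2)) A * emeasure (gauss (v / 2)) B"
 proof -
  have "emeasure (gauss r) C = (nn_integral ?S (%a. indicator C (sqrt r * a)))" if [measurable]: "C : sets borel" for r C
  proof -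
   have "emeasure (gauss r) C = (nn_integral (gauss r) (%a. indicator C a))" using that by (simp add: nn_integral_indicator)
   also have "... = (nn_integral ?S (%a. indicator C (sqrt r * a)))" unfolding gauss_def by (rule nn_integral_distr) measurable
   finally show ?thesis .
  qed
  thus ?thesis using A B by simp
 qed
 finally show ?thesis .
qed

section \<open>White noise and its dyadic refinement\<close>

definition noise_level :: "(nat => real) measure" where "noise_level = PiM UNIV (%_. gauss 1)"

definition noise :: "(nat => nat => real) measure" where "noise = PiM UNIV (%_. noise_level)"

lemma prob_space_noise_level: "prob_space noise_level" unfolding noise_level_def by (intro prob_space_PiM prob_space_gauss)

lemma prob_space_noise: "prob_space noise" unfolding noise_def by (intro prob_space_PiM prob_space_noise_level)

lemma noise_coord [measurable]: "(%w. w m k) : borel_measurable noise"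
proof -
 have "(%x. x k) : borel_measurable noise_level" unfolding noise_level_def by (intro measurable_PiM_component_rev) auto
 moreover have "(%w. w m) : measurable noise noise_level" unfolding noise_def by (intro measurable_component_singleton) simp
 ultimately show ?thesis by (rule measurable_compose[rotated])
qed

text \<open>\<open>dyad m k\<close> is the increment over the \<open>k\<close>-th interval of length \<open>1/2^m\<close> (Levy's midpoint refinement).\<close>

primrec dyad :: "nat => (nat => nat => real) => nat => real" where "dyad 0 w = w 0"
| "dyad (Suc m) w = (%j. dyad m w (j div 2) / 2 +
  (if even j then 1 else - 1) * (sqrt (1 / 2 ^ m) / 2 * w (Suc m) (j div 2)))"

lemma dyad_measurable [measurable]: "(%w. dyad m w k) : borel_measurable noise" by (induction m arbitrary: k) auto

lemma dyad_cong: "(!!i. i <= m ==> w i = w' i) ==> dyad m w = dyad m w'"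
proof (induction m)
 case (Suc m)
 hence "dyad m w = dyad m w'" by simp
 thus ?case using Suc.prems[of "Suc m"] by (simp add: fun_eq_iff)
qed simp

lemma measurable_vec:
 assumes "!!j. (%z. f z j) : measurable M (N j)"
 shows "f : measurable M (PiM UNIV N)"
proof -
 have "(%z. \<lambda>j\<in>UNIV. f z j) : measurable M (PiM UNIV N)" by (intro measurable_restrict assms)
 thus ?thesis by (simp add: restrict_def)
qed

lemma dyad_vec_measurable: "dyad m : measurable noise (PB UNIV)" by (intro measurable_vec dyad_measurable)

lemma gauss_coord: "(%a. a i) : borel_measurable (PiM UNIV (%_. gauss v))" using measurable_component_singleton[of i UNIV "%_. gauss v"]
 by (simp add: measurable_cong_sets[OF refl sets_gauss])

text \<open>One step of \<open>dyad\<close> as a function of fresh noise in the first component and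
  old increments in the second.\<close>

definition refine :: "real => (nat => real) \<times> (nat => real) => nat => real" where
 "refine v z j = snd z (j div 2) / 2 + (if even j then 1 else - 1) * (sqrt v / 2 * fst z (j div 2))"

lemma refine_measurable: "refine v : measurable (noise_level XM PiM UNIV (%_. gauss w)) (PB UNIV)"
proof (rule measurable_vec)
 fix j
 have "(%z. fst z i) : borel_measurable (noise_level XM PiM UNIV (%_. gauss w))" for i :: nat by (rule measurable_compose[OF measurable_fst])
   (simp add: noise_level_def gauss_coord)
 moreover have "(%z. snd z i) : borel_measurable (noise_level XM PiM UNIV (%_. gauss w))" for i :: nat
  by (rule measurable_compose[OF measurable_snd]) (simp add: gauss_coord)
 ultimately show "(%z. refine v z j) : borel_measurable (noise_level XM PiM UNIV (%_. gauss w))"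
  unfolding refine_def by (intro borel_measurable_add borel_measurable_times borel_measurable_divide measurable_const) simp_all
qed

lemma sets_PiM_gauss: "sets (PiM I (%i. gauss (v i))) = sets (PB I)" by (rule sets_PiM_cong) auto

text \<open>New intervals \<open>2 * k\<close> and \<open>2 * k + 1\<close> depend on the same pair
  of entries and on no other, so grouping them turns the event into a box of pairs.\<close>

lemma dyad_refine_law:
 assumes v: "0 <= v"
 shows "distr (noise_level XM PiM UNIV (%_. gauss v)) (PB UNIV)
  (refine v) = PiM UNIV (%_ :: nat. gauss (v / 2))"
proof -
 let ?P = "noise_level XM PiM UNIV (%_ :: nat. gauss v)"
 let ?R = "refine v"
 interpret G: prob_space "gauss r" for r by (rule prob_space_gauss)
 interpret T: product_prob_space "%_. gauss (v / 2)" "UNIV :: nat set" by unfold_locales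
 have R: "?R : measurable ?P (PB UNIV)" by (rule refine_measurable)
 have sets: "sets (PiM UNIV (%_ :: nat. gauss (v / 2))) = sets (PB UNIV)" by (rule sets_PiM_gauss)
 show ?thesis
 proof (rule T.PiM_eq)
  fix J :: "nat set" and F assume J: "finite J" and F: "!!j. j : J ==> F j : sets (gauss (v / 2))"
  define F' where "F' j = (if j : J then F j else UNIV)" for j
  have F': "F' j : sets borel" for j using F by (auto simp: F'_def)
  obtain K where K: "J \<subseteq> {..<2 * K}"
  proof -
   obtain K where "J \<subseteq> {..<K}" using J finite_nat_iff_bounded by blast
   hence "J \<subseteq> {..<2 * K}" by auto
   thus ?thesis by (rule that)
  qed
  define E where "E k = {(a, b). b / 2 + sqrt v / 2 * a : F' (2 * k) & b / 2 - sqrt v / 2 * a : F' (2 * k + 1)}" for k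
  have E: "E k : sets (gauss 1 XM gauss v)" for k
  proof -
   have "(%(a, b). b / 2 + sqrt v / 2 * a) : measurable (gauss 1 XM gauss v) borel"
    "(%(a, b). b / 2 - sqrt v / 2 * a) : measurable (gauss 1 XM gauss v) borel" by measurable
   from measurable_sets[OF this(1) F'[of "2 * k"]] measurable_sets[OF this(2) F'[of "2 * k + 1"]]
   have "(%(a, b). b / 2 + sqrt v / 2 * a) -` F' (2 * k) Int (%(a, b). b / 2 - sqrt v / 2 * a) -` F' (2 * k + 1)
     : sets (gauss 1 XM gauss v)" by (auto simp: space_pair_measure)
   also have "(%(a, b). b / 2 + sqrt v / 2 * a) -` F' (2 * k) Int (%(a, b). b / 2 - sqrt v / 2 * a) -` F' (2 * k + 1) = E k" unfolding E_def by auto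
   finally show ?thesis .
  qed
  have div2: "(ALL j:{..<2 * K}. Q j) <-> (ALL k:{..<K}. Q (2 * k) & Q (2 * k + 1))" for Q
  proof safe
   fix j assume a: "ALL k:{..<K}. Q (2 * k) & Q (2 * k + 1)" and j: "j < 2 * K"
   hence "j div 2 < K" by auto
   hence "Q (2 * (j div 2))" "Q (2 * (j div 2) + 1)" using a by auto
   thus "Q j" by (cases "even j") auto
  qed auto
  have "emeasure (distr ?P (PB UNIV) ?R) (prod_emb UNIV (%_. gauss (v / 2)) J (Pi\<^sub>E J F))
   = emeasure ?P (?R -` prod_emb UNIV (%_. gauss (v / 2)) J (Pi\<^sub>E J F) Int space ?P)" using J F sets by (intro emeasure_distr R) (auto intro!: sets_PiM_I)
  also have "?R -` prod_emb UNIV (%_. gauss (v / 2)) J (Pi\<^sub>E J F) Int space ?P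
   = {z:space ?P. ALL j:{..<2 * K}. ?R z j : F' j}" using K by (auto simp: prod_emb_def PiE_iff F'_def subset_eq simp del: of_nat_mult)
  also have "... = {z:space ?P. ALL k:{..<K}. (fst z k, snd z k) : E k}" unfolding div2 by (simp add: E_def refine_def)
  also have "emeasure ?P ... = (PROD k:{..<K}. emeasure (gauss 1 XM gauss v) (E k))" unfolding noise_level_def by (intro emeasure_pair_PiM_box prob_space_gauss E) simp
  also have "... = (PROD k<K. emeasure (gauss (v / 2)) (F' (2 * k)) * emeasure (gauss (v / 2)) (F' (2 * k + 1)))"
   unfolding E_def by (intro prod.cong refl gauss_split v F')
  also have "... = (PROD j<2 * K. emeasure (gauss (v / 2)) (F' j))" by (induction K) (simp_all add: mult_ac)
  also have "... = (PROD j:J. emeasure (gauss (v / 2)) (F j))"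
  proof -
   have "emeasure (gauss (v / 2)) UNIV = 1" using G.emeasure_space_1[of "v / 2"] by simp
   hence "(PROD j<2 * K. emeasure (gauss (v / 2)) (F' j)) = (PROD j:J. emeasure (gauss (v / 2)) (F' j))" using K J by (intro prod.mono_neutral_right) (auto simp: F'_def)
   thus ?thesis by (simp add: F'_def)
  qed
  finally show "emeasure (distr ?P (PB UNIV) ?R) (prod_emb UNIV (%_. gauss (v / 2)) J (Pi\<^sub>E J F))
   = (PROD j:J. emeasure (gauss (v / 2)) (F j))" .
 qed (simp add: sets)
qed

text \<open>\<open>dyad m\<close> does not read noise level \<open>Suc m\<close>. Resampling that
  level therefore exhibits the next refinement as \<open>refine\<close> of an independent
  pair.\<close>

lemma dyad_law: "distr noise (PB UNIV) (dyad m) = PiM UNIV (%_ :: nat. gauss (1 / 2 ^ m))"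
proof (induction m)
 case 0
 interpret P: product_prob_space "%_ :: nat. noise_level" UNIV using prob_space_noise_level by (intro product_prob_spaceI)
 have "distr noise (PB UNIV) (%w. w 0) = distr noise noise_level (%w. w 0)" unfolding noise_level_def by (intro distr_cong refl sets_PiM_gauss[symmetric])
 also have "... = noise_level" unfolding noise_def by (rule P.PiM_component) simp
 finally show ?case by (simp add: noise_level_def)
next
 case (Suc m)
 let ?v = "1 / 2 ^ m :: real"
 let ?R = "refine ?v"
 let ?B = "PiM UNIV (%_ :: nat. borel :: real measure)"
 interpret L: prob_space noise_level by (rule prob_space_noise_level)
 interpret N: prob_space noise by (rule prob_space_noise)
 have D: "distr noise (PiM UNIV (%_ :: nat. gauss ?v)) (dyad m) = PiM UNIV (%_ :: nat. gauss ?v)" using Suc by (subst distr_cong[OF refl sets_PiM_gauss refl]) simp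
 have Dm: "dyad m : measurable noise (PiM UNIV (%_ :: nat. gauss ?v))" using dyad_vec_measurable[of m] by (simp add: measurable_cong_sets[OF refl sets_PiM_gauss])
 have R: "?R : measurable (noise_level XM PiM UNIV (%_ :: nat. gauss ?v)) ?B" by (rule refine_measurable)
 have upd: "(%(x, X). X(Suc m := x)) : measurable (noise_level XM noise) noise"
 proof -
  have "(%(x, X). X(Suc m := x)) : measurable (noise_level XM noise) (PiM UNIV (%_ :: nat. noise_level))"
  proof (rule measurable_vec)
   fix j
   show "(%z. (case z of (x, X) => X(Suc m := x)) j) : measurable (noise_level XM noise) noise_level"
    unfolding noise_def by (cases "j = Suc m") (simp_all add: case_prod_beta)
  qed
  thus ?thesis by (simp add: noise_def)
 qed
 have "distr noise ?B (dyad (Suc m)) = distr (distr (noise_level XM noise) noise (%(x, X). X(Suc m := x))) ?B (dyad (Suc m))"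
  using PiM_resample[of "%_. noise_level" "Suc m"] prob_space_noise_level by (simp add: noise_def)
 also have "... = distr (noise_level XM noise) ?B (dyad (Suc m) o (%(x, X). X(Suc m := x)))" by (rule distr_distr[OF dyad_vec_measurable upd])
 also have "dyad (Suc m) o (%(x, X). X(Suc m := x)) = ?R o (%(x, X). (x, dyad m X))"
 proof (rule ext)
  fix z :: "(nat => real) \<times> (nat => nat => real)"
  have "dyad m ((snd z)(Suc m := fst z)) = dyad m (snd z)" by (rule dyad_cong) simp
  thus "(dyad (Suc m) o (%(x, X). X(Suc m := x))) z = (?R o (%(x, X). (x, dyad m X))) z" by (simp add: case_prod_beta fun_eq_iff refine_def)
 qed
 also have "distr (noise_level XM noise) ?B (?R o (%(x, X). (x, dyad m X)))
  = distr (distr (noise_level XM noise) (noise_level XM PiM UNIV (%_ :: nat. gauss ?v)) (%(x, X). (x, dyad m X))) ?B ?R"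
  using Dm by (intro distr_distr[symmetric] R) (simp add: case_prod_beta measurable_compose[OF measurable_snd])
 also have "distr (noise_level XM noise) (noise_level XM PiM UNIV (%_ :: nat. gauss ?v)) (%(x, X). (x, dyad m X))
  = noise_level XM PiM UNIV (%_ :: nat. gauss ?v)" using pair_measure_distr[of "%x. x" noise_level noise_level "dyad m" noise "PiM UNIV (%_. gauss ?v)"] Dm
   N.prob_space_distr[OF Dm, THEN prob_space_imp_sigma_finite] by (simp add: D case_prod_beta')
 also have "distr (noise_level XM PiM UNIV (%_ :: nat. gauss ?v)) ?B ?R = PiM UNIV (%_ :: nat. gauss (?v / 2))" by (rule dyad_refine_law) simp
 finally show ?case by (simp add: mult.commute)
qed

section \<open>Polygonal interpolation and its uniform limit\<close>

definition ramp :: "real => real" where "ramp y = min 1 (max 0 y)"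

text \<open>A ramp over an interval is the mean of the ramps over its halves, so refining without
  displacement would leave the interpolation unchanged.\<close>

lemma ramp_half: "ramp z = (ramp (2 * z) + ramp (2 * z - 1)) / 2" by (simp add: ramp_def min_def max_def)

lemma ramp_mono: "x <= y ==> ramp x <= ramp y" by (simp add: ramp_def min_def max_def)

lemma ramp_bounds: "0 <= ramp x" "ramp x <= 1" by (simp_all add: ramp_def)

lemma continuous_ramp: "continuous_on S ramp" unfolding ramp_def by (intro continuous_intros)

text \<open>Piecewise linear path with the given increments; the summation stops where all later
  ramps vanish.\<close>

definition polygon :: "nat => (nat => nat => real) => real => real" where "polygon m w t = (SUM j<nat \<lceil>2 ^ m * t\<rceil>. dyad m w j * ramp (2 ^ m * t - real j))"

lemma polygon_eq:
 assumes "2 ^ m * t <= real N"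
 shows "polygon m w t = (SUM j<N. dyad m w j * ramp (2 ^ m * t - real j))" unfolding polygon_def
proof (rule sum.mono_neutral_left)
 show "{..<nat \<lceil>2 ^ m * t\<rceil>} \<subseteq> {..<N}" using assms by (auto simp: ceiling_le_iff nat_le_iff intro: less_le_trans)
 show "ALL i:{..<N} - {..<nat \<lceil>2 ^ m * t\<rceil>}. dyad m w i * ramp (2 ^ m * t - real i) = 0"
 proof
  fix i assume "i : {..<N} - {..<nat \<lceil>2 ^ m * t\<rceil>}"
  hence "2 ^ m * t <= real i" by (simp add: not_less nat_le_iff ceiling_le_iff)
  thus "dyad m w i * ramp (2 ^ m * t - real i) = 0" by (simp add: ramp_def)
 qed
qed simp

lemma sum_pairs: "(SUM j<2 * N. f j) = (SUM k<N. f (2 * k) + f (2 * k + 1))" for f :: "nat => real" by (induction N) simp_all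

text \<open>By \<open>ramp_half\<close> the halved increments reproduce the coarse polygon; what
  remains are the displacements times tent functions.\<close>

lemma polygon_step:
 assumes "2 ^ m * t <= real N"
 shows "polygon (Suc m) w t - polygon m w t =
  (SUM k<N. sqrt (1 / 2 ^ m) / 2 * w (Suc m) k *
   (ramp (2 * (2 ^ m * t - real k)) - ramp (2 * (2 ^ m * t - real k) - 1)))"
proof -
 have "2 ^ Suc m * t <= real (2 * N)" using assms by simp
 hence "polygon (Suc m) w t = (SUM j<2 * N. dyad (Suc m) w j * ramp (2 ^ Suc m * t - real j))" by (rule polygon_eq)
 also have "... = (SUM k<N. dyad (Suc m) w (2 * k) * ramp (2 ^ Suc m * t - real (2 * k)) +
   dyad (Suc m) w (2 * k + 1) * ramp (2 ^ Suc m * t - real (2 * k + 1)))" by (rule sum_pairs)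
 also have "... = (SUM k<N. dyad m w k * ramp (2 ^ m * t - real k) + sqrt (1 / 2 ^ m) / 2 * w (Suc m) k *
   (ramp (2 * (2 ^ m * t - real k)) - ramp (2 * (2 ^ m * t - real k) - 1)))"
 proof (rule sum.cong[OF refl])
  fix k
  have e: "2 ^ Suc m * t - real (2 * k) = 2 * (2 ^ m * t - real k)" "2 ^ Suc m * t - real (2 * k + 1) = 2 * (2 ^ m * t - real k) - 1" by simp_all
  have d: "dyad (Suc m) w (2 * k) = dyad m w k / 2 + sqrt (1 / 2 ^ m) / 2 * w (Suc m) k"
   "dyad (Suc m) w (2 * k + 1) = dyad m w k / 2 - sqrt (1 / 2 ^ m) / 2 * w (Suc m) k" by simp_all
  show "dyad (Suc m) w (2 * k) * ramp (2 ^ Suc m * t - real (2 * k)) +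
   dyad (Suc m) w (2 * k + 1) * ramp (2 ^ Suc m * t - real (2 * k + 1)) =
   dyad m w k * ramp (2 ^ m * t - real k) + sqrt (1 / 2 ^ m) / 2 * w (Suc m) k *
   (ramp (2 * (2 ^ m * t - real k)) - ramp (2 * (2 ^ m * t - real k) - 1))"
   unfolding e d ramp_half[of "2 ^ m * t - real k"] by (simp only: algebra_simps) (simp add: field_simps)
 qed
 also have "... = polygon m w t + (SUM k<N. sqrt (1 / 2 ^ m) / 2 * w (Suc m) k *
   (ramp (2 * (2 ^ m * t - real k)) - ramp (2 * (2 ^ m * t - real k) - 1)))" by (simp add: sum.distrib polygon_eq[OF assms])
 finally show ?thesis by simp
qed

text \<open>The fourth moment bound trades the maximum over the \<open>K 2^m\<close> coefficients for a sum:
 \<open>x <= \<rho> (1 + (x / \<rho>)\<^sup>4)\<close> with \<open>\<rho> = (9/10)^m\<close>.\<close>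

definition levy_err :: "nat => nat => (nat => nat => real) => real" where
 "levy_err K m w = (SUM k<K * 2 ^ m. (9 / 10) ^ m * (sqrt (1 / 2 ^ m) / 2 * w (Suc m) k / (9 / 10) ^ m) ^ 4)"

lemma levy_err_nonneg: "0 <= levy_err K m w" unfolding levy_err_def by (intro sum_nonneg) (simp add: zero_le_even_power)

lemma levy_err_measurable [measurable]: "levy_err K m : borel_measurable noise" unfolding levy_err_def by measurable

lemma x_le_fourth: "x <= 1 + x ^ 4" for x :: real
proof (cases "x <= 1")
 case True
 moreover have "0 <= x ^ 4" by (simp add: zero_le_even_power)
 ultimately show ?thesis by linarith
next
 case False
 hence "x ^ 1 <= x ^ 4" by (intro power_increasing) auto
 thus ?thesis by simp
qed

text \<open>The tents are nonnegative with total at most 1, so the constant part of the bound on the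
  displacements enters once; only the fourth powers are summed over all intervals.\<close>

lemma polygon_step_bound:
 assumes "t <= real K"
 shows "abs (polygon (Suc m) w t - polygon m w t) <= (9 / 10) ^ m + levy_err K m w"
proof -
 define c :: real where "c = (9 / 10) ^ m"
 have c: "c > 0" by (simp add: c_def)
 define N where "N = K * 2 ^ m"
 define x where "x k = sqrt (1 / 2 ^ m) / 2 * w (Suc m) k" for k
 define T where "T k = ramp (2 * (2 ^ m * t - real k)) - ramp (2 * (2 ^ m * t - real k) - 1)" for k
 have T0: "0 <= T k" for k unfolding T_def using ramp_mono[of "2 * (2 ^ m * t - real k) - 1"] by simp
 have T1: "T k <= 1" for k unfolding T_def using ramp_bounds[of "2 * (2 ^ m * t - real k)"]
  ramp_bounds[of "2 * (2 ^ m * t - real k) - 1"] by linarith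
 \<comment> \<open>Each tent is enlarged to a difference of ramps two units apart, and these
   differences telescope.\<close>
 have "(SUM k<N. T k) <= (SUM k<N. ramp (2 * (2 ^ m * t) - 2 * real k) - ramp (2 * (2 ^ m * t) - 2 * real (Suc k)))" unfolding T_def
 proof (rule sum_mono)
  fix k
  have "ramp (2 * (2 ^ m * t) - 2 * real (Suc k)) <= ramp (2 * (2 ^ m * t - real k) - 1)" by (rule ramp_mono) simp
  thus "ramp (2 * (2 ^ m * t - real k)) - ramp (2 * (2 ^ m * t - real k) - 1)
   <= ramp (2 * (2 ^ m * t) - 2 * real k) - ramp (2 * (2 ^ m * t) - 2 * real (Suc k))" by (simp add: right_diff_distrib)
 qed
 also have "... = ramp (2 * (2 ^ m * t) - 2 * real 0) - ramp (2 * (2 ^ m * t) - 2 * real N)" by (rule sum_lessThan_telescope')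
 also have "... <= 1" using ramp_bounds[of "2 * (2 ^ m * t) - 2 * real 0"] ramp_bounds[of "2 * (2 ^ m * t) - 2 * real N"] by linarith
 finally have sT: "(SUM k<N. T k) <= 1" .
 have xb: "abs (x k) <= c + c * (x k / c) ^ 4" for k
 proof -
  have "abs (x k / c) <= 1 + abs (x k / c) ^ 4" by (rule x_le_fourth)
  moreover have "abs (x k / c) ^ 4 = (x k / c) ^ 4" by (rule power_even_abs) simp
  moreover have "abs (x k / c) = abs (x k) / c" using c by (simp add: abs_divide)
  ultimately have "abs (x k) / c <= 1 + (x k / c) ^ 4" by linarith
  hence "abs (x k) / c * c <= (1 + (x k / c) ^ 4) * c" using c by (intro mult_right_mono) auto
  thus ?thesis using c by (simp add: algebra_simps)
 qed
 have "2 ^ m * t <= real N" using assms by (simp add: N_def mult.commute)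
 hence "abs (polygon (Suc m) w t - polygon m w t) = abs (SUM k<N. x k * T k)" by (simp add: polygon_step x_def T_def)
 also have "... <= (SUM k<N. abs (x k) * T k)" using sum_abs[of "%k. x k * T k" "{..<N}"] by (simp add: abs_mult abs_of_nonneg[OF T0])
 also have "... <= (SUM k<N. c * T k + c * (x k / c) ^ 4)"
 proof (rule sum_mono)
  fix k
  have "abs (x k) * T k <= (c + c * (x k / c) ^ 4) * T k" by (intro mult_right_mono xb T0)
  also have "... = c * T k + c * (x k / c) ^ 4 * T k" by (simp add: algebra_simps)
  also have "... <= c * T k + c * (x k / c) ^ 4 * 1" using c T1 by (intro add_left_mono mult_left_mono) (auto simp: zero_le_even_power)
  finally show "abs (x k) * T k <= c * T k + c * (x k / c) ^ 4" by simp
 qed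
 also have "... = c * (SUM k<N. T k) + levy_err K m w" by (simp add: sum.distrib sum_distrib_left levy_err_def N_def x_def c_def)
 also have "... <= c * 1 + levy_err K m w" using c sT by (intro add_right_mono mult_left_mono) auto
 finally show ?thesis by (simp add: c_def)
qed

lemma noise_fourth_moment: "(nn_integral noise (%w. ennreal ((w m k) ^ 4))) = 3"
proof -
 interpret L: product_prob_space "%_ :: nat. gauss 1" UNIV using prob_space_gauss by (intro product_prob_spaceI)
 interpret P: product_prob_space "%_ :: nat. noise_level" UNIV using prob_space_noise_level by (intro product_prob_spaceI)
 have "(nn_integral noise (%w. ennreal ((w m k) ^ 4))) = (nn_integral (distr noise noise_level (%w. w m)) (%x. ennreal ((x k) ^ 4)))"
  unfolding noise_def noise_level_def by (intro nn_integral_distr[symmetric]) (auto intro!: measurable_compose[OF gauss_coord])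
 also have "distr noise noise_level (%w. w m) = noise_level" unfolding noise_def by (rule P.PiM_component) simp
 also have "(nn_integral noise_level (%x. ennreal ((x k) ^ 4))) = (nn_integral (distr noise_level (gauss 1) (%x. x k)) (%x. ennreal (x ^ 4)))"
  unfolding noise_level_def by (intro nn_integral_distr[symmetric]) (auto simp: measurable_cong_sets[OF sets_gauss refl])
 also have "distr noise_level (gauss 1) (%x. x k) = gauss 1" unfolding noise_level_def by (rule L.PiM_component) simp
 also have "(nn_integral (gauss 1) (%x. ennreal (x ^ 4))) = (nn_integral lborel (%x. ennreal (std_normal_density x * x ^ 4)))"
  by (simp add: gauss_density nn_integral_density ennreal_mult' zero_le_even_power)
 also have "... = ennreal (\<integral>x. std_normal_density x * x ^ (2 * 2) \<partial>lborel)" using integrable_std_normal_moment[of 4]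
  by (subst nn_integral_eq_integral) (auto simp: zero_le_even_power)
 also have "(\<integral>x. std_normal_density x * x ^ (2 * 2) \<partial>lborel) = 3" by (subst integral_std_normal_moment_even) (simp add: fact_numeral)
 finally show ?thesis by simp
qed

definition levy_good :: "(nat => nat => real) => bool" where "levy_good w <-> (ALL K. (\<Sum>m. ennreal (levy_err K m w)) ~= \<infinity>)"

lemma levy_good_measurable [measurable]: "Measurable.pred noise levy_good" unfolding levy_good_def by measurable

text \<open>The expectations of the error terms are summable, hence the error terms are summable
  almost surely.\<close>

lemma AE_levy_good: "AE w in noise. levy_good w" unfolding levy_good_def AE_all_countable
proof
 fix K
 \<comment> \<open>The ratio is \<open>1 / (2 * (9/10) ^ 3)\<close>: there are \<open>2 ^ m\<close>
   intervals, a fourth moment of order \<open>1 / 4 ^ m\<close>, and the inverse cube of the rate.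
   Any rate strictly between \<open>2 powr (- 1/3)\<close> and 1 would give a convergent
   series.\<close>
 define q :: real where "q = 500 / 729"
 have tm: "(nn_integral noise (%w. ennreal (levy_err K m w))) = ennreal (3 * real K / 16 * q ^ m)" for m
 proof -
  define c :: real where "c = (9 / 10) ^ m * (sqrt (1 / 2 ^ m) / 2 / (9 / 10) ^ m) ^ 4"
  have c0: "c >= 0" by (simp add: c_def zero_le_even_power)
  have s4: "sqrt (1 / 2 ^ m) ^ 4 = (1 / 2 ^ m)\<^sup>2"
  proof -
   have "sqrt y ^ 4 = y\<^sup>2" if "0 <= y" for y
   proof -
    have "sqrt y ^ (2 * 2) = ((sqrt y)\<^sup>2)\<^sup>2" by (rule power_mult)
    thus ?thesis using that by simp
   qed
   thus ?thesis by simp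
  qed
  have c: "2 ^ m * c = q ^ m / 16"
  proof -
   define a b :: real where "a = (9 / 10) ^ m" and "b = 2 ^ m"
   have ab: "a > 0" "b > 0" by (simp_all add: a_def b_def)
   have "c = a * ((1 / b)\<^sup>2 / 16 / a ^ 4)" unfolding c_def power_divide[of "_ / 2"] power_divide[of _ 2] s4 by (simp add: a_def b_def)
   hence 1: "b * c = 1 / (16 * (b * a ^ 3))" using ab by (simp add: field_simps power2_eq_square power3_eq_cube power4_eq_xxxx)
   have "q = 1 / (2 * (9 / 10) ^ 3)" by (simp add: q_def power3_eq_cube)
   hence "q ^ m = 1 / (b * ((9 / 10) ^ 3) ^ m)" by (simp only: power_divide power_mult_distrib power_one b_def)
   also have "((9 / 10) ^ 3) ^ m = a ^ 3" unfolding a_def power_mult[symmetric] by (simp add: mult.commute)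
   finally show ?thesis using 1 by (simp add: b_def)
  qed
  have "levy_err K m w = (SUM k<K * 2 ^ m. c * w (Suc m) k ^ 4)" for w
   unfolding levy_err_def c_def by (intro sum.cong refl) (simp add: power_mult_distrib power_divide mult_ac)
  hence "(nn_integral noise (%w. ennreal (levy_err K m w))) = (nn_integral noise (%w. (SUM k<K * 2 ^ m. ennreal c * ennreal (w (Suc m) k ^ 4))))"
   using c0 by (simp add: sum_ennreal[symmetric] ennreal_mult zero_le_even_power del: sum_ennreal)
  also have "... = (SUM k<K * 2 ^ m. ennreal c * 3)" by (subst nn_integral_sum) (simp_all add: nn_integral_cmult noise_fourth_moment)
  also have "... = ennreal (real (K * 2 ^ m) * (c * 3))" using c0 by (simp add: ennreal_mult ennreal_of_nat_eq_real_of_nat ennreal_mult' del: of_nat_mult)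
  also have "real (K * 2 ^ m) * (c * 3) = 3 * real K * (2 ^ m * c)" by simp
  finally show ?thesis by (simp add: c)
 qed
 have "(nn_integral noise (%w. (\<Sum>m. ennreal (levy_err K m w)))) = (\<Sum>m. ennreal (3 * real K / 16 * q ^ m))" by (subst nn_integral_suminf) (simp_all add: tm)
 also have "... = ennreal (\<Sum>m. 3 * real K / 16 * q ^ m)" by (intro suminf_ennreal_eq summable_sums summable_mult summable_geometric) (auto simp: q_def)
 finally have "(nn_integral noise (%w. (\<Sum>m. ennreal (levy_err K m w)))) ~= \<infinity>" by simp
 thus "AE w in noise. (\<Sum>m. ennreal (levy_err K m w)) ~= \<infinity>" by (intro nn_integral_PInf_AE) auto
qed

text \<open>The zero path on the exceptional set makes continuity and the start at 0 hold for every
  sample point.\<close>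

definition bm :: "real => (nat => nat => real) => real" where "bm s w = (if levy_good w then lim (%m. polygon m w s) else 0)"

lemma polygon_measurable [measurable]: "(%w. polygon m w s) : borel_measurable noise" unfolding polygon_def by measurable

lemma bm_measurable [measurable]: "bm s : borel_measurable noise"
proof -
 have "(%w. lim (%m. polygon m w s)) : borel_measurable noise" by (rule borel_measurable_lim_metric) simp
 thus ?thesis unfolding bm_def[abs_def] by measurable
qed

lemma polygon_uniform_limit:
 assumes "levy_good w"
 shows "uniform_limit {0..real K} (%m t. polygon m w t) (%t. bm t w) sequentially"
proof -
 have fin: "(\<Sum>m. ennreal (levy_err K m w)) ~= \<infinity>" using assms by (simp add: levy_good_def)
 have sm: "summable (%m. levy_err K m w)" by (rule summable_suminf_not_top[OF levy_err_nonneg]) (use fin in simp)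
 have "summable (%m. (9 / 10) ^ m + levy_err K m w)" by (intro summable_add sm summable_geometric) simp
 hence u: "uniform_limit {0..real K} (%n t. SUM i<n. polygon (Suc i) w t - polygon i w t)
   (%t. \<Sum>i. polygon (Suc i) w t - polygon i w t) sequentially" by (rule Weierstrass_m_test[rotated]) (auto intro!: polygon_step_bound)
 have "uniform_limit {0..real K} (%n t. polygon 0 w t + (SUM i<n. polygon (Suc i) w t - polygon i w t))
   (%t. polygon 0 w t + (\<Sum>i. polygon (Suc i) w t - polygon i w t)) sequentially" by (intro uniform_limit_add uniform_limit_const u)
 hence v: "uniform_limit {0..real K} (%n t. polygon n w t)
   (%t. polygon 0 w t + (\<Sum>i. polygon (Suc i) w t - polygon i w t)) sequentially" by (simp add: sum_lessThan_telescope[of "%i. polygon i w _"] del: sum_subtractf)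
 have "bm t w = polygon 0 w t + (\<Sum>i. polygon (Suc i) w t - polygon i w t)" if "t : {0..real K}" for t
  using tendsto_uniform_limitI[OF v that] assms by (simp add: bm_def limI)
 from uniform_limit_cong'[THEN iffD2, OF refl this v] show ?thesis .
qed

lemma bm_continuous: "continuous_on {0..} (%s. bm s w)"
proof (cases "levy_good w")
 case True
 have pc: "continuous_on {0..real K} (%t. polygon m w t)" for m K
 proof -
  have "continuous_on {0..real K} (%t. SUM j<K * 2 ^ m. dyad m w j * ramp (2 ^ m * t - real j))"
   by (intro continuous_intros continuous_on_compose2[OF continuous_ramp[of UNIV]]) auto
  moreover have "polygon m w t = (SUM j<K * 2 ^ m. dyad m w j * ramp (2 ^ m * t - real j))"
   if "t : {0..real K}" for t using that by (intro polygon_eq) (simp add: mult.commute)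
  ultimately show ?thesis by (subst continuous_on_cong[OF refl]) auto
 qed
 have c: "continuous_on {0..real K} (%s. bm s w)" for K by (rule uniform_limit_theorem[OF _ polygon_uniform_limit[OF True]]) (auto simp: pc)
 show ?thesis unfolding continuous_on_eq_continuous_within
 proof
  fix x :: real assume x: "x : {0..}"
  obtain K :: nat where K: "x < real K" using reals_Archimedean2 by blast
  have "continuous (at x within {0..real K}) (%s. bm s w)" using c[of K] x K by (auto simp: continuous_on_eq_continuous_within)
  moreover have "at x within {0..real K} = at x within {0..}" using K by (intro at_within_nhd[of _ "{..<real K}"]) auto
  ultimately show "continuous (at x within {0..}) (%s. bm s w)" by simp
 qed
qed (simp add: bm_def)

lemma sum_dyad_Suc: "(SUM j<2 * k. dyad (Suc m) w j) = (SUM j<k. dyad m w j)" unfolding sum_pairs by (intro sum.cong refl) simp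

text \<open>At a dyadic point later refinements change nothing, because the two halves of an
  increment add up to it.\<close>

lemma polygon_dyadic: "polygon (n + i) w (real k / 2 ^ n) = (SUM j<k. dyad n w j)"
proof -
 have "2 ^ (n + i) * (real k / 2 ^ n) = real (k * 2 ^ i)" by (simp add: power_add)
 hence "polygon (n + i) w (real k / 2 ^ n) = (SUM j<k * 2 ^ i. dyad (n + i) w j * ramp (real (k * 2 ^ i) - real j))" by (subst polygon_eq[of _ _ "k * 2 ^ i"]) auto
 also have "... = (SUM j<k * 2 ^ i. dyad (n + i) w j)"
 proof (rule sum.cong[OF refl])
  fix j assume "j : {..<k * 2 ^ i}"
  hence "Suc j <= k * 2 ^ i" by simp
  hence "real (Suc j) <= real (k * 2 ^ i)" by (simp only: of_nat_le_iff)
  hence "1 <= real (k * 2 ^ i) - real j" by linarith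
  thus "dyad (n + i) w j * ramp (real (k * 2 ^ i) - real j) = dyad (n + i) w j" by (simp add: ramp_def)
 qed
 also have "... = (SUM j<k. dyad n w j)"
 proof (induction i)
  case (Suc i)
  have k: "k * 2 ^ Suc i = 2 * (k * 2 ^ i)" by simp
  show ?case unfolding k add_Suc_right sum_dyad_Suc by (rule Suc)
 qed simp
 finally show ?thesis .
qed

lemma bm_dyadic: "levy_good w ==> bm (real k / 2 ^ n) w = (SUM j<k. dyad n w j)"
proof -
 assume g: "levy_good w"
 have "eventually (%m. polygon m w (real k / 2 ^ n) = (SUM j<k. dyad n w j)) sequentially" unfolding eventually_sequentially
 proof (intro exI allI impI)
  fix m assume "n <= m"
  thus "polygon m w (real k / 2 ^ n) = (SUM j<k. dyad n w j)" using polygon_dyadic[of n "m - n" w k] by simp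
 qed
 hence "(%m. polygon m w (real k / 2 ^ n)) ----> (SUM j<k. dyad n w j)" by (rule tendsto_eventually)
 thus ?thesis using g by (simp add: bm_def limI)
qed

lemma bm_0: "bm 0 w = 0" using bm_dyadic[of w 0 0] by (cases "levy_good w") (auto simp: bm_def)

section \<open>Gaussian independent increments of the limit\<close>

lemma indep_vars_PiM_gauss: "prob_space.indep_vars (PiM UNIV (%_ :: nat. gauss v)) (%_. borel) (%j y. y j) UNIV"
proof -
 interpret L: product_prob_space "%_ :: nat. gauss v" UNIV using prob_space_gauss by (intro product_prob_spaceI)
 have "distr (PiM UNIV (%_ :: nat. gauss v)) borel (%y. y j) = gauss v" for j using L.PiM_component[of j] by (subst distr_cong[OF refl sets_gauss[symmetric] refl]) simp
 moreover have "distr (PiM UNIV (%_ :: nat. gauss v)) (PiM UNIV (%_. borel)) (%x. \<lambda>i\<in>UNIV. x i) = PiM UNIV (%_. gauss v)"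
  by (subst distr_cong[OF refl sets_PiM_gauss[of UNIV "%_. v", symmetric] refl]) (simp add: restrict_def distr_id)
 ultimately show ?thesis by (subst L.indep_vars_iff_distr_eq_PiM) (simp_all add: gauss_coord)
qed

text \<open>Disjoint blocks of independent entries have independent sums; an empty block gives
  \<open>gauss 0\<close>.\<close>

lemma block_law:
 assumes v: "0 < v" and k: "mono k" and A: "!!i. A i : sets borel"
 shows "measure (PiM UNIV (%_ :: nat. gauss v)) {y:space (PiM UNIV (%_ :: nat. gauss v)).
   ALL i<m. (SUM j:{k i..<k (Suc i)}. y j) : A i}
  = (PROD i<m. measure (gauss (real (k (Suc i) - k i) * v)) (A i))"
proof (cases "m = 0")
 case True
 interpret P: prob_space "PiM UNIV (%_ :: nat. gauss v)" by (intro prob_space_PiM prob_space_gauss)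
 show ?thesis using True P.prob_space by simp
next
 case m: False
 let ?P = "PiM UNIV (%_ :: nat. gauss v)"
 interpret L: product_prob_space "%_ :: nat. gauss v" UNIV using prob_space_gauss by (intro product_prob_spaceI)
 have dj: "disjoint_family_on (%i. {k i..<k (Suc i)}) {..<m}" unfolding disjoint_family_on_def
 proof (intro ballI impI)
  fix a b :: nat assume "a ~= b"
  then consider "Suc a <= b" | "Suc b <= a" by linarith
  thus "{k a..<k (Suc a)} Int {k b..<k (Suc b)} = {}" using monoD[OF k, of "Suc a" b] monoD[OF k, of "Suc b" a] by cases auto
 qed
 have "L.indep_vars (%i. PB {k i..<k (Suc i)}) (%i y. restrict (%j. y j) {k i..<k (Suc i)}) {..<m}" by (rule L.indep_vars_restrict[OF indep_vars_PiM_gauss _ dj]) simp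
 hence "L.indep_vars (%_. borel) (%i y. (%z. SUM j:{k i..<k (Suc i)}. z j :: real) (restrict (%j. y j) {k i..<k (Suc i)})) {..<m}"
  by (rule L.indep_vars_compose2) (intro borel_measurable_sum[where f="%j z. z j"] measurable_component_singleton)
 hence ind: "L.indep_vars (%_. borel) (%i y. SUM j:{k i..<k (Suc i)}. y j) {..<m}" by simp
 have bm: "(%y. SUM j:S. y j) : borel_measurable ?P" for S by (intro borel_measurable_sum[where f="%j z. z j"] gauss_coord)
 have law: "distr ?P borel (%y. SUM j:{k i..<k (Suc i)}. y j) = gauss (real (k (Suc i) - k i) * v)" for i
 proof (cases "k i < k (Suc i)")
  case False
  have "distr ?P borel (%y. 0 :: real) = gauss 0" unfolding gauss_0 by (rule measure_eqI) (auto simp: emeasure_distr L.emeasure_space_1[simplified] indicator_def)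
  thus ?thesis using False by simp
 next
  case True
  have "L.indep_vars (%_. borel) (%j y. y j) {k i..<k (Suc i)}" by (rule L.indep_vars_subset[OF indep_vars_PiM_gauss]) simp
  moreover have "distributed ?P lborel (%y. y j) (normal_density 0 (sqrt v))" for j
  proof -
   have "distr ?P borel (%y. y j) = gauss v" using L.PiM_component[of j] by (subst distr_cong[OF refl sets_gauss[symmetric] refl]) simp
   thus ?thesis using v by (simp add: distributed_gauss_iff gauss_coord)
  qed
  ultimately have "distributed ?P lborel (%y. SUM j:{k i..<k (Suc i)}. y j)
   (normal_density (SUM j:{k i..<k (Suc i)}. 0) (sqrt (SUM j:{k i..<k (Suc i)}. (sqrt v)\<^sup>2)))" using True v by (intro L.sum_indep_normal) auto
  hence "distributed ?P lborel (%y. SUM j:{k i..<k (Suc i)}. y j) (normal_density 0 (sqrt (real (k (Suc i) - k i) * v)))" using v by simp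
  thus ?thesis using True v by (subst (asm) distributed_gauss_iff) auto
 qed
 have "measure ?P (\<Inter>i\<in>{..<m}. (%y. SUM j:{k i..<k (Suc i)}. y j) -` A i Int space ?P)
  = (PROD i<m. measure ?P ((%y. SUM j:{k i..<k (Suc i)}. y j) -` A i Int space ?P))" using m A by (intro L.indep_varsD_finite[OF ind]) auto
 also have "... = (PROD i<m. measure (gauss (real (k (Suc i) - k i) * v)) (A i))"
  unfolding law[symmetric] using A by (intro prod.cong refl measure_distr[symmetric] bm) auto
 also have "(\<Inter>i\<in>{..<m}. (%y. SUM j:{k i..<k (Suc i)}. y j) -` A i Int space ?P)
  = {y:space ?P. ALL i<m. (SUM j:{k i..<k (Suc i)}. y j) : A i}" using m by auto
 finally show ?thesis .
qed

lemma bm_inc_law_dyadic: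
 assumes k: "mono k"
 shows "inc_law noise bm (%i. real (k i) / 2 ^ n) m" unfolding inc_law_def
proof (intro allI impI)
 fix A :: "nat => real set" assume A: "ALL i. A i : sets borel"
 let ?P = "PiM UNIV (%_ :: nat. gauss (1 / 2 ^ n))"
 interpret N: prob_space noise by (rule prob_space_noise)
 have dl: "distr noise ?P (dyad n) = ?P" using dyad_law[of n] by (subst distr_cong[OF refl sets_PiM_gauss refl]) simp
 have dm: "dyad n : measurable noise ?P" using dyad_vec_measurable[of n] by (simp add: measurable_cong_sets[OF refl sets_PiM_gauss])
 define S where "S = {y:space ?P. ALL i<m. (SUM j:{k i..<k (Suc i)}. y j) : A i}"
 have sm: "(%y. SUM j:B. y j) : borel_measurable ?P" for B by (intro borel_measurable_sum[where f="%j z. z j"] gauss_coord)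
 have "{y:space ?P. (SUM j:{k i..<k (Suc i)}. y j) : A i} : sets ?P" for i
 proof -
  have "(%y. SUM j:{k i..<k (Suc i)}. y j) -` A i Int space ?P : sets ?P" using A by (intro measurable_sets[OF sm]) blast
  also have "(%y. SUM j:{k i..<k (Suc i)}. y j) -` A i Int space ?P = {y:space ?P. (SUM j:{k i..<k (Suc i)}. y j) : A i}" unfolding vimage_def by blast
  finally show ?thesis .
 qed
 hence "{y:space ?P. ALL i:{..<m}. (SUM j:{k i..<k (Suc i)}. y j) : A i} : sets ?P" by (intro sets.sets_Collect_finite_All) auto
 hence S: "S : sets ?P" unfolding S_def by (simp only: Ball_def lessThan_iff)
 have inc: "bm (real (k (Suc i)) / 2 ^ n) w - bm (real (k i) / 2 ^ n) w = (SUM j:{k i..<k (Suc i)}. dyad n w j)"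
  if "levy_good w" for w i
 proof -
  have "{..<k (Suc i)} = {..<k i} Un {k i..<k (Suc i)}" using monoD[OF k, of i "Suc i"] by auto
  hence "(SUM j<k (Suc i). dyad n w j) = (SUM j<k i. dyad n w j) + (SUM j:{k i..<k (Suc i)}. dyad n w j)" by (simp add: sum.union_disjoint ivl_disj_int)
  thus ?thesis by (simp add: bm_dyadic[OF that])
 qed
 have "measure noise {w:space noise. ALL i<m. bm (real (k (Suc i)) / 2 ^ n) w - bm (real (k i) / 2 ^ n) w : A i}
  = measure noise (dyad n -` S Int space noise)"
 proof (rule N.finite_measure_eq_AE)
  show "AE w in noise. w : {w:space noise. ALL i<m. bm (real (k (Suc i)) / 2 ^ n) w - bm (real (k i) / 2 ^ n) w : A i}
   <-> w : dyad n -` S Int space noise" using AE_levy_good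
  proof eventually_elim
   case (elim w)
   thus ?case by (auto simp: inc S_def space_PiM)
  qed
  have [measurable]: "A i : sets borel" for i using A by simp
  show "{w:space noise. ALL i<m. bm (real (k (Suc i)) / 2 ^ n) w - bm (real (k i) / 2 ^ n) w : A i} : sets noise" by measurable
  show "dyad n -` S Int space noise : sets noise" by (rule measurable_sets[OF dm S])
 qed
 also have "... = measure ?P S" using measure_distr[OF dm S] by (simp add: dl)
 also have "... = (PROD i<m. measure (gauss (real (k (Suc i) - k i) * (1 / 2 ^ n))) (A i))" unfolding S_def using A by (intro block_law k) auto
 also have "... = (PROD i<m. measure (gauss (real (k (Suc i)) / 2 ^ n - real (k i) / 2 ^ n)) (A i))"
  using monoD[OF k, of "_" "Suc _"] by (intro prod.cong refl) (simp add: of_nat_diff diff_divide_distrib)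
 finally show "measure noise {w:space noise. ALL i<m. bm (real (k (Suc i)) / 2 ^ n) w - bm (real (k i) / 2 ^ n) w : A i}
  = (PROD i<m. measure (gauss (real (k (Suc i)) / 2 ^ n - real (k i) / 2 ^ n)) (A i))" .
qed

lemma integral_gauss_tendsto:
 assumes f: "continuous_on UNIV f" "!!x. 0 <= f x & f x <= (1 :: real)" and v: "w ----> v"
 shows "(%n. \<integral>x. f x \<partial>gauss (w n)) ----> (\<integral>x. f x \<partial>gauss v)"
proof -
 have fm[measurable]: "f : borel_measurable borel" by (rule borel_measurable_continuous_onI[OF f(1)])
 interpret S: prob_space "density lborel std_normal_density" by (rule prob_space_std_normal)
 show ?thesis unfolding integral_gauss[OF fm]
 proof (rule integral_dominated_convergence[where w="%_. 1"])
  show "AE x in density lborel std_normal_density. (%n. f (sqrt (w n) * x)) ----> f (sqrt v * x)"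
  proof (rule AE_I2)
   fix x
   have "(%n. sqrt (w n) * x) ----> sqrt v * x" by (intro tendsto_intros v)
   thus "(%n. f (sqrt (w n) * x)) ----> f (sqrt v * x)" using f(1) by (auto intro: continuous_on_tendsto_compose)
  qed
 qed (use f(2) in auto)
qed

lemma integral_PiM_gauss_prod:
 assumes f: "!!i. continuous_on UNIV (f i)" "!!i x. 0 <= f i x & f i x <= (1 :: real)"
 shows "(\<integral>y. (PROD i<m. f i (y i)) \<partial>PiM {..<m :: nat} (%i. gauss (v i))) = (PROD i<m. \<integral>x. f i x \<partial>gauss (v i))"
proof -
 interpret G: prob_space "gauss r" for r by (rule prob_space_gauss)
 interpret P: product_prob_space "%i. gauss (v i)" "{..<m}" by unfold_locales
 have "f i : borel_measurable borel" for i by (rule borel_measurable_continuous_onI[OF f(1)])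
 hence "integrable (gauss r) (f i)" for r i using f(2) by (intro G.integrable_const_bound[where B=1]) (auto simp: measurable_cong_sets[OF sets_gauss refl])
 thus ?thesis by (intro P.product_integral_prod) auto
qed

text \<open>Times are rounded down to dyadic ones. Continuity of the paths, and of
  \<open>gauss\<close> in its variance, passes integrals of continuous test functions to the limit,
  and these determine the law of the increments.\<close>

lemma bm_inc_law:
 assumes u: "mono u" "0 <= u 0"
 shows "inc_law noise bm u m" unfolding inc_law_def
proof (intro allI impI)
 fix A :: "nat => real set" assume A: "ALL i. A i : sets borel"
 interpret N: prob_space noise by (rule prob_space_noise)
 interpret G: prob_space "gauss r" for r by (rule prob_space_gauss)
 let ?Q = "PiM {..<m} (%i. gauss (u (Suc i) - u i))"
 interpret P: product_prob_space "%i. gauss (u (Suc i) - u i)" "{..<m}" by unfold_locales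
 have u0: "0 <= u i" for i using u monoD[OF u(1), of 0 i] by linarith
 define k where "k n i = nat \<lfloor>2 ^ n * u i\<rfloor>" for n i
 have kmono: "mono (k n)" for n unfolding k_def using u(1) by (auto intro!: monoI nat_mono floor_mono mult_left_mono dest: monoD)
 have kr: "real (k n i) = of_int \<lfloor>2 ^ n * u i\<rfloor>" for n i using u0[of i] by (simp add: k_def)
 have klim: "(%n. real (k n i) / 2 ^ n) ----> u i" for i
 proof (rule tendsto_sandwich)
  show "eventually (%n. u i - 1 / 2 ^ n <= real (k n i) / 2 ^ n) sequentially"
  proof (rule always_eventually, rule allI)
   fix n
   have "2 ^ n * u i - 1 <= real (k n i)" unfolding kr by linarith
   hence "(2 ^ n * u i - 1) / 2 ^ n <= real (k n i) / 2 ^ n" by (intro divide_right_mono) auto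
   thus "u i - 1 / 2 ^ n <= real (k n i) / 2 ^ n" by (simp add: diff_divide_distrib)
  qed
  show "eventually (%n. real (k n i) / 2 ^ n <= u i) sequentially"
  proof (rule always_eventually, rule allI)
   fix n
   have "real (k n i) <= 2 ^ n * u i" unfolding kr by linarith
   thus "real (k n i) / 2 ^ n <= u i" by (simp add: field_simps)
  qed
  show "(%n. u i - 1 / 2 ^ n) ----> u i" by real_asymp
 qed simp
 have blim: "(%n. bm (real (k n i) / 2 ^ n) v) ----> bm (u i) v" for i v by (rule continuous_on_tendsto_compose[OF bm_continuous klim]) (auto simp: u0)
 have "measure noise {v:space noise. ALL i:{..<m}. bm (u (Suc i)) v - bm (u i) v : A i}
  = measure ?Q {y:space ?Q. ALL i:{..<m}. y i : A i}"
 proof (rule law_eq_cont)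
  show "prob_space noise" by (rule prob_space_noise)
  show "prob_space ?Q" by (intro prob_space_PiM prob_space_gauss)
  show "(%y. y i) : borel_measurable ?Q" if "i : {..<m}" for i using measurable_component_singleton[OF that, of "%i. gauss (u (Suc i) - u i)"]
   by (simp add: measurable_cong_sets[OF refl sets_gauss])
 next
  fix f :: "nat => real => real"
  assume f: "!!i. continuous_on UNIV (f i)" "!!i x. 0 <= f i x & f i x <= 1"
  have fm[measurable]: "f i : borel_measurable borel" for i by (rule borel_measurable_continuous_onI[OF f(1)])
  define X where "X n i v = bm (real (k n (Suc i)) / 2 ^ n) v - bm (real (k n i) / 2 ^ n) v" for n i v
  have "(%n. \<integral>v. (PROD i<m. f i (X n i v)) \<partial>noise)
   ----> (\<integral>v. (PROD i<m. f i (bm (u (Suc i)) v - bm (u i) v)) \<partial>noise)"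
  proof (rule integral_dominated_convergence[where w="%_. 1"])
   show "AE v in noise. (%n. PROD i<m. f i (X n i v)) ----> (PROD i<m. f i (bm (u (Suc i)) v - bm (u i) v))" unfolding X_def
    by (intro AE_I2 tendsto_prod continuous_on_tendsto_compose[OF f(1)] tendsto_diff blim) auto
   show "AE v in noise. norm (PROD i<m. f i (X n i v)) <= 1" for n using f(2) by (intro AE_I2) (simp add: abs_prod prod_le_1)
  qed (auto simp: X_def)
  moreover have "(\<integral>v. (PROD i<m. f i (X n i v)) \<partial>noise)
    = (PROD i<m. \<integral>x. f i x \<partial>gauss (real (k n (Suc i)) / 2 ^ n - real (k n i) / 2 ^ n))" for n
  proof -
   let ?D = "%v. \<lambda>i\<in>{..<m}. X n i v"
   have D: "distr noise (PB {..<m}) ?D = PiM {..<m} (%i. gauss (real (k n (Suc i)) / 2 ^ n - real (k n i) / 2 ^ n))"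
    unfolding X_def by (rule inc_law_distr[OF prob_space_noise _ bm_inc_law_dyadic[OF kmono]]) simp
   have "(\<integral>v. (PROD i<m. f i (X n i v)) \<partial>noise) = (\<integral>v. (PROD i<m. f i (?D v i)) \<partial>noise)" by simp
   also have "... = (\<integral>y. (PROD i<m. f i (y i)) \<partial>distr noise (PB {..<m}) ?D)"
    by (intro integral_distr[symmetric] measurable_restrict borel_measurable_prod measurable_compose[OF _ fm] measurable_component_singleton)
     (auto simp: X_def)
   finally show ?thesis unfolding D integral_PiM_gauss_prod[OF f] .
  qed
  moreover have "(%n. PROD i<m. \<integral>x. f i x \<partial>gauss (real (k n (Suc i)) / 2 ^ n - real (k n i) / 2 ^ n))
   ----> (PROD i<m. \<integral>x. f i x \<partial>gauss (u (Suc i) - u i))" by (intro tendsto_prod integral_gauss_tendsto f tendsto_diff klim)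
  ultimately have "(\<integral>v. (PROD i<m. f i (bm (u (Suc i)) v - bm (u i) v)) \<partial>noise) = (PROD i<m. \<integral>x. f i x \<partial>gauss (u (Suc i) - u i))"
   using LIMSEQ_unique by simp
  thus "(\<integral>v. (PROD i<m. f i (bm (u (Suc i)) v - bm (u i) v)) \<partial>noise) = (\<integral>y. (PROD i<m. f i (y i)) \<partial>?Q)"
   by (simp add: integral_PiM_gauss_prod[OF f])
 qed (use A in auto)
 also have "{y:space ?Q. ALL i:{..<m}. y i : A i} = Pi\<^sub>E {..<m} A" by (intro set_eqI, simp only: mem_Collect_eq space_PiM PiE_iff space_gauss) blast
 also have "measure ?Q (Pi\<^sub>E {..<m} A) = (PROD i<m. measure (gauss (u (Suc i) - u i)) (A i))"
 proof -
  interpret F: finite_product_prob_space "%i. gauss (u (Suc i) - u i)" "{..<m}" by unfold_locales simp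
  show ?thesis using A by (intro F.prob_times) simp
 qed
 finally show "measure noise {v:space noise. ALL i<m. bm (u (Suc i)) v - bm (u i) v : A i}
  = (PROD i<m. measure (gauss (u (Suc i) - u i)) (A i))" by (simp only: Ball_def lessThan_iff)
qed

section \<open>Wiener measure\<close>

text \<open>Extensionality makes a path determined by its values at nonnegative times, the only
  coordinates that carry the law.\<close>

definition wiener_paths :: "(real => real) set" where "wiener_paths = {f:extensional {0..}. f 0 = 0 & continuous_on {0..} f}"

definition path_algebra :: "(real => real) measure" where "path_algebra = restrict_space (PB {0..}) wiener_paths"

definition wiener :: "(real => real) measure" where "wiener = distr noise path_algebra (%w. \<lambda>s\<in>{0..}. bm s w)"

lemma space_path_algebra [simp]: "space path_algebra = wiener_paths" by (auto simp: path_algebra_def space_restrict_space space_PiM wiener_paths_def PiE_def)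

lemma wiener_pathsD:
 assumes "f : wiener_paths"
 shows "f 0 = 0" "continuous_on {0..} f" "f : extensional {0..}" using assms by (auto simp: wiener_paths_def)

lemma measurable_path_algebraI:
 assumes "!!s. 0 <= s ==> (%w. f w s) : borel_measurable M" "!!w. w : space M ==> f w : wiener_paths"
 shows "f : measurable M path_algebra" unfolding path_algebra_def
proof (rule measurable_restrict_space2)
 show "f : space M \<rightarrow> wiener_paths" using assms(2) by blast
 have ext: "f w : extensional {0..}" if "w : space M" for w using wiener_pathsD(3)[OF assms(2)[OF that]] .
 have "(%w. \<lambda>s\<in>{0..}. f w s) : measurable M (PB {0..})" using assms(1) by (intro measurable_restrict) auto
 thus "f : measurable M (PB {0..})" by (rule measurable_cong[THEN iffD1, rotated]) (simp add: extensional_restrict ext)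
qed

lemma path_eval_measurable: "0 <= s ==> (%f. f s) : borel_measurable path_algebra"
 unfolding path_algebra_def by (intro measurable_restrict_space1 measurable_component_singleton) simp

lemma path_measure_eqI:
 assumes P: "sets P = sets path_algebra" and Q: "sets Q = sets path_algebra" and eq: "distr P (PB {0..}) (%f. f) = distr Q (PB {0..}) (%f. f)"
 shows "P = Q"
proof (rule measure_eqI)
 show "sets P = sets Q" by (simp add: P Q)
 fix A assume A: "A : sets P"
 then obtain B where B: "B : sets (PB {0..})" "A = wiener_paths Int B" unfolding P path_algebra_def sets_restrict_space by blast
 have "(%f. f) : measurable path_algebra (PB {0..})" unfolding path_algebra_def by (rule measurable_restrict_space1) simp
 hence m: "(%f. f) : measurable P (PB {0..})" "(%f. f) : measurable Q (PB {0..})" by (simp_all add: measurable_cong_sets[OF P refl] measurable_cong_sets[OF Q refl])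
 have sp: "space P = wiener_paths" "space Q = wiener_paths" using sets_eq_imp_space_eq[OF P] sets_eq_imp_space_eq[OF Q] by simp_all
 have "emeasure P A = emeasure (distr P (PB {0..}) (%f. f)) B" using B by (subst emeasure_distr[OF m(1)]) (simp_all add: sp vimage_def Int_commute)
 also have "... = emeasure Q A" unfolding eq using B by (subst emeasure_distr[OF m(2)]) (simp_all add: sp vimage_def Int_commute)
 finally show "emeasure P A = emeasure Q A" .
qed

lemma sets_wiener [simp, measurable_cong]: "sets wiener = sets path_algebra" by (simp add: wiener_def)

lemma space_wiener [simp]: "space wiener = wiener_paths" using sets_eq_imp_space_eq[OF sets_wiener] by simp

lemma bm_path_measurable: "(%w. \<lambda>s\<in>{0..}. bm s w) : measurable noise path_algebra"
proof (rule measurable_path_algebraI)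
 fix w
 have "continuous_on {0..} (\<lambda>s\<in>{0..}. bm s w)" by (subst continuous_on_cong[OF refl, of _ _ "%s. bm s w"]) (auto simp: bm_continuous)
 thus "(\<lambda>s\<in>{0..}. bm s w) : wiener_paths" by (simp add: wiener_paths_def bm_0)
qed simp

lemma prob_space_wiener: "prob_space wiener" unfolding wiener_def by (intro prob_space.prob_space_distr prob_space_noise bm_path_measurable)

lemma wiener_eval_measurable: "0 <= s ==> (%f. f s) : borel_measurable wiener" by (simp add: measurable_cong_sets[OF sets_wiener refl] path_eval_measurable)

lemma wiener_inc_law:
 assumes u: "mono u" "0 <= u 0"
 shows "inc_law wiener (%s f. f s) u m" unfolding inc_law_def
proof (intro allI impI)
 fix A :: "nat => real set" assume A: "ALL i. A i : sets borel"
 have u0: "0 <= u i" for i using u monoD[OF u(1), of 0 i] by linarith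
 have "{f:space wiener. ALL i:{..<m}. f (u (Suc i)) - f (u i) : A i} : sets wiener"
 proof (rule sets.sets_Collect_finite_All)
  fix i
  have "(%f. f (u (Suc i)) - f (u i)) -` A i Int space wiener : sets wiener" using A u0 by (intro measurable_sets[OF borel_measurable_diff] wiener_eval_measurable) blast+
  also have "(%f. f (u (Suc i)) - f (u i)) -` A i Int space wiener = {f:space wiener. f (u (Suc i)) - f (u i) : A i}" unfolding vimage_def by blast
  finally show "{f:space wiener. f (u (Suc i)) - f (u i) : A i} : sets wiener" .
 qed simp
 hence "{f:space path_algebra. ALL i<m. f (u (Suc i)) - f (u i) : A i} : sets path_algebra"
  by (simp only: Ball_def lessThan_iff sets_wiener space_wiener space_path_algebra)
 hence "measure wiener {f:space wiener. ALL i<m. f (u (Suc i)) - f (u i) : A i}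
  = measure noise ((%w. \<lambda>s\<in>{0..}. bm s w) -` {f:space path_algebra. ALL i<m. f (u (Suc i)) - f (u i) : A i} Int space noise)"
  unfolding wiener_def space_distr by (rule measure_distr[OF bm_path_measurable])
 also have "(%w. \<lambda>s\<in>{0..}. bm s w) -` {f:space path_algebra. ALL i<m. f (u (Suc i)) - f (u i) : A i} Int space noise
  = {w:space noise. ALL i<m. bm (u (Suc i)) w - bm (u i) w : A i}" using measurable_space[OF bm_path_measurable] u0 by auto
 finally show "measure wiener {f:space wiener. ALL i<m. f (u (Suc i)) - f (u i) : A i} = (PROD i<m. measure (gauss (u (Suc i) - u i)) (A i))"
  using bm_inc_law[OF u, of m] A unfolding inc_law_def by simp
qed

lemma time_grid:
 fixes J :: "real set"
 assumes "finite J" "J \<subseteq> {0..}"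
 obtains u :: "nat => real" and m where "u 0 = 0" "mono u" "J \<subseteq> u ` {..m}" "!!i. 0 <= u i"
proof -
 define S where "S = insert 0 J"
 define xs where "xs = sorted_list_of_set S"
 have "finite S" using assms(1) by (simp add: S_def)
 hence "set xs = S" "sorted xs" by (simp_all add: xs_def)
 hence xs: "set xs = insert 0 J" "sorted xs" "xs ~= []" by (auto simp: S_def)
 define u where "u i = xs ! min i (length xs - 1)" for i
 have len: "min i (length xs - 1) < length xs" for i using xs(3) by (cases xs) auto
 have mono: "mono u" unfolding u_def using xs(2) len by (intro monoI sorted_nth_mono) auto
 have pos: "0 <= u i" for i unfolding u_def using nth_mem[OF len[of i]] xs(1) assms(2) by auto
 have im: "J \<subseteq> u ` {..length xs}"
 proof
  fix x assume "x : J"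
  then obtain i where i: "i < length xs" "xs ! i = x" using xs(1) by (metis in_set_conv_nth insertCI)
  thus "x : u ` {..length xs}" by (intro image_eqI[of _ _ i]) (auto simp: u_def min_def)
 qed
 obtain i where i: "i < length xs" "xs ! i = 0" using xs(1) by (metis in_set_conv_nth insertCI)
 have "u 0 <= u i" using mono by (auto dest: monoD)
 moreover have "u i = 0" using i by (simp add: u_def min_def)
 ultimately have "u 0 = 0" using pos[of 0] by linarith
 thus ?thesis by (intro that[of u "length xs"] mono im pos)
qed

text \<open>Recognizes Wiener measure after splicing and for an arbitrary standard Brownian motion.
  One grid per finite set of times is checked, so the grid may be made to contain a splicing
  time.\<close>

lemma wiener_unique:
 assumes M: "prob_space M" and X: "!!s. 0 <= s ==> X s : borel_measurable M"
  and path: "!!w. w : space M ==> (\<lambda>s\<in>{0..}. X s w) : wiener_paths" and law: "!!J. finite J ==> J \<subseteq> {0..} ==>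
   EX u m. u 0 = 0 & mono u & J \<subseteq> u ` {..m} & inc_law M X u m"
 shows "distr M path_algebra (%w. \<lambda>s\<in>{0..}. X s w) = wiener"
proof (rule path_measure_eqI)
 have m: "(%w. \<lambda>s\<in>{0..}. X s w) : measurable M path_algebra" using X path by (intro measurable_path_algebraI) auto
 have id: "(%f. f) : measurable path_algebra (PB {0..})" unfolding path_algebra_def by (rule measurable_restrict_space1) simp
 have "distr (distr M path_algebra (%w. \<lambda>s\<in>{0..}. X s w)) (PB {0..}) (%f. f)
  = distr M (PB {0..}) (%w. \<lambda>s\<in>{0..}. X s w)" by (subst distr_distr[OF id m]) (simp add: comp_def)
 also have "... = distr wiener (PB {0..}) (%f. \<lambda>s\<in>{0..}. f s)"
 proof (rule inc_law_unique[OF M prob_space_wiener X _ wiener_eval_measurable])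
  show "X 0 w = 0" if "w : space M" for w using wiener_pathsD(1)[OF path[OF that]] by simp
  show "f 0 = 0" if "f : space wiener" for f using that wiener_pathsD(1) by simp
  fix J :: "real set" assume J: "finite J" "J \<subseteq> {0..}"
  obtain u m where u: "u 0 = 0" "mono u" "J \<subseteq> u ` {..m}" "inc_law M X u m" using law[OF J] by blast
  have "0 <= u i" for i using monoD[OF u(2), of 0 i] u(1) by simp
  thus "EX u m. u 0 = 0 & (ALL i. 0 <= u i) & J \<subseteq> u ` {..m} & inc_law M X u m & inc_law wiener (%s f. f s) u m"
   using u wiener_inc_law[OF u(2), of m] by (intro exI[of _ u] exI[of _ m]) simp
 qed
 also have "... = distr wiener (PB {0..}) (%f. f)" by (intro distr_cong refl) (use wiener_pathsD(3) in \<open>simp add: extensional_restrict\<close>)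
 finally show "distr (distr M path_algebra (%w. \<lambda>s\<in>{0..}. X s w)) (PB {0..}) (%f. f)
  = distr wiener (PB {0..}) (%f. f)" .
qed simp_all

section \<open>Coalescing families of paths\<close>

text \<open>A description of \<open>coalesce\<close> that is symmetric apart from the last clause: paths that have met stay
 together, and the \<open>j\<close>-th path follows \<open>w j\<close> as long as \<open>w j\<close> has not met a path of lower index.\<close>

definition merging :: "(nat => real) => (nat => real => real) => nat => bool" where
 "merging t v n <-> (ALL i<n. ALL j<n. ALL s s'. t i <= s --> t j <= s --> v i s = v j s --> s <= s' --> v i s' = v j s')"

definition coal :: "(nat => real) => (nat => real => real) => (nat => real => real) => nat => bool" where
 "coal t w v n <-> (ALL j<n. continuous_on {t j..} (v j)) & merging t v n & (ALL j<n. v j (t j) = w j (t j)) &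
  (ALL j<n. ALL s>=t j. (ALL k<j. ALL r. t j <= r --> r <= s --> t k <= r --> w j r ~= v k r) --> v j s = w j s)"

lemma coalD:
 assumes "coal t w v n"
 shows "j < n ==> continuous_on {t j..} (v j)" "merging t v n" "j < n ==> v j (t j) = w j (t j)"
  "j < n ==> t j <= s ==> (!!k r. k < j ==> t j <= r ==> r <= s ==> t k <= r ==> w j r ~= v k r) ==> v j s = w j s"
proof -
 have *: "(ALL j<n. continuous_on {t j..} (v j))" "merging t v n" "(ALL j<n. v j (t j) = w j (t j))"
  "(ALL j<n. ALL s>=t j. (ALL k<j. ALL r. t j <= r --> r <= s --> t k <= r --> w j r ~= v k r) --> v j s = w j s)" using assms unfolding coal_def by blast+
 show "j < n ==> continuous_on {t j..} (v j)" "merging t v n" "j < n ==> v j (t j) = w j (t j)" using *(1-3) by blast+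
 show "v j s = w j s" if "j < n" "t j <= s" "!!k r. k < j ==> t j <= r ==> r <= s ==> t k <= r ==> w j r ~= v k r" using *(4)[rule_format, OF that(1,2)] that(3) by blast
qed

lemma mergingD: "merging t v n ==> i < n ==> j < n ==> t i <= s ==> t j <= s ==> v i s = v j s ==> s <= s' ==> v i s' = v j s'" unfolding merging_def by blast

lemma closed_meeting_times:
 assumes w: "continuous_on {t n..} w" and v: "!!k. k < n ==> continuous_on {t k..} (v k)"
 shows "closed (meeting_times t n w v)"
proof -
 have "closed {s:{max (t n) (t k)..}. w s - v k s = 0}" if "k < n" for k
 proof -
  have "continuous_on {max (t n) (t k)..} (%s. w s - v k s)" by (intro continuous_intros continuous_on_subset[OF w] continuous_on_subset[OF v[OF that]]) auto
  from continuous_closed_preimage_constant[OF this, of 0] show ?thesis by simp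
 qed
 hence "closed (\<Union>k\<in>{..<n}. {s:{max (t n) (t k)..}. w s - v k s = 0})" by (intro closed_UN) auto
 also have "(\<Union>k\<in>{..<n}. {s:{max (t n) (t k)..}. w s - v k s = 0}) = meeting_times t n w v" unfolding meeting_times_def by auto
 finally show ?thesis .
qed

lemma first_meeting:
 assumes w: "continuous_on {t n..} w" and v: "!!k. k < n ==> continuous_on {t k..} (v k)" and ne: "meeting_times t n w v ~= {}"
 shows "Inf (meeting_times t n w v) : meeting_times t n w v" "s : meeting_times t n w v ==> Inf (meeting_times t n w v) <= s"
proof -
 have b: "bdd_below (meeting_times t n w v)" by (rule bdd_belowI[of _ "t n"]) (simp add: meeting_times_def)
 show "Inf (meeting_times t n w v) : meeting_times t n w v" by (rule closed_contains_Inf[OF ne b closed_meeting_times[where v=v, OF w v]])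
 show "s : meeting_times t n w v ==> Inf (meeting_times t n w v) <= s" by (rule cInf_lower[OF _ b])
qed

text \<open>The new path equals its driver up to the first meeting \<open>S\<close> and the old path
  \<open>v K\<close> afterwards. An earlier encounter would contradict minimality, and a later one
  is an encounter of two old paths, which already merge.\<close>

lemma coal_Suc:
 assumes w: "continuous_on {t n..} (w n)" and v: "coal t w v n"
 shows "coal t w (v(n := follow_until_meeting t n (w n) v)) (Suc n)"
proof -
 define M where "M = meeting_times t n (w n) v"
 define u where "u = follow_until_meeting t n (w n) v"
 note cont = coalD(1)[OF v] and merge = coalD(2)[OF v]
 have inM: "r : M" if "k < n" "t n <= r" "t k <= r" "w n r = v k r" for k r using that unfolding M_def meeting_times_def by blast
 have "continuous_on {t n..} u & u (t n) = w n (t n) &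
  (ALL s>=t n. (ALL r:M. s < r) --> u s = w n s) &
  (ALL k<n. ALL s s'. t n <= s --> t k <= s --> u s = v k s --> s <= s' --> u s' = v k s')"
 proof (cases "M = {}")
  case True
  hence "u = w n" unfolding u_def follow_until_meeting_def M_def by (auto simp: fun_eq_iff)
  thus ?thesis using w inM True by auto
 next
  case False
  define S where "S = Inf M"
  have S: "S : M" "!!s. s : M ==> S <= s" using first_meeting[where v=v and n=n and w="w n", OF w cont] False unfolding S_def M_def by auto
  define K where "K = (LEAST k. k < n & t k <= S & w n S = v k S)"
  have "EX k. k < n & t k <= S & w n S = v k S" using S(1) unfolding M_def meeting_times_def by auto
  from LeastI_ex[OF this] have K: "K < n" "t K <= S" "w n S = v K S" unfolding K_def by auto
  have tS: "t n <= S" using S(1) unfolding M_def meeting_times_def by auto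
  have u: "u s = (if s < S then w n s else v K s)" for s using False unfolding u_def follow_until_meeting_def Let_def M_def[symmetric] S_def[symmetric] K_def by simp
  have "continuous_on {t n..S} (w n)" by (rule continuous_on_subset[OF w]) auto
  hence c1: "continuous_on {t n..S} u" by (rule continuous_on_eq) (auto simp: u K(3))
  have "continuous_on {S..} (v K)" by (rule continuous_on_subset[OF cont[OF K(1)]]) (use K(2) in auto)
  hence c2: "continuous_on {S..} u" by (rule continuous_on_eq) (auto simp: u)
  have "continuous_on ({t n..S} Un {S..}) u" by (intro continuous_on_closed_Un c1 c2) auto
  moreover have "{t n..S} Un {S..} = {t n..}" using tS by auto
  ultimately have c: "continuous_on {t n..} u" by simp
  have start: "u (t n) = w n (t n)" using tS K(3) by (cases "t n = S") (auto simp: u)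
  have free: "u s = w n s" if "ALL r:M. s < r" for s using that S(1) by (simp add: u)
  have mg: "u s' = v k s'" if "k < n" "t n <= s" "t k <= s" "u s = v k s" "s <= s'" for k s s'
  proof (cases "s < S")
   case True
   hence "s : M" using inM[of k s] that by (simp add: u)
   thus ?thesis using S(2) True by force
  next
   case False
   hence "v K s = v k s" using that by (simp add: u)
   hence "v K s' = v k s'" using mergingD[OF merge K(1) that(1), of s s'] that K(2) False by auto
   thus ?thesis using False that by (simp add: u)
  qed
  show ?thesis using c start free mg by blast
 qed
 hence uc: "continuous_on {t n..} u" and us: "u (t n) = w n (t n)" and uf: "!!s. s >= t n ==> ALL r:M. s < r ==> u s = w n s"
  and um: "!!k s s'. k < n ==> t n <= s ==> t k <= s ==> u s = v k s ==> s <= s' ==> u s' = v k s'" by blast+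
 have "merging t (v(n := u)) (Suc n)" unfolding merging_def
 proof (intro allI impI)
  fix i j s s' assume ij: "i < Suc n" "j < Suc n" and s: "t i <= s" "t j <= s" "s <= s'"
   and e: "(v(n := u)) i s = (v(n := u)) j s"
  consider "i = n" "j = n" | "i = n" "j < n" | "i < n" "j = n" | "i < n" "j < n" using ij by linarith
  thus "(v(n := u)) i s' = (v(n := u)) j s'"
  proof cases
   case 2 thus ?thesis using um[of j s s'] s e by simp
  next
   case 3 thus ?thesis using um[of i s s'] s e by simp
  next
   case 4 thus ?thesis using mergingD[OF merge, of i j s s'] s e by simp
  qed simp
 qed
 moreover have "(v(n := u)) j s = w j s"
  if j: "j < Suc n" and s: "t j <= s" and no: "ALL k<j. ALL r. t j <= r --> r <= s --> t k <= r --> w j r ~= (v(n := u)) k r" for j s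
 proof (cases "j = n")
  case True
  have "ALL r:M. s < r"
  proof
   fix r assume "r : M"
   then obtain k where "k < n" "t n <= r" "t k <= r" "w n r = v k r" unfolding M_def meeting_times_def by blast
   thus "s < r" using no True by (auto simp: not_le[symmetric])
  qed
  thus ?thesis using uf s True by simp
 next
  case False
  hence j': "j < n" using j by simp
  have "v j s = w j s" using no j' by (intro coalD(4)[OF v j' s]) auto
  thus ?thesis using False by simp
 qed
 ultimately have "coal t w (v(n := u)) (Suc n)" unfolding coal_def using uc us cont coalD(3)[OF v] by (auto simp: less_Suc_eq)
 thus ?thesis by (simp add: u_def)
qed

lemma coal_coalesce:
 assumes "!!j. j < n ==> continuous_on {t j..} (w j)"
 shows "coal t w (coalesce t w n) n" using assms
proof (induction n)
 case 0
 thus ?case by (simp add: coal_def merging_def)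
next
 case (Suc n)
 thus ?case unfolding coalesce.simps by (intro coal_Suc) auto
qed

text \<open>Continuity extends the identity with the driver to time \<open>S\<close> itself, where a
  meeting is allowed.\<close>

lemma coal_until:
 assumes w: "continuous_on {t j..} (w j)" and x: "coal t w x n" and j: "j < n"
  and no: "!!k r. k < j ==> t j <= r ==> r < S ==> t k <= r ==> w j r ~= x k r" and s: "t j <= s" "s <= S"
 shows "x j s = w j s"
proof (cases "s < S")
 case True
 show ?thesis by (rule coalD(4)[OF x j s(1)]) (use no True in force)
next
 case sS: False
 have before: "x j r = w j r" if "t j <= r" "r < S" for r by (rule coalD(4)[OF x j that(1)]) (use no that in force)
 have "x j S = w j S"
 proof (cases "t j = S")
  case True thus ?thesis using coalD(3)[OF x j] by simp
 next
  case False
  hence lt: "t j < S" using s by simp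
  have "((%r. x j r - w j r) \<longlongrightarrow> x j S - w j S) (at S within {t j..})" using coalD(1)[OF x j] w s by (intro tendsto_diff) (auto simp: continuous_on_def)
  hence "((%r. x j r - w j r) \<longlongrightarrow> x j S - w j S) (at S within {t j..<S})" by (rule tendsto_within_subset) auto
  moreover have "eventually (%r. x j r - w j r = 0) (at S within {t j..<S})" unfolding eventually_at_filter using before by (intro always_eventually) auto
  ultimately have "((%r. 0) \<longlongrightarrow> x j S - w j S) (at S within {t j..<S})" by (rule Lim_transform_eventually)
  moreover have "at S within {t j..<S} ~= bot" using lt by (simp add: at_within_eq_bot_iff)
  ultimately have "x j S - w j S = 0" by (simp add: tendsto_const_iff)
  thus ?thesis by simp
 qed
 thus ?thesis using sS s by simp
qed

text \<open>Induction on the index: up to time \<open>u\<close> both families see the same lower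
  paths and hence the same first meeting. Stopping at \<open>u\<close> expresses that the family up
  to \<open>u\<close> depends only on the drivers up to \<open>u\<close>.\<close>

lemma coal_unique_until:
 assumes w: "!!j. j < n ==> continuous_on {t j..} (w j)" and w': "!!j. j < n ==> continuous_on {t j..} (w' j)"
  and v: "coal t w v n" and v': "coal t w' v' n" and agree: "!!j s. j < n ==> t j <= s ==> s <= u ==> w j s = w' j s"
 shows "j < n ==> t j <= s ==> s <= u ==> v j s = v' j s"
proof (induction j arbitrary: s rule: less_induct)
 case (less j)
 have eq: "v k r = v' k r" if "k < j" "t k <= r" "r <= u" for k r using less.IH[OF that(1) _ that(2,3)] less.prems(1) that(1) by simp
 have cont: "continuous_on {t k..} (v k)" if "k < j" for k using coalD(1)[OF v] that less.prems(1) by simp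
 define M where "M = meeting_times t j (w j) v"
 show ?case
 proof (cases "EX r:M. r <= s")
  case False
  hence no: "w j r ~= v k r" if "k < j" "t j <= r" "r <= s" "t k <= r" for k r using that unfolding M_def meeting_times_def by blast
  hence "v j s = w j s" by (intro coalD(4)[OF v less.prems(1,2)]) auto
  moreover have "v' j s = w' j s" using no eq agree[OF less.prems(1)] less.prems(3) by (intro coalD(4)[OF v' less.prems(1,2)]) force
  ultimately show ?thesis using agree[OF less.prems] by simp
 next
  case True
  define S where "S = Inf M"
  have S: "S : M" "!!s. s : M ==> S <= s" using first_meeting[where v=v and n=j and w="w j", OF w[OF less.prems(1)] cont] True unfolding S_def M_def by auto
  then obtain k where k: "k < j" "t j <= S" "t k <= S" "w j S = v k S" unfolding M_def meeting_times_def by blast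
  have "S <= s" using True S(2) by force
  have at: "x j s = v k s"
   if x: "coal t y x n" and y: "continuous_on {t j..} (y j)" and xe: "!!k r. k < j ==> t k <= r ==> r <= u ==> v k r = x k r"
    and ye: "!!r. t j <= r ==> r <= u ==> w j r = y j r" for x y
  proof -
   have "x j S = y j S"
   proof (rule coal_until[OF y x less.prems(1) _ k(2) order_refl])
    fix k r' assume "k < j" "t j <= r'" "r' < S" "t k <= r'"
    hence "w j r' ~= v k r'" using S(2)[of r'] unfolding M_def meeting_times_def by fastforce
    thus "y j r' ~= x k r'"
     using xe[of k r'] ye[of r'] \<open>k < j\<close> \<open>t k <= r'\<close> \<open>t j <= r'\<close> \<open>r' < S\<close> \<open>S <= s\<close> less.prems(3) by simp
   qed
   hence "x j S = x k S" using k xe[of k S] ye[of S] \<open>S <= s\<close> less.prems(3) by simp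
   hence "x j s = x k s" using mergingD[OF coalD(2)[OF x] less.prems(1), of k S s] k less.prems(1) \<open>S <= s\<close> by simp
   thus ?thesis using xe[OF k(1), of s] k(3) \<open>S <= s\<close> less.prems(3) by simp
  qed
  show ?thesis using at[OF v w[OF less.prems(1)] refl refl] at[OF v' w'[OF less.prems(1)] eq agree[OF less.prems(1)]] by simp
 qed
qed

lemma coal_unique:
 assumes w: "!!j. j < n ==> continuous_on {t j..} (w j)" and v: "coal t w v n" and v': "coal t w v' n"
 shows "j < n ==> t j <= s ==> v j s = v' j s" using coal_unique_until[OF w w v v', of s j s] by simp

lemma coal_cong:
 assumes "coal t w v n" and "!!j s. j < n ==> t j <= s ==> w' j s = w j s" and "!!j s. j < n ==> t j <= s ==> v' j s = v j s"
 shows "coal t w' v' n"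
proof -
 have "continuous_on {t j..} (v' j)" if "j < n" for j using coalD(1)[OF assms(1) that] by (rule continuous_on_eq) (use assms(3)[OF that] in auto)
 moreover have "merging t v' n" unfolding merging_def
 proof (intro allI impI)
  fix i j s s' assume *: "i < n" "j < n" "t i <= s" "t j <= s" "v' i s = v' j s" "s <= s'"
  hence "v i s' = v j s'" using mergingD[OF coalD(2)[OF assms(1)], of i j s s'] assms(3) by simp
  thus "v' i s' = v' j s'" using * assms(3)[of i s'] assms(3)[of j s'] by simp
 qed
 moreover have "v' j s = w' j s"
  if "j < n" "t j <= s" "ALL k<j. ALL r. t j <= r --> r <= s --> t k <= r --> w' j r ~= v' k r" for j s
 proof -
  have "v j s = w j s"
  proof (rule coalD(4)[OF assms(1) that(1,2)])
   fix k r assume k: "k < j" "t j <= r" "r <= s" "t k <= r"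
   hence "w' j r ~= v' k r" using that(3) by blast
   thus "w j r ~= v k r" using assms(2)[OF that(1) k(2)] assms(3)[of k r] k that(1) by simp
  qed
  thus ?thesis using assms(2,3)[OF that(1,2)] by simp
 qed
 moreover have "v' j (t j) = w' j (t j)" if "j < n" for j using coalD(3)[OF assms(1) that] assms(2,3)[OF that order_refl] by simp
 ultimately show ?thesis unfolding coal_def by (intro conjI allI impI) blast+
qed

text \<open>A crossing contains a meeting by the intermediate value theorem, and after a meeting the
  paths agree.\<close>

lemma coal_noncrossing:
 assumes v: "coal t w v n" and ij: "i < n" "j < n" "t i <= s" "t j <= s" and lt: "v i s <= v j s" and s: "s <= s'"
 shows "v i s' <= v j s'"
proof (rule ccontr)
 assume c: "\<not> v i s' <= v j s'"
 have "continuous_on {s..s'} (%r. v i r - v j r)" by (intro continuous_intros continuous_on_subset[OF coalD(1)[OF v ij(1)]] continuous_on_subset[OF coalD(1)[OF v ij(2)]])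
   (use ij in auto)
 then obtain r where r: "s <= r" "r <= s'" "v i r - v j r = 0" using IVT'[of "%r. v i r - v j r" s 0 s'] c lt s by auto
 hence "v i s' = v j s'" using mergingD[OF coalD(2)[OF v] ij(1,2), of r s'] ij by simp
 thus False using c by simp
qed


text \<open>Exchanging the roles of two paths: from their first meeting on, the paths \<open>w j\<close> and \<open>w (Suc j)\<close>
 exchange their increments. \<open>S\<close> is the first meeting time and \<open>b\<close> tells whether they meet.\<close>

definition exchange :: "nat => bool => real => (nat => real => real) => nat => real => real" where "exchange j b S w i s =
  (if b & S < s & i = j then w j S + (w (Suc j) s - w (Suc j) S)
   else if b & S < s & i = Suc j then w (Suc j) S + (w j s - w j S) else w i s)"

definition is_first_meeting :: "(nat => real) => (nat => real => real) => nat => bool => real => bool" where "is_first_meeting t v j b S <->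
  (b --> t j <= S & t (Suc j) <= S & v j S = v (Suc j) S) &
  (ALL s. t j <= s --> t (Suc j) <= s --> v j s = v (Suc j) s --> b & S <= s)"

definition swap :: "nat => nat => nat" where "swap j i = (if i = j then Suc j else if i = Suc j then j else i)"

lemma swap_simps [simp]: "swap j j = Suc j" "swap j (Suc j) = j" "i ~= j ==> i ~= Suc j ==> swap j i = i" by (auto simp: swap_def)

lemma swap_swap [simp]: "swap j (swap j i) = i" by (auto simp: swap_def)

lemma swap_less: "Suc j < i ==> swap j k < i <-> k < i" by (auto simp: swap_def)

text \<open>Only the priority between \<open>j\<close> and \<open>Suc j\<close> changes, and it
  matters from \<open>S\<close> on. The path that loses priority has to merge at \<open>S\<close>,
  which it does by definition of \<open>S\<close>. The path that gains priority has to follow its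
  own driver after \<open>S\<close>, and the exchange has given this driver exactly the increments
  that the merged path follows.\<close>

lemma coal_exchange:
 assumes w: "!!i. i < n ==> continuous_on {t i..} (w i)" and v: "coal t w v n" and j: "Suc j < n" and S: "is_first_meeting t v j b S"
 shows "coal (t o swap j) (exchange j b S w o swap j) (v o swap j) n"
proof -
 have jn: "j < n" using j by simp
 have sn: "swap j i < n" if "i < n" for i using swap_less[OF j] that by simp
 have before: "exchange j b S w i s = w i s" if "b --> s <= S" for i s using that by (auto simp: exchange_def)
 have start: "exchange j b S w i (t i) = w i (t i)" for i using S by (auto simp: exchange_def is_first_meeting_def)
 have Sm: "b & S <= s" if "t j <= s" "t (Suc j) <= s" "v j s = v (Suc j) s" for s using S that unfolding is_first_meeting_def by blast
 have free: "v i s = exchange j b S w (swap j (swap j i)) s"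
  if i: "swap j i < n" and s: "t i <= s" and no: "!!k r. k < swap j i ==> t i <= r ==> r <= s ==> t (swap j k) <= r ==> exchange j b S w i r ~= v (swap j k) r" for i s
 proof -
  have no_low: "exchange j b S w i r ~= v k r" if "k < j" "i = j | i = Suc j" "t i <= r" "r <= s" "t k <= r" for k r
  proof -
   have "k < swap j i" "swap j k = k" using that(1,2) by auto
   thus ?thesis using no[of k r] that by simp
  qed
  consider "i < j" | "i = Suc j" | "i = j" | "Suc j < i" by linarith
  hence "v i s = exchange j b S w i s"
  proof cases
   case 1
   hence e: "exchange j b S w i r = w i r" for r by (auto simp: exchange_def)
   have "i < n" using 1 jn by simp
   hence "v i s = w i s"
   proof (rule coalD(4)[OF v _ s])
    fix k r assume k: "k < i" "t i <= r" "r <= s" "t k <= r"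
    thus "w i r ~= v k r" using no[of k r] 1 e by simp
   qed
   thus ?thesis by (simp add: e)
  next
   case 4
   have e: "exchange j b S w i r = w i r" for r using 4 by (auto simp: exchange_def)
   have "i < n" using i 4 by simp
   hence "v i s = w i s"
   proof (rule coalD(4)[OF v _ s])
    fix k r assume k: "k < i" "t i <= r" "r <= s" "t k <= r"
    \<comment> \<open>The swap permutes the indices below \<open>i\<close> among themselves.\<close>
    have "swap j k < swap j i" using k(1) 4 swap_less[OF 4, of k] by simp
    thus "w i r ~= v k r" using no[of "swap j k" r] k e by simp
   qed
   thus ?thesis by (simp add: e)
  next
   case 3
   \<comment> \<open>Path \<open>j\<close> now gives way to path \<open>Suc j\<close>; at
     \<open>S\<close> its driver would have met that path.\<close>
   have inot: "\<not> (b & S <= s)"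
   proof
    assume bS: "b & S <= s"
    hence tS: "t j <= S" "t (Suc j) <= S" "v j S = v (Suc j) S" using S by (auto simp: is_first_meeting_def)
    have "v j S = w j S"
    proof (rule coalD(4)[OF v jn tS(1)])
     fix k r assume "k < j" "t j <= r" "r <= S" "t k <= r"
     thus "w j r ~= v k r" using no_low[of k r] bS before[of r j] 3 by auto
    qed
    hence "exchange j b S w j S = v (Suc j) S" using before[of S j] tS(3) by simp
    thus False using no[of j S] 3 bS tS by auto
   qed
   have "v j s = w j s"
   proof (rule coalD(4)[OF v jn])
    show "t j <= s" using s 3 by simp
    fix k r assume "k < j" "t j <= r" "r <= s" "t k <= r"
    thus "w j r ~= v k r" using no_low[of k r] inot before[of r j] 3 by auto
   qed
   thus ?thesis using before[of s j] inot 3 by auto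
  next
   case 2
   define W where "W = exchange j b S w (Suc j)"
   have low: "W r ~= v k r" if "k < j" "t (Suc j) <= r" "r <= s" "t k <= r" for k r using no_low[of k r] that 2 by (simp add: W_def)
   have Wb: "W r = w (Suc j) r" if "b --> r <= S" for r using before[of r "Suc j"] that by (simp add: W_def)
   \<comment> \<open>Up to \<open>S\<close> the path follows its old driver: the first encounter of
     that driver is either with path \<open>j\<close>, hence not before \<open>S\<close>, or with a
     path of index below \<open>j\<close>, which \<open>low\<close> forbids.\<close>
   have upto: "v (Suc j) r = w (Suc j) r" if r: "t (Suc j) <= r" "r <= s" "b --> r <= S" for r
   proof (rule coal_until[OF w[OF j] v j _ r(1) order_refl])
    fix k r' assume k: "k < Suc j" "t (Suc j) <= r'" "r' < r" "t k <= r'"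
    show "w (Suc j) r' ~= v k r'"
    proof
     assume e: "w (Suc j) r' = v k r'"
     define M where "M = meeting_times t (Suc j) (w (Suc j)) v"
     have r'M: "r' : M" using k e unfolding M_def meeting_times_def by blast
     have cv: "continuous_on {t k..} (v k)" if "k < Suc j" for k using coalD(1)[OF v] that j by simp
     define T where "T = Inf M"
     have T: "T : M" "!!s. s : M ==> T <= s" using first_meeting[where v=v and n="Suc j" and w="w (Suc j)", OF w[OF j] cv] r'M unfolding T_def M_def by auto
     then obtain l where l: "l < Suc j" "t (Suc j) <= T" "t l <= T" "w (Suc j) T = v l T" unfolding M_def meeting_times_def by blast
     have Tr: "T < r" using T(2)[OF r'M] k(3) by simp
     have vT: "v (Suc j) T = w (Suc j) T"
     proof (rule coal_until[OF w[OF j] v j _ l(2) order_refl])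
      fix k r' assume "k < Suc j" "t (Suc j) <= r'" "r' < T" "t k <= r'"
      thus "w (Suc j) r' ~= v k r'" using T(2)[of r'] unfolding M_def meeting_times_def by fastforce
     qed
     show False
     proof (cases "l = j")
      case True
      hence "b & S <= T" using Sm[of T] l vT by simp
      thus False using r(3) Tr by simp
     next
      case False
      hence "l < j" using l(1) by simp
      moreover have "b --> T <= S" using Tr r(3) by auto
      ultimately show False using low[of l T] l Wb[of T] Tr r by simp
     qed
    qed
   qed
   show ?thesis
   proof (cases "b & S < s")
    case False
    thus ?thesis using upto[of s] Wb[of s] s 2 by (auto simp: W_def)
   next
    case True
    hence tS: "t j <= S" "t (Suc j) <= S" "v j S = v (Suc j) S" using S by (auto simp: is_first_meeting_def)
    have vS: "v (Suc j) S = w (Suc j) S" using upto[of S] True tS by simp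
    \<comment> \<open>If \<open>w j\<close> met a lower path up to \<open>S\<close>, path
      \<open>j\<close> would have merged with such a path and brought path \<open>Suc j\<close> to
      it at \<open>S\<close>, against \<open>low\<close>.\<close>
    have nomeet: "w j r' ~= v k r'" if k: "k < j" "t j <= r'" "r' <= S" "t k <= r'" for k r'
    proof
     assume e: "w j r' = v k r'"
     define M where "M = meeting_times t j (w j) v"
     have r'M: "r' : M" using k e unfolding M_def meeting_times_def by blast
     have cv: "continuous_on {t k..} (v k)" if "k < j" for k using coalD(1)[OF v] that jn by simp
     define T where "T = Inf M"
     have T: "T : M" "!!s. s : M ==> T <= s" using first_meeting[where v=v and n=j and w="w j", OF w[OF jn] cv] r'M unfolding T_def M_def by auto
     then obtain l where l: "l < j" "t j <= T" "t l <= T" "w j T = v l T" unfolding M_def meeting_times_def by blast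
     have Tr: "T <= S" using T(2)[OF r'M] k(3) by simp
     have "v j T = w j T"
     proof (rule coal_until[OF w[OF jn] v jn _ l(2) order_refl])
      fix k r' assume "k < j" "t j <= r'" "r' < T" "t k <= r'"
      thus "w j r' ~= v k r'" using T(2)[of r'] unfolding M_def meeting_times_def by fastforce
     qed
     hence "v j S = v l S" using mergingD[OF coalD(2)[OF v] jn, of l T S] l Tr jn by simp
     thus False using low[of l S] l(1,3) Tr tS True vS Wb[of S] by simp
    qed
    have "v j S = w j S" by (rule coalD(4)[OF v jn tS(1)]) (rule nomeet)
    \<comment> \<open>At \<open>S\<close> both drivers agree, so adding the increments of
      \<open>w j\<close> reproduces \<open>w j\<close>.\<close>
    hence Wj: "W r = w j r" if "S < r" for r using True that vS tS(3) by (simp add: W_def exchange_def)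
    have "v j s = w j s"
    proof (rule coalD(4)[OF v jn])
     show "t j <= s" using tS True by simp
     fix k r assume k: "k < j" "t j <= r" "r <= s" "t k <= r"
     show "w j r ~= v k r"
     proof (cases "r <= S")
      case True thus ?thesis using nomeet k by simp
     next
      case False thus ?thesis using low[of k r] k Wj[of r] tS by simp
     qed
    qed
    moreover have "v (Suc j) s = v j s" using mergingD[OF coalD(2)[OF v] j jn tS(2,1), of s] tS(3) True by simp
    ultimately show ?thesis using Wj[of s] True 2 by (simp add: W_def)
   qed
  qed
  thus ?thesis by simp
 qed
 show ?thesis unfolding coal_def
 proof (intro conjI allI impI)
  show "continuous_on {(t o swap j) i..} ((v o swap j) i)" if "i < n" for i using coalD(1)[OF v sn[OF that]] by simp
  show "merging (t o swap j) (v o swap j) n" unfolding merging_def comp_def using mergingD[OF coalD(2)[OF v] sn sn] by blast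
  show "(v o swap j) i ((t o swap j) i) = (exchange j b S w o swap j) i ((t o swap j) i)" if "i < n" for i using coalD(3)[OF v sn[OF that]] by (simp add: start)
  fix i s assume i: "i < n" and s: "(t o swap j) i <= s"
   and no: "ALL k<i. ALL r. (t o swap j) i <= r --> r <= s --> (t o swap j) k <= r -->
    (exchange j b S w o swap j) i r ~= (v o swap j) k r"
  have "v (swap j i) s = exchange j b S w (swap j (swap j (swap j i))) s" by (rule free) (use i s no in simp_all)
  thus "(v o swap j) i s = (exchange j b S w o swap j) i s" by simp
 qed
qed

section \<open>Measurability of first meetings\<close>

lemma pred_countable_Bex:
 assumes "countable X" "!!i. i : X ==> Measurable.pred M (P i)"
 shows "Measurable.pred M (%x. EX i:X. P i x)" using sets.sets_Collect_countable_Ex'[of X M P] assms by (simp add: pred_def)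

lemma pred_countable_Ball:
 assumes "countable X" "!!i. i : X ==> Measurable.pred M (P i)"
 shows "Measurable.pred M (%x. ALL i:X. P i x)" using sets.sets_Collect_countable_All'[of X M P] assms by (simp add: pred_def)

text \<open>Compactness turns an exact zero into arbitrarily small values, and continuity lets
  countably many points witness them. Rational fractions of the interval are used because its end
  points need not be rational.\<close>

lemma zero_in_interval_iff:
 fixes f :: "real => real"
 assumes f: "continuous_on {a..q} f" and aq: "a <= q"
 shows "(EX r. a <= r & r <= q & f r = 0) <-> (ALL n::nat. EX C:{0..1} Int \<rat>. abs (f (a + C * (q - a))) < 1 / real (Suc n))"
proof
 assume "EX r. a <= r & r <= q & f r = 0"
 then obtain r where r: "a <= r" "r <= q" "f r = 0" by blast
 show "ALL n::nat. EX C:{0..1} Int \<rat>. abs (f (a + C * (q - a))) < 1 / real (Suc n)"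
 proof
  fix n
  obtain d where d: "d > 0" "ALL x:{a..q}. dist x r < d --> dist (f x) (f r) < 1 / real (Suc n)"
   using f[unfolded continuous_on_iff, rule_format, of r "1 / real (Suc n)"] r by auto
  show "EX C:{0..1} Int \<rat>. abs (f (a + C * (q - a))) < 1 / real (Suc n)"
  proof (cases "a = q")
   case True
   thus ?thesis using r by (intro bexI[of _ 0]) auto
  next
   case False
   hence L: "q - a > 0" using aq by simp
   define l where "l = max 0 ((r - a) / (q - a) - d / (q - a))"
   define h where "h = min 1 ((r - a) / (q - a) + d / (q - a))"
   have fr: "0 <= (r - a) / (q - a)" "(r - a) / (q - a) <= 1" "d / (q - a) > 0" using r L d(1) by (auto simp: divide_le_eq)
   have "l < h" unfolding l_def h_def using fr by auto
   then obtain C where C: "C : \<rat>" "l < C" "C < h" using Rats_dense_in_real by blast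
   hence t01: "0 <= C" "C <= 1" and tt: "abs (C - (r - a) / (q - a)) < d / (q - a)" unfolding l_def h_def by (auto simp: abs_less_iff)
   have "a + C * (q - a) - r = (C - (r - a) / (q - a)) * (q - a)" using L by (simp add: field_simps)
   hence "abs (a + C * (q - a) - r) = abs (C - (r - a) / (q - a)) * (q - a)" using L by (simp add: abs_mult)
   also have "... < d" using tt L by (simp add: pos_less_divide_eq)
   finally have "dist (a + C * (q - a)) r < d" by (simp add: dist_real_def)
   moreover have "a + C * (q - a) : {a..q}"
   proof -
    have "C * (q - a) <= q - a" "0 <= C * (q - a)" using t01 L mult_right_mono[of C 1 "q - a"] by auto
    thus ?thesis by simp
   qed
   ultimately have "abs (f (a + C * (q - a))) < 1 / real (Suc n)" using d(2) r(3) by (auto simp: dist_real_def)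
   thus ?thesis using C(1) t01 by (intro bexI[of _ C]) auto
  qed
 qed
next
 assume A: "ALL n::nat. EX C:{0..1} Int \<rat>. abs (f (a + C * (q - a))) < 1 / real (Suc n)"
 have "continuous_on {a..q} (%x. abs (f x))" by (intro continuous_intros f)
 then obtain r where r: "r : {a..q}" "!!x. x : {a..q} ==> (abs (f r)) <= abs (f x)" using continuous_attains_inf[of "{a..q}" "%x. abs (f x)"] aq by auto
 have "f r = 0"
 proof (rule ccontr)
  assume "f r ~= 0"
  then obtain n where n: "1 / real (Suc n) < abs (f r)" using nat_approx_posE[of "abs (f r)"] by auto
  obtain C where C: "C : {0..1}" "abs (f (a + C * (q - a))) < 1 / real (Suc n)" using A by blast
  have "C * (q - a) <= q - a" "0 <= C * (q - a)" using C(1) aq mult_right_mono[of C 1 "q - a"] by auto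
  hence "a + C * (q - a) : {a..q}" by simp
  from r(2)[OF this] show False using C(2) n by linarith
 qed
 thus "EX r. a <= r & r <= q & f r = 0" using r(1) by auto
qed

lemma follow_measurable:
 fixes w :: "'a => real => real" and v :: "'a => nat => real => real"
 assumes wc: "!!u. u : space M ==> continuous_on {t n..} (w u)" and vc: "!!u k. u : space M ==> k < n ==> continuous_on {t k..} (v u k)"
  and wm: "!!s. t n <= s ==> (%u. w u s) : borel_measurable M" and vm: "!!k s. k < n ==> t k <= s ==> (%u. v u k s) : borel_measurable M" and s: "t n <= s"
 shows "(%u. follow_until_meeting t n (w u) (v u) s) : borel_measurable M"
proof -
 define a where "a k = max (t n) (t k)" for k :: nat
 define m where "m k q u <-> (EX r. a k <= r & r <= q & w u r - v u k r = 0)" for k :: nat and q u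
 have m_meas: "Measurable.pred M (m k q)" if k: "k < n" for k q
 proof (cases "a k <= q")
  case False
  hence "m k q = (%_. False)" by (auto simp: m_def fun_eq_iff)
  thus ?thesis by simp
 next
  case True
  have meas: "(%u. w u r - v u k r) : borel_measurable M" if "a k <= r" for r using that k by (intro borel_measurable_diff wm vm) (auto simp: a_def)
  have "Measurable.pred M (%u. ALL n::nat. EX D:{0..1} Int \<rat>. abs (w u (a k + D * (q - a k)) - v u k (a k + D * (q - a k))) < 1 / real (Suc n))"
  proof (rule pred_intros_countable(1), rule pred_countable_Bex)
   show "countable ({0..1} Int \<rat> :: real set)" using countable_rat by (rule countable_subset[rotated]) auto
   fix i :: nat and D :: real assume "D : {0..1} Int \<rat>"
   hence "a k <= a k + D * (q - a k)" using True by auto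
   from meas[OF this] show "Measurable.pred M (%u. abs (w u (a k + D * (q - a k)) - v u k (a k + D * (q - a k))) < 1 / real (Suc i))" by measurable
  qed
  moreover have "m k q u <-> (ALL n::nat. EX D:{0..1} Int \<rat>. abs (w u (a k + D * (q - a k)) - v u k (a k + D * (q - a k))) < 1 / real (Suc n))"
   if "u : space M" for u unfolding m_def
  proof (rule zero_in_interval_iff[OF _ True])
   show "continuous_on {a k..q} (%r. w u r - v u k r)"
    by (intro continuous_intros continuous_on_subset[OF wc[OF that]] continuous_on_subset[OF vc[OF that k]]) (auto simp: a_def)
  qed
  ultimately show ?thesis by (subst measurable_cong) auto
 qed
 \<comment> \<open>Path \<open>k\<close> is met at the first meeting time iff it is met by every
   rational time by which some path is met.\<close>
 define C where "C k u <-> k < n & (ALL q:\<rat>. (EX l:{..<n}. m l q u) --> m k q u)" for k :: nat and u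
 have C_meas: "Measurable.pred M (C k)" for k
 proof (cases "k < n")
  case True
  thus ?thesis unfolding C_def by (intro pred_intros_logic pred_countable_Ball pred_intros_finite countable_rat m_meas) auto
 next
  case False
  hence "C k = (%_. False)" by (simp add: C_def fun_eq_iff)
  thus ?thesis by simp
 qed
 define K where "K u = (LEAST k. C k u)" for u
 have K_meas: "K : measurable M (count_space UNIV)" unfolding K_def by (intro measurable_Least C_meas)
 \<comment> \<open>The default 0 makes the map measurable for every fixed \<open>k\<close>; the
   index actually selected never reaches it.\<close>
 have "(%u. if EX l:{..<n}. m l s u then (%k u. if k < n & t k <= s then v u k s else 0) (K u) u else w u s) : borel_measurable M"
 proof (rule measurable_If)
  show "(%u. (%k u. if k < n & t k <= s then v u k s else 0) (K u) u) : borel_measurable M"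
  proof (rule measurable_compose_countable[OF _ K_meas])
   fix k show "(%u. if k < n & t k <= s then v u k s else 0) : borel_measurable M"
    using vm[of k s] by (cases "k < n & t k <= s") auto
  qed
  show "(%u. w u s) : borel_measurable M" by (rule wm[OF s])
  have "Measurable.pred M (%u. EX l:{..<n}. m l s u)" by (intro pred_intros_finite m_meas) auto
  thus "{u:space M. EX l:{..<n}. m l s u} : sets M" by (rule predE)
 qed
 moreover have "follow_until_meeting t n (w u) (v u) s =
  (if EX l:{..<n}. m l s u then (%k u. if k < n & t k <= s then v u k s else 0) (K u) u else w u s)"
  if u: "u : space M" for u
 proof -
  define T where "T = meeting_times t n (w u) (v u)"
  define S where "S = Inf T"
  have mT: "m l q u <-> (EX r. r <= q & t n <= r & t l <= r & w u r = v u l r)" for l q unfolding m_def a_def by auto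
  have ex: "(EX l:{..<n}. m l q u) <-> (EX r:T. r <= q)" for q unfolding mT T_def meeting_times_def by auto
  show ?thesis
  proof (cases "EX r:T. r <= s")
   case False
   have "T = {} | s < S"
   proof (rule ccontr)
    assume "\<not> (T = {} | s < S)"
    hence "T ~= {}" "S <= s" by auto
    hence "S : T" using first_meeting(1)[where v="v u" and n=n and w="w u", OF wc[OF u] vc[OF u]] by (simp add: S_def T_def)
    thus False using False \<open>S <= s\<close> by blast
   qed
   thus ?thesis using False unfolding ex by (auto simp: follow_until_meeting_def Let_def T_def[symmetric] S_def[symmetric])
  next
   case True
   hence ne: "T ~= {}" by blast
   have S: "S : T" "!!r. r : T ==> S <= r" using first_meeting[where v="v u" and n=n and w="w u", OF wc[OF u] vc[OF u]] ne by (auto simp: S_def T_def)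
   have Ss: "S <= s" using True S(2) by force
   have exq: "(EX r:T. r <= q) <-> S <= q" for q using S by force
   have CK: "C k u <-> k < n & t k <= S & w u S = v u k S" for k
   proof
    assume C: "C k u"
    hence k: "k < n" and all: "!!q. q : \<rat> ==> S <= q ==> m k q u" unfolding C_def ex exq by blast+
    define Tk where "Tk = {r:{a k..}. w u r - v u k r = 0}"
    have "continuous_on {a k..} (%r. w u r - v u k r)"
     by (intro continuous_intros continuous_on_subset[OF wc[OF u]] continuous_on_subset[OF vc[OF u k]]) (auto simp: a_def)
    from continuous_closed_preimage_constant[OF this, of 0] have cl: "closed Tk" by (simp add: Tk_def)
    \<comment> \<open>Meetings with \<open>k\<close> by rational times just after \<open>S\<close>
      accumulate at \<open>S\<close>, and the set of such meetings is closed.\<close>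
    have "S : closure Tk" unfolding closure_approachable
    proof (intro allI impI)
     fix e :: real assume "e > 0"
     then obtain q where q: "q : \<rat>" "S < q" "q < S + e" using Rats_dense_in_real[of S "S + e"] by auto
     then obtain r where r: "a k <= r" "r <= q" "w u r - v u k r = 0" using all[of q] unfolding m_def by auto
     hence "r : T" using k unfolding T_def meeting_times_def a_def by auto
     hence "S <= r" by (rule S(2))
     thus "EX y:Tk. dist y S < e" using r q by (intro bexI[of _ r]) (auto simp: Tk_def dist_real_def)
    qed
    hence "S : Tk" using cl by simp
    hence "a k <= S" "w u S = v u k S" unfolding Tk_def by simp_all
    thus "k < n & t k <= S & w u S = v u k S" using k by (simp add: a_def)
   next
    assume k: "k < n & t k <= S & w u S = v u k S"
    have tn: "t n <= S" using S(1) by (simp add: T_def meeting_times_def)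
    have "m k q u" if "S <= q" for q unfolding mT using k tn that by (intro exI[of _ S]) simp
    thus "C k u" unfolding C_def ex exq using k by simp
   qed
   have "EX k. C k u" unfolding CK using S(1) by (auto simp: T_def meeting_times_def)
   hence "C (K u) u" unfolding K_def by (rule LeastI_ex)
   hence "K u < n" "t (K u) <= s" using Ss unfolding CK by auto
   moreover have "follow_until_meeting t n (w u) (v u) s = v u (K u) s"
    using ne Ss unfolding follow_until_meeting_def Let_def T_def[symmetric] S_def[symmetric] K_def CK by simp
   ultimately show ?thesis using True unfolding ex by simp
  qed
 qed
 ultimately show ?thesis by (subst measurable_cong) auto
qed

section \<open>Measurable path-valued maps\<close>

lemma path_dist_le_rat_iff:
 assumes "0 <= c"
 shows "dist p q <= c <-> (ALL s:\<rat>. abs (tval p s - tval q s) <= c * (1 + abs s)) &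
  abs (Psi (st p) - Psi (st q)) <= c"
proof -
 have "abs (tval p s - tval q s) <= c * (1 + abs s)" if R: "ALL s:\<rat>. abs (tval p s - tval q s) <= c * (1 + abs s)" for s
 proof -
  have "continuous_on UNIV (%s. c * (1 + abs s) - abs (tval p s - tval q s))" by (intro continuous_intros continuous_tval)
  hence "closed {s. 0 <= c * (1 + abs s) - abs (tval p s - tval q s)}" by (intro closed_Collect_le continuous_on_const)
  moreover have "\<rat> \<subseteq> {s. 0 <= c * (1 + abs s) - abs (tval p s - tval q s)}" using R by auto
  ultimately have "closure \<rat> \<subseteq> {s. 0 <= c * (1 + abs s) - abs (tval p s - tval q s)}" by (rule closure_minimal[rotated])
  thus ?thesis by (simp add: Rats_closure_real subset_eq)
 qed
 thus ?thesis unfolding dist_le_iff[OF assms] by blast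
qed

text \<open>Distances to fixed paths are measurable because rational times determine them; by
  Lindelof every open set is a countable union of balls.\<close>

lemma path_measurableI:
 fixes f :: "'a => bw_path"
 assumes t: "!!s. (%w. tval (f w) s) : borel_measurable M" and st: "(%w. Psi (st (f w))) : borel_measurable M"
 shows "f : borel_measurable M"
proof -
 have dm: "(%w. dist p (f w)) : borel_measurable M" for p unfolding borel_measurable_iff_le
 proof
  fix c :: real
  show "{w:space M. dist p (f w) <= c} : sets M"
  proof (cases "0 <= c")
   case True
   have "Measurable.pred M (%w. (ALL s:\<rat>. abs (tval p s - tval (f w) s) <= c * (1 + abs s)) &
     abs (Psi (st p) - Psi (st (f w))) <= c)" using t st by (intro pred_intros_logic pred_countable_Ball countable_rat borel_measurable_le
     borel_measurable_abs borel_measurable_diff borel_measurable_const | simp)+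
   hence "Measurable.pred M (%w. dist p (f w) <= c)" unfolding path_dist_le_rat_iff[OF True] .
   thus ?thesis by (rule predE)
  next
   case False
   hence "{w:space M. dist p (f w) <= c} = {}" using zero_le_dist[of p] order_trans by blast
   thus ?thesis by (simp only: sets.empty_sets)
  qed
 qed
 show ?thesis
 proof (rule borel_measurableI)
  fix S :: "bw_path set" assume S: "open S"
  define F where "F = {B. EX p r. B = ball p r & B \<subseteq> S}"
  have "!!B. B : F ==> open B" by (auto simp: F_def)
  then obtain F' where F': "F' \<subseteq> F" "countable F'" "\<Union>F' = \<Union>F" using Lindelof[of F] by blast
  have "\<Union>F = S"
  proof
   show "S \<subseteq> \<Union>F"
   proof
    fix p assume "p : S"
    then obtain e where "e > 0" "ball p e \<subseteq> S" using S open_contains_ball by blast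
    thus "p : \<Union>F" unfolding F_def by (intro UnionI[of "ball p e"]) auto
   qed
  qed (auto simp: F_def)
  hence "f -` S Int space M = (\<Union>B\<in>F'. f -` B Int space M)" using F'(3) by blast
  moreover have "f -` B Int space M : sets M" if "B : F'" for B
  proof -
   have "B : F" using F'(1) that by blast
   then obtain p r where B: "B = ball p r" unfolding F_def by blast
   have "f -` B Int space M = {w:space M. dist p (f w) < r}" unfolding B by auto
   moreover have "{w:space M. dist p (f w) < r} : sets M" using borel_measurable_iff_less[of "%w. dist p (f w)" M] dm[of p] by blast
   ultimately show ?thesis by (simp only:)
  qed
  ultimately show "f -` S Int space M : sets M" using sets.countable_UN'[OF F'(2), of "%B. f -` B Int space M" M] by (simp only: image_subset_iff) blast
 qed
qed

section \<open>Coalescing Brownian motions on the canonical space\<close>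

text \<open>The type is that of the auxiliary probability space in \<open>coalescing_fdds\<close>,
  so this space itself serves as a witness there.\<close>

definition WS :: "(nat => real => real) measure" where "WS = PiM UNIV (%_. wiener)"

lemma prob_space_wspace: "prob_space WS" unfolding WS_def by (intro prob_space_PiM prob_space_wiener)

abbreviation (input) "WW == WS XM WS"

interpretation W: prob_space WS by (rule prob_space_wspace)

lemma space_wspace: "w : space WS <-> (ALL i. w i : wiener_paths)" by (auto simp: WS_def space_PiM)

lemma wspace_coord: "(%w. w i) : measurable WS wiener" unfolding WS_def by (rule measurable_component_singleton) simp

lemma wspace_eval: "0 <= s ==> (%w. w i s) : borel_measurable WS" by (rule measurable_compose[OF wspace_coord wiener_eval_measurable])

lemma wspace_cont: "w : space WS ==> continuous_on {0..} (w i)" "w : space WS ==> w i 0 = 0" using wiener_pathsD by (auto simp: space_wspace)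

lemma wspace_measurableI:
 assumes "!!i s. 0 <= s ==> (%x. f x i s) : borel_measurable M" "!!x i. x : space M ==> f x i : wiener_paths"
 shows "f : measurable M WS" unfolding WS_def by (intro measurable_vec) (simp add: measurable_cong_sets[OF refl sets_wiener] measurable_path_algebraI assms)

text \<open>The double family of coordinates is flattened to one product over pairs of an index and
  a time, where finite boxes determine a measure; every event of \<open>WS\<close> is a preimage
  under the flattening.\<close>

lemma wspace_eqI:
 assumes P: "prob_space P" "sets P = sets WS" and Q: "prob_space Q" "sets Q = sets WS"
  and eq: "!!J A. finite J ==> J \<subseteq> UNIV \<times> {0..} ==> (!!k. A k : sets borel) ==>
   measure P {w:space P. ALL k:J. w (fst k) (snd k) : A k} = measure Q {w:space Q. ALL k:J. w (fst k) (snd k) : A k}"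
 shows "P = Q"
proof -
 let ?I = "(UNIV :: nat set) \<times> {0 :: real..}"
 define e where "e w = (\<lambda>k\<in>?I. w (fst k) (snd k))" for w :: "nat => real => real"
 have em: "e : measurable WS (PiM ?I (%_. borel))" unfolding e_def by (intro measurable_restrict wspace_eval) auto
 have eP: "e : measurable P (PiM ?I (%_. borel))" and eQ: "e : measurable Q (PiM ?I (%_. borel))"
  using em by (simp_all only: measurable_cong_sets[OF P(2) refl] measurable_cong_sets[OF Q(2) refl])
 have sP: "space P = space WS" and sQ: "space Q = space WS" using sets_eq_imp_space_eq P(2) Q(2) by blast+
 let ?V = "vimage_algebra (space WS) e (PiM ?I (%_. borel))"
 have ev: "e : measurable ?V (PiM ?I (%_. borel))" using measurable_space[OF em] by (intro measurable_vimage_algebra1) blast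
 have "(%w. w) : measurable ?V WS"
 proof (rule wspace_measurableI)
  fix i :: nat and s :: real assume s: "0 <= s"
  have "(%w. e w (i, s)) : borel_measurable ?V" using s by (intro measurable_compose[OF ev measurable_component_singleton]) auto
  moreover have "(%w. e w (i, s)) = (%w. w i s)" using s by (simp add: e_def)
  ultimately show "(%w. w i s) : borel_measurable ?V" by simp
 qed (simp add: space_wspace)
 hence gen: "EX B:sets (PiM ?I (%_. borel)). A = e -` B Int space WS" if "A : sets WS" for A
 proof -
  assume m: "(%w. w) : measurable ?V WS"
  have "(%w. w) -` A Int space ?V : sets ?V" by (rule measurable_sets[OF m that])
  moreover have "(%w. w) -` A Int space ?V = A" using sets.sets_into_space[OF that] by auto
  moreover have "e : space WS \<rightarrow> space (PiM ?I (%_. borel))" using measurable_space[OF em] by blast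
  ultimately show ?thesis unfolding sets_vimage_algebra2[OF \<open>e : space WS \<rightarrow> _\<close>] by auto
 qed
 have de: "distr P (PiM ?I (%_. borel)) e = distr Q (PiM ?I (%_. borel)) e"
 proof (rule measure_eqI_PiM_infinite)
  show "finite_measure (distr P (PiM ?I (%_. borel)) e)" by (intro prob_space.finite_measure prob_space.prob_space_distr P eP)
  fix A J assume J: "finite J" "J \<subseteq> ?I" and A: "!!k. k : J ==> A k : sets (borel :: real measure)"
  define A' where "A' k = (if k : J then A k else UNIV)" for k
  let ?B = "prod_emb ?I (%_. borel) J (Pi\<^sub>E J A)"
  have B: "?B : sets (PiM ?I (%_. borel))" using J A by (intro sets_PiM_I) auto
  have pre: "e -` ?B Int space WS = {w:space WS. ALL k:J. w (fst k) (snd k) : A' k}"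
  proof (rule set_eqI)
   fix w
   have "e w : ?B <-> (ALL k:J. e w k : A k)" unfolding prod_emb_def by (auto simp: PiE_iff e_def space_PiM)
   also have "... <-> (ALL k:J. w (fst k) (snd k) : A' k)" using J(2) unfolding e_def A'_def by (intro ball_cong refl) auto
   finally show "w : e -` ?B Int space WS <-> w : {w:space WS. ALL k:J. w (fst k) (snd k) : A' k}" by auto
  qed
  have "emeasure (distr P (PiM ?I (%_. borel)) e) ?B = emeasure P {w:space P. ALL k:J. w (fst k) (snd k) : A' k}" unfolding emeasure_distr[OF eP B] sP pre ..
  also have "... = emeasure Q {w:space Q. ALL k:J. w (fst k) (snd k) : A' k}" using eq[OF J, of A'] A
   by (simp add: A'_def finite_measure.emeasure_eq_measure[OF prob_space.finite_measure[OF P(1)]]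
    finite_measure.emeasure_eq_measure[OF prob_space.finite_measure[OF Q(1)]])
  also have "... = emeasure (distr Q (PiM ?I (%_. borel)) e) ?B" unfolding emeasure_distr[OF eQ B] sQ pre ..
  finally show "emeasure (distr P (PiM ?I (%_. borel)) e) ?B = emeasure (distr Q (PiM ?I (%_. borel)) e) ?B" .
 qed simp_all
 show ?thesis
 proof (rule measure_eqI)
  show "sets P = sets Q" by (simp only: P Q)
  fix A assume "A : sets P"
  hence "A : sets WS" by (simp only: P)
  from gen[OF this] obtain B where B: "B : sets (PiM ?I (%_. borel))" "A = e -` B Int space WS" by blast
  have "emeasure P A = emeasure (distr P (PiM ?I (%_. borel)) e) B" unfolding emeasure_distr[OF eP B(1)] sP B(2) ..
  also have "... = emeasure Q A" unfolding de emeasure_distr[OF eQ B(1)] sQ B(2) ..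
  finally show "emeasure P A = emeasure Q A" .
 qed
qed

definition drive :: "(nat => real \<times> real) => (nat => real => real) => nat => real => real" where "drive z w i s = fst (z i) + w i (s - snd (z i))"

text \<open>Later steps of \<open>coalesce\<close> do not change path \<open>i\<close>, so stopping
  after \<open>Suc i\<close> steps defines one infinite family.\<close>

definition cpath :: "(nat => real \<times> real) => (nat => real => real) => nat => real => real" where "cpath z w i = coalesce (%i. snd (z i)) (drive z w) (Suc i) i"

definition bpath :: "(nat => real \<times> real) => (nat => real => real) => nat => bw_path" where "bpath z w i = real_path (cpath z w i) (snd (z i))"

lemma drive_cont:
 assumes "w : space WS"
 shows "continuous_on {snd (z i)..} (drive z w i)"
proof -
 have "continuous_on {snd (z i)..} (w i o (%s. s - snd (z i)))" by (intro continuous_on_compose continuous_intros continuous_on_subset[OF wspace_cont(1)[OF assms]]) auto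
 thus ?thesis unfolding drive_def comp_def by (intro continuous_intros)
qed

lemma drive_measurable: "snd (z i) <= s ==> (%w. drive z w i s) : borel_measurable WS"
 unfolding drive_def by (intro borel_measurable_add borel_measurable_const wspace_eval) simp

lemma coalesce_stable: "i < n ==> coalesce t w n i = coalesce t w (Suc i) i"
proof (induction n)
 case (Suc n)
 thus ?case by (cases "i = n") auto
qed simp

lemma coalesce_cpath: "i < n ==> coalesce (%i. snd (z i)) (drive z w) n i = cpath z w i" unfolding cpath_def by (rule coalesce_stable)

lemma coal_cpath:
 assumes "w : space WS"
 shows "coal (%i. snd (z i)) (drive z w) (cpath z w) n" by (rule coal_cong[OF coal_coalesce[of n "%i. snd (z i)" "drive z w", OF drive_cont[OF assms]]])
  (simp_all add: coalesce_cpath)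

lemma cpath_cont: "w : space WS ==> continuous_on {snd (z i)..} (cpath z w i)" by (rule coalD(1)[OF coal_cpath lessI])

lemma cpath_start: "w : space WS ==> cpath z w i (snd (z i)) = fst (z i)" using coalD(3)[OF coal_cpath lessI, of w z i] by (simp add: drive_def wspace_cont)

lemma cpath_unique:
 assumes "w : space WS" "coal (%i. snd (z i)) (drive z w) v n" "i < n" "snd (z i) <= s"
 shows "v i s = cpath z w i s" by (rule coal_unique[OF _ assms(2) coal_cpath[OF assms(1)] assms(3,4)]) (rule drive_cont[OF assms(1)])

lemma coal_time_cong:
 assumes "coal t w v n" "!!i. i < n ==> t i = t' i"
 shows "coal t' w v n"
proof -
 have "merging t' v n" unfolding merging_def
 proof (intro allI impI)
  fix i j s s' assume *: "i < n" "j < n" "t' i <= s" "t' j <= s" "v i s = v j s" "s <= s'"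
  thus "v i s' = v j s'" using assms(2)[of i] assms(2)[of j] mergingD[OF coalD(2)[OF assms(1)], of i j s s'] by simp
 qed
 moreover have "v j s = w j s"
  if j: "j < n" "t' j <= s" and no: "ALL k<j. ALL r. t' j <= r --> r <= s --> t' k <= r --> w j r ~= v k r" for j s
 proof (rule coalD(4)[OF assms(1) j(1)])
  show "t j <= s" using j assms(2) by simp
  show "w j r ~= v k r" if "k < j" "t j <= r" "r <= s" "t k <= r" for k r using no[rule_format, of k r] that assms(2)[of k] assms(2)[of j] j(1) by simp
 qed
 moreover have "continuous_on {t' j..} (v j)" "v j (t' j) = w j (t' j)" if "j < n" for j using coalD(1,3)[OF assms(1) that] assms(2)[OF that] by simp_all
 ultimately show ?thesis unfolding coal_def by (intro conjI allI impI) assumption+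
qed

lemma cpath_prefix:
 assumes w: "w : space WS" "w' : space WS" and eq: "!!i. i < n ==> z i = z' i" "!!i. i < n ==> w i = w' i" and i: "i < n" "snd (z i) <= s"
 shows "cpath z w i s = cpath z' w' i s"
proof (rule cpath_unique[OF w(2) _ i(1)])
 have "coal (%i. snd (z i)) (drive z' w') (cpath z w) n" by (rule coal_cong[OF coal_cpath[OF w(1)]]) (simp_all add: drive_def eq)
 thus "coal (%i. snd (z' i)) (drive z' w') (cpath z w) n" by (rule coal_time_cong) (simp add: eq)
 show "snd (z' i) <= s" using i eq by simp
qed

lemma cpath_measurable:
 assumes "snd (z i) <= s"
 shows "(%w. cpath z w i s) : borel_measurable WS" using assms
proof (induction i arbitrary: s rule: less_induct)
 case (less i)
 have "(%w. follow_until_meeting (%i. snd (z i)) i (drive z w i) (coalesce (%i. snd (z i)) (drive z w) i) s) : borel_measurable WS"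
 proof (rule follow_measurable[where t="%i. snd (z i)" and v="%w. coalesce (%i. snd (z i)) (drive z w) i"])
  show "continuous_on {snd (z k)..} (coalesce (%i. snd (z i)) (drive z w) i k)" if "w : space WS" "k < i" for w k
   using cpath_cont[OF that(1)] that(2) by (simp add: coalesce_cpath)
  show "(%w. coalesce (%i. snd (z i)) (drive z w) i k s) : borel_measurable WS" if "k < i" "snd (z k) <= s" for k s
   using less.IH[OF that] by (simp add: coalesce_cpath[OF that(1)])
 qed (use drive_cont drive_measurable less.prems in auto)
 thus ?case by (simp add: cpath_def)
qed

lemma bpath_vals:
 assumes "w : space WS"
 shows "st (bpath z w i) = ereal (snd (z i))" "pval (bpath z w i) s = ereal (cpath z w i (max s (snd (z i))))"
  "tval (bpath z w i) s = tanh (cpath z w i (max s (snd (z i))))" unfolding bpath_def using real_path_vals[OF cpath_cont[OF assms, of z i]] by auto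

lemma bpath_measurable: "(%w. bpath z w i) : borel_measurable WS"
proof (rule path_measurableI)
 have "(%w. tanh (cpath z w i (max s (snd (z i))))) : borel_measurable WS" for s by (rule measurable_compose[OF cpath_measurable borel_measurable_continuous_onI])
   (auto intro!: continuous_intros)
 thus "(%w. tval (bpath z w i) s) : borel_measurable WS" for s by (rule measurable_cong[THEN iffD2, rotated]) (simp add: bpath_vals)
 show "(%w. Psi (st (bpath z w i))) : borel_measurable WS"
  by (rule measurable_cong[THEN iffD2, OF _ borel_measurable_const[of "Psi (ereal (snd (z i)))"]]) (simp add: bpath_vals)
qed

lemma bpath_eqI:
 assumes "w : space WS" "w' : space WS" "snd (z i) = snd (z' k)" "!!s. snd (z i) <= s ==> cpath z w i s = cpath z' w' k s"
 shows "bpath z w i = bpath z' w' k" by (rule path_eqI) (use assms in \<open>auto simp: bpath_vals\<close>)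

lemma bpath_prefix:
 assumes "w : space WS" "w' : space WS" and "!!i. i < n ==> z i = z' i" "!!i. i < n ==> w i = w' i" "i < n"
 shows "bpath z w i = bpath z' w' i" by (rule bpath_eqI) (use assms cpath_prefix[OF assms(1,2), of n z z' i] in auto)

definition paths :: "(nat => bw_path) measure" where "paths = PB UNIV"

lemma bpaths_measurable: "bpath z : measurable WS paths" unfolding paths_def by (intro measurable_vec bpath_measurable)

definition skel_law :: "(nat => real \<times> real) => (nat => bw_path) measure" where "skel_law z = distr WS paths (bpath z)"

section \<open>The Markov property at deterministic times\<close>

definition splice_path :: "real => (real => real) => (real => real) => real => real" where
 "splice_path a f h = (\<lambda>s\<in>{0..}. if s <= a then f s else f a + h (s - a))"

lemma splice_path_in_paths:
 assumes a: "0 <= c" and f: "f : wiener_paths" and h: "h : wiener_paths"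
 shows "splice_path c f h : wiener_paths"
proof -
 have c1: "continuous_on {0..c} (splice_path c f h)" by (rule continuous_on_eq[OF continuous_on_subset[OF wiener_pathsD(2)[OF f]]]) (auto simp: splice_path_def)
 have "continuous_on {c..} (h o (%s. s - c))" by (intro continuous_on_compose continuous_intros continuous_on_subset[OF wiener_pathsD(2)[OF h]]) auto
 hence "continuous_on {c..} (%s. f c + h (s - c))" by (intro continuous_intros) (simp add: comp_def)
 hence c2: "continuous_on {c..} (splice_path c f h)" by (rule continuous_on_eq) (use a wiener_pathsD(1)[OF h] in \<open>auto simp: splice_path_def\<close>)
 have "continuous_on ({0..c} Un {c..}) (splice_path c f h)" by (intro continuous_on_closed_Un c1 c2) auto
 moreover have "{0..c} Un {c..} = {0..}" using a by auto
 ultimately have "continuous_on {0..} (splice_path c f h)" by simp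
 thus ?thesis using wiener_pathsD(1)[OF f] a by (simp add: wiener_paths_def splice_path_def)
qed

lemma splice_path_eval_measurable:
 assumes "0 <= a" "0 <= s"
 shows "(%z. splice_path a (fst z) (snd z) s) : borel_measurable (wiener XM wiener)"
proof (cases "s <= a")
 case True
 thus ?thesis using assms by (simp add: splice_path_def measurable_compose[OF measurable_fst wiener_eval_measurable])
next
 case False
 have "(%z. fst z a + snd z (s - a)) : borel_measurable (wiener XM wiener)"
  using False assms by (intro borel_measurable_add measurable_compose[OF measurable_fst wiener_eval_measurable]
   measurable_compose[OF measurable_snd wiener_eval_measurable]) auto
 thus ?thesis using False assms by (simp add: splice_path_def)
qed

lemma splice_path_measurable:
 assumes "0 <= a"
 shows "(%z. splice_path a (fst z) (snd z)) : measurable (wiener XM wiener) path_algebra"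
 by (intro measurable_path_algebraI splice_path_eval_measurable assms splice_path_in_paths)
  (auto simp: space_pair_measure)

lemma wiener_event:
 assumes "!!i. A i : sets borel" "!!i. 0 <= u i"
 shows "{f:space wiener. ALL i<m. f (u (Suc i)) - f (u i) : A i} : sets wiener"
proof -
 have "{f:space wiener. ALL i:{..<m}. f (u (Suc i)) - f (u i) : A i} : sets wiener"
 proof (rule sets.sets_Collect_finite_All)
  fix i
  have "(%f. f (u (Suc i)) - f (u i)) -` A i Int space wiener : sets wiener"
   using assms by (intro measurable_sets[OF borel_measurable_diff] wiener_eval_measurable) blast+
  also have "(%f. f (u (Suc i)) - f (u i)) -` A i Int space wiener = {f:space wiener. f (u (Suc i)) - f (u i) : A i}" unfolding vimage_def by blast
  finally show "{f:space wiener. f (u (Suc i)) - f (u i) : A i} : sets wiener" .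
 qed simp
 thus ?thesis by (simp only: Ball_def lessThan_iff)
qed

text \<open>On a grid through the splicing time the first \<open>p\<close> increments come from one
  path and the others from the second. The shifted grid \<open>u'\<close> stays at 0 for its first
  \<open>p\<close> steps, and \<open>A1\<close>, \<open>A2\<close> are trivial where the other path
  is responsible.\<close>

lemma splice_path_inc_law:
 assumes u: "mono u" "u 0 = 0" and p: "p <= m"
 shows "inc_law (wiener XM wiener) (%s z. splice_path (u p) (fst z) (snd z) s) u m" unfolding inc_law_def
proof (intro allI impI)
 fix A :: "nat => real set" assume A: "ALL i. A i : sets borel"
 interpret W: prob_space wiener by (rule prob_space_wiener)
 interpret WW: pair_prob_space wiener wiener ..
 have u0: "0 <= u i" for i using u monoD[OF u(1), of 0 i] by simp
 define u' where "u' i = max 0 (u i - u p)" for i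
 have u': "mono u'" "0 <= u' i" for i unfolding u'_def by (intro monoI max.mono diff_right_mono monoD[OF u(1)] order_refl) auto
 define A1 where "A1 i = (if i < p then A i else UNIV)" for i
 define A2 where "A2 i = (if i < p then UNIV else A i)" for i
 have A12: "A1 i : sets borel" "A2 i : sets borel" for i using A by (auto simp: A1_def A2_def)
 define E1 where "E1 = {f:space wiener. ALL i<m. f (u (Suc i)) - f (u i) : A1 i}"
 define E2 where "E2 = {f:space wiener. ALL i<m. f (u' (Suc i)) - f (u' i) : A2 i}"
 have E: "E1 : sets wiener" "E2 : sets wiener" unfolding E1_def E2_def by (intro wiener_event A12 u0 u'(2))+
 have inc: "splice_path (u p) f h (u (Suc i)) - splice_path (u p) f h (u i) =
   (if i < p then f (u (Suc i)) - f (u i) else h (u' (Suc i)) - h (u' i))"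
  if "h : wiener_paths" for f h i
 proof (cases "i < p")
  case True
  hence "u (Suc i) <= u p" "u i <= u p" using u(1) by (auto intro: monoD)
  thus ?thesis using True u0 by (simp add: splice_path_def)
 next
  case False
  hence ge: "u p <= u i" "u p <= u (Suc i)" using u(1) by (auto intro: monoD)
  have "splice_path (u p) f h s = f (u p) + h (s - u p)" if "u p <= s" for s
   using that u0[of p] wiener_pathsD(1)[OF \<open>h : wiener_paths\<close>] by (auto simp: splice_path_def)
  thus ?thesis using False ge by (simp add: u'_def)
 qed
 have "{z:space (wiener XM wiener). ALL i<m. splice_path (u p) (fst z) (snd z) (u (Suc i)) - splice_path (u p) (fst z) (snd z) (u i) : A i} = E1 \<times> E2"
 proof (rule set_eqI)
  fix z :: "(real => real) \<times> (real => real)"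
  show "z : {z:space (wiener XM wiener). ALL i<m. splice_path (u p) (fst z) (snd z) (u (Suc i)) - splice_path (u p) (fst z) (snd z) (u i) : A i} <-> z : E1 \<times> E2"
  proof (cases "snd z : wiener_paths")
   case True
   thus ?thesis by (cases z) (auto simp: E1_def E2_def space_pair_measure inc A1_def A2_def)
  qed (auto simp: E2_def space_pair_measure)
 qed
 hence "measure (wiener XM wiener) {z:space (wiener XM wiener). ALL i<m. splice_path (u p) (fst z) (snd z) (u (Suc i)) - splice_path (u p) (fst z) (snd z) (u i) : A i}
  = measure wiener E1 * measure wiener E2" using E by (simp add: measure_def W.emeasure_pair_measure_Times enn2real_mult)
 also have "measure wiener E1 = (PROD i<m. measure (gauss (u (Suc i) - u i)) (A1 i))" using wiener_inc_law[OF u(1), of m] u(2) A12 unfolding inc_law_def E1_def by simp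
 also have "measure wiener E2 = (PROD i<m. measure (gauss (u' (Suc i) - u' i)) (A2 i))"
  using wiener_inc_law[OF u'(1) u'(2), of m] A12 unfolding inc_law_def E2_def by simp
 also have "(PROD i<m. measure (gauss (u (Suc i) - u i)) (A1 i)) * (PROD i<m. measure (gauss (u' (Suc i) - u' i)) (A2 i))
  = (PROD i<m. measure (gauss (u (Suc i) - u i)) (A i))"
 proof (subst prod.distrib[symmetric], rule prod.cong[OF refl])
  fix i
  have one: "measure (gauss v) UNIV = 1" for v using prob_space.prob_space[OF prob_space_gauss[of v]] by simp
  have "u' (Suc i) - u' i = u (Suc i) - u i" if "\<not> i < p" using that monoD[OF u(1), of p i] monoD[OF u(1), of p "Suc i"] by (simp add: u'_def)
  thus "measure (gauss (u (Suc i) - u i)) (A1 i) * measure (gauss (u' (Suc i) - u' i)) (A2 i)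
   = measure (gauss (u (Suc i) - u i)) (A i)" by (simp add: A1_def A2_def one)
 qed
 finally show "measure (wiener XM wiener) {z:space (wiener XM wiener). ALL i<m. splice_path (u p) (fst z) (snd z) (u (Suc i)) - splice_path (u p) (fst z) (snd z) (u i) : A i}
  = (PROD i<m. measure (gauss (u (Suc i) - u i)) (A i))" .
qed

text \<open>This invariance is the Markov property at a fixed time: the past and a fresh independent
  continuation recompose to a Wiener path.\<close>

lemma wiener_concat:
 assumes a: "0 <= c"
 shows "distr (wiener XM wiener) path_algebra (%z. splice_path c (fst z) (snd z)) = wiener"
proof -
 interpret W: prob_space wiener by (rule prob_space_wiener)
 interpret WW: pair_prob_space wiener wiener ..
 have r: "(\<lambda>s\<in>{0..}. splice_path c f h s) = splice_path c f h" for f h unfolding splice_path_def by (rule ext) simp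
 have "distr (wiener XM wiener) path_algebra (%z. \<lambda>s\<in>{0..}. splice_path c (fst z) (snd z) s) = wiener"
 proof (rule wiener_unique[OF WW.prob_space_axioms splice_path_eval_measurable[OF a]])
  show "(\<lambda>s\<in>{0..}. splice_path c (fst z) (snd z) s) : wiener_paths" if "z : space (wiener XM wiener)" for z
   unfolding r using that by (intro splice_path_in_paths a) (auto simp: space_pair_measure)
  fix J :: "real set" assume J: "finite J" "J \<subseteq> {0..}"
  have "finite (insert c J)" "insert c J \<subseteq> {0..}" using J a by auto
  from time_grid[OF this] obtain u :: "nat => real" and m
   where u: "u 0 = 0" "mono u" "insert c J \<subseteq> u ` {..m}" "!!i. 0 <= u i" by metis
  then obtain p where p: "p <= m" "c = u p" by auto
  show "EX u m. u 0 = 0 & mono u & J \<subseteq> u ` {..m} & inc_law (wiener XM wiener) (%s z. splice_path c (fst z) (snd z) s) u m"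
   using u splice_path_inc_law[OF u(2,1) p(1)] unfolding p(2) by (intro exI[of _ u] exI[of _ m]) simp
 qed
 thus ?thesis unfolding r .
qed

text \<open>Each coordinate has its own splicing time, since one common instant corresponds to
  different ages of paths with different starts.\<close>

definition wconcat :: "(nat => real) => (nat => real => real) \<times> (nat => real => real) => nat => real => real" where
 "wconcat a z i = splice_path (a i) (fst z i) (snd z i)"

lemma wconcat_measurable:
 assumes "!!i. 0 <= a i"
 shows "wconcat a : measurable WW WS"
proof -
 have "(%z. wconcat a z i) : measurable WW wiener" for i
 proof -
  have "(%z. (fst z i, snd z i)) : measurable WW (wiener XM wiener)"
   by (intro measurable_Pair measurable_compose[OF measurable_fst wspace_coord] measurable_compose[OF measurable_snd wspace_coord])
  from measurable_compose[OF this splice_path_measurable[OF assms]]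
  show ?thesis by (simp add: wconcat_def measurable_cong_sets[OF refl sets_wiener])
 qed
 thus ?thesis unfolding WS_def[symmetric] by (subst (3) WS_def) (rule measurable_vec)
qed

lemma wspace_concat:
 assumes a: "!!i. 0 <= c i"
 shows "distr WW WS (wconcat c) = WS"
proof -
 interpret WW: pair_prob_space WS WS ..
 interpret V: prob_space wiener by (rule prob_space_wiener)
 interpret VV: pair_prob_space wiener wiener ..
 have "distr WW WS (wconcat c) = PiM UNIV (%_. wiener)"
 proof (rule measure_eqI_PiM_infinite)
  show "finite_measure (distr WW WS (wconcat c))" by (intro prob_space.finite_measure WW.prob_space_distr wconcat_measurable a)
  fix A J assume J: "finite J" "J \<subseteq> (UNIV :: nat set)" and A: "!!i. i : J ==> A i : sets wiener"
  let ?E = "%k. (%z. splice_path (c k) (fst z) (snd z)) -` A k Int space (wiener XM wiener)"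
  have B: "prod_emb UNIV (%_. wiener) J (Pi\<^sub>E J A) : sets WS" unfolding WS_def using J A by (intro sets_PiM_I) auto
  have cm: "(%z. splice_path (c k) (fst z) (snd z)) : measurable (wiener XM wiener) wiener" for k
   using splice_path_measurable[OF a[of k]] by (simp add: measurable_cong_sets[OF refl sets_wiener])
  have "emeasure (distr WW WS (wconcat c)) (prod_emb UNIV (%_. wiener) J (Pi\<^sub>E J A))
   = emeasure WW (wconcat c -` prod_emb UNIV (%_. wiener) J (Pi\<^sub>E J A) Int space WW)" by (rule emeasure_distr[OF wconcat_measurable[OF a] B])
  also have "wconcat c -` prod_emb UNIV (%_. wiener) J (Pi\<^sub>E J A) Int space WW
   = {z:space (PiM UNIV (%_. wiener) XM PiM UNIV (%_. wiener)). ALL k:J. (fst z k, snd z k) : ?E k}"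
   (is "?L = ?R")
  proof (rule set_eqI)
   fix z :: "(nat => real => real) \<times> (nat => real => real)"
   show "z : ?L <-> z : ?R"
   proof (cases "z : space WW")
    case True
    hence "fst z i : wiener_paths" "snd z i : wiener_paths" for i by (auto simp: space_pair_measure space_wspace)
    thus ?thesis using True by (auto simp: WS_def[symmetric] prod_emb_def wconcat_def space_pair_measure PiE_iff splice_path_in_paths[OF a])
   qed (auto simp: WS_def)
  qed
  also have "emeasure WW {z:space (PiM UNIV (%_. wiener) XM PiM UNIV (%_. wiener)). ALL k:J. (fst z k, snd z k) : ?E k}
   = (PROD k:J. emeasure (wiener XM wiener) (?E k))" unfolding WS_def by (rule emeasure_pair_PiM_box[OF prob_space_wiener prob_space_wiener _ J(1)])
    (rule measurable_sets[OF cm A])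
  also have "... = (PROD k:J. emeasure wiener (A k))"
  proof (rule prod.cong[OF refl])
   fix k assume "k : J"
   hence "A k : sets path_algebra" using A by (simp only: sets_wiener)
   thus "emeasure (wiener XM wiener) (?E k) = emeasure wiener (A k)"
    by (subst (3) wiener_concat[OF a[of k], symmetric]) (rule emeasure_distr[OF splice_path_measurable[OF a], symmetric])
  qed
  also have "... = emeasure (PiM UNIV (%_. wiener)) (prod_emb UNIV (%_. wiener) J (Pi\<^sub>E J A))"
   using J A by (intro emeasure_PiM_emb[symmetric] prob_space_wiener) auto
  finally show "emeasure (distr WW WS (wconcat c)) (prod_emb UNIV (%_. wiener) J (Pi\<^sub>E J A))
   = emeasure (PiM UNIV (%_. wiener)) (prod_emb UNIV (%_. wiener) J (Pi\<^sub>E J A))" .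
 qed (simp_all add: WS_def)
 thus ?thesis by (simp add: WS_def)
qed

lemma wspace_reindex:
 assumes "inj f"
 shows "(%w. w o f) : measurable WS WS" "distr WS WS (%w. w o f) = WS"
proof -
 have "(%w. %i. w (f i)) : measurable WS (PiM UNIV (%_. wiener))" by (intro measurable_vec wspace_coord)
 thus "(%w. w o f) : measurable WS WS" by (simp add: WS_def comp_def)
 show "distr WS WS (%w. w o f) = WS" using distr_PiM_reindex[of UNIV "%_. wiener" f UNIV] assms prob_space_wiener by (simp add: WS_def comp_def restrict_UNIV)
qed

section \<open>Exchange of increments\<close>

definition exch :: "(nat => real \<times> real) => nat => bool => real => (nat => real => real) => nat => real => real" where
 "exch z j b S w i = (\<lambda>s\<in>{0..}. exchange j b S (drive z w) i (s + snd (z i)) - fst (z i))"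

lemma drive_exch: "snd (z i) <= s ==> drive z (exch z j b S w) i s = exchange j b S (drive z w) i s" by (simp add: drive_def exch_def)

lemma exch_in_paths:
 assumes u: "u : space WS" and S: "b ==> snd (z j) <= S & snd (z (Suc j)) <= S"
 shows "exch z j b S u i : wiener_paths"
proof -
 let ?w = "drive z u"
 have c: "continuous_on {snd (z i)..} (exchange j b S ?w i)"
 proof (cases "b & (i = j | i = Suc j)")
  case False
  hence "exchange j b S ?w i = ?w i" by (auto simp: exchange_def fun_eq_iff)
  thus ?thesis using drive_cont[OF u] by simp
 next
  case True
  have SS: "snd (z i) <= S" "snd (z (swap j i)) <= S" using True S by auto
  have c1: "continuous_on {snd (z i)..S} (exchange j b S ?w i)" by (rule continuous_on_eq[OF continuous_on_subset[OF drive_cont[OF u, of z i]]]) (auto simp: exchange_def)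
  have "continuous_on {S..} (%s. ?w i S + (?w (swap j i) s - ?w (swap j i) S))"
   by (intro continuous_intros continuous_on_subset[OF drive_cont[OF u, of z "swap j i"]]) (use SS in auto)
  hence c2: "continuous_on {S..} (exchange j b S ?w i)" by (rule continuous_on_eq) (use True in \<open>auto simp: exchange_def\<close>)
  have "continuous_on ({snd (z i)..S} Un {S..}) (exchange j b S ?w i)" by (intro continuous_on_closed_Un c1 c2) auto
  moreover have "{snd (z i)..S} Un {S..} = {snd (z i)..}" using SS by auto
  ultimately show ?thesis by simp
 qed
 have "continuous_on {0..} (exchange j b S ?w i o (%s. s + snd (z i)))" by (intro continuous_on_compose continuous_intros continuous_on_subset[OF c]) auto
 hence "continuous_on {0..} (%s. exchange j b S ?w i (s + snd (z i)) - fst (z i))" by (intro continuous_intros) (simp add: comp_def)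
 hence "continuous_on {0..} (exch z j b S u i)" unfolding exch_def by (rule continuous_on_eq) simp
 moreover have "exchange j b S ?w i (snd (z i)) = fst (z i)" using S wspace_cont(2)[OF u] by (auto simp: exchange_def drive_def)
 ultimately show ?thesis by (simp add: wiener_paths_def exch_def)
qed

lemma exch_measurable:
 assumes S: "snd (z j) <= S" "snd (z (Suc j)) <= S"
 shows "exch z j True S : measurable WS WS"
proof (rule wspace_measurableI)
 show "exch z j True S w i : wiener_paths" if "w : space WS" for w i using exch_in_paths[OF that] S by simp
 fix i :: nat and s :: real assume s: "0 <= s"
 have "(%w. exchange j True S (drive z w) i (s + snd (z i))) : borel_measurable WS"
 proof -
  consider "S < s + snd (z i)" "i = j" | "S < s + snd (z i)" "i = Suc j"
   | "\<not> (S < s + snd (z i) & (i = j | i = Suc j))" by auto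
  thus ?thesis
  proof cases
   case 1
   hence "(%w. drive z w j S + (drive z w (Suc j) (s + snd (z i)) - drive z w (Suc j) S)) : borel_measurable WS"
    using S s by (intro borel_measurable_add borel_measurable_diff drive_measurable) auto
   thus ?thesis using 1 by (simp add: exchange_def)
  next
   case 2
   hence "(%w. drive z w (Suc j) S + (drive z w j (s + snd (z i)) - drive z w j S)) : borel_measurable WS"
    using S s by (intro borel_measurable_add borel_measurable_diff drive_measurable) auto
   thus ?thesis using 2 by (simp add: exchange_def)
  next
   case 3
   hence "exchange j True S (drive z w) i (s + snd (z i)) = drive z w i (s + snd (z i))" for w by (auto simp: exchange_def)
   thus ?thesis using s drive_measurable[of z i "s + snd (z i)"] by simp
  qed
 qed
 thus "(%w. exch z j True S w i s) : borel_measurable WS" using s by (simp add: exch_def)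
qed

text \<open>After every driver is split at time \<open>S\<close>, exchanging increments merely
  permutes the continuations. The age \<open>max 0 (S - snd (z i))\<close> is 0 for paths not yet
  started.\<close>

lemma exch_wconcat:
 assumes S: "snd (z j) <= S" "snd (z (Suc j)) <= S"
 shows "exch z j True S (wconcat (%i. max 0 (S - snd (z i))) (w, h)) = wconcat (%i. max 0 (S - snd (z i))) (w, h o swap j)"
proof (intro ext)
 fix i :: nat and s :: real
 consider "i = j" "S < s + snd (z i)" | "i = Suc j" "S < s + snd (z i)"
  | "i = j | i = Suc j" "s + snd (z i) <= S" | "i ~= j" "i ~= Suc j" by linarith
 thus "exch z j True S (wconcat (%i. max 0 (S - snd (z i))) (w, h)) i s = wconcat (%i. max 0 (S - snd (z i))) (w, h o swap j) i s"
  using S by cases (auto simp: exch_def exchange_def drive_def wconcat_def splice_path_def algebra_simps max_def)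
qed

text \<open>The continuations are independent and identically distributed, so permuting them
  preserves the law.\<close>

lemma exch_law:
 assumes S: "snd (z j) <= S" "snd (z (Suc j)) <= S"
 shows "distr WS WS (exch z j True S) = WS"
proof -
 let ?K = "wconcat (%i. max 0 (S - snd (z i)))"
 let ?\<pi> = "%z. (fst z, snd z o swap j)"
 have inj: "inj (swap j)" by (rule inj_on_inverseI[of _ "swap j"]) simp
 note sw = wspace_reindex[OF inj]
 have K: "?K : measurable WW WS" by (intro wconcat_measurable) simp
 have \<pi>: "?\<pi> : measurable WW WW" by (intro measurable_Pair measurable_fst measurable_compose[OF measurable_snd sw(1)])
 have "distr WW WW (%(x, y). (x, y o swap j))
  = distr WS WS (%x. x) XM distr WS WS (%w. w o swap j)" by (rule pair_measure_distr[symmetric, OF measurable_ident_sets[OF refl] sw(1)])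
   (simp add: sw(2) W.sigma_finite_measure_axioms)
 hence \<pi>': "distr WW WW ?\<pi> = WW" by (simp add: sw(2) distr_id case_prod_beta')
 have "distr WS WS (exch z j True S) = distr (distr WW WS ?K) WS (exch z j True S)" by (simp add: wspace_concat)
 also have "... = distr WW WS (exch z j True S o ?K)" by (rule distr_distr[OF exch_measurable[OF S] K])
 also have "exch z j True S o ?K = ?K o ?\<pi>" using exch_wconcat[where z=z and j=j and S=S, OF S] by (auto simp: fun_eq_iff)
 also have "distr WW WS (?K o ?\<pi>) = distr (distr WW WW ?\<pi>) WS ?K" by (rule distr_distr[OF K \<pi>, symmetric])
 also have "... = WS" unfolding \<pi>' by (simp add: wspace_concat)
 finally show ?thesis .
qed

section \<open>Exchange at the first meeting\<close>

text \<open>Measure preserving maps may be chosen at random if the choice can be read off the image: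
  each event \<open>N = k\<close> is its own preimage under \<open>C k\<close>, so the pieces
  reassemble to the whole.\<close>

lemma distr_countable_choice:
 fixes N :: "'a => nat"
 assumes N: "N : measurable M (count_space UNIV)" and C: "!!k. C k : measurable M M" "!!k. distr M M (C k) = M"
  and inv: "!!k x. x : space M ==> N (C k x) = k <-> N x = k"
 shows "(%x. C (N x) x) : measurable M M" "distr M M (%x. C (N x) x) = M"
proof -
 show m: "(%x. C (N x) x) : measurable M M" by (rule measurable_compose_countable[OF C(1) N])
 show "distr M M (%x. C (N x) x) = M"
 proof (rule measure_eqI)
  fix A assume "A : sets (distr M M (%x. C (N x) x))"
  hence A: "A : sets M" by simp
  have E: "N -` {k} Int space M : sets M" for k using measurable_sets[OF N, of "{k}"] by simp
  have sum: "emeasure M B = (\<Sum>k. emeasure M (B Int (N -` {k} Int space M)))" if B: "B : sets M" for B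
  proof -
   have "(\<Sum>k. emeasure M (B Int (N -` {k} Int space M))) = emeasure M (\<Union>k. B Int (N -` {k} Int space M))"
    using B E by (intro suminf_emeasure) (auto simp: disjoint_family_on_def)
   also have "(\<Union>k. B Int (N -` {k} Int space M)) = B" using sets.sets_into_space[OF B] by auto
   finally show ?thesis ..
  qed
  have "emeasure (distr M M (%x. C (N x) x)) A = emeasure M ((%x. C (N x) x) -` A Int space M)" by (rule emeasure_distr[OF m A])
  also have "... = (\<Sum>k. emeasure M ((%x. C (N x) x) -` A Int space M Int (N -` {k} Int space M)))" by (rule sum[OF measurable_sets[OF m A]])
  also have "... = (\<Sum>k. emeasure M (A Int (N -` {k} Int space M)))"
  proof (rule suminf_cong)
   fix k
   have "(%x. C (N x) x) -` A Int space M Int (N -` {k} Int space M) = C k -` (A Int (N -` {k} Int space M)) Int space M"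
    using inv measurable_space[OF C(1)[of k]] by auto
   thus "emeasure M ((%x. C (N x) x) -` A Int space M Int (N -` {k} Int space M)) = emeasure M (A Int (N -` {k} Int space M))"
    using emeasure_distr[OF C(1)[of k], of "A Int (N -` {k} Int space M)"] A E[of k] by (simp add: C(2))
  qed
  also have "... = emeasure M A" by (rule sum[OF A, symmetric])
  finally show "emeasure (distr M M (%x. C (N x) x)) A = emeasure M A" .
 qed simp
qed

text \<open>Dominated convergence for products of continuous test functions of finitely many
  coordinates, which determine a law on \<open>WS\<close>.\<close>

lemma wspace_limit_law:
 assumes R: "!!m. R m : measurable WS WS" "!!m. distr WS WS (R m) = WS" and lim: "!!u i s. u : space WS ==> 0 <= s ==> (%m. R m u i s) ----> Q u i s"
  and Q: "!!u i. u : space WS ==> Q u i : wiener_paths"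
 shows "Q : measurable WS WS" "distr WS WS Q = WS"
proof -
 have Rm: "(%u. R m u i s) : borel_measurable WS" if "0 <= s" for m i s by (rule measurable_compose[OF R(1) wspace_eval[OF that]])
 have Qm: "(%u. Q u i s) : borel_measurable WS" if "0 <= s" for i s by (rule borel_measurable_LIMSEQ_real[OF lim[OF _ that] Rm[OF that]])
 show m: "Q : measurable WS WS" by (rule wspace_measurableI[OF Qm Q])
 show "distr WS WS Q = WS"
 proof (rule wspace_eqI)
  fix J :: "(nat \<times> real) set" and A :: "nat \<times> real => real set"
  assume J: "finite J" "J \<subseteq> UNIV \<times> {0..}" and A: "!!k. A k : sets borel"
  have pos: "0 <= snd k" if "k : J" for k using J(2) that by auto
  let ?B = "{u:space WS. ALL k:J. u (fst k) (snd k) : A k}"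
  have B: "?B : sets WS"
  proof (rule sets.sets_Collect_finite_All[OF _ J(1)])
   fix k assume "k : J"
   hence "(%u. u (fst k) (snd k)) -` A k Int space WS : sets WS" by (intro measurable_sets[OF wspace_eval[OF pos] A])
   thus "{u:space WS. u (fst k) (snd k) : A k} : sets WS" by (simp only: vimage_def Int_def mem_Collect_eq conj_commute)
  qed
  have "measure (distr WS WS Q) {u:space (distr WS WS Q). ALL k:J. u (fst k) (snd k) : A k}
   = measure WS (Q -` ?B Int space WS)" unfolding space_distr by (rule measure_distr[OF m B])
  also have "Q -` ?B Int space WS = {u:space WS. ALL k:J. Q u (fst k) (snd k) : A k}" using measurable_space[OF m] by blast
  also have "measure WS {u:space WS. ALL k:J. Q u (fst k) (snd k) : A k} = measure WS ?B"
  proof (rule law_eq_cont[where X="%k u. Q u (fst k) (snd k)" and Y="%k u. u (fst k) (snd k)", OF J(1) prob_space_wspace prob_space_wspace Qm[OF pos] wspace_eval[OF pos] _ A])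
   fix f :: "nat \<times> real => real => real"
   assume f: "!!i. continuous_on UNIV (f i)" "!!i x. 0 <= f i x & f i x <= 1"
   have fm: "f i : borel_measurable borel" for i by (rule borel_measurable_continuous_onI[OF f(1)])
   let ?I = "%X. \<integral>u. (PROD k:J. f k (X u (fst k) (snd k))) \<partial>WS"
   have "(%m. ?I (R m)) ----> ?I Q"
   proof (rule integral_dominated_convergence[where w="%_. 1"])
    show "AE u in WS. (%m. PROD k:J. f k (R m u (fst k) (snd k))) ----> (PROD k:J. f k (Q u (fst k) (snd k)))"
     by (intro AE_I2 tendsto_prod continuous_on_tendsto_compose[OF f(1)] lim pos) auto
    show "AE u in WS. norm (PROD k:J. f k (R m u (fst k) (snd k))) <= 1" for m using f(2) by (intro AE_I2) (simp add: abs_prod prod_le_1)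
    show "(%u. PROD k:J. f k (Q u (fst k) (snd k))) : borel_measurable WS" by (intro borel_measurable_prod measurable_compose[OF _ fm] Qm pos)
    show "(%u. PROD k:J. f k (R m u (fst k) (snd k))) : borel_measurable WS" for m by (intro borel_measurable_prod measurable_compose[OF _ fm] Rm pos)
   qed simp
   moreover have "?I (R m) = ?I (%u. u)" for m
   proof -
    have "?I (R m) = (\<integral>u. (PROD k:J. f k (u (fst k) (snd k))) \<partial>distr WS WS (R m))"
     by (intro integral_distr[symmetric] R borel_measurable_prod measurable_compose[OF _ fm] wspace_eval pos)
    thus ?thesis by (simp only: R(2))
   qed
   ultimately show "?I Q = ?I (%u. u)" by (simp add: LIMSEQ_const_iff)
  qed
  finally show "measure (distr WS WS Q) {u:space (distr WS WS Q). ALL k:J. u (fst k) (snd k) : A k}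
   = measure WS ?B" .
 qed (auto intro: W.prob_space_distr m prob_space_wspace)
qed

definition met :: "(nat => real \<times> real) => nat => (nat => real => real) => real => bool" where
 "met z j w s <-> snd (z j) <= s & snd (z (Suc j)) <= s & cpath z w j s = cpath z w (Suc j) s"

definition meet :: "(nat => real \<times> real) => nat => (nat => real => real) => real" where "meet z j w = Inf {s. met z j w s}"

lemma met_mono:
 assumes "w : space WS" "met z j w s" "s <= s'"
 shows "met z j w s'" using mergingD[OF coalD(2)[OF coal_cpath[OF assms(1)]], of j "Suc (Suc j)" "Suc j" z s s'] assms(2,3) by (auto simp: met_def)

lemma meet:
 assumes w: "w : space WS" and ex: "met z j w s"
 shows "met z j w (meet z j w)" "meet z j w <= s"
proof -
 let ?a = "max (snd (z j)) (snd (z (Suc j)))"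
 have "continuous_on {?a..} (%s. cpath z w j s - cpath z w (Suc j) s)" by (intro continuous_intros continuous_on_subset[OF cpath_cont[OF w]]) auto
 from continuous_closed_preimage_constant[OF this, of 0]
 have "closed {s:{?a..}. cpath z w j s - cpath z w (Suc j) s = 0}" by simp
 moreover have "{s:{?a..}. cpath z w j s - cpath z w (Suc j) s = 0} = {s. met z j w s}" by (auto simp: met_def)
 ultimately have cl: "closed {s. met z j w s}" by simp
 have bd: "bdd_below {s. met z j w s}" by (rule bdd_belowI[of _ "snd (z j)"]) (simp add: met_def)
 show "met z j w (meet z j w)" using closed_contains_Inf[OF _ bd cl] ex by (auto simp: meet_def)
 show "meet z j w <= s" using ex by (auto simp: meet_def intro: cInf_lower[OF _ bd])
qed

lemma met_measurable: "Measurable.pred WS (%w. met z j w s)"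
proof (cases "snd (z j) <= s & snd (z (Suc j)) <= s")
 case True
 hence "Measurable.pred WS (%w. cpath z w j s = cpath z w (Suc j) s)" unfolding pred_def by (intro borel_measurable_eq cpath_measurable) auto
 thus ?thesis using True by (simp add: met_def)
next
 case False
 hence "(%w. met z j w s) = (%_. False)" by (auto simp: met_def)
 thus ?thesis by simp
qed

text \<open>Meetings up to \<open>S\<close> are determined by the drivers up to \<open>S\<close>,
  which the exchange leaves untouched. This is the invariance required of the random choice.\<close>

lemma met_exch:
 assumes w: "w : space WS" and S: "snd (z j) <= S" "snd (z (Suc j)) <= S" and s: "s <= S"
 shows "met z j (exch z j True S w) s <-> met z j w s"
proof -
 let ?w = "exch z j True S w"
 have w': "?w : space WS" using exch_in_paths[OF w] S by (simp add: space_wspace)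
 have "cpath z ?w i s = cpath z w i s" if "snd (z i) <= s" "i < Suc (Suc j)" for i
 proof (rule coal_unique_until[where t="%i. snd (z i)" and n="Suc (Suc j)", OF drive_cont[OF w'] drive_cont[OF w] coal_cpath[OF w'] coal_cpath[OF w] _ that(2,1) s])
  show "drive z ?w i r = drive z w i r" if "i < Suc (Suc j)" "snd (z i) <= r" "r <= S" for i r using that by (simp add: drive_exch exchange_def)
 qed
 thus ?thesis by (auto simp: met_def)
qed

definition resample :: "(nat => real \<times> real) => nat => (nat => real => real) => nat => real => real" where
 "resample z j w = exch z j (EX s. met z j w s) (meet z j w) w"

text \<open>The meeting time is rounded up to the grid \<open>T + k / 2 ^ m\<close>. Value 0 of
  \<open>N\<close> codes that no meeting occurs and selects the identity; value \<open>Suc k\<close>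
  codes the grid time number \<open>k\<close> and selects the exchange there.\<close>

lemma resample_approx: "EX R :: nat => (nat => real => real) => nat => real => real.
  (ALL m. R m : measurable WS WS) & (ALL m. distr WS WS (R m) = WS) &
  (ALL w:space WS. ALL i. ALL s>=0. (%m. R m w i s) ----> resample z j w i s)"
proof -
 define T where "T = max (snd (z j)) (snd (z (Suc j)))"
 define hit where "hit m w k <-> met z j w (T + real k / 2 ^ m)" for m k :: nat and w
 define C where "C m k = (case k of 0 => (%w. w) | Suc k => exch z j True (T + real k / 2 ^ m))" for m k :: nat
 define N where "N m w = (if EX k. hit m w k then Suc (LEAST k. hit m w k) else 0)" for m :: nat and w
 have T: "snd (z j) <= T" "snd (z (Suc j)) <= T" by (auto simp: T_def)
 have u: "snd (z j) <= T + real k / 2 ^ m" "snd (z (Suc j)) <= T + real k / 2 ^ m" for k m using T by (auto intro: add_increasing2)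
 have hit_meas: "Measurable.pred WS (%w. hit m w k)" for m k unfolding hit_def by (rule met_measurable)
 have N_meas: "N m : measurable WS (count_space UNIV)" for m unfolding N_def
  by (rule measurable_If) (use hit_meas in \<open>auto intro!: measurable_compose[OF measurable_Least] pred_intros_countable\<close>)
 have N0: "N m w = 0 <-> (ALL k. \<not> hit m w k)" for m w by (auto simp: N_def)
 have NS: "N m w = Suc k <-> hit m w k & (ALL k'<k. \<not> hit m w k')" for m w k
 proof
  assume k: "N m w = Suc k"
  hence ex: "EX k. hit m w k" using N0[of m w] by auto
  hence L: "(LEAST k. hit m w k) = k" using k by (simp add: N_def)
  show "hit m w k & (ALL k'<k. \<not> hit m w k')" using LeastI_ex[OF ex] not_less_Least[of _ "hit m w"] unfolding L by blast
 next
  assume k: "hit m w k & (ALL k'<k. \<not> hit m w k')"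
  hence "(LEAST k. hit m w k) = k" by (intro Least_equality) (auto simp: not_less[symmetric])
  thus "N m w = Suc k" using k by (auto simp: N_def)
 qed
 have C1: "C m k : measurable WS WS" for m k unfolding C_def by (cases k) (auto intro: exch_measurable u)
 have C2: "distr WS WS (C m k) = WS" for m k unfolding C_def by (cases k) (auto intro: exch_law u simp: distr_id)
 have inv: "N m (C m k w) = k <-> N m w = k" if w: "w : space WS" for m k w
 proof (cases k)
  case (Suc l)
  have "hit m (C m k w) l' = hit m w l'" if "l' <= l" for l' unfolding hit_def C_def Suc using met_exch[OF w u, of "T + real l' / 2 ^ m" l m] that
   by (simp add: divide_right_mono)
  thus ?thesis unfolding Suc NS by simp
 qed (simp add: C_def)
 have R: "(%w. C m (N m w) w) : measurable WS WS" "distr WS WS (%w. C m (N m w) w) = WS" for m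
  using distr_countable_choice[where M=WS and N="N m" and C="C m", OF N_meas C1 C2 inv] by blast+
 have lim: "(%m. C m (N m w) w i s) ----> resample z j w i s"
  if w: "w : space WS" and s: "0 <= s" for w i and s :: real
 proof -
  show "(%m. C m (N m w) w i s) ----> resample z j w i s"
 proof (cases "EX s. met z j w s")
  case False
  hence "N m w = 0" for m by (simp add: N0 hit_def)
  moreover have "resample z j w i s = w i s" using False s by (simp add: resample_def exch_def exchange_def drive_def)
  ultimately show ?thesis by (simp add: C_def)
 next
  case True
  then obtain s0 where s0: "met z j w s0" by blast
  define S where "S = meet z j w"
  have S: "met z j w S" "!!s. met z j w s ==> S <= s" using meet[OF w] s0 unfolding S_def by auto
  have ST: "T <= S" using S(1) by (simp add: met_def T_def)
  define v where "v m = T + real (N m w - 1) / 2 ^ m" for m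
  \<comment> \<open>Meetings persist, so the first grid time at which the paths have met is at most
    one step late.\<close>
  have v: "S <= v m & v m <= S + 1 / 2 ^ m & C m (N m w) = exch z j True (v m)" for m
  proof -
   obtain k0 :: nat where k0: "(S - T) * 2 ^ m <= real k0" using real_arch_simple by blast
   hence "S <= T + real k0 / 2 ^ m" by (simp add: field_simps)
   hence "hit m w k0" unfolding hit_def by (rule met_mono[OF w S(1)])
   hence "N m w ~= 0" by (auto simp: N0)
   then obtain k where k: "N m w = Suc k" by (cases "N m w") auto
   hence h: "hit m w k" "!!k'. k' < k ==> \<not> hit m w k'" unfolding NS by auto
   have vk: "v m = T + real k / 2 ^ m" by (simp add: v_def k)
   have "S <= v m" unfolding vk using h(1) S(2) by (simp add: hit_def)
   moreover have "v m <= S + 1 / 2 ^ m"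
   proof (cases k)
    case 0 thus ?thesis using ST by (simp add: vk add_increasing2)
   next
    case (Suc l)
    hence "\<not> met z j w (T + real l / 2 ^ m)" using h(2)[of l] by (simp add: hit_def)
    hence "T + real l / 2 ^ m < S" using met_mono[OF w S(1)] by (meson not_le)
    thus ?thesis by (simp add: vk Suc add_divide_distrib)
   qed
   moreover have "C m (N m w) = exch z j True (v m)" by (simp add: C_def k vk)
   ultimately show ?thesis by blast
  qed
  have vS: "v ----> S"
  proof (rule tendsto_sandwich[of "%_. S" _ _ "%m. S + 1 / 2 ^ m"])
   have "(%m. S + (1 / 2) ^ m) ----> S + 0" by (intro tendsto_add tendsto_const LIMSEQ_power_zero) simp
   thus "(%m. S + 1 / 2 ^ m) ----> S" by (simp add: power_divide)
  qed (use v in auto)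
  have wv: "(%m. drive z w l (v m)) ----> drive z w l S" if "l = j | l = Suc j" for l
  proof (rule continuous_on_tendsto_compose[OF drive_cont[OF w, of z l] vS])
   show "S : {snd (z l)..}" using that ST T by auto
   have "v m : {snd (z l)..}" for m using that ST T v[of m] by auto
   thus "\<forall>\<^sub>F m in sequentially. v m : {snd (z l)..}" by simp
  qed
  let ?r = "s + snd (z i)"
  have "(%m. exchange j True (v m) (drive z w) i ?r) ----> exchange j True S (drive z w) i ?r"
  proof (cases "S < ?r & (i = j | i = Suc j)")
   case False
   hence "exchange j True (v m) (drive z w) i ?r = drive z w i ?r" for m using v[of m] by (auto simp: exchange_def)
   moreover have "exchange j True S (drive z w) i ?r = drive z w i ?r" using False by (auto simp: exchange_def)
   ultimately show ?thesis by simp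
  next
   case T: True
   have ev: "\<forall>\<^sub>F m in sequentially. v m < ?r" by (rule order_tendstoD(2)[OF vS]) (use T in simp)
   have "(%m. drive z w i (v m) + (drive z w (swap j i) ?r - drive z w (swap j i) (v m)))
    ----> drive z w i S + (drive z w (swap j i) ?r - drive z w (swap j i) S)" by (intro tendsto_intros wv) (use T in auto)
   also have "drive z w i S + (drive z w (swap j i) ?r - drive z w (swap j i) S) = exchange j True S (drive z w) i ?r" using T by (auto simp: exchange_def)
   finally show ?thesis by (rule Lim_transform_eventually) (use ev T in \<open>auto elim!: eventually_mono simp: exchange_def\<close>)
  qed
  hence "(%m. exch z j True (v m) w i s) ----> exch z j True S w i s" using s unfolding exch_def by (simp add: tendsto_diff)
  thus ?thesis using True v by (simp add: resample_def S_def)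
 qed
qed
 show ?thesis by (rule exI[of _ "%m w. C m (N m w) w"]) (use R lim in simp)
qed

lemma resample_law: "resample z j : measurable WS WS" "distr WS WS (resample z j) = WS"
proof -
 have p: "resample z j w i : wiener_paths" if "w : space WS" for w i unfolding resample_def using meet(1)[OF that] by (intro exch_in_paths[OF that]) (auto simp: met_def)
 obtain R :: "nat => (nat => real => real) => nat => real => real"
  where R: "!!m. R m : measurable WS WS" "!!m. distr WS WS (R m) = WS" and lim: "!!w i s. w : space WS ==> 0 <= s ==> (%m. R m w i s) ----> resample z j w i s"
  using resample_approx[of z j] by blast
 show "resample z j : measurable WS WS" "distr WS WS (resample z j) = WS" using wspace_limit_law[where R=R and Q="resample z j", OF R lim p] by blast+
qed

text \<open>Uniqueness of coalescing families identifies the exchanged family of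
  \<open>coal_exchange\<close> with the one built from the swapped starting points.\<close>

lemma resample_cpath:
 assumes w: "w : space WS" and s: "snd (z i) <= s"
 shows "cpath (z o swap j) (resample z j w o swap j) (swap j i) s = cpath z w i s"
proof -
 define n where "n = Suc (Suc (max i (Suc j)))"
 have n: "i < n" "Suc j < n" by (auto simp: n_def)
 let ?b = "EX s. met z j w s" and ?S = "meet z j w"
 have fm: "is_first_meeting (%i. snd (z i)) (cpath z w) j ?b ?S" unfolding is_first_meeting_def
 proof (intro conjI allI impI)
  assume ?b
  thus "snd (z j) <= ?S" "snd (z (Suc j)) <= ?S" "cpath z w j ?S = cpath z w (Suc j) ?S" using meet(1)[OF w] by (auto simp: met_def)
 next
  fix s assume "snd (z j) <= s" "snd (z (Suc j)) <= s" "cpath z w j s = cpath z w (Suc j) s"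
  hence "met z j w s" by (simp add: met_def)
  thus ?b "?S <= s" using meet(2)[OF w] by auto
 qed
 have "coal ((%i. snd (z i)) o swap j) (exchange j ?b ?S (drive z w) o swap j) (cpath z w o swap j) n"
  by (rule coal_exchange[OF drive_cont[OF w] coal_cpath[OF w] n(2) fm])
 hence c: "coal (%i. snd ((z o swap j) i)) (drive (z o swap j) (resample z j w o swap j)) (cpath z w o swap j) n" unfolding comp_def
 proof (rule coal_cong)
  fix i s assume "snd (z (swap j i)) <= s"
  from drive_exch[of z "swap j i", OF this, of j ?b ?S w]
  show "drive (%x. z (swap j x)) (%x. resample z j w (swap j x)) i s = exchange j ?b ?S (drive z w) (swap j i) s" by (simp add: drive_def resample_def)
 qed simp
 have "resample z j w : space WS" using measurable_space[OF resample_law(1) w] .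
 hence w': "resample z j w o swap j : space WS" by (simp add: space_wspace)
 have "(cpath z w o swap j) (swap j i) s = cpath (z o swap j) (resample z j w o swap j) (swap j i) s"
  by (rule cpath_unique[OF w' c]) (use n s in \<open>auto simp: swap_def\<close>)
 thus ?thesis by simp
qed

text \<open>Resampling and relabelling both preserve \<open>WS\<close>, so building the paths in the
  other order changes nothing but their labels.\<close>

lemma bpath_swap_law: "distr WS paths (%w. bpath z w o swap j) = skel_law (z o swap j)"
proof -
 have inj: "inj (swap j)" by (rule inj_on_inverseI[of _ "swap j"]) simp
 note sw = wspace_reindex[OF inj]
 have "skel_law (z o swap j) = distr (distr (distr WS WS (resample z j)) WS (%w. w o swap j)) paths (bpath (z o swap j))" by (simp only: skel_law_def resample_law sw)
 also have "... = distr WS paths (bpath (z o swap j) o ((%w. w o swap j) o resample z j))"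
  by (simp only: distr_distr[OF sw(1) resample_law(1)] distr_distr[OF bpaths_measurable measurable_comp[OF resample_law(1) sw(1)]])
 also have "... = distr WS paths (%w. bpath z w o swap j)"
 proof (rule distr_cong[OF refl refl], rule ext)
  fix w i assume w: "w : space WS"
  have "resample z j w : space WS" using measurable_space[OF resample_law(1) w] .
  hence w': "resample z j w o swap j : space WS" by (simp add: space_wspace)
  have "bpath (z o swap j) (resample z j w o swap j) i = bpath z w (swap j i)" by (rule bpath_eqI[OF w' w]) (use resample_cpath[OF w, of z "swap j i" _ j] in simp_all)
  thus "(bpath (z o swap j) o ((%w. w o swap j) o resample z j)) w i = (bpath z w o swap j) i" by simp
 qed
 finally show ?thesis ..
qed

section \<open>Subfamilies of coalescing Brownian motions\<close>

lemma paths_coord [measurable]: "(%x. x i) : borel_measurable paths" unfolding paths_def by (rule measurable_component_singleton) simp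

lemma space_paths_algebra [simp]: "space paths = UNIV" by (simp add: paths_def space_PiM PiE_UNIV_domain)

lemma prob_space_skel_law: "prob_space (skel_law z)" unfolding skel_law_def by (intro prob_space.prob_space_distr prob_space_wspace bpaths_measurable)

lemma sets_skel_law [simp, measurable_cong]: "sets (skel_law z) = sets paths" by (simp add: skel_law_def)

lemma space_skel_law [simp]: "space (skel_law z) = UNIV" by (simp add: skel_law_def)

lemma paths_law_eqI:
 fixes P Q :: "(nat => bw_path) measure"
 assumes P: "prob_space P" "sets P = sets paths" and Q: "prob_space Q" "sets Q = sets paths"
  and eq: "!!n A. (!!i. A i : sets borel) ==> emeasure P {x. ALL i<n. x i : A i} = emeasure Q {x. ALL i<n. x i : A i}"
 shows "P = Q"
proof (rule measure_eqI_PiM_infinite)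
 show "finite_measure P" using P(1) by (rule prob_space.finite_measure)
 show "sets P = sets (PB UNIV)" "sets Q = sets (PB UNIV)" using P Q by (simp_all add: paths_def)
 fix A and J :: "nat set" assume J: "finite J" and A: "!!i. i : J ==> A i : sets (borel :: bw_path measure)"
 obtain n where n: "J \<subseteq> {..<n}" using finite_nat_iff_bounded[THEN iffD1, OF J] by blast
 define A' where "A' i = (if i : J then A i else UNIV)" for i
 have "prod_emb UNIV (%_. borel) J (Pi\<^sub>E J A) = {x. ALL i<n. x i : A' i}" using n by (auto simp: prod_emb_def A'_def PiE_iff space_PiM subset_eq)
 thus "emeasure P (prod_emb UNIV (%_. borel) J (Pi\<^sub>E J A)) = emeasure Q (prod_emb UNIV (%_. borel) J (Pi\<^sub>E J A))" using eq[of A' n] A by (simp add: A'_def)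
qed

lemma prefix_event:
 assumes "!!i. A i : sets borel"
 shows "{x. ALL i<n. x i : A i} : sets paths"
proof -
 have "{x:space paths. ALL i:{..<n}. x i : A i} : sets paths"
 proof (rule sets.sets_Collect_finite_All)
  fix i
  have "(%x. x i) -` A i Int space paths : sets paths" by (rule measurable_sets[OF paths_coord assms])
  thus "{x:space paths. x i : A i} : sets paths" by (simp add: vimage_def)
 qed simp
 thus ?thesis by (simp add: Ball_def)
qed

lemma paths_reindex: "(%x. x o f) : measurable paths paths" unfolding comp_def by (subst (2) paths_def) (intro measurable_vec paths_coord)

text \<open>Composition with \<open>cyc m\<close> moves entry 0 behind the entries 1 to
  \<open>m\<close>; it is a product of adjacent transpositions.\<close>

definition cyc :: "nat => nat => nat" where "cyc m i = (if i < m then Suc i else if i = m then 0 else i)"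

lemma cyc_Suc: "cyc (Suc m) = cyc m o swap m" by (auto simp: cyc_def swap_def fun_eq_iff)

lemma bpath_cyc_law: "distr WS paths (%w. bpath z w o cyc m) = skel_law (z o cyc m)"
proof (induction m)
 case 0
 have "cyc 0 = id" by (auto simp: cyc_def)
 thus ?case by (simp add: skel_law_def)
next
 case (Suc m)
 have m: "(%w. bpath z w o f) : measurable WS paths" for z f using measurable_comp[OF bpaths_measurable paths_reindex] by (simp add: comp_def)
 have *: "distr (distr WS paths (%w. bpath z w o f)) paths (%x. x o swap m)
  = distr WS paths (%w. bpath z w o f o swap m)" for z f by (subst distr_distr[OF paths_reindex m]) (simp add: comp_def)
 have "distr WS paths (%w. bpath z w o cyc (Suc m)) = distr (skel_law (z o cyc m)) paths (%x. x o swap m)" unfolding Suc.IH[symmetric] * cyc_Suc comp_assoc ..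
 also have "... = distr WS paths (%w. bpath (z o cyc m) w o swap m)" using *[of "z o cyc m" id] by (simp add: skel_law_def)
 also have "... = skel_law (z o cyc (Suc m))" unfolding bpath_swap_law cyc_Suc comp_assoc ..
 finally show ?case .
qed

text \<open>For an event about \<open>n\<close> remaining paths the first starting point is moved
  behind them by \<open>cyc n\<close>, where it no longer influences them.\<close>

lemma skel_law_tail: "distr (skel_law z) paths (%x. x o Suc) = skel_law (z o Suc)"
proof (rule paths_law_eqI)
 interpret S: prob_space "skel_law z" by (rule prob_space_skel_law)
 show "prob_space (distr (skel_law z) paths (%x. x o Suc))" by (intro S.prob_space_distr) (simp only: measurable_cong_sets[OF sets_skel_law refl] paths_reindex)
 fix n and A :: "nat => bw_path set" assume A: "!!i. A i : sets borel"
 note B = prefix_event[of A n, OF A]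
 have m: "(%w. bpath z w o f) : measurable WS paths" for z f using measurable_comp[OF bpaths_measurable paths_reindex] by (simp add: comp_def)
 have d: "emeasure (distr WS paths (%w. bpath z w o f)) {x. ALL i<n. x i : A i}
  = emeasure WS {w:space WS. ALL i<n. bpath z w (f i) : A i}" for z f unfolding emeasure_distr[OF m B] by (rule arg_cong[where f="emeasure WS"]) auto
 have "emeasure (distr (skel_law z) paths (%x. x o Suc)) {x. ALL i<n. x i : A i}
  = emeasure (distr WS paths (%w. bpath z w o Suc)) {x. ALL i<n. x i : A i}"
  unfolding skel_law_def by (subst distr_distr[OF paths_reindex bpaths_measurable]) (simp add: comp_def)
 also have "... = emeasure WS {w:space WS. ALL i<n. bpath z w (cyc n i) : A i}" unfolding d by (rule arg_cong[where f="emeasure WS"]) (auto simp: cyc_def)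
 also have "... = emeasure (skel_law (z o cyc n)) {x. ALL i<n. x i : A i}" by (simp only: d[symmetric] bpath_cyc_law)
 also have "... = emeasure WS {w:space WS. ALL i<n. bpath (z o cyc n) w i : A i}" using d[of "z o cyc n" id] by (simp add: skel_law_def)
 also have "... = emeasure WS {w:space WS. ALL i<n. bpath (z o Suc) w i : A i}"
 proof (rule arg_cong[where f="emeasure WS"], rule Collect_cong, rule conj_cong[OF refl])
  fix w assume w: "w : space WS"
  have "bpath (z o cyc n) w i = bpath (z o Suc) w i" if "i < n" for i by (rule bpath_prefix[OF w w _ _ that]) (simp_all add: cyc_def)
  thus "(ALL i<n. bpath (z o cyc n) w i : A i) = (ALL i<n. bpath (z o Suc) w i : A i)" by auto
 qed
 also have "... = emeasure (skel_law (z o Suc)) {x. ALL i<n. x i : A i}" using d[of "z o Suc" id] by (simp add: skel_law_def)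
 finally show "emeasure (distr (skel_law z) paths (%x. x o Suc)) {x. ALL i<n. x i : A i}
  = emeasure (skel_law (z o Suc)) {x. ALL i<n. x i : A i}" .
qed (simp_all add: prob_space_skel_law)

lemma skel_law_drop: "distr (skel_law z) paths (%x i. x (n + i)) = skel_law (%i. z (n + i))"
proof (induction n)
 case 0
 thus ?case by (simp add: distr_id2)
next
 case (Suc n)
 have "distr (skel_law z) paths (%x i. x (Suc n + i)) = distr (distr (skel_law z) paths (%x i. x (n + i))) paths (%x. x o Suc)"
 proof (subst distr_distr[OF paths_reindex])
  show "(%x i. x (n + i)) : measurable (skel_law z) paths" using paths_reindex[of "(+) n"] by (simp add: comp_def)
 qed (simp add: comp_def)
 thus ?case using skel_law_tail[of "%i. z (n + i)"] by (simp add: Suc.IH comp_def)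
qed

section \<open>Coalescing Brownian motions on arbitrary spaces\<close>

lemma standard_BM_law:
 assumes B: "standard_BM N B"
 shows "(%w. \<lambda>s\<in>{0..}. B s w) : measurable N path_algebra" "distr N path_algebra (%w. \<lambda>s\<in>{0..}. B s w) = wiener"
proof -
 from B have N: "prob_space N" and Bm: "!!s. 0 <= s ==> B s : borel_measurable N" and Bc: "!!w. w : space N ==> B 0 w = 0 & continuous_on {0..} (%s. B s w)"
  and Bd: "!!r s. 0 <= r ==> r < s ==> distributed N lborel (%w. B s w - B r w) (normal_density 0 (sqrt (s - r)))"
  and Bi: "!!u m. 0 <= u 0 ==> mono u ==> prob_space.indep_vars N (%_. borel) (%i w. B (u (Suc i)) w - B (u i) w) {..<m :: nat}" unfolding standard_BM_def by blast+
 interpret N: prob_space N by (rule N)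
 have paths: "(\<lambda>s\<in>{0..}. B s w) : wiener_paths" if "w : space N" for w
 proof -
  have "continuous_on {0..} (\<lambda>s\<in>{0..}. B s w)" by (rule continuous_on_eq[of _ "%s. B s w"]) (use Bc[OF that] in auto)
  thus ?thesis using Bc[OF that] by (simp add: wiener_paths_def)
 qed
 show "(%w. \<lambda>s\<in>{0..}. B s w) : measurable N path_algebra" by (rule measurable_path_algebraI) (use Bm paths in auto)
 show "distr N path_algebra (%w. \<lambda>s\<in>{0..}. B s w) = wiener"
 proof (rule wiener_unique[OF N Bm paths])
  fix J :: "real set" assume "finite J" "J \<subseteq> {0..}"
  then obtain u :: "nat => real" and m where u: "u 0 = 0" "mono u" "J \<subseteq> u ` {..m}" "!!i. 0 <= u i" using time_grid by metis
  have "inc_law N B u m" unfolding inc_law_def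
  proof (intro allI impI)
   fix A :: "nat => real set" assume A: "ALL i. A i : sets borel"
   let ?D = "%i w. B (u (Suc i)) w - B (u i) w"
   show "measure N {w:space N. ALL i<m. ?D i w : A i} = (PROD i<m. measure (gauss (u (Suc i) - u i)) (A i))"
   proof (cases "m = 0")
    case True thus ?thesis by (simp add: N.prob_space)
   next
    case False
    have "{w:space N. ALL i<m. ?D i w : A i} = (\<Inter>i\<in>{..<m}. ?D i -` A i Int space N)" using False by auto
    also have "measure N ... = (PROD i<m. measure N (?D i -` A i Int space N))" by (rule N.indep_varsD_finite[OF Bi]) (use u A False in auto)
    also have "... = (PROD i<m. measure (gauss (u (Suc i) - u i)) (A i))"
    proof (rule prod.cong[OF refl])
     fix i
     have Dm: "?D i : borel_measurable N" using Bm u(4) by (intro borel_measurable_diff) auto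
     have "distr N borel (?D i) = gauss (u (Suc i) - u i)"
     proof (cases "u i < u (Suc i)")
      case True
      from Bd[OF u(4) True] show ?thesis using distributed_gauss_iff[of "u (Suc i) - u i" N "?D i"] True by (simp only: diff_gt_0_iff_gt)
     next
      case False
      hence "u (Suc i) = u i" using monoD[OF u(2), of i "Suc i"] by simp
      thus ?thesis by (simp add: gauss_0 N.distr_const)
     qed
     thus "measure N (?D i -` A i Int space N) = measure (gauss (u (Suc i) - u i)) (A i)" using measure_distr[OF Dm, of "A i"] A by simp
    qed
    finally show ?thesis .
   qed
  qed
  thus "EX u m. u 0 = 0 & mono u & J \<subseteq> u ` {..m} & inc_law N B u m" using u by blast
 qed
qed

lemma wspace_component: "distr WS path_algebra (%w. w i) = wiener"
proof -
 interpret L: product_prob_space "%_ :: nat. wiener" UNIV using prob_space_wiener by (intro product_prob_spaceI)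
 show ?thesis using L.PiM_component[of i] unfolding WS_def by (subst distr_cong[OF refl sets_wiener[symmetric] refl]) simp
qed

lemma wspace_inc_law:
 assumes u: "mono u" "0 <= u 0"
 shows "inc_law WS (%s w. w i s) u m" unfolding inc_law_def
proof (intro allI impI)
 fix A :: "nat => real set" assume A: "ALL i. A i : sets borel"
 have u0: "0 <= u i" for i using u monoD[OF u(1), of 0 i] by linarith
 have c: "(%w. w i) : measurable WS path_algebra" using wspace_coord by (simp add: measurable_cong_sets[OF refl sets_wiener])
 let ?E = "{f:space wiener. ALL i<m. f (u (Suc i)) - f (u i) : A i}"
 have "?E : sets wiener" by (rule wiener_event) (use A u0 in blast)+
 hence "?E : sets path_algebra" by (simp only: sets_wiener)
 from measure_distr[OF c this]
 have "measure wiener ?E = measure WS ((%w. w i) -` ?E Int space WS)" by (simp add: wspace_component)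
 also have "(%w. w i) -` ?E Int space WS = {w:space WS. ALL k<m. w i (u (Suc k)) - w i (u k) : A k}"
 proof -
  have "w i : space wiener" if "w : space WS" for w using measurable_space[OF wspace_coord that] .
  thus ?thesis by blast
 qed
 finally show "measure WS {w:space WS. ALL k<m. w i (u (Suc k)) - w i (u k) : A k} = (PROD k<m. measure (gauss (u (Suc k) - u k)) (A k))"
  using wiener_inc_law[OF u, of m] A unfolding inc_law_def by simp
qed

lemma wspace_increment:
 assumes "0 <= r" "r <= s"
 shows "distr WS borel (%w. w i s - w i r) = gauss (s - r)"
proof (rule measure_eqI)
 interpret G: prob_space "gauss (s - r)" by (rule prob_space_gauss)
 have m: "(%w. w i s - w i r) : borel_measurable WS" using assms by (intro borel_measurable_diff wspace_eval) auto
 fix A assume "A : sets (distr WS borel (%w. w i s - w i r))"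
 hence A: "A : sets borel" by simp
 let ?u = "%k :: nat. if k = 0 then r else s"
 have "inc_law WS (%s w. w i s) ?u 1" using assms by (intro wspace_inc_law) (auto simp: mono_def)
 hence "measure WS {w:space WS. w i s - w i r : A} = measure (gauss (s - r)) A" unfolding inc_law_def using A by (auto dest: spec[of _ "%_. A"])
 also have "{w:space WS. w i s - w i r : A} = (%w. w i s - w i r) -` A Int space WS" by auto
 finally show "emeasure (distr WS borel (%w. w i s - w i r)) A = emeasure (gauss (s - r)) A"
  by (simp add: emeasure_distr[OF m A] W.emeasure_eq_measure G.emeasure_eq_measure)
qed simp

lemma wspace_standard_BM: "standard_BM WS (%s w. w i s)" unfolding standard_BM_def
proof (intro conjI allI impI ballI)
 show "prob_space WS" by (rule prob_space_wspace)
 show "(%w. w i s) : borel_measurable WS" if "0 <= s" for s by (rule wspace_eval[OF that])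
 show "w i 0 = 0" "continuous_on {0..} (%s. w i s)" if "w : space WS" for w using wspace_cont[OF that, of i] by simp_all
 show "distributed WS lborel (%w. w i s - w i r) (normal_density 0 (sqrt (s - r)))" if "0 <= r & r < s" for r s
  using that wspace_increment[of r s i] distributed_gauss_iff[of "s - r" WS "%w. w i s - w i r"] by (simp add: borel_measurable_diff wspace_eval)
 fix u :: "nat => real" and m :: nat assume u: "0 <= u 0 & mono u"
 have u0: "0 <= u k" for k using u monoD[of u 0 k] by auto
 have um: "u k <= u (Suc k)" for k using u monoD[of u k "Suc k"] by auto
 show "W.indep_vars (%_. borel) (%k w. w i (u (Suc k)) - w i (u k)) {..<m}"
 proof (cases "m = 0")
  case True
  thus ?thesis by (simp add: W.indep_vars_def W.indep_sets_def)
 next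
  case False
  show ?thesis
  proof (subst W.indep_vars_iff_distr_eq_PiM)
   show "{..<m} ~= {}" using False by auto
   show "(%w. w i (u (Suc k)) - w i (u k)) : borel_measurable WS" for k using u0 by (intro borel_measurable_diff wspace_eval)
   have "distr WS (PB {..<m}) (%w. \<lambda>k\<in>{..<m}. w i (u (Suc k)) - w i (u k)) = PiM {..<m} (%k. gauss (u (Suc k) - u k))"
    by (rule inc_law_distr[OF prob_space_wspace wspace_eval[OF u0] wspace_inc_law]) (use u in auto)
   also have "... = PiM {..<m} (%k. distr WS borel (%w. w i (u (Suc k)) - w i (u k)))" using wspace_increment[OF u0 um] by simp
   finally show "distr WS (PB {..<m}) (%w. \<lambda>k\<in>{..<m}. w i (u (Suc k)) - w i (u k))
    = PiM {..<m} (%k. distr WS borel (%w. w i (u (Suc k)) - w i (u k)))" .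
  qed
 qed
qed

lemma wspace_box:
 assumes "finite J" "!!i. i : J ==> A i : sets wiener"
 shows "measure WS {w:space WS. ALL i:J. w i : A i} = (PROD i:J. measure wiener (A i))"
proof -
 interpret V: prob_space wiener by (rule prob_space_wiener)
 have "emeasure WS {w:space WS. ALL i:J. w i : A i} = (PROD i:J. emeasure wiener (A i))"
  unfolding WS_def by (rule emeasure_PiM_UNIV_box[OF prob_space_wiener]) (use assms in auto)
 thus ?thesis by (simp add: W.emeasure_eq_measure V.emeasure_eq_measure prod_ennreal prod_nonneg)
qed

lemma wspace_indep: "prob_space.indep_vars WS (%_. PB {0..}) (%i w. \<lambda>s\<in>{0..}. w i s) I"
proof -
 interpret L: product_prob_space "%_ :: nat. wiener" UNIV using prob_space_wiener by (intro product_prob_spaceI)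
 have c: "distr WS wiener (%w. w i) = wiener" for i using wspace_component[of i] by (subst distr_cong[OF refl sets_wiener refl])
 have "W.indep_vars (%_. wiener) (%i w. w i) UNIV"
 proof (subst W.indep_vars_iff_distr_eq_PiM)
  show "distr WS (PiM UNIV (%_. wiener)) (%w. \<lambda>i\<in>UNIV. w i) = PiM UNIV (%i. distr WS wiener (%w. w i))"
   unfolding c by (simp add: restrict_UNIV distr_id2 WS_def)
 qed (simp_all add: wspace_coord)
 hence "W.indep_vars (%_. PB {0..}) (%i w. (%f. \<lambda>s\<in>{0..}. f s) (w i)) UNIV"
  by (rule W.indep_vars_compose2) (intro measurable_restrict wiener_eval_measurable, simp)
 thus ?thesis by (rule W.indep_vars_subset) simp
qed

lemma coalescing_BMs_wspace: "coalescing_BMs WS n z (%i w. bpath z w i)" unfolding coalescing_BMs_def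
proof (intro conjI exI[of _ "%i s w. w i s"] allI impI ballI)
 fix j w assume "j < n"
 thus "bpath z w j = real_path (coalesce (%i. snd (z i)) (%i s. fst (z i) + w i (s - snd (z i))) n j) (snd (z j))"
  using coalesce_cpath[of j n z w] by (simp add: bpath_def drive_def[abs_def])
qed (simp_all add: prob_space_wspace wspace_standard_BM wspace_indep)

text \<open>The given \<open>n\<close> motions are completed by zero paths to a sequence of drivers,
  and the same padding is applied on \<open>WS\<close>. The padded laws agree by independence, and
  the first \<open>n\<close> coalescing paths do not see the padding.\<close>

lemma coalescing_BMs_law:
 assumes P: "coalescing_BMs N n z P"
 shows "distr N (PB {..<n}) (%u. \<lambda>i\<in>{..<n}. P i u) =
  distr WS (PB {..<n}) (%u. \<lambda>i\<in>{..<n}. bpath z u i)"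
proof -
 from P obtain B where N: "prob_space N" and BM: "!!i. i < n ==> standard_BM N (B i)"
  and ind: "prob_space.indep_vars N (%_. PB {0..}) (%i u. \<lambda>s\<in>{0..}. B i s u) {..<n}" and Pj: "!!j u. j < n ==> u : space N ==> P j u =
     real_path (coalesce (%i. snd (z i)) (%i s. fst (z i) + B i (s - snd (z i)) u) n j) (snd (z j))" unfolding coalescing_BMs_def by blast
 interpret N: prob_space N by (rule N)
 define zero where "zero = (\<lambda>s\<in>{0 :: real..}. 0 :: real)"
 have z0: "zero : wiener_paths"
 proof -
  have "continuous_on {0..} zero" by (rule continuous_on_eq[OF continuous_on_const[of _ 0]]) (simp add: zero_def)
  thus ?thesis by (simp add: wiener_paths_def zero_def)
 qed
 define b where "b u i = (if i < n then \<lambda>s\<in>{0..}. B i s u else zero)" for u and i :: nat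
 define c where "c u i = (if i < n then u i else zero)" for u :: "nat => real => real" and i :: nat
 note law = standard_BM_law[OF BM]
 have const: "(%_. zero) : measurable M wiener" for M :: "'m measure" using z0 by (intro measurable_const) simp
 have bm: "b : measurable N WS" unfolding WS_def
 proof (rule measurable_vec)
  fix i show "(%u. b u i) : measurable N wiener"
   using law(1)[of i] const by (cases "i < n") (simp_all add: b_def measurable_cong_sets[OF refl sets_wiener])
 qed
 have cm: "c : measurable WS WS"
 proof (subst (2) WS_def, rule measurable_vec)
  fix i show "(%u. c u i) : measurable WS wiener"
   using wspace_coord const by (cases "i < n") (simp_all add: c_def)
 qed
 have eq: "distr N WS b = distr WS WS c"
 proof (rule measure_eqI_PiM_infinite)
  show "finite_measure (distr N WS b)" by (intro prob_space.finite_measure N.prob_space_distr bm)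
  show "sets (distr N WS b) = sets (PiM UNIV (%_ :: nat. wiener))" "sets (distr WS WS c) = sets (PiM UNIV (%_. wiener))" by (simp_all add: WS_def)
  fix A and J :: "nat set" assume J: "finite J" and A: "!!i. i : J ==> A i : sets wiener"
  let ?E = "prod_emb UNIV (%_. wiener) J (Pi\<^sub>E J A)"
  have E: "?E : sets WS" unfolding WS_def using J A by (intro sets_PiM_I) auto
  have E': "u : ?E <-> (ALL i:J. u i : A i)" if "u : space WS" for u
  proof -
   have "!!i. u i : wiener_paths" using that by (simp add: space_wspace)
   thus ?thesis by (auto simp: prod_emb_def PiE_iff space_PiM)
  qed
  let ?J = "J Int {..<n}"
  have mb: "measure (distr N WS b) ?E = (if ALL i:J - {..<n}. zero : A i then (PROD i:?J. measure wiener (A i)) else 0)"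
  proof -
   have "measure (distr N WS b) ?E = measure N {u:space N. ALL i:J. b u i : A i}"
    unfolding measure_distr[OF bm E] by (rule arg_cong[where f="measure N"]) (use E' measurable_space[OF bm] in auto)
   also have "... = (if ALL i:J - {..<n}. zero : A i then (PROD i:?J. measure wiener (A i)) else 0)"
   proof (cases "ALL i:J - {..<n}. zero : A i")
    case False
    hence "{u:space N. ALL i:J. b u i : A i} = {}" by (auto simp: b_def)
    thus ?thesis using False by (simp only: measure_empty if_False)
   next
    case True
    show ?thesis
    proof (cases "?J = {}")
     case J0: True
     hence "{u:space N. ALL i:J. b u i : A i} = space N" using True by (auto simp: b_def)
     thus ?thesis using True by (simp add: J0 N.prob_space)
    next
     case False
     let ?X = "%i u. \<lambda>s\<in>{0..}. B i s u"
     \<comment> \<open>Independence is stated for the product field on all functions, so each event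
       of \<open>wiener\<close> is written as the trace of such a set.\<close>
     have "EX C. C : sets (PB {0 :: real..}) & A i = wiener_paths Int C" if "i : J" for i
      using A[OF that] unfolding sets_wiener path_algebra_def sets_restrict_space by blast
     then obtain C where C: "!!i. i : J ==> C i : sets (PB {0 :: real..})" "!!i. i : J ==> A i = wiener_paths Int C i" by metis
     have Xp: "?X i u : wiener_paths" if "i < n" "u : space N" for i u using measurable_space[OF law(1)[OF that(1)] that(2)] by simp
     have Xi: "?X i -` C i Int space N = ?X i -` A i Int space N" if "i : ?J" for i using that C(2)[of i] Xp[of i] by auto
     have "{u:space N. ALL i:J. b u i : A i} = (\<Inter>i\<in>?J. ?X i -` A i Int space N)" using True False by (auto simp: b_def)
     also have "... = (\<Inter>i\<in>?J. ?X i -` C i Int space N)" using Xi by simp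
     also have "measure N ... = (PROD i:?J. measure N (?X i -` C i Int space N))"
      by (rule N.indep_varsD_finite[OF N.indep_vars_subset[OF ind]]) (use False J C(1) in auto)
     also have "... = (PROD i:?J. measure wiener (A i))"
     proof (rule prod.cong[OF refl])
      fix i assume i: "i : ?J"
      hence Ai: "A i : sets path_algebra" using A[of i] by (simp only: Int_iff sets_wiener)
      have "i < n" using i by simp
      thus "measure N (?X i -` C i Int space N) = measure wiener (A i)" unfolding Xi[OF i] using measure_distr[OF law(1) Ai, of i] law(2)[of i] by simp
     qed
     finally show ?thesis using True by simp
    qed
   qed
   finally show ?thesis .
  qed
  have mc: "measure (distr WS WS c) ?E = (if ALL i:J - {..<n}. zero : A i then (PROD i:?J. measure wiener (A i)) else 0)"
  proof -
   have "measure (distr WS WS c) ?E = measure WS {u:space WS. ALL i:J. c u i : A i}"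
    unfolding measure_distr[OF cm E] by (rule arg_cong[where f="measure WS"]) (use E' measurable_space[OF cm] in auto)
   also have "... = (if ALL i:J - {..<n}. zero : A i then (PROD i:?J. measure wiener (A i)) else 0)"
   proof (cases "ALL i:J - {..<n}. zero : A i")
    case False
    hence "{u:space WS. ALL i:J. c u i : A i} = {}" by (auto simp: c_def)
    thus ?thesis using False by (simp only: measure_empty if_False)
   next
    case True
    hence "{u:space WS. ALL i:J. c u i : A i} = {u:space WS. ALL i:?J. u i : A i}" by (auto simp: c_def)
    thus ?thesis using True wspace_box[of ?J A] J A by simp
   qed
   finally show ?thesis .
  qed
  show "emeasure (distr N WS b) ?E = emeasure (distr WS WS c) ?E"
   using mb mc by (simp add: finite_measure.emeasure_eq_measure prob_space.finite_measure N.prob_space_distr bm W.prob_space_distr cm)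
 qed
 let ?G = "%u. \<lambda>i\<in>{..<n}. bpath z u i"
 have G: "?G : measurable WS (PB {..<n})" by (intro measurable_restrict bpath_measurable)
 have "distr N (PB {..<n}) (%u. \<lambda>i\<in>{..<n}. P i u) = distr N (PB {..<n}) (?G o b)"
 proof (rule distr_cong[OF refl refl])
  fix u assume u: "u : space N"
  have bu: "b u : space WS" using measurable_space[OF bm u] .
  have "P j u = bpath z (b u) j" if j: "j < n" for j
  proof -
   let ?w = "%i s. fst (z i) + B i (s - snd (z i)) u"
   have dr: "?w i s = drive z (b u) i s" if "i < n" "snd (z i) <= s" for i s using that by (simp add: drive_def b_def)
   have wc: "continuous_on {snd (z i)..} (?w i)" if "i < n" for i by (rule continuous_on_eq[OF drive_cont[OF bu, of z i]]) (use dr[OF that] in auto)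
   have "coal (%i. snd (z i)) ?w (coalesce (%i. snd (z i)) ?w n) n" by (rule coal_coalesce[OF wc])
   hence c: "coal (%i. snd (z i)) (drive z (b u)) (coalesce (%i. snd (z i)) ?w n) n" by (rule coal_cong) (simp_all add: dr)
   show ?thesis unfolding Pj[OF j u]
   proof (rule path_eqI)
    note rp = real_path_vals[OF coalD(1)[OF c j]]
    show "st (real_path (coalesce (%i. snd (z i)) ?w n j) (snd (z j))) = st (bpath z (b u) j)" by (simp add: rp bpath_vals[OF bu])
    show "tval (real_path (coalesce (%i. snd (z i)) ?w n j) (snd (z j))) s = tval (bpath z (b u) j) s" for s by (simp add: rp bpath_vals[OF bu] cpath_unique[OF bu c j])
   qed
  qed
  thus "(\<lambda>i\<in>{..<n}. P i u) = (?G o b) u" by auto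
 qed
 also have "... = distr WS (PB {..<n}) (?G o c)" by (simp only: distr_distr[OF G bm, symmetric] eq distr_distr[OF G cm])
 also have "... = distr WS (PB {..<n}) ?G"
 proof (rule distr_cong[OF refl refl])
  fix u assume u: "u : space WS"
  have "bpath z (c u) i = bpath z u i" if "i < n" for i by (rule bpath_prefix[OF measurable_space[OF cm u] u refl _ that]) (simp add: c_def)
  thus "(?G o c) u = ?G u" by auto
 qed
 finally show ?thesis .
qed

text \<open>Two copies meet at their common start and stay merged.\<close>

lemma bpath_duplicate:
 assumes w: "w : space WS" and z: "z i = z j"
 shows "bpath z w i = bpath z w j"
proof (rule bpath_eqI[OF w w])
 show "snd (z i) = snd (z j)" by (simp add: z)
 fix s assume s: "snd (z i) <= s"
 let ?n = "Suc (max i j)"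
 show "cpath z w i s = cpath z w j s" by (rule mergingD[OF coalD(2)[OF coal_cpath[OF w, of z ?n]], of i j "snd (z i)"])
   (use s z cpath_start[OF w, of z i] cpath_start[OF w, of z j] in auto)
qed

lemma measurable_comp_wspace: "(%w. bpath z w o f) : measurable WS paths" using measurable_comp[OF bpaths_measurable paths_reindex] by (simp add: comp_def)

text \<open>Prefixing the chosen points to the family does not change the law of the family, and a path that
 occurs twice merges with its copy at once.\<close>

lemma skel_law_reindex: "distr (skel_law z) paths (%x. x o f) = skel_law (z o f)"
proof (rule paths_law_eqI)
 have m: "(%x. x o f) : measurable (skel_law z) paths" by (simp only: measurable_cong_sets[OF sets_skel_law refl] paths_reindex)
 show "prob_space (distr (skel_law z) paths (%x. x o f))" by (rule prob_space.prob_space_distr[OF prob_space_skel_law m])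
 fix n and A :: "nat => bw_path set" assume A: "!!i. A i : sets borel"
 note B = prefix_event[of A n, OF A]
 define y where "y i = (if i < n then z (f i) else z (i - n))" for i
 have yz: "(%i. y (n + i)) = z" by (simp add: y_def)
 have mn: "(%x i. x (n + i)) : measurable paths paths" using paths_reindex[of "(+) n"] by (simp add: comp_def)
 have "distr (skel_law z) paths (%x. x o f) = distr (distr (distr WS paths (bpath y)) paths (%x i. x (n + i))) paths (%x. x o f)"
  using skel_law_drop[of y n] by (simp add: skel_law_def yz)
 also have "... = distr WS paths (%w. bpath y w o (%i. n + f i))"
  by (subst distr_distr[OF mn bpaths_measurable], subst distr_distr[OF paths_reindex measurable_comp[OF bpaths_measurable mn]]) (simp add: comp_def)
 finally have "emeasure (distr (skel_law z) paths (%x. x o f)) {x. ALL i<n. x i : A i}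
   = emeasure WS ((%w. bpath y w o (%i. n + f i)) -` {x. ALL i<n. x i : A i} Int space WS)" using emeasure_distr[OF measurable_comp_wspace B] by simp
 also have "(%w. bpath y w o (%i. n + f i)) -` {x. ALL i<n. x i : A i} Int space WS
  = bpath (z o f) -` {x. ALL i<n. x i : A i} Int space WS"
 proof -
  have "bpath y w (n + f i) = bpath (z o f) w i" if w: "w : space WS" and i: "i < n" for w i
  proof -
   have "bpath y w (n + f i) = bpath y w i" by (rule bpath_duplicate[OF w]) (simp add: y_def i)
   also have "... = bpath (z o f) w i" by (rule bpath_prefix[OF w w _ _ i]) (simp_all add: y_def)
   finally show ?thesis .
  qed
  thus ?thesis by auto
 qed
 also have "emeasure WS ... = emeasure (skel_law (z o f)) {x. ALL i<n. x i : A i}" unfolding skel_law_def by (rule emeasure_distr[OF bpaths_measurable B, symmetric])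
 finally show "emeasure (distr (skel_law z) paths (%x. x o f)) {x. ALL i<n. x i : A i}
  = emeasure (skel_law (z o f)) {x. ALL i<n. x i : A i}" .
qed (simp_all add: prob_space_skel_law)

text \<open>Probabilities about chosen paths may be computed as if these paths came first in the
  order, where they are closest to their drivers.\<close>

lemma prob_reindex:
 assumes E: "E : sets paths"
 shows "measure WS {w:space WS. bpath z w o f : E} = measure WS {w:space WS. bpath (z o f) w : E}"
proof -
 have "measure (skel_law (z o f)) E = measure (distr (skel_law z) paths (%x. x o f)) E" by (simp only: skel_law_reindex)
 also have "distr (skel_law z) paths (%x. x o f) = distr WS paths (%w. bpath z w o f)"
  unfolding skel_law_def by (subst distr_distr[OF paths_reindex bpaths_measurable]) (simp add: comp_def)
 finally show ?thesis unfolding skel_law_def measure_distr[OF bpaths_measurable E] measure_distr[OF measurable_comp_wspace E]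
  by (simp only: vimage_def Int_def mem_Collect_eq conj_commute)
qed

text \<open>Markov's inequality with the fourth moment: the order \<open>v ^ 2\<close> beats the
  number \<open>1 / v\<close> of intervals in a union bound, which a variance bound would
  not.\<close>

lemma gauss_tail:
 assumes "0 <= v" "0 < c"
 shows "measure (gauss v) {x. c < abs x} <= 3 * v\<^sup>2 / c ^ 4"
proof -
 interpret G: prob_space "gauss v" by (rule prob_space_gauss)
 have h4: "has_bochner_integral lborel (%x. std_normal_density x * x ^ 4) 3" using std_normal_moment_even[of 2] by (simp add: fact_numeral power2_eq_square)
 have "integrable (density lborel std_normal_density) (%x. x ^ 4)" "(\<integral>x. x ^ 4 \<partial>density lborel std_normal_density) = 3"
  using h4 by (simp_all add: integrable_density integral_density has_bochner_integral_iff)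
 moreover have "sqrt v ^ 4 = v\<^sup>2" using assms power_mult[of "sqrt v" 2 2] by simp
 ultimately have i4: "integrable (gauss v) (%x. x ^ 4)" "(\<integral>x. x ^ 4 \<partial>gauss v) = 3 * v\<^sup>2" unfolding gauss_def using assms
  by (simp_all add: integrable_distr_eq integral_distr power_mult_distrib)
 have "measure (gauss v) {x:space (gauss v). c ^ 4 <= x ^ 4} <= (\<integral>x. x ^ 4 \<partial>gauss v) / c ^ 4"
  using assms by (intro integral_Markov_inequality_measure[where A="{}"] i4) auto
 moreover have "measure (gauss v) {x. c < abs x} <= measure (gauss v) {x:space (gauss v). c ^ 4 <= x ^ 4}"
 proof (rule G.finite_measure_mono)
  show "{x. c < abs x} \<subseteq> {x:space (gauss v). c ^ 4 <= x ^ 4}" using assms(2) power_mono[of c "abs _" 4] by (auto simp: power_even_abs)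
 qed (simp add: borel_closed closed_Collect_le continuous_intros)
 ultimately show ?thesis by (simp add: i4)
qed

text \<open>On the interval the density lies between its values at \<open>d\<close> and at 0. The
  lower bound becomes sharp as \<open>d\<close> shrinks, which is what the expected count
  needs.\<close>

lemma gauss_interval:
 assumes v: "0 < v" and d: "0 <= d"
 shows "measure (gauss v) {-d<..d} <= 2 * d / sqrt (2 * pi * v)" "2 * d / sqrt (2 * pi * v) * exp (- d\<^sup>2 / (2 * v)) <= measure (gauss v) {-d<..d}"
proof -
 interpret G: prob_space "gauss v" by (rule prob_space_gauss)
 let ?f = "normal_density 0 (sqrt v)"
 have f: "?f x = 1 / sqrt (2 * pi * v) * exp (- x\<^sup>2 / (2 * v))" for x using v by (simp add: normal_density_def)
 have "emeasure (gauss v) {-d<..d} = (nn_integral lborel (%x. ennreal (?f x) * indicator {-d<..d} x))" unfolding gauss_density[OF v] by (rule emeasure_density) auto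
 hence e: "ennreal (measure (gauss v) {-d<..d}) = (nn_integral lborel (%x. ennreal (?f x) * indicator {-d<..d} x))" by (simp add: G.emeasure_eq_measure)
 have c: "(nn_integral lborel (%x. ennreal k * indicator {-d<..d} x)) = ennreal (2 * d * k)" if "0 <= k" for k
  using d that by (simp add: nn_integral_cmult_indicator ennreal_mult[symmetric] mult.commute)
 have "ennreal (measure (gauss v) {-d<..d}) <= ennreal (2 * d * (1 / sqrt (2 * pi * v)))"
  unfolding e using v by (subst c[symmetric]) (auto intro!: nn_integral_mono mult_right_mono simp: f divide_right_mono indicator_def)
 thus "measure (gauss v) {-d<..d} <= 2 * d / sqrt (2 * pi * v)" using v d by (subst (asm) ennreal_le_iff) (auto simp: mult_ac)
 have k: "1 / sqrt (2 * pi * v) * exp (- d\<^sup>2 / (2 * v)) <= ?f x" if "x : {-d<..d}" for x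
 proof -
  have "x\<^sup>2 <= d\<^sup>2" using that by (intro abs_le_square_iff[THEN iffD1]) auto
  thus ?thesis using v unfolding f by (intro mult_left_mono) (auto simp: divide_right_mono)
 qed
 have "ennreal (2 * d * (1 / sqrt (2 * pi * v) * exp (- d\<^sup>2 / (2 * v)))) <= ennreal (measure (gauss v) {-d<..d})"
  unfolding e using v by (subst c[symmetric]) (auto intro!: nn_integral_mono ennreal_leI simp: indicator_def k[simplified])
 thus "2 * d / sqrt (2 * pi * v) * exp (- d\<^sup>2 / (2 * v)) <= measure (gauss v) {-d<..d}" by (simp add: mult_ac)
qed

section \<open>Two coalescing Brownian motions\<close>

lemma cpath_0: "w : space WS ==> snd (z 0) <= s ==> cpath z w 0 s = drive z w 0 s" by (rule coalD(4)[OF coal_cpath[of w z 1]]) auto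

text \<open>With a common start, path 0 is its driver and path 1 is its driver until it hits path
  0.\<close>

lemma met_iff_drive:
 assumes w: "w : space WS" and r: "snd (z 0) = r" "snd (z 1) = r"
 shows "met z 0 w s <-> (EX u:{r..s}. drive z w 0 u = drive z w 1 u)"
proof
 assume m: "met z 0 w s"
 show "EX u:{r..s}. drive z w 0 u = drive z w 1 u"
 proof (rule ccontr)
  assume no: "\<not> ?thesis"
  have "cpath z w 1 s = drive z w 1 s"
  proof (rule coalD(4)[OF coal_cpath[OF w, of z 2]])
   show "drive z w 1 r' ~= cpath z w k r'" if "k < 1" "snd (z 1) <= r'" "r' <= s" "snd (z k) <= r'" for k r' using no that r cpath_0[OF w, of z r'] by force
  qed (use m r in \<open>auto simp: met_def\<close>)
  moreover have "drive z w 0 s ~= drive z w 1 s" using no m r by (auto simp: met_def)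
  ultimately show False using m cpath_0[OF w, of z s] r by (simp add: met_def)
 qed
next
 assume "EX u:{r..s}. drive z w 0 u = drive z w 1 u"
 then obtain u where u: "r <= u" "u <= s" "drive z w 0 u = drive z w 1 u" by auto
 let ?T = "meeting_times (%i. snd (z i)) 1 (drive z w 1) (cpath z w)"
 have uT: "u : ?T" using u r cpath_0[OF w, of z u] by (auto simp: meeting_times_def)
 hence ne: "?T ~= {}" by blast
 note fm = first_meeting[where t="%i. snd (z i)" and n=1 and v="cpath z w", OF drive_cont[OF w] cpath_cont[OF w] ne]
 let ?S = "Inf ?T"
 have S: "r <= ?S" "drive z w 1 ?S = cpath z w 0 ?S" using fm(1) r by (auto simp: meeting_times_def)
 have "cpath z w 1 ?S = drive z w 1 ?S"
 proof (rule coal_until[OF drive_cont[OF w] coal_cpath[OF w, of z 2] _ _ _ order_refl])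
  show "drive z w 1 r' ~= cpath z w k r'" if "k < 1" "snd (z 1) <= r'" "r' < ?S" "snd (z k) <= r'" for k r' using fm(2)[of r'] that by (auto simp: meeting_times_def)
 qed (use S r in auto)
 hence "met z 0 w ?S" using S r by (simp add: met_def)
 thus "met z 0 w s" by (rule met_mono[OF w]) (use fm(2)[OF uT] u in simp)
qed

lemma wspace_difference:
 assumes "0 < S"
 shows "distr WS borel (%w. w 1 S - w 0 S) = gauss (2 * S)"
proof -
 have "W.indep_vars (%_. borel) (%i w. (%f. f S) (\<lambda>s\<in>{0..}. w i s)) UNIV"
  by (rule W.indep_vars_compose2[OF wspace_indep]) (use assms in \<open>auto intro: measurable_component_singleton\<close>)
 hence "W.indep_vars (%_. borel) (%i w. w i S) UNIV" using assms by simp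
 from W.indep_vars_subset[OF this, of "insert 1 {0}"]
 have i: "W.indep_var borel (%w. w 1 S) borel (%w. w 0 S)" using W.indep_vars_sum[of "{0}" 1 "%i w. w i S"] by simp
 have "distr WS borel (%w. w i S) = gauss S" for i
 proof -
  have "distr WS borel (%w. w i S) = distr WS borel (%w. w i S - w i 0)" by (rule distr_cong) (simp_all add: wspace_cont)
  thus ?thesis using wspace_increment[of 0 S i] assms by simp
 qed
 hence "distributed WS lborel (%w. w i S) (normal_density 0 (sqrt S))" for i using distributed_gauss_iff[OF assms, of WS "%w. w i S"] wspace_eval[of S i] assms by simp
 from W.diff_indep_normal[OF i _ _ this[of 1] this[of 0]]
 have "distributed WS lborel (%w. w 1 S - w 0 S) (normal_density 0 (sqrt (2 * S)))" using assms by simp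
 thus ?thesis using distributed_gauss_iff[of "2 * S" WS "%w. w 1 S - w 0 S"] assms by simp
qed

text \<open>The reflection principle: exchanging the increments after the meeting reverses the sign of the distance.\<close>

lemma prob_not_met:
 assumes z: "z 0 = (x, r)" "z 1 = (y, r)" and xy: "x <= y" and rs: "r < s"
 shows "measure WS {w:space WS. \<not> met z 0 w s} = measure (gauss (2 * (s - r))) {-(y - x)<..y - x}"
proof -
 interpret G: prob_space "gauss (2 * (s - r))" by (rule prob_space_gauss)
 define D where "D w = drive z w 1 s - drive z w 0 s" for w
 have D: "D w = (y - x) + (w 1 (s - r) - w 0 (s - r))" for w by (simp add: D_def drive_def z[simplified])
 note iff = met_iff_drive[of _ z r, unfolded z snd_conv, OF _ refl refl]
 \<comment> \<open>The difference starts nonnegative and cannot become nonpositive without a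
   zero.\<close>
 have pos: "D w > 0" if w: "w : space WS" and no: "\<not> met z 0 w s" for w
 proof (rule ccontr)
  let ?d = "%u. drive z w 1 u - drive z w 0 u"
  assume "\<not> D w > 0"
  moreover have "?d r >= 0" using xy wspace_cont(2)[OF w] by (simp add: drive_def z[simplified])
  moreover have "continuous_on {r..s} ?d" by (intro continuous_intros continuous_on_subset[OF drive_cont[OF w]]) (auto simp: z[simplified])
  ultimately obtain u where "r <= u" "u <= s" "?d u = 0" using IVT2'[of ?d s 0 r] rs by (auto simp: D_def)
  thus False using no iff[OF w] by force
 qed
 let ?R = "resample z 0"
 \<comment> \<open>Resampling keeps the event of a meeting by time \<open>s\<close> and negates the
   final difference on it, because the drivers agree at the meeting.\<close>
 have R: "met z 0 (?R w) s = met z 0 w s & (met z 0 w s --> D (?R w) = - D w)" if w: "w : space WS" for w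
 proof (cases "EX u. met z 0 w u")
  case False
  hence "?R w i = restrict (w i) {0..}" for i by (simp add: resample_def exch_def exchange_def drive_def cong: restrict_cong)
  moreover have "restrict (w i) {0..} = w i" for i using w wiener_pathsD(3) by (intro extensional_restrict) (simp add: space_wspace)
  ultimately have "?R w = w" by auto
  thus ?thesis using False by simp
 next
  case True
  then obtain u where u: "met z 0 w u" by blast
  define S where "S = meet z 0 w"
  have S: "met z 0 w S" "!!u. met z 0 w u ==> S <= u" using meet[OF w] u unfolding S_def by auto
  have Sr: "r <= S" using S(1) by (simp add: met_def z)
  have RE: "?R w = exch z 0 True S w" using True by (simp add: resample_def S_def)
  have RS: "?R w : space WS" using measurable_space[OF resample_law(1) w] .
  have mS: "met z 0 (?R w) u <-> met z 0 w u" if "u <= S" for u unfolding RE by (rule met_exch[OF w]) (use Sr that z in \<open>auto simp: z[simplified]\<close>)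
  have 1: "met z 0 (?R w) s = met z 0 w s"
  proof (cases "s <= S")
   case False
   thus ?thesis using met_mono[OF RS, of z 0 S s] met_mono[OF w, of z 0 S s] mS[of S] S(1) by simp
  qed (rule mS)
  have "D (?R w) = - D w" if "met z 0 w s"
  proof -
   obtain u where "r <= u" "u <= S" "drive z w 0 u = drive z w 1 u" using iff[OF w, of S] S(1) by auto
   moreover from this have "S <= u" using iff[OF w, of u] by (intro S(2)) auto
   ultimately have e: "drive z w 0 S = drive z w 1 S" by auto
   have "drive z (?R w) i s = exchange 0 True S (drive z w) i s" if "i = 0 | i = 1" for i unfolding RE using rs that by (intro drive_exch) (auto simp: z z[simplified])
   thus ?thesis using e S(2)[OF that] by (auto simp: D_def exchange_def)
  qed
  thus ?thesis using 1 by simp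
 qed
 have Dm: "D : borel_measurable WS" unfolding D_def by (intro borel_measurable_diff drive_measurable) (use rs in \<open>auto simp: z z[simplified]\<close>)
 note mm = met_measurable[of z 0 s]
 have mp: "Measurable.pred WS (%w. met z 0 w s & P (D w))" if "Measurable.pred borel P" for P by (intro pred_intros_logic mm measurable_compose[OF Dm that])
 have pb: "Measurable.pred borel (%d :: real. 0 < d)" "Measurable.pred borel (%d :: real. d < 0)" by measurable
 \<comment> \<open>Reflection turns \<open>0 < D\<close> into \<open>D < 0\<close> on the meeting
   event, and \<open>D < 0\<close> forces a meeting. So the probability of not meeting is that of
   \<open>0 < D\<close> minus that of \<open>D < 0\<close>.\<close>
 have "measure WS {w:space WS. met z 0 w s & 0 < D w}
  = measure WS (?R -` {w:space WS. met z 0 w s & 0 < D w} Int space WS)"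
  using measure_distr[OF resample_law(1)[of z 0] predE[OF mp[OF pb(1)]]] by (simp add: resample_law(2))
 also have "?R -` {w:space WS. met z 0 w s & 0 < D w} Int space WS = {w:space WS. met z 0 w s & D w < 0}" using R measurable_space[OF resample_law(1)] by auto
 also have "... = {w:space WS. D w < 0}" using pos by force
 finally have "measure WS {w:space WS. met z 0 w s & 0 < D w} = measure WS {w:space WS. D w < 0}" .
 moreover have "measure WS {w:space WS. 0 < D w} = measure WS {w:space WS. \<not> met z 0 w s} +
  measure WS {w:space WS. met z 0 w s & 0 < D w}"
 proof (subst W.finite_measure_Union[symmetric])
  show "{w:space WS. \<not> met z 0 w s} : sets WS" by (intro predE pred_intros_logic mm)
  show "{w:space WS. met z 0 w s & 0 < D w} : sets WS" by (rule predE[OF mp[OF pb(1)]])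
  show "measure WS {w:space WS. 0 < D w} = measure WS ({w:space WS. \<not> met z 0 w s} Un {w:space WS. met z 0 w s & 0 < D w})"
   by (rule arg_cong[where f="measure WS"]) (use pos in auto)
 qed auto
 moreover have gD: "measure WS {w:space WS. D w : A} = measure (gauss (2 * (s - r))) {g. y - x + g : A}"
  if "A : sets borel" for A
 proof -
  have B: "{g. y - x + g : A} : sets borel" using measurable_sets[of "%g. y - x + g" borel borel A] that by (simp add: vimage_def)
  have "(%w. w 1 (s - r) - w 0 (s - r)) : borel_measurable WS" using rs by (intro borel_measurable_diff wspace_eval) auto
  from measure_distr[OF this B] wspace_difference[of "s - r"] rs show ?thesis by (simp add: D vimage_def Int_def conj_commute)
 qed
 have "measure WS {w:space WS. 0 < D w} = measure (gauss (2 * (s - r))) {-(y - x)<..}" using gD[of "{0<..}"] by (simp add: greaterThan_def algebra_simps)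
 \<comment> \<open>\<open>D\<close> is \<open>y - x\<close> plus a symmetric Gaussian, so both
   probabilities are upper tails, and their difference is a half-open interval.\<close>
 moreover have "measure WS {w:space WS. D w < 0} = measure (gauss (2 * (s - r))) {y - x<..}"
 proof -
  have "measure WS {w:space WS. D w < 0} = measure (distr (gauss (2 * (s - r))) borel uminus) {..<-(y - x)}"
   using gD[of "{..<0}"] by (simp add: gauss_uminus lessThan_def algebra_simps)
  also have "... = measure (gauss (2 * (s - r))) {y - x<..}"
   by (subst measure_distr) (auto intro!: arg_cong[where f="measure _"] simp: measurable_cong_sets[OF sets_gauss refl])
  finally show ?thesis .
 qed
 moreover have "measure (gauss (2 * (s - r))) {-(y - x)<..} = measure (gauss (2 * (s - r))) {-(y - x)<..y - x} + measure (gauss (2 * (s - r))) {y - x<..}"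
  using xy by (subst G.finite_measure_Union[symmetric]) (auto intro!: arg_cong[where f="measure _"])
 ultimately show ?thesis by linarith
qed

section \<open>Oscillation and independence\<close>

lemma wiener_tail:
 assumes "0 <= h" "0 < c"
 shows "measure wiener {f:space wiener. c < abs (f h)} <= 3 * h\<^sup>2 / c ^ 4"
proof -
 have c: "(%w. w 0) : measurable WS path_algebra" using wspace_coord by (simp add: measurable_cong_sets[OF refl sets_wiener])
 have m: "(%f. f h) : borel_measurable wiener" using assms by (intro wiener_eval_measurable)
 have "distr wiener borel (%f. f h) = distr WS borel (%w. w 0 h)"
  by (subst wspace_component[of 0, symmetric], subst distr_distr[OF path_eval_measurable c]) (use assms in \<open>auto simp: comp_def\<close>)
 also have "... = distr WS borel (%w. w 0 h - w 0 0)" by (rule distr_cong) (simp_all add: wspace_cont)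
 also have "... = gauss h" using wspace_increment[of 0 h 0] assms by simp
 finally have "measure wiener {f:space wiener. c < abs (f h)} = measure (gauss h) {x. c < abs x}"
  using measure_distr[OF m, of "{x. c < abs x}"] by (simp add: vimage_def Int_def conj_commute borel_open open_Collect_less continuous_intros)
 thus ?thesis using gauss_tail[OF assms] by simp
qed

text \<open>Decompose by the first grid time with absolute value above \<open>2 * c\<close>. From
  there the remaining increment is independent and, by \<open>small\<close>, at most
  \<open>c\<close> in absolute value with probability at least 1/2; then the final absolute value
  still exceeds \<open>c\<close>.\<close>

lemma wiener_max_grid:
 fixes u :: "nat => real"
 assumes u: "mono u" "0 <= u 0" "u m <= h" and c: "0 < c" and small: "3 * h\<^sup>2 / c ^ 4 <= 1 / 2"
 shows "measure wiener {f:space wiener. EX k<=m. 2 * c < abs (f (u k))} <= 6 * h\<^sup>2 / c ^ 4"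
proof -
 interpret W: prob_space wiener by (rule prob_space_wiener)
 interpret WW: pair_prob_space wiener wiener ..
 have u0: "0 <= u k" for k using u monoD[OF u(1), of 0 k] by simp
 have uh: "u k <= h" if "k <= m" for k using u monoD[OF u(1) that] by simp
 have h: "0 <= h" using u0[of m] u(3) by simp
 have ev: "(%f. abs (f s)) : borel_measurable wiener" if "0 <= s" for s by (intro borel_measurable_abs wiener_eval_measurable that)
 define E where "E k = {f:space wiener. (ALL l<k. abs (f (u l)) <= 2 * c) & 2 * c < abs (f (u k))}" for k
 have E: "E k : sets wiener" for k
 proof -
  have "Measurable.pred wiener (%f. (ALL l:{..<k}. abs (f (u l)) <= 2 * c) & 2 * c < abs (f (u k)))"
   by (intro pred_intros_logic pred_intros_finite finite_lessThan; unfold pred_def)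
    (rule borel_measurable_le borel_measurable_less; rule borel_measurable_const ev[OF u0])+
  thus ?thesis unfolding E_def Ball_def lessThan_iff by (rule predE)
 qed
 define T where "T = {f:space wiener. c < abs (f h)}"
 have T: "T : sets wiener" unfolding T_def by (intro borel_measurable_less borel_measurable_const ev h)
 have half: "measure wiener (E k) <= 2 * measure wiener (E k Int T)" if k: "k <= m" for k
 proof -
  let ?g = "h - u k"
  define F where "F = {f:space wiener. abs (f ?g) <= c}"
  define A where "A = {f:space wiener. f : E k & abs (f h - f (u k)) <= c}"
  have g: "0 <= ?g" using uh[OF k] by simp
  have F: "F : sets wiener" unfolding F_def by (intro borel_measurable_le borel_measurable_const ev g)
  have "1 / 2 <= measure wiener F"
  proof -
   have "measure wiener (space wiener - F) <= 3 * ?g\<^sup>2 / c ^ 4"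
   proof -
    have "space wiener - F = {f:space wiener. c < abs (f ?g)}" unfolding F_def by (auto simp: not_le)
    thus ?thesis using wiener_tail[OF g c] by (simp only:)
   qed
   also have "... <= 3 * h\<^sup>2 / c ^ 4" using g c u0[of k] by (intro divide_right_mono mult_left_mono power_mono) auto
   finally show ?thesis using W.prob_compl[OF F] small by simp
  qed
  have A: "A : sets wiener"
  proof -
   have "(%f. abs (f h - f (u k))) : borel_measurable wiener" by (intro borel_measurable_abs borel_measurable_diff wiener_eval_measurable h u0)
   hence "E k Int {f:space wiener. abs (f h - f (u k)) <= c} : sets wiener" by (intro sets.Int E borel_measurable_le borel_measurable_const)
   moreover have "E k Int {f:space wiener. abs (f h - f (u k)) <= c} = A" unfolding A_def by auto
   ultimately show ?thesis by simp
  qed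
  have "measure wiener (E k) * measure wiener F = measure (wiener XM wiener) (E k \<times> F)"
   by (simp only: measure_def W.emeasure_pair_measure_Times[OF E F] enn2real_mult)
  \<comment> \<open>Splicing at \<open>u k\<close> realizes the independence of the past event from
    the later increment.\<close>
  also have "E k \<times> F = (%z. splice_path (u k) (fst z) (snd z)) -` A Int space (wiener XM wiener)"
  proof (rule set_eqI)
   fix z :: "(real => real) \<times> (real => real)"
   obtain f g where z: "z = (f, g)" by (cases z)
   show "z : E k \<times> F <-> z : (%z. splice_path (u k) (fst z) (snd z)) -` A Int space (wiener XM wiener)"
   proof (cases "f : wiener_paths & g : wiener_paths")
    case True
    have "splice_path (u k) f g (u l) = f (u l)" if "l <= k" for l using monoD[OF u(1) that] u0 by (simp add: splice_path_def)
    moreover have "splice_path (u k) f g h = f (u k) + g ?g" using uh[OF k] h wiener_pathsD(1)[of g] True by (auto simp: splice_path_def)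
    ultimately show ?thesis using True splice_path_in_paths[OF u0, of f g k] by (auto simp: z E_def F_def A_def space_pair_measure)
   qed (auto simp: z E_def F_def space_pair_measure)
  qed
  also have "measure (wiener XM wiener) ... = measure wiener A" using measure_distr[OF splice_path_measurable[OF u0[of k]], of A] A wiener_concat[OF u0[of k]] by simp
  also have "... <= measure wiener (E k Int T)" by (intro W.finite_measure_mono sets.Int E T) (auto simp: A_def E_def T_def)
  finally show ?thesis using \<open>1 / 2 <= measure wiener F\<close> mult_left_mono[of "1/2" "measure wiener F" "measure wiener (E k)"] by simp
 qed
 have disj: "disjoint_family_on E {..m}"
 proof (unfold disjoint_family_on_def, intro ballI impI)
  fix a b :: nat assume "a ~= b"
  then consider "a < b" | "b < a" by linarith
  thus "E a Int E b = {}" by cases (auto simp: E_def not_less[symmetric])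
 qed
 have "{f:space wiener. EX k<=m. 2 * c < abs (f (u k))} \<subseteq> (\<Union>k\<in>{..m}. E k)"
 proof clarify
  fix f k assume f: "f : space wiener" "k <= m" "2 * c < abs (f (u k))"
  define l where "l = (LEAST k. 2 * c < abs (f (u k)))"
  have "2 * c < abs (f (u l))" "l <= k" "!!l'. l' < l ==> \<not> 2 * c < abs (f (u l'))"
   unfolding l_def using LeastI[of "%k. 2 * c < abs (f (u k))", OF f(3)] Least_le[of "%k. 2 * c < abs (f (u k))", OF f(3)] not_less_Least by blast+
  thus "f : (\<Union>k\<in>{..m}. E k)" using f by (intro UN_I[of l]) (auto simp: E_def not_less)
 qed
 hence "measure wiener {f:space wiener. EX k<=m. 2 * c < abs (f (u k))} <= measure wiener (\<Union>k\<in>{..m}. E k)"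
  using E by (intro W.finite_measure_mono sets.finite_UN) auto
 also have "... = (SUM k<=m. measure wiener (E k))" by (rule W.finite_measure_finite_Union) (use E disj in auto)
 also have "... <= (SUM k<=m. 2 * measure wiener (E k Int T))" by (intro sum_mono half) simp
 also have "... = 2 * measure wiener (\<Union>k\<in>{..m}. E k Int T)" unfolding sum_distrib_left[symmetric]
  by (subst W.finite_measure_finite_Union) (use E T disj in \<open>auto simp: disjoint_family_on_def\<close>)
 also have "... <= 2 * measure wiener T" using T by (intro mult_left_mono W.finite_measure_mono) auto
 also have "... <= 6 * h\<^sup>2 / c ^ 4" using wiener_tail[OF h c] by (simp add: T_def)
 finally show ?thesis .
qed

text \<open>Dyadic grids exhaust the supremum by continuity. When the smallness condition fails, the
  claimed bound exceeds 1.\<close>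

lemma wspace_sup:
 assumes h: "0 < h" and c: "0 < c"
 shows "{w:space WS. EX s:{0..h}. 2 * c < abs (w i s)} : sets WS" (is "?A : _") "measure WS {w:space WS. EX s:{0..h}. 2 * c < abs (w i s)} <= 6 * h\<^sup>2 / c ^ 4"
proof -
 interpret V: prob_space wiener by (rule prob_space_wiener)
 define u where "u m k = h * (real k / 2 ^ m)" for m k :: nat
 define B where "B m = {f:space wiener. EX k<=2 ^ m. 2 * c < abs (f (u m k))}" for m
 define A where "A m = (%w. w i) -` B m Int space WS" for m
 have u: "0 <= u m k" "k <= 2 ^ m ==> u m k <= h" for m k using h by (auto simp: u_def divide_le_eq mult_left_le)
 have "Measurable.pred wiener (%f. EX k<=2 ^ m. 2 * c < abs (f (u m k)))" for m
  unfolding pred_def by (intro sets.sets_Collect_conj sets.sets_Collect_countable_Ex sets.sets_Collect_const borel_measurable_less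
    borel_measurable_const borel_measurable_abs wiener_eval_measurable u)
 hence Bs: "B m : sets wiener" for m unfolding B_def by (rule predE)
 have As: "A m : sets WS" for m unfolding A_def by (rule measurable_sets[OF wspace_coord Bs])
 have AA: "?A = (\<Union>m. A m)"
 proof (intro equalityI subsetI)
  fix w assume "w : ?A"
  then obtain s where w: "w : space WS" and s: "0 <= s" "s <= h" "2 * c < abs (w i s)" by auto
  have "continuous_on {0..} (%s. abs (w i s))" by (intro continuous_intros wspace_cont w)
  from this[unfolded continuous_on_iff, rule_format, of s "abs (w i s) - 2 * c"] s
  obtain d where d: "d > 0" "!!s'. 0 <= s' ==> dist s' s < d ==> dist (abs (w i s')) (abs (w i s)) < abs (w i s) - 2 * c" by auto
  obtain m where m: "(1 / 2) ^ m < d / h" using real_arch_pow_inv[of "d / h" "1 / 2"] d h by auto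
  define k where "k = nat \<lfloor>s * 2 ^ m / h\<rfloor>"
  have k: "real k <= s * 2 ^ m / h" "s * 2 ^ m / h < real k + 1" unfolding k_def using s h by (auto simp: of_nat_floor)
  have "s * 2 ^ m / h <= 2 ^ m" using s h by (simp add: divide_le_eq)
  hence "real k <= real (2 ^ m)" using k unfolding of_nat_power of_nat_numeral by linarith
  hence k2: "k <= 2 ^ m" unfolding of_nat_le_iff .
  have "u m k <= s" "s < u m k + h * (1 / 2) ^ m" using k h by (auto simp: u_def field_simps)
  moreover have "h * (1 / 2) ^ m < d" using m h by (simp add: field_simps)
  ultimately have "dist (u m k) s < d" by (simp add: dist_real_def)
  from d(2)[OF u(1) this] have "2 * c < abs (w i (u m k))" by (simp add: dist_real_def)
  thus "w : (\<Union>m. A m)" using w k2 by (auto simp: A_def B_def space_wspace)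
 next
  fix w assume "w : (\<Union>m. A m)"
  thus "w : ?A" using u by (fastforce simp: A_def B_def)
 qed
 thus "?A : sets WS" using As by auto
 show "measure WS ?A <= 6 * h\<^sup>2 / c ^ 4"
 proof (cases "3 * h\<^sup>2 / c ^ 4 <= 1 / 2")
  case True
  have inc: "incseq A"
  proof (rule incseq_SucI, rule subsetI)
   fix m w assume "w : A m"
   then obtain k where "w i : space wiener" "k <= 2 ^ m" "2 * c < abs (w i (u m k))" "w : space WS" by (auto simp: A_def B_def)
   moreover have "u (Suc m) (2 * k) = u m k" by (simp add: u_def)
   ultimately show "w : A (Suc m)" by (auto simp: A_def B_def intro!: exI[of _ "2 * k"])
  qed
  have "measure WS (A m) <= 6 * h\<^sup>2 / c ^ 4" for m
  proof -
   have "(%w. w i) : measurable WS path_algebra" "B m : sets path_algebra"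
    using wspace_coord Bs[of m] by (simp_all only: measurable_cong_sets[OF refl sets_wiener] sets_wiener)
   hence "measure WS (A m) = measure wiener (B m)" using measure_distr[of "%w. w i" WS path_algebra "B m"] by (simp only: A_def wspace_component)
   also have "... <= 6 * h\<^sup>2 / c ^ 4" unfolding B_def
   proof (rule wiener_max_grid[OF _ _ _ c True])
    show "mono (u m)" using h by (auto simp: mono_def u_def divide_right_mono)
   qed (use u in auto)
   finally show ?thesis .
  qed
  thus ?thesis unfolding AA by (intro LIMSEQ_le_const2[OF W.finite_Lim_measure_incseq[OF _ inc]]) (use As in auto)
 next
  case False
  thus ?thesis using W.prob_le_1[of ?A] by linarith
 qed
qed

text \<open>Before time \<open>r\<close> path 2 is its driver, since the other two start only at
  \<open>r\<close>. Its position at \<open>r\<close> depends on coordinate 2, the meeting of the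
  others on coordinates 0 and 1; resampling coordinate 2 separates them.\<close>

lemma indep_third:
 assumes z: "z 0 = (x, r)" "z 1 = (x', r)" and t: "snd (z 2) < r" and B: "B : sets borel"
 shows "measure WS {w:space WS. cpath z w 2 r : B & \<not> met z 0 w s} =
  measure WS {w:space WS. cpath z w 2 r : B} * measure WS {w:space WS. \<not> met z 0 w s}"
proof -
 interpret V: prob_space wiener by (rule prob_space_wiener)
 let ?h = "r - snd (z 2)"
 define E where "E = {f:space wiener. fst (z 2) + f ?h : B}"
 define N where "N = {w:space WS. \<not> met z 0 w s}"
 define F where "F = (%(f :: real => real, w :: nat => real => real). fun_upd w 2 f)"
 have Fl: "distr (wiener XM WS) WS F = WS" unfolding WS_def F_def by (rule PiM_resample[OF prob_space_wiener])
 have Fm: "F : measurable (wiener XM WS) WS"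
 proof (subst (2) WS_def, rule measurable_vec)
  fix j show "(%z. F z j) : measurable (wiener XM WS) wiener"
   using measurable_compose[OF measurable_snd wspace_coord] by (cases "j = 2") (simp_all add: F_def case_prod_beta')
 qed
 have E: "E : sets wiener"
 proof -
  have "(%f. fst (z 2) + f ?h) -` B Int space wiener : sets wiener"
   by (intro measurable_sets[OF borel_measurable_add B] borel_measurable_const wiener_eval_measurable) (use t in auto)
  thus ?thesis unfolding E_def vimage_def Int_def by (simp only: mem_Collect_eq conj_commute)
 qed
 have N: "N : sets WS" unfolding N_def by (intro predE pred_intros_logic met_measurable)
 have c2: "cpath z w 2 r = fst (z 2) + w 2 ?h" if "w : space WS" for w
 proof -
  have "cpath z w 2 r = drive z w 2 r" by (rule coal_until[OF drive_cont[OF that] coal_cpath[OF that, of z 3] _ _ _ order_refl])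
    (use t z in \<open>auto simp: less_2_cases_iff z[simplified]\<close>)
  thus ?thesis by (simp add: drive_def)
 qed
 have iff: "met z 0 (fun_upd w 2 f) s <-> met z 0 w s" if "w : space WS" "f : wiener_paths" for w f
 proof -
  have "fun_upd w 2 f : space WS" using that by (simp add: space_wspace)
  thus ?thesis using met_iff_drive[of _ z r, unfolded z snd_conv, OF _ refl refl] that(1) by (simp add: drive_def)
 qed
 have p: "measure WS A = measure (wiener XM WS) (F -` A Int space (wiener XM WS))" if "A : sets WS" for A using measure_distr[OF Fm that] by (simp only: Fl)
 have t: "measure (wiener XM WS) (G \<times> H) = measure wiener G * measure WS H" if "G : sets wiener" "H : sets WS" for G H
  using that by (simp add: measure_def W.emeasure_pair_measure_Times enn2real_mult)
 define C where "C = {w:space WS. cpath z w 2 r : B}"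
 have C: "C : sets WS"
 proof -
  have "(%w. cpath z w 2 r) -` B Int space WS : sets WS" using t assms(3) by (intro measurable_sets[OF cpath_measurable B]) simp
  thus ?thesis unfolding C_def vimage_def Int_def by (simp only: mem_Collect_eq conj_commute)
 qed
 have up: "fun_upd w 2 f : space WS" if "w : space WS" "f : wiener_paths" for w f using that by (simp add: space_wspace)
 have pre: "F -` (C Int N) Int space (wiener XM WS) = E \<times> N" "F -` C Int space (wiener XM WS) = E \<times> space WS"
  by (auto simp: F_def C_def N_def E_def space_pair_measure up c2 iff)
 have "{w:space WS. cpath z w 2 r : B & \<not> met z 0 w s} = C Int N" by (auto simp: C_def N_def)
 thus ?thesis using p[OF sets.Int[OF C N]] p[OF C] t[OF E N] t[OF E sets.top] unfolding pre by (simp add: C_def[symmetric] N_def[symmetric] W.prob_space)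
qed

section \<open>Events for finitely many paths\<close>

lemma AE_approx:
 assumes M: "prob_space M" and A: "!!e. 0 < e ==> EX A:sets M. measure M A <= e & (ALL x:space M - A. P x)"
 shows "AE x in M. P x"
proof -
 interpret prob_space M by (rule M)
 have "EX A. A : sets M & measure M A <= 1 / Suc n & (ALL x:space M - A. P x)" for n using A[of "1 / Suc n"] by auto
 then obtain A where A: "!!n. A n : sets M" "!!n. measure M (A n) <= 1 / Suc n" "!!n x. x : space M - A n ==> P x" by metis
 have B: "(\<Inter>n. A n) : sets M" using A(1) by (intro sets.countable_INT) auto
 have "measure M (\<Inter>n. A n) <= 0"
 proof (rule field_le_epsilon)
  fix e :: real assume "0 < e"
  then obtain n where "1 / Suc n < e" using nat_approx_posE by blast
  moreover have "measure M (\<Inter>n. A n) <= measure M (A n)" by (intro finite_measure_mono A) auto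
  ultimately show "measure M (\<Inter>n. A n) <= 0 + e" using A(2)[of n] by linarith
 qed
 hence "emeasure M (\<Inter>n. A n) = 0" by (simp add: emeasure_eq_measure ennreal_neg)
 thus ?thesis using A(3) B by (intro AE_I[of _ _ "\<Inter>n. A n"]) auto
qed

lemma paths_tval: "(%x. tval (x i) s) : borel_measurable paths" by (rule measurable_compose[OF paths_coord borel_measurable_continuous_onI[OF continuous_on_tval]])

lemma paths_event:
 assumes "Measurable.pred paths Q"
 shows "{x. Q x} : sets paths" "{w:space WS. Q (bpath z w o f)} : sets WS" "measure WS {w:space WS. Q (bpath z w o f)} = measure WS {w:space WS. Q (bpath (z o f) w)}"
proof -
 show Q: "{x. Q x} : sets paths" using predE[OF assms] by simp
 show "{w:space WS. Q (bpath z w o f)} : sets WS" by (rule predE[OF measurable_compose[OF measurable_comp_wspace assms]])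
 show "measure WS {w:space WS. Q (bpath z w o f)} = measure WS {w:space WS. Q (bpath (z o f) w)}" using prob_reindex[OF Q, of z f] by simp
qed

lemma tval_bpath_eq_iff:
 assumes "w : space WS" "snd (z i) <= s" "snd (z j) <= s"
 shows "tval (bpath z w i) s = tval (bpath z w j) s <-> cpath z w i s = cpath z w j s"
 using assms by (simp add: bpath_vals max_absorb1 inj_eq[OF strict_mono_imp_inj_on[OF tanh_real_strict_mono]])

text \<open>Reindexing by the constant map \<open>i\<close> makes the path first in its family,
  hence equal to its driver, to which the maximal inequality applies.\<close>

lemma path_deviation:
 assumes h: "0 < h" and c: "0 < c"
 shows "EX A:sets WS. measure WS A <= 6 * h\<^sup>2 / c ^ 4 &
  (ALL w:space WS - A. ALL s:{snd (z i)..snd (z i) + h}. abs (cpath z w i s - fst (z i)) <= 2 * c)"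
proof -
 obtain y t where zi: "z i = (y, t)" by (cases "z i")
 \<comment> \<open>Clamping lets rational \<open>q\<close> reach a dense part of the time interval,
   whose end points need not be rational.\<close>
 define g where "g q = t + max 0 (min h q)" for q
 have g: "g q : {t..t + h}" "s : {t..t + h} ==> g (s - t) = s" for q s using h by (auto simp: g_def)
 define Q where "Q x <-> (EX q:\<rat>. \<not> (tanh (y - 2 * c) <= tval (x 0) (g q) & tval (x 0) (g q) <= tanh (y + 2 * c)))" for x :: "nat => bw_path"
 have "Measurable.pred paths (%x. \<not> (tanh (y - 2 * c) <= tval (x 0) s & tval (x 0) s <= tanh (y + 2 * c)))" for s
  by (intro pred_intros_logic; unfold pred_def) (intro borel_measurable_le borel_measurable_const paths_tval)+
 hence Q: "Measurable.pred paths Q" unfolding Q_def by (intro pred_countable_Bex countable_rat)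
 have QD: "Q x <-> \<not> (ALL s:{t..t + h}. abs (v s - y) <= 2 * c)"
  if x: "!!s. t <= s ==> tval (x 0) s = tanh (v s)" and v: "continuous_on {t..} v" for x v
 proof -
  have "tval (x 0) (g q) = tanh (v (g q))" for q using x g(1)[of q] by simp
  hence "\<not> Q x <-> (ALL q:\<rat>. abs (v (g q) - y) <= 2 * c)" unfolding Q_def abs_le_iff by (auto simp: algebra_simps)
  also have "... <-> (ALL q. abs (v (g q) - y) <= 2 * c)"
  proof (intro iffI allI)
   fix q assume *: "ALL q:\<rat>. abs (v (g q) - y) <= 2 * c"
   have "continuous_on UNIV g" unfolding g_def by (intro continuous_intros)
   hence "continuous_on UNIV (v o g)" by (rule continuous_on_compose) (rule continuous_on_subset[OF v], use g in auto)
   hence "continuous_on (closure \<rat>) (%q. abs (v (g q) - y))" unfolding Rats_closure_real comp_def by (intro continuous_intros)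
   thus "abs (v (g q) - y) <= 2 * c" by (rule continuous_le_on_closure) (use * in \<open>simp_all add: Rats_closure_real\<close>)
  qed blast
  also have "... <-> (ALL s:{t..t + h}. abs (v s - y) <= 2 * c)" using g by metis
  finally show ?thesis by blast
 qed
 let ?A = "{w:space WS. Q (bpath z w o (%_. i))}"
 have "measure WS ?A = measure WS {w:space WS. Q (bpath (z o (%_. i)) w)}" by (rule paths_event(3)[OF Q])
 also have "{w:space WS. Q (bpath (z o (%_. i)) w)} \<subseteq> {w:space WS. EX s:{0..h}. 2 * c < abs (w 0 s)}"
 proof safe
  fix w assume w: "w : space WS" and "Q (bpath (z o (%_. i)) w)"
  then obtain s where s: "s : {t..t + h}" "2 * c < abs (cpath (z o (%_. i)) w 0 s - y)"
   using QD[of "bpath (z o (%_. i)) w" "cpath (z o (%_. i)) w 0"] cpath_cont[OF w, of "z o (%_. i)" 0] by (auto simp: bpath_vals zi not_le max_absorb1)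
  thus "EX s:{0..h}. 2 * c < abs (w 0 s)" using cpath_0[OF w, of "z o (%_. i)" s] by (intro bexI[of _ "s - t"]) (auto simp: zi drive_def)
 qed
 hence "measure WS {w:space WS. Q (bpath (z o (%_. i)) w)} <= 6 * h\<^sup>2 / c ^ 4"
  using W.finite_measure_mono[OF _ wspace_sup(1)[OF h c, of 0]] wspace_sup(2)[OF h c, of 0] by (meson order_trans)
 finally have "measure WS ?A <= 6 * h\<^sup>2 / c ^ 4" .
 moreover have "ALL s:{t..t + h}. abs (cpath z w i s - y) <= 2 * c" if "w : space WS - ?A" for w
  using that QD[of "bpath z w o (%_. i)" "cpath z w i"] cpath_cont[of w z i] by (auto simp: bpath_vals zi max_absorb1)
 ultimately show ?thesis using paths_event(2)[OF Q, of z "%_. i"] by (intro bexI[of _ ?A]) (simp_all add: zi)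
qed

lemma pair_event:
 assumes z: "z i = (x, r)" "z j = (y, r)" and xy: "x <= y" and rs: "r < s"
 shows "{w:space WS. cpath z w i s ~= cpath z w j s} : sets WS"
  "measure WS {w:space WS. cpath z w i s ~= cpath z w j s} = measure (gauss (2 * (s - r))) {-(y - x)<..y - x}"
  "measure WS {w:space WS. cpath z w i s ~= cpath z w j s} <= (y - x) / sqrt (pi * (s - r))"
proof -
 let ?f = "%k. if k = 0 then i else j" and ?Q = "%x :: nat => bw_path. tval (x 0) s ~= tval (x 1) s"
 have Q: "Measurable.pred paths ?Q" by (intro pred_intros_logic; unfold pred_def) (intro borel_measurable_eq paths_tval)
 have e: "{w:space WS. cpath z w i s ~= cpath z w j s} = {w:space WS. ?Q (bpath z w o ?f)}" using rs by (auto simp: tval_bpath_eq_iff z)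
 show "{w:space WS. cpath z w i s ~= cpath z w j s} : sets WS" unfolding e by (rule paths_event(2)[OF Q])
 have "measure WS {w:space WS. ?Q (bpath z w o ?f)} = measure WS {w:space WS. ?Q (bpath (z o ?f) w)}" by (rule paths_event(3)[OF Q])
 also have "{w:space WS. ?Q (bpath (z o ?f) w)} = {w:space WS. \<not> met (z o ?f) 0 w s}" using rs by (auto simp: tval_bpath_eq_iff z met_def)
 also have "measure WS ... = measure (gauss (2 * (s - r))) {-(y - x)<..y - x}" by (rule prob_not_met[OF _ _ xy rs]) (simp_all add: z)
 finally show p: "measure WS {w:space WS. cpath z w i s ~= cpath z w j s} = measure (gauss (2 * (s - r))) {-(y - x)<..y - x}" unfolding e .
 \<comment> \<open>The difference of two motions has variance \<open>2 * (s - r)\<close>, so the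
   factor 2 in the interval bound cancels.\<close>
 have "sqrt (2 * pi * (2 * (s - r))) = 2 * sqrt (pi * (s - r))" using real_sqrt_mult[of 4 "pi * (s - r)"] by (simp add: mult_ac)
 thus "measure WS {w:space WS. cpath z w i s ~= cpath z w j s} <= (y - x) / sqrt (pi * (s - r))"
  using gauss_interval(1)[of "2 * (s - r)" "y - x"] xy rs unfolding p by (simp only: mult_divide_mult_cancel_left) simp
qed

text \<open>The path \<open>k\<close> locates a random position at time \<open>r\<close>. Its
  independence from the pair started at \<open>r\<close> keeps the factor for the bin, so a sum over
  all bins stays small.\<close>

lemma triple_event:
 assumes z: "z i = (x, r)" "z j = (y, r)" and xy: "x <= y" and rs: "snd (z k) < r" "r < s"
 shows "measure WS {w:space WS. cpath z w k r : {a..<b} & cpath z w i s ~= cpath z w j s}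
  <= measure WS {w:space WS. cpath z w k r : {a..<b}} * ((y - x) / sqrt (pi * (s - r)))"
proof -
 let ?f = "%l :: nat. if l = 0 then i else if l = 1 then j else k"
 let ?R = "%x :: nat => bw_path. tanh a <= tval (x 2) r & \<not> tanh b <= tval (x 2) r"
 let ?Q = "%x :: nat => bw_path. ?R x & tval (x 0) s ~= tval (x 1) s"
 have R: "Measurable.pred paths ?R" by (intro pred_intros_logic; unfold pred_def) (intro borel_measurable_le borel_measurable_const paths_tval)+
 have Q: "Measurable.pred paths ?Q" by (rule pred_intros_logic(3)[OF R], intro pred_intros_logic; unfold pred_def) (intro borel_measurable_eq paths_tval)
 have iff: "?R (bpath y w o g) <-> cpath y w (g 2) r : {a..<b}" if "w : space WS" "snd (y (g 2)) <= r" for y w g using that by (simp add: bpath_vals max_absorb1 not_le)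
 let ?z = "z o ?f"
 have e1: "{w:space WS. cpath z w k r : {a..<b} & cpath z w i s ~= cpath z w j s} = {w:space WS. ?Q (bpath z w o ?f)}"
  using rs iff[of _ z ?f] by (auto simp: tval_bpath_eq_iff z)
 have e2: "{w:space WS. ?Q (bpath ?z w)} = {w:space WS. cpath ?z w 2 r : {a..<b} & \<not> met ?z 0 w s}"
  using rs iff[of _ ?z "%l. l"] by (auto simp: tval_bpath_eq_iff z met_def comp_def)
 have e3: "{w:space WS. cpath z w k r : {a..<b}} = {w:space WS. ?R (bpath z w o ?f)}" using rs iff[of _ z ?f] by auto
 have e4: "{w:space WS. ?R (bpath ?z w)} = {w:space WS. cpath ?z w 2 r : {a..<b}}" using rs iff[of _ ?z "%l. l"] by (auto simp: comp_def)
 have e5: "measure WS {w:space WS. \<not> met ?z 0 w s} <= (y - x) / sqrt (pi * (s - r))"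
  using pair_event(2,3)[of ?z 0 x r 1 y s] prob_not_met[of ?z x r y s] z xy rs by simp
 have "measure WS {w:space WS. cpath ?z w 2 r : {a..<b} & \<not> met ?z 0 w s}
  = measure WS {w:space WS. cpath ?z w 2 r : {a..<b}} * measure WS {w:space WS. \<not> met ?z 0 w s}" by (rule indep_third[of ?z x r y]) (use z rs in simp_all)
 thus ?thesis unfolding e1 paths_event(3)[OF Q, of z ?f] e2 e3 paths_event(3)[OF R, of z ?f] e4 using mult_left_mono[OF e5 measure_nonneg] by simp
qed

section \<open>The skeleton\<close>

definition rpt :: "nat => real \<times> real" where "rpt = from_nat_into (\<rat> \<times> \<rat>)"

abbreviation "rx i \<equiv> fst (rpt i)"
abbreviation "rt i \<equiv> snd (rpt i)"

lemma rpt: "inj rpt" "rx i : \<rat>" "rt i : \<rat>" "x : \<rat> ==> t : \<rat> ==> EX i. rpt i = (x, t)"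
proof -
 have "infinite (\<rat> :: real set)" using Rats_infinite .
 hence "bij_betw rpt UNIV (\<rat> \<times> \<rat>)" unfolding rpt_def
  by (intro bij_betw_from_nat_into countable_SIGMA countable_rat) (auto simp: finite_cartesian_product_iff)
 hence "inj rpt" "range rpt = \<rat> \<times> \<rat>" by (auto simp: bij_betw_def)
 moreover from this(2) have "rpt i : \<rat> \<times> \<rat>" by blast
 ultimately show "inj rpt" "rx i : \<rat>" "rt i : \<rat>" "x : \<rat> ==> t : \<rat> ==> EX i. rpt i = (x, t)"
  by (auto simp: mem_Times_iff) (metis (no_types) SigmaI imageE)
qed

text \<open>This and the following conditions quantify over rational times and natural bounds, so
  that \<open>good\<close> is an event of sequence space and holds almost surely for every sequence
  with the law of the skeleton.\<close>

definition equi :: "(nat => bw_path) => bool" where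
 "equi x <-> (ALL L k. EX m. ALL i. ALL s:\<rat>. ALL s':\<rat>. abs s <= real L --> (abs s') <= real L --> (abs (s - s')) < 1 / real (Suc m) -->
  abs (tval (x i) s - tval (x i) s') <= 1 / real (Suc k))"

definition proper :: "(nat => bw_path) => bool" where "proper x <-> (ALL i. st (x i) = ereal (rt i) & tval (x i) (rt i) = tanh (rx i)) &
  (ALL i L. EX m. ALL s:\<rat>. abs s <= real L --> (abs (tval (x i) s)) <= 1 - 1 / real (Suc m))"

definition ordered :: "(nat => bw_path) => bool" where "ordered x <-> (ALL i j. ALL s:\<rat>. ALL s':\<rat>. rt i <= s --> rt j <= s --> s <= s' -->
  tval (x i) s <= tval (x j) s --> tval (x i) s' <= tval (x j) s')"

text \<open>Paths from a bounded slice occupy finitely many positions at \<open>s\<close>, encoded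
  by representatives of bounded index to keep the condition countable.\<close>

definition fin_vals :: "(nat => bw_path) => bool" where
 "fin_vals x <-> (ALL r:\<rat>. ALL s:\<rat>. ALL A. r < s --> (EX n. ALL i. rt i = r --> (abs (rx i)) <= real A -->
  (EX j<=n. tval (x i) s = tval (x j) s)))"

text \<open>Two skeleton paths started later on either side of path \<open>i\<close> merge by time
  \<open>s\<close>; whatever is confined between them agrees with path \<open>i\<close> from then
  on.\<close>

definition squeezed :: "(nat => bw_path) => bool" where "squeezed x <-> (ALL i. ALL r:\<rat>. ALL s:\<rat>. rt i < r --> r < s --> (EX j k. rt j = r & rt k = r &
  tanh (rx j) < tval (x i) r & tval (x i) r < tanh (rx k) & tval (x j) s = tval (x k) s))"

text \<open>Supplies barriers near both infinite values, against which paths with infinite positions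
  are compared.\<close>

definition unbounded :: "(nat => bw_path) => bool" where "unbounded x <-> (ALL q:\<rat>. ALL r:\<rat>. ALL M. q < r --> (EX j k. rt j = q & rt k = q &
  tval (x j) r < tanh (- real M) & tanh (real M) < tval (x k) r))"

definition good :: "(nat => bw_path) => bool" where "good x <-> equi x & proper x & ordered x & fin_vals x & squeezed x & unbounded x"

lemma pred_cmp:
 assumes "f : borel_measurable M" "g : borel_measurable M"
 shows "Measurable.pred M (%x. f x <= (g x :: real))" "Measurable.pred M (%x. f x < g x)" "Measurable.pred M (%x. f x = g x)"
 unfolding pred_def by (rule borel_measurable_le[OF assms] borel_measurable_less[OF assms] borel_measurable_eq[OF assms])+

lemma good_measurable: "Measurable.pred paths good"
proof -
 have c: "Measurable.pred paths (%x. K)" for K by simp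
 have st: "Measurable.pred paths (%x. st (x i) = t)" for i t unfolding start_eq_iff
  by (intro pred_cmp measurable_compose[OF paths_coord borel_measurable_continuous_onI[OF continuous_on_Psi_start]] borel_measurable_const)
 note intros = c pred_intros_logic(3-5) pred_intros_countable(1,2) pred_countable_Ball[OF countable_rat]
  pred_cmp borel_measurable_abs borel_measurable_diff borel_measurable_const paths_tval
 show ?thesis unfolding good_def
 proof (intro pred_intros_logic)
  show "Measurable.pred paths equi" "Measurable.pred paths ordered" "Measurable.pred paths fin_vals" "Measurable.pred paths squeezed" "Measurable.pred paths unbounded"
   unfolding equi_def ordered_def fin_vals_def squeezed_def unbounded_def by (intro intros)+
  show "Measurable.pred paths proper" unfolding proper_def by (intro st intros)
 qed
qed

section \<open>Almost sure equicontinuity and order of the skeleton\<close>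

lemma tanh_lipschitz:
 assumes "a <= b"
 shows "tanh b - tanh a <= b - (a :: real)"
proof -
 have "a - tanh a <= b - tanh b"
 proof (rule DERIV_nonneg_imp_nondecreasing[OF assms])
  fix x :: real
  have "((%x. x - tanh x) has_real_derivative tanh x ^ 2) (at x)" using cosh_real_pos[of x] by (auto intro!: derivative_eq_intros)
  thus "EX y. ((%x. x - tanh x) has_real_derivative y) (at x) & 0 <= y" by (auto intro!: exI[of _ "tanh x ^ 2"])
 qed
 thus ?thesis by simp
qed

text \<open>Paths started on a fine grid confine all paths of the skeleton for a short time.\<close>

lemma AE_equi: "AE w in WS. equi (bpath rpt w)" unfolding equi_def
proof (subst AE_all_countable, intro allI, subst AE_all_countable, intro allI)
 fix L k :: nat
 \<comment> \<open>The comparison below is carried out with tolerance \<open>8 * h\<close>, hence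
   the factor 8.\<close>
 define h where "h = 1 / real (8 * Suc k)"
 have h: "0 < h" "h <= 1" "h : \<rat>" by (auto simp: h_def divide_le_eq)
 have kh: "1 / real (Suc k) = 8 * h" by (simp add: h_def field_simps)
 have "\<forall>\<^sub>F R in at_top. 1 - h < tanh (R :: real)" by (rule order_tendstoD(1)[OF tanh_real_at_top]) (use h in simp)
 hence "EX R>0. 1 - h < tanh (R :: real)" using eventually_conj[OF eventually_gt_at_top[of 0]] eventually_happens'[OF trivial_limit_at_top_linorder] by blast
 \<comment> \<open>Beyond \<open>R\<close> the compressed value is within \<open>h\<close> of its
   limit, so finitely many spatial grid points suffice.\<close>
 then obtain R where R: "0 < R" "1 - h < tanh (R :: real)" by blast
 define P where "P = \<lceil>(R + 2) / h\<rceil>"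
 have P: "abs j <= P" if "abs (of_int j * h) <= R + 2" for j :: int
 proof -
  have "real_of_int (abs j) <= (R + 2) / h" using that h by (simp add: pos_le_divide_eq abs_mult)
  thus ?thesis unfolding P_def by linarith
 qed
 \<comment> \<open>\<open>Q * d\<close> bounds the total failure probability: the number of grid
   positions, times at most \<open>3 * Suc L / d\<close> time slots, times
   \<open>24 * d ^ 2 / (h / 8) ^ 4\<close> for one deviation over time \<open>2 * d\<close>.\<close>
 define Q where "Q = real (card {-P..P}) * (3 * real (Suc L)) * (24 / (h / 8) ^ 4)"
 show "AE w in WS. EX m. ALL i. ALL s:\<rat>. ALL s':\<rat>. abs s <= real L --> (abs s') <= real L --> (abs (s - s')) < 1 / real (Suc m) -->
  abs (tval (bpath rpt w i) s - tval (bpath rpt w i) s') <= 1 / real (Suc k)"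
 proof (rule AE_approx[OF prob_space_wspace])
  fix e :: real assume e: "0 < e"
  obtain m :: nat where m: "Q / e < real m" using reals_Archimedean2 by blast
  define d where "d = 1 / real (Suc m)"
  have d: "0 < d" "d : \<rat>" by (auto simp: d_def)
  define K where "K = int (Suc L * Suc m)"
  define G where "G = {-P..P} \<times> {-K..K}"
  have "EX i. rpt i = (of_int j * h, of_int l * d)" for j l :: int using h d by (intro rpt(4)) auto
  then obtain b where b: "!!j l. rpt (b j l) = (of_int j * h, of_int l * d)" by metis
  define dev where "dev j l A <-> A : sets WS & measure WS A <= 6 * (2 * d)\<^sup>2 / (h / 8) ^ 4 &
   (ALL w:space WS - A. ALL s:{of_int l * d..of_int l * d + 2 * d}. abs (cpath rpt w (b j l) s - of_int j * h) <= 2 * (h / 8))" for j l A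
  have "EX A. dev j l A" for j l unfolding dev_def using path_deviation[of "2 * d" "h / 8" rpt "b j l"] d h by (auto simp: b)
  define A where "A j l = (SOME A. dev j l A)" for j l
  have "dev j l (A j l)" for j l unfolding A_def by (rule someI_ex) fact
  hence A: "A j l : sets WS" "measure WS (A j l) <= 6 * (2 * d)\<^sup>2 / (h / 8) ^ 4"
   "w : space WS - A j l ==> s : {of_int l * d..of_int l * d + 2 * d} ==> (abs (cpath rpt w (b j l) s - of_int j * h)) <= 2 * (h / 8)"
   for j l w s unfolding dev_def by blast+
  define U where "U = (\<Union>g\<in>G. A (fst g) (snd g))"
  have "measure WS U <= (SUM g:G. measure WS (A (fst g) (snd g)))"
   unfolding U_def by (rule W.finite_measure_subadditive_finite) (use A(1) in \<open>auto simp: G_def\<close>)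
  also have "... <= real (card G) * (6 * (2 * d)\<^sup>2 / (h / 8) ^ 4)" using sum_bounded_above[OF A(2)] by simp
  also have "... <= Q * d"
  proof -
   have "real (card {-K..K}) <= 3 * real (Suc L) * real (Suc m)" by (simp add: K_def algebra_simps)
   hence "real (card G) <= real (card {-P..P}) * (3 * real (Suc L) * real (Suc m))"
    by (simp only: G_def card_cartesian_product of_nat_mult) (intro mult_left_mono, simp_all)
   hence "real (card G) * (6 * (2 * d)\<^sup>2 / (h / 8) ^ 4) <= real (card {-P..P}) * (3 * real (Suc L) * real (Suc m)) * (6 * (2 * d)\<^sup>2 / (h / 8) ^ 4)"
    by (rule mult_right_mono) (use h in simp)
   also have "... = Q * (real (Suc m) * d * d)" unfolding Q_def power2_eq_square by (simp add: mult_ac del: of_nat_Suc)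
   also have "real (Suc m) * d = 1" by (simp add: d_def)
   finally show ?thesis by simp
  qed
  also have "... <= e" using m e by (simp add: d_def field_simps)
  finally have Ue: "measure WS U <= e" .
  have main: "abs (tval (bpath rpt w i) s - tval (bpath rpt w i) s') <= 8 * h"
   if w: "w : space WS - U" and s: "abs s <= real L" "s <= s'" "s' - s < d" for w i s s'
  proof (cases "s' <= rt i")
   case False
   have w': "w : space WS" using w by simp
   \<comment> \<open>The path may start inside the slot; it is constant before its start, so the
     comparison begins at \<open>u\<close>.\<close>
   define u where "u = max s (rt i)"
   define l where "l = \<lfloor>s / d\<rfloor>"
   let ?v = "cpath rpt w"
   have l: "of_int l * d <= s" "s < of_int l * d + d" using floor_divide_lower[OF d(1), of s] floor_divide_upper[OF d(1), of s] by (simp_all add: l_def algebra_simps)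
   have "abs l <= K"
   proof -
    have "s / d = s * real (Suc m)" by (simp add: d_def)
    moreover have "abs s * real (Suc m) <= real L * real (Suc m)" by (rule mult_right_mono[OF s(1)]) simp
    ultimately have "abs (s / d) <= of_int (int (L * Suc m))" by (simp only: abs_mult abs_of_nat of_nat_mult of_int_of_nat_eq of_int_mult)
    hence "abs l <= int (L * Suc m) + 1" unfolding l_def by linarith
    thus ?thesis unfolding K_def by simp
   qed
   hence bar: "abs (?v (b j l) r - of_int j * h) <= h / 4" if "abs (of_int j * h) <= R + 2" "s <= r" "r <= s'" for j r
   proof -
    have "(j, l) : G" using P[OF that(1)] \<open>\<bar>l\<bar> <= K\<close> by (simp add: G_def abs_le_iff)
    hence "w : space WS - A j l" using w by (force simp: U_def)
    from A(3)[OF this] that l s show ?thesis by simp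
   qed
   have u: "s <= u" "u <= s'" "rt i <= u" using False s by (auto simp: u_def)
   have nc: "?v p s' <= ?v q s'" if "?v p u <= ?v q u" "rt p <= u" "rt q <= u" for p q
    by (rule coal_noncrossing[OF coal_cpath[OF w', of rpt "Suc (max p q)"] _ _ that(2,3,1) u(2)]) auto
   have bl: "rt (b j l) <= u" for j using l(1) u(1) by (simp add: b)
   define y where "y = ?v i u"
   define y' where "y' = ?v i s'"
   have rest: "tanh y <= 1" "- 1 <= tanh y" "tanh y' <= 1" "- 1 <= tanh y'" using tanh_real_bounds'[of y] tanh_real_bounds'[of y'] by auto
   have lo: "tanh y - tanh y' <= 8 * h"
   proof (cases "- R <= y")
    case True
    define c where "c = min y R"
    \<comment> \<open>The grid path starts between one and two steps below \<open>c\<close> and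
      moves by at most \<open>h / 4\<close>: it is below the path at \<open>u\<close> and above
      \<open>c - 3 * h\<close> at \<open>s'\<close>.\<close>
    define j where "j = \<lfloor>c / h\<rfloor> - 1"
    have j: "of_int j * h <= c - h" "c - 2 * h < of_int j * h"
     using floor_divide_lower[OF h(1), of c] floor_divide_upper[OF h(1), of c] by (simp_all add: j_def algebra_simps)
    have jR: "abs (of_int j * h) <= R + 2" using j True h R by (auto simp: c_def abs_le_iff)
    have "?v (b j l) u <= y" "c - 3 * h <= ?v (b j l) s'" using bar[OF jR u(1,2)] bar[OF jR s(2) order_refl] j h unfolding c_def by linarith+
    hence "c - 3 * h <= y'" using nc[of "b j l" i] bl u by (force simp: y_def y'_def)
    hence "tanh c - tanh y' <= 3 * h" using tanh_lipschitz[of "c - 3 * h" c] h tanh_real_le_iff[of "c - 3 * h" y'] by linarith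
    moreover have "tanh y - tanh c <= h" using R rest h by (auto simp: c_def min_def)
    ultimately show ?thesis using h by linarith
   next
    case False
    hence "tanh y <= - tanh R" using tanh_real_le_iff[of y "- R"] by simp
    thus ?thesis using R rest h by linarith
   qed
   have hi: "tanh y' - tanh y <= 8 * h"
   proof (cases "y <= R")
    case True
    define c where "c = max y (- R)"
    define j where "j = \<lceil>c / h\<rceil> + 1"
    have j: "c + h <= of_int j * h" "of_int j * h < c + 2 * h"
     using ceiling_divide_upper[OF h(1), of c] ceiling_divide_lower[OF h(1), of c] by (simp_all add: j_def algebra_simps)
    have jR: "abs (of_int j * h) <= R + 2" using j True h R by (auto simp: c_def abs_le_iff)
    have "y <= ?v (b j l) u" "?v (b j l) s' <= c + 3 * h" using bar[OF jR u(1,2)] bar[OF jR s(2) order_refl] j h unfolding c_def by linarith+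
    hence "y' <= c + 3 * h" using nc[of i "b j l"] bl u by (force simp: y_def y'_def)
    hence "tanh y' - tanh c <= 3 * h" using tanh_lipschitz[of c "c + 3 * h"] h tanh_real_le_iff[of y' "c + 3 * h"] by linarith
    moreover have "tanh c - tanh y <= h" using R rest h by (auto simp: c_def max_def)
    ultimately show ?thesis using h by linarith
   next
    case False
    hence "tanh R <= tanh y" using tanh_real_le_iff[of R y] by simp
    thus ?thesis using R rest h by linarith
   qed
   have "tval (bpath rpt w i) s = tanh y" "tval (bpath rpt w i) s' = tanh y'" using u False by (simp_all add: bpath_vals[OF w'] y_def y'_def u_def max_absorb1)
   thus ?thesis using lo hi by (simp add: abs_le_iff)
  next
   case True
   thus ?thesis using w s h by (simp add: bpath_vals max_absorb2)
  qed
  have "abs (tval (bpath rpt w i) s - tval (bpath rpt w i) s') <= 8 * h"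
   if "w : space WS - U" "abs s <= real L" "abs s' <= real L" "abs (s - s') < d" for w i s s'
   using main[of w s s' i] main[of w s' s i] that by (cases "s <= s'") (auto simp: abs_minus_commute)
  moreover have "U : sets WS" unfolding U_def G_def using A(1) by (intro sets.finite_UN) auto
  ultimately show "EX A:sets WS. measure WS A <= e & (ALL w:space WS - A. EX m. ALL i. ALL s:\<rat>. ALL s':\<rat>. abs s <= real L --> (abs s') <= real L -->
   abs (s - s') < 1 / real (Suc m) --> (abs (tval (bpath rpt w i) s - tval (bpath rpt w i) s')) <= 1 / real (Suc k))"
   using Ue unfolding kh by (intro bexI[of _ U] conjI ballI exI[of _ m]) (simp_all add: d_def)
 qed
qed

lemma proper_bpath:
 assumes "w : space WS"
 shows "proper (bpath rpt w)" unfolding proper_def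
proof (intro conjI allI)
 fix i show "st (bpath rpt w i) = ereal (rt i)" "tval (bpath rpt w i) (rt i) = tanh (rx i)"
  by (simp_all add: bpath_vals[OF assms] cpath_start[OF assms])
 fix L :: nat
 have "continuous_on {- real L..real L} (%s. abs (tval (bpath rpt w i) s))" by (intro continuous_intros continuous_on_subset[OF continuous_tval]) auto
 from continuous_attains_sup[OF compact_Icc _ this]
 obtain r where r: "ALL s:{- real L..real L}. abs (tval (bpath rpt w i) s) <= abs (tval (bpath rpt w i) r)" by auto
 have "abs (tanh y) < 1" for y :: real using tanh_real_bounds'[of y] by linarith
 hence "abs (tval (bpath rpt w i) r) < 1" by (simp add: bpath_vals[OF assms])
 then obtain m where m: "1 / real (Suc m) < 1 - abs (tval (bpath rpt w i) r)" using nat_approx_posE[of "1 - abs (tval (bpath rpt w i) r)"] by auto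
 have "abs (tval (bpath rpt w i) s) <= 1 - 1 / real (Suc m)" if "abs s <= real L" for s using bspec[OF r, of s] that m by (simp add: abs_le_iff)
 thus "EX m. ALL s:\<rat>. abs s <= real L --> (abs (tval (bpath rpt w i) s)) <= 1 - 1 / real (Suc m)" by blast
qed

lemma ordered_bpath:
 assumes "w : space WS"
 shows "ordered (bpath rpt w)" unfolding ordered_def
proof (intro allI ballI impI)
 fix i j s s' assume *: "rt i <= s" "rt j <= s" "s <= s'" "tval (bpath rpt w i) s <= tval (bpath rpt w j) s"
 hence "cpath rpt w i s <= cpath rpt w j s" by (simp add: bpath_vals[OF assms] max_absorb1)
 from coal_noncrossing[OF coal_cpath[OF assms, of rpt "Suc (max i j)"] _ _ *(1,2) this *(3)] *
 show "tval (bpath rpt w i) s' <= tval (bpath rpt w j) s'" by (simp add: bpath_vals[OF assms] max_absorb1)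
qed

section \<open>Counting the skeleton\<close>

text \<open>Each value is counted at its smallest index, which makes the count a measurable
  series.\<close>

lemma count_image:
 fixes f :: "nat => 'b"
 shows "cnt (f ` I) = (\<Sum>i. if i : I & (ALL j<i. j : I --> f j ~= f i) then 1 else 0)"
proof -
 define B where "B i = (if i : I & (ALL j<i. j : I --> f j ~= f i) then {f i} else {})" for i
 have "f ` I = (\<Union>i. B i)"
 proof (intro equalityI subsetI)
  fix y assume "y : f ` I"
  then obtain i where i: "i : I & f i = y" by blast
  define k where "k = (LEAST i. i : I & f i = y)"
  have "k : I & f k = y" "!!j. j < k ==> \<not> (j : I & f j = y)" unfolding k_def using i by (rule LeastI) (rule not_less_Least)
  thus "y : (\<Union>i. B i)" by (intro UN_I[of k]) (auto simp: B_def)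
 qed (auto simp: B_def split: if_splits)
 moreover have "disjoint_family B" unfolding disjoint_family_on_def
 proof (intro ballI impI)
  fix i j :: nat assume "i ~= j"
  then consider "i < j" | "j < i" by linarith
  thus "B i Int B j = {}" by cases (auto simp: B_def)
 qed
 ultimately have "cnt (f ` I) = (\<Sum>i. cnt (B i))" by (simp add: suminf_emeasure)
 also have "... = (\<Sum>i. if i : I & (ALL j<i. j : I --> f j ~= f i) then 1 else 0)" by (intro suminf_cong) (simp add: B_def)
 finally show ?thesis .
qed

lemma count_image_measurable: "(%x. cnt ((%i. tval (x i) T) ` I)) : borel_measurable paths" unfolding count_image
proof (intro borel_measurable_suminf_order measurable_If borel_measurable_const)
 fix i :: nat
 have "Measurable.pred paths (%x. i : I & (ALL j. j < i --> j : I --> tval (x j) T ~= tval (x i) T))"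
  by (intro pred_intros_conj1' pred_intros_countable pred_intros_imp' pred_intros_logic(2) pred_cmp paths_tval)
 thus "{x:space paths. i : I & (ALL j<i. j : I --> tval (x j) T ~= tval (x i) T)} : sets paths" by (rule predE)
qed

definition slice :: "real => real => real => nat set" where "slice r A B = {i. rt i = r & A <= rx i & rx i <= B}"

text \<open>Insert the points from left to right. A new position appears only if the new path has
  not merged with its left neighbour, and the distances between neighbours telescope.\<close>

lemma expected_count_finite:
 assumes rT: "r < T" and J: "finite J" and JAB: "J \<subseteq> slice r A B" and AB: "A <= B"
 shows "(nn_integral WS (%w. cnt ((%i. tval (bpath rpt w i) T) ` J))) <= ennreal (1 + (B - A) / sqrt (pi * (T - r)))" using J JAB AB
proof (induction J arbitrary: B rule: finite_ranking_induct[where f=rx])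
 case empty
 thus ?case by simp
next
 case (insert i J)
 let ?c = "sqrt (pi * (T - r))" and ?f = "%w i. tval (bpath rpt w i) T"
 have c: "0 < ?c" using rT by simp
 show ?case
 proof (cases "J = {}")
  case True
  have "ennreal 1 <= ennreal (1 + (B - A) / ?c)" using c insert.prems by (intro ennreal_leI) simp
  thus ?thesis using True by (simp add: W.emeasure_space_1 del: ennreal_plus)
 next
  case False
  define B' where "B' = Max (rx ` J)"
  have "B' : rx ` J" using False insert.hyps(1) by (simp add: B'_def)
  then obtain j where j: "j : J" "rx j = B'" by blast
  have sl: "rt i = r" "rx i <= B" "rt j = r" "A <= B'" "J \<subseteq> slice r A B'" using insert.prems j insert.hyps(1) by (auto simp: slice_def B'_def)
  have ji: "B' <= rx i" using insert.hyps(2)[OF j(1)] j(2) by simp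
  let ?D = "{w:space WS. cpath rpt w j T ~= cpath rpt w i T}"
  have zz: "rpt j = (B', r)" "rpt i = (rx i, r)" using sl j by (simp_all add: prod_eq_iff)
  note D = pair_event[OF zz ji rT]
  have "(nn_integral WS (%w. cnt (?f w ` insert i J)))
   <= (nn_integral WS (%w. cnt (?f w ` J) + indicator ?D w))"
  proof (rule nn_integral_mono)
   fix w assume w: "w : space WS"
   show "cnt (?f w ` insert i J) <= cnt (?f w ` J) + indicator ?D w"
   proof (cases "?f w i : ?f w ` J")
    case True thus ?thesis by (simp add: insert_absorb)
   next
    case False
    hence "?f w j ~= ?f w i" using j(1) by (metis imageI)
    hence "w : ?D" using w tval_bpath_eq_iff[OF w, of rpt j T i] rT sl by simp
    thus ?thesis using False insert.hyps(1) by (simp add: emeasure_count_space_finite add.commute)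
   qed
  qed
  also have "... = (nn_integral WS (%w. cnt (?f w ` J))) + emeasure WS ?D"
   using measurable_compose[OF bpaths_measurable count_image_measurable] D(1) by (simp add: nn_integral_add)
  also have "... <= ennreal (1 + (B' - A) / ?c) + ennreal ((rx i - B') / ?c)"
   using insert.IH[OF sl(5,4)] D(3) by (intro add_mono) (simp_all add: W.emeasure_eq_measure ennreal_leI)
  also have "... = ennreal (1 + (rx i - A) / ?c)" using ji divide_right_mono[OF sl(4), of ?c] divide_right_mono[OF ji, of ?c] c
   by (subst ennreal_plus[symmetric]) (simp_all add: diff_divide_distrib)
  also have "... <= ennreal (1 + (B - A) / ?c)" using sl c by (intro ennreal_leI) (simp add: divide_right_mono)
  finally show ?thesis .
 qed
qed

lemma expected_count:
 assumes rT: "r < T" and AB: "A <= B"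
 shows "(nn_integral WS (%w. cnt ((%i. tval (bpath rpt w i) T) ` slice r A B))) <= ennreal (1 + (B - A) / sqrt (pi * (T - r)))"
proof -
 let ?J = "%n. slice r A B Int {..n :: nat}" and ?f = "%w i. tval (bpath rpt w i) T"
 have sup: "cnt (f ` slice r A B) = (SUP n. cnt (f ` ?J n))" for f :: "nat => real"
 proof -
  have "f ` slice r A B = (\<Union>n. f ` ?J n)" by auto
  thus ?thesis by (simp only:) (rule SUP_emeasure_incseq[symmetric], auto simp: incseq_def)
 qed
 have "(nn_integral WS (%w. cnt (?f w ` slice r A B))) = (SUP n. nn_integral WS (%w. cnt (?f w ` ?J n)))"
  unfolding sup by (rule nn_integral_monotone_convergence_SUP[OF _ measurable_compose[OF bpaths_measurable count_image_measurable]])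
   (intro incseq_SucI le_funI emeasure_mono image_mono, auto)
 also have "... <= ennreal (1 + (B - A) / sqrt (pi * (T - r)))" by (intro SUP_least expected_count_finite rT AB) auto
 finally show ?thesis .
qed

text \<open>A finite expectation makes the number of positions finite almost surely, and finitely
  many positions have representatives of bounded index.\<close>

lemma AE_fin_vals: "AE w in WS. fin_vals (bpath rpt w)"
proof -
 have *: "AE w in WS. r < s --> (EX n. ALL i. rt i = r --> (abs (rx i)) <= real A --> (EX j<=n. tval (bpath rpt w i) s = tval (bpath rpt w j) s))" for r s and A :: nat
 proof (cases "r < s")
  case True
  let ?I = "slice r (- real A) (real A)" and ?f = "%w i. tval (bpath rpt w i) s"
  have "(nn_integral WS (%w. cnt (?f w ` ?I))) ~= \<infinity>" using expected_count[OF True, of "- real A" "real A"] by (auto simp: top_unique)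
  hence "AE w in WS. cnt (?f w ` ?I) ~= \<infinity>" by (rule nn_integral_PInf_AE[OF measurable_compose[OF bpaths_measurable count_image_measurable]])
  thus ?thesis
  proof (eventually_elim)
   fix w assume "cnt (?f w ` ?I) ~= \<infinity>"
   hence "finite (?f w ` ?I)" by (auto simp: emeasure_count_space split: if_splits)
   from finite_subset_image[OF this order_refl] obtain C where C: "C \<subseteq> ?I" "finite C" "?f w ` ?I = ?f w ` C" by blast
   have "EX j<=Max (insert 0 C). ?f w i = ?f w j" if "i : ?I" for i
   proof -
    have "?f w i : ?f w ` C" using that C(3) by blast
    then obtain j where "j : C" "?f w i = ?f w j" by blast
    thus ?thesis using C(2) by (intro exI[of _ j]) auto
   qed
   thus "r < s --> (EX n. ALL i. rt i = r --> (abs (rx i)) <= real A --> (EX j<=n. ?f w i = ?f w j))"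
    by (intro impI exI[of _ "Max (insert 0 C)"]) (auto simp: slice_def abs_le_iff)
  qed
 qed simp
 show ?thesis unfolding fin_vals_def using * by (simp add: AE_ball_countable countable_rat AE_all_countable)
qed

lemma AE_unbounded: "AE w in WS. unbounded (bpath rpt w)"
proof -
 have *: "AE w in WS. q < r --> (EX j k. rt j = q & rt k = q & tval (bpath rpt w j) r < tanh (- real M) & tanh (real M) < tval (bpath rpt w k) r)"
  if q: "q : \<rat>" for q r and M :: nat
 proof (cases "q < r")
  case True
  show ?thesis
  proof (rule AE_approx[OF prob_space_wspace])
   fix e :: real assume e: "0 < e"
   define h where "h = r - q"
   obtain c :: nat where c: "12 * h\<^sup>2 / e < real c" using reals_Archimedean2 by blast
   have h: "0 < h" using True by (simp add: h_def)
   have "0 <= 12 * h\<^sup>2 / e" using e by simp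
   hence c0: "0 < real c" using c by linarith
   have "6 * h\<^sup>2 / real c ^ 4 <= 6 * h\<^sup>2 / real c" using c0 by (intro divide_left_mono) (auto simp: power_numeral_reduce mult_ge1_I)
   also have "... <= e / 2" using c c0 e by (simp add: field_simps)
   finally have small: "6 * h\<^sup>2 / real c ^ 4 <= e / 2" .
   \<comment> \<open>Starts beyond \<open>M\<close> by more than the admissible deviation
     \<open>2 * c\<close>.\<close>
   obtain j k where jk: "rpt j = (- real M - 2 * c - 1, q)" "rpt k = (real M + 2 * c + 1, q)"
    using rpt(4)[OF _ q, of "- real M - 2 * c - 1"] rpt(4)[OF _ q, of "real M + 2 * c + 1"] by auto
   obtain A B where A: "A : sets WS" "measure WS A <= e / 2" "!!w. w : space WS - A ==> (abs (cpath rpt w j r - rx j)) <= 2 * c"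
    and B: "B : sets WS" "measure WS B <= e / 2" "!!w. w : space WS - B ==> (abs (cpath rpt w k r - rx k)) <= 2 * c"
    using path_deviation[OF h c0, of rpt j] path_deviation[OF h c0, of rpt k] small True h_def jk by fastforce
   have "measure WS (A Un B) <= e" using A(1,2) B(1,2) measure_Un_le[OF A(1) B(1)] by linarith
   moreover have "tval (bpath rpt w j) r < tanh (- real M) & tanh (real M) < tval (bpath rpt w k) r" if "w : space WS - (A Un B)" for w
   proof -
    have "cpath rpt w j r < - real M" "real M < cpath rpt w k r" using A(3)[of w] B(3)[of w] that jk by (auto simp: abs_le_iff)
    moreover have "w : space WS" using that by simp
    ultimately show ?thesis using True jk by (simp add: bpath_vals max_absorb1 del: tanh_minus)
   qed
   ultimately show "EX A:sets WS. measure WS A <= e & (ALL w:space WS - A. q < r -->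
    (EX j k. rt j = q & rt k = q & tval (bpath rpt w j) r < tanh (- real M) & tanh (real M) < tval (bpath rpt w k) r))"
    using A(1) B(1) jk by (intro bexI[of _ "A Un B"] conjI ballI impI exI[of _ j] exI[of _ k]) auto
  qed
 qed simp
 show ?thesis unfolding unbounded_def using * by (simp add: AE_ball_countable countable_rat AE_all_countable)
qed

text \<open>Space at time \<open>r\<close> is cut into bins of width \<open>h\<close>. The path
  falls into one bin, and the grid paths around that bin fail to merge by \<open>s\<close> with
  conditional probability at most \<open>h * C\<close>, whatever the bin; summing over all bins
  keeps this bound, which is small with \<open>h\<close>.\<close>

lemma AE_squeezed: "AE w in WS. squeezed (bpath rpt w)"
proof -
 let ?P = "%i r s w. rt i < r --> r < s --> (EX j k. rt j = r & rt k = r &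
  tanh (rx j) < tval (bpath rpt w i) r & tval (bpath rpt w i) r < tanh (rx k) & tval (bpath rpt w j) s = tval (bpath rpt w k) s)"
 have *: "AE w in WS. ?P i r s w" if r: "r : \<rat>" for i r s
 proof (cases "rt i < r & r < s")
  case True
  show ?thesis
  proof (rule AE_approx[OF prob_space_wspace])
   fix e :: real assume e: "0 < e"
   \<comment> \<open>The grid paths around a bin start \<open>2 * h\<close> apart, hence the factor
     2.\<close>
   define C where "C = 2 / sqrt (pi * (s - r))"
   have C: "0 < C" using True by (simp add: C_def)
   obtain m where m: "1 / real (Suc m) < e / C" using nat_approx_posE[of "e / C"] e C by auto
   define h where "h = 1 / real (Suc m)"
   have h: "0 < h" "h * C < e" using m C by (auto simp: h_def field_simps)
   have "EX j. rpt j = (of_int l * h, r)" for l :: int using r by (intro rpt(4)) (auto simp: h_def)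
   then obtain b where b: "!!l :: int. rpt (b l) = (of_int l * h, r)" by metis
   define G where "G n = {w:space WS. cpath rpt w i r : {of_int (int_decode n) * h..<of_int (int_decode n + 1) * h}}" for n
   define A where "A n = {w:space WS. cpath rpt w i r : {of_int (int_decode n) * h..<of_int (int_decode n + 1) * h} &
    cpath rpt w (b (int_decode n - 1)) s ~= cpath rpt w (b (int_decode n + 1)) s}" for n
   have vm: "(%w. cpath rpt w i r) : borel_measurable WS" using True by (intro cpath_measurable) simp
   have G: "G n : sets WS" for n using measurable_sets[OF vm, of "{of_int (int_decode n) * h..<of_int (int_decode n + 1) * h}"]
    unfolding G_def vimage_def Int_def by (simp only: mem_Collect_eq conj_commute) simp
   have hh: "of_int (int_decode n - 1) * h <= of_int (int_decode n + 1) * h" for n using h by simp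
   have A: "A n : sets WS" "emeasure WS (A n) <= ennreal (h * C) * emeasure WS (G n)" for n
   proof -
    have "A n = G n Int {w:space WS. cpath rpt w (b (int_decode n - 1)) s ~= cpath rpt w (b (int_decode n + 1)) s}" unfolding A_def G_def by auto
    thus "A n : sets WS" using pair_event(1)[OF b b hh, of s] True G by (simp only:) (intro sets.Int, auto)
    have "of_int (int_decode n + 1) * h - of_int (int_decode n - 1) * h = 2 * h" by (simp add: algebra_simps)
    hence "measure WS (A n) <= measure WS (G n) * (2 * h / sqrt (pi * (s - r)))"
     using triple_event[OF b b hh[of n], of i s "of_int (int_decode n) * h" "of_int (int_decode n + 1) * h"] True unfolding A_def G_def by simp
    also have "... = h * C * measure WS (G n)" by (simp add: C_def)
    finally show "emeasure WS (A n) <= ennreal (h * C) * emeasure WS (G n)" using h C by (simp add: W.emeasure_eq_measure ennreal_mult[symmetric])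
   qed
   have "emeasure WS (\<Union>n. A n) <= (\<Sum>n. emeasure WS (A n))" by (rule emeasure_subadditive_countably) (use A(1) in auto)
   also have "... <= (\<Sum>n. ennreal (h * C) * emeasure WS (G n))" by (intro suminf_le A(2)) auto
   also have "... = ennreal (h * C) * (\<Sum>n. emeasure WS (G n))" by simp
   also have "(\<Sum>n. emeasure WS (G n)) = emeasure WS (\<Union>n. G n)"
   proof (rule suminf_emeasure)
    have "l = l'" if "of_int l * h <= v" "v < of_int (l + 1) * h" "of_int l' * h <= v" "v < of_int (l' + 1) * h" for l l' :: int and v
    proof -
     have "of_int l * h < of_int (l' + 1) * h" "of_int l' * h < of_int (l + 1) * h" using that by linarith+
     hence "l < l' + 1" "l' < l + 1" using h(1) by (simp_all only: mult_less_cancel_right_pos of_int_less_iff)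
     thus ?thesis by simp
    qed
    thus "disjoint_family G" unfolding disjoint_family_on_def G_def by (auto dest!: arg_cong[where f=int_encode]) (metis int_decode_inverse)
   qed (use G in auto)
   also have "ennreal (h * C) * emeasure WS (\<Union>n. G n) <= ennreal (h * C) * 1" by (intro mult_left_mono W.emeasure_le_1) simp
   finally have Ae: "measure WS (\<Union>n. A n) <= e" using h C by (simp add: W.emeasure_eq_measure)
   have "?P i r s w" if w: "w : space WS - (\<Union>n. A n)" for w
   proof (intro impI)
    let ?v = "cpath rpt w i r"
    define l where "l = \<lfloor>?v / h\<rfloor>"
    have l: "of_int l * h <= ?v" "?v < of_int (l + 1) * h" using floor_divide_lower[OF h(1), of ?v] floor_divide_upper[OF h(1), of ?v] by (simp_all add: l_def)
    have w': "w : space WS" using w by simp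
    have "w ~: A (int_encode l)" using w by blast
    hence "cpath rpt w (b (l - 1)) s = cpath rpt w (b (l + 1)) s" using l w' by (simp add: A_def)
    moreover have "of_int (l - 1) * h < ?v" using l(1) h(1) by (simp add: algebra_simps)
    ultimately show "EX j k. rt j = r & rt k = r & tanh (rx j) < tval (bpath rpt w i) r & tval (bpath rpt w i) r < tanh (rx k) &
     tval (bpath rpt w j) s = tval (bpath rpt w k) s" using l True by (intro exI[of _ "b (l - 1)"] exI[of _ "b (l + 1)"]) (simp add: b bpath_vals[OF w'] max_absorb1)
   qed
   thus "EX A:sets WS. measure WS A <= e & (ALL w:space WS - A. ?P i r s w)" using Ae A(1) by (intro bexI[of _ "\<Union>n. A n"]) auto
  qed
 next
  case False
  hence "?P i r s w" for w by blast
  thus ?thesis by (intro AE_I2)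
 qed
 show ?thesis unfolding squeezed_def using * by (simp add: AE_ball_countable countable_rat AE_all_countable)
qed

lemma AE_good_bpath: "AE w in WS. good (bpath rpt w)" using AE_space AE_equi AE_fin_vals AE_unbounded AE_squeezed
proof eventually_elim
 case (elim w)
 thus ?case by (simp add: good_def proper_bpath ordered_bpath)
qed

lemma AE_good: "AE x in skel_law rpt. good x" unfolding skel_law_def
 by (subst AE_distr_iff[OF bpaths_measurable]) (use predE[OF good_measurable] AE_good_bpath in simp_all)

section \<open>The closure of a good skeleton\<close>

lemma rat_right:
 fixes f :: "real => real"
 assumes f: "continuous_on UNIV f" and R: "!!q. q : \<rat> ==> a < q ==> 0 <= f q" and s: "a <= s"
 shows "0 <= f s"
proof (rule ccontr)
 assume "\<not> 0 <= f s"
 hence "open {q. f q < 0}" "s : {q. f q < 0}" using f by (auto intro: open_Collect_less)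
 then obtain e where e: "0 < e" "!!q. dist q s < e ==> f q < 0" unfolding open_dist by blast
 obtain q where "q : \<rat>" "s < q" "q < s + e" using Rats_dense_in_real[of s "s + e"] e(1) by auto
 thus False using R[of q] e(2)[of q] s by (simp add: dist_real_def)
qed

lemma tanh_rat:
 assumes "a < b" "- 1 < b" "a < 1"
 obtains X :: real where "X : \<rat>" "a < tanh X" "tanh X < b"
proof -
 obtain c where c: "max a (- 1) < c" "c < min b 1" using dense[of "max a (- 1)" "min b 1"] assms by auto
 obtain c' where c': "c < c'" "c' < min b 1" using dense c(2) by blast
 have t: "tanh (artanh c) = c" "tanh (artanh c') = c'" using c c' by (auto intro!: tanh_artanh_real simp: abs_less_iff)
 hence "artanh c < artanh c'" using c' by (metis tanh_real_less_iff)
 then obtain X where X: "X : \<rat>" "artanh c < X" "X < artanh c'" using Rats_dense_in_real by blast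
 hence "c < tanh X" "tanh X < c'" using t by (metis tanh_real_less_iff)+
 thus ?thesis using that[of X] X(1) c c' by auto
qed

lemma tval_tendsto:
 assumes "(%n. P n) ----> q" "u ----> s"
 shows "(%n. tval (P n) (u n)) ----> tval q s"
proof -
 have "(%n. tval (P n) (u n) - tval q (u n)) ----> 0"
 proof (rule tendsto_rabs_zero_cancel, rule tendsto_sandwich[of "%_. 0" _ _ "%n. dist (P n) q * (1 + abs (u n))"])
  have "(%n. dist (P n) q) ----> 0" using assms(1) by (simp add: tendsto_dist_iff[symmetric])
  from tendsto_mult[OF this tendsto_add[OF tendsto_const tendsto_rabs[OF assms(2)]], of 1]
  show "(%n. dist (P n) q * (1 + abs (u n))) ----> 0" by simp
 qed (simp_all add: tval_dist)
 moreover have "(%n. tval q (u n)) ----> tval q s" by (rule continuous_on_tendsto_compose[OF continuous_tval assms(2)]) auto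
 ultimately show ?thesis using tendsto_add by fastforce
qed

lemma start_tendsto: "P ----> q ==> (%n. Psi (st (P n))) ----> Psi (st q)" by (rule continuous_on_tendsto_compose[OF continuous_on_Psi_start]) auto

lemma Psi_less: "Psi s < Psi t <-> s < t" by (simp add: Psi_def tanh_ereal_less_iff)

context
 fixes x :: "nat => bw_path"
 assumes good: "good x"
begin

definition K0 :: "bw_path set" where "K0 = closure (range x)"

lemma x_start: "st (x i) = ereal (rt i)" and x_pos: "tval (x i) (rt i) = tanh (rx i)" using good by (auto simp: good_def proper_def)

lemma x_real: "abs (tval (x i) s) < 1"
proof -
 obtain L :: nat where L: "abs s < real L" using reals_Archimedean2 by blast
 obtain m where m: "!!q. q : \<rat> ==> (abs q) <= real L ==> (abs (tval (x i) q)) <= 1 - 1 / real (Suc m)" using good unfolding good_def proper_def by blast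
 have "0 <= max (1 - 1 / real (Suc m) - abs (tval (x i) s)) (abs s - real L)"
 proof (rule rat_right[of "%s. max (1 - 1 / real (Suc m) - abs (tval (x i) s)) (abs s - real L)" s])
  show "continuous_on UNIV (%s. max (1 - 1 / real (Suc m) - abs (tval (x i) s)) (abs s - real L))" by (intro continuous_intros continuous_tval)
  show "0 <= max (1 - 1 / real (Suc m) - abs (tval (x i) q)) (abs q - real L)" if "q : \<rat>" for q using m[OF that] by linarith
 qed simp
 moreover have "0 < 1 / real (Suc m)" by simp
 ultimately show ?thesis using L by linarith
qed

lemma x_ordered_rat:
 assumes "r : \<rat>" "rt i <= r" "rt j <= r" "tval (x i) r <= tval (x j) r" "r <= s"
 shows "tval (x i) s <= tval (x j) s"
proof -
 have "0 <= tval (x j) s - tval (x i) s"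
 proof (rule rat_right[OF _ _ assms(5)])
  show "continuous_on UNIV (%s. tval (x j) s - tval (x i) s)" by (intro continuous_intros continuous_tval)
  show "0 <= tval (x j) q - tval (x i) q" if "q : \<rat>" "r < q" for q
  proof -
   have "ordered x" using good by (simp add: good_def)
   from this[unfolded ordered_def, rule_format, of r q i j] assms that show ?thesis by simp
  qed
 qed
 thus ?thesis by simp
qed

text \<open>A strict inequality persists for a moment, so it can be moved from the real time
  \<open>u\<close> to a rational one.\<close>

lemma x_ordered:
 assumes u: "rt i <= u" "rt j <= u" "tval (x i) u < tval (x j) u" "u <= s"
 shows "tval (x i) s <= tval (x j) s"
proof (cases "u = s")
 case False
 have "open {q. tval (x i) q < tval (x j) q}" by (intro open_Collect_less continuous_tval)
 then obtain e where e: "0 < e" "!!q. dist q u < e ==> tval (x i) q < tval (x j) q" unfolding open_dist using u(3) by blast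
 have "u < min s (u + e)" using u(4) False e(1) by simp
 from Rats_dense_in_real[OF this] obtain q where q: "q : \<rat>" "u < q" "q < min s (u + e)" by blast
 have "tval (x i) q < tval (x j) q" by (rule e(2)) (use q in \<open>simp add: dist_real_def\<close>)
 thus ?thesis by - (rule x_ordered_rat[OF q(1)]; use q u(1,2) in simp)
qed (use u in simp)

lemma K0_seq:
 assumes "q : K0"
 obtains k where "(%n. x (k n)) ----> q"
proof -
 have "EX P. (ALL n. P n : range x) & P ----> q" using assms unfolding K0_def closure_sequential .
 then obtain P where P: "(ALL n. P n : range x) & P ----> q" ..
 hence "EX i. P n = x i" for n by blast
 then obtain k where "!!n. P n = x (k n)" by metis
 hence "P = (%n. x (k n))" by blast
 thus ?thesis using that[of k] P by simp
qed

text \<open>The approximating skeleton paths may start slightly after \<open>u\<close>. They are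
  compared at \<open>w n\<close>, the later of \<open>u\<close> and their start, which tends to
  \<open>u\<close>; there the strict inequality eventually holds. The sign \<open>c\<close> covers
  both directions.\<close>

lemma K0_ordered:
 assumes q: "q : K0" "st q <= ereal u" and d: "rt d <= u" and c: "c = 1 | c = - 1" and lt: "c * tval (x d) u < c * tval q u" and s: "u <= s"
 shows "c * tval (x d) s <= c * tval q s"
proof (cases "u = s")
 case False
 hence us: "u < s" using s by simp
 obtain k where k: "(%n. x (k n)) ----> q" using K0_seq[OF q(1)] .
 define w where "w n = max u (rt (k n))" for n
 have early: "\<forall>\<^sub>F n in sequentially. w n < a" if "u < a" for a
 proof -
  have "Psi (st q) < Psi a" using q(2) that unfolding Psi_less by (simp add: le_less_trans)
  from order_tendstoD(2)[OF start_tendsto[OF k] this] show ?thesis by eventually_elim (use that in \<open>simp add: x_start Psi_less w_def\<close>)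
 qed
 have w: "w ----> u"
 proof (rule order_tendstoI)
  show "\<forall>\<^sub>F n in sequentially. a < w n" if "a < u" for a using that by (simp add: w_def max_def)
 qed (rule early)
 have "(%n. c * tval (x d) (w n)) ----> c * tval (x d) u" "(%n. c * tval (x (k n)) (w n)) ----> c * tval q u" by (intro tendsto_intros tval_tendsto w k)+
 from order_tendstoD(1)[OF tendsto_diff[OF this(2,1)], of 0] lt
 have "\<forall>\<^sub>F n in sequentially. c * tval (x d) (w n) < c * tval (x (k n)) (w n)" by simp
 with early[OF us] have "\<forall>\<^sub>F n in sequentially. c * tval (x d) s <= c * tval (x (k n)) s"
 proof eventually_elim
  case (elim n)
  have "rt d <= w n" "rt (k n) <= w n" using d by (auto simp: w_def)
  thus ?case using c elim x_ordered[of d "w n" "k n" s] x_ordered[of "k n" "w n" d s] by auto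
 qed
 thus ?thesis by (intro tendsto_lowerbound[OF tendsto_mult_left[OF tval_tendsto[OF k tendsto_const]]]) auto
qed (use lt in simp)

text \<open>Order relative to skeleton paths started exactly at \<open>r\<close>. It is stated for a
  function because it applies to members of the closure and, for uniqueness, to paths not yet known
  to belong to it.\<close>

definition sandwich :: "(real => real) => real => bool" where
 "sandwich f r <-> (ALL d s. rt d = r --> r <= s --> (tanh (rx d) < f r --> tval (x d) s <= f s) & (f r < tanh (rx d) --> f s <= tval (x d) s))"

lemma K0_sandwich: "q : K0 ==> st q <= ereal r ==> sandwich (tval q) r" unfolding sandwich_def using K0_ordered[of q r _ 1] K0_ordered[of q r _ "- 1"] x_pos by fastforce

lemma x_K0: "x i : K0" unfolding K0_def by (rule subsetD[OF closure_subset]) simp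

lemma sandwich_real:
 assumes "sandwich f r" "r : \<rat>" "abs (f r) < 1" "r <= s"
 shows "abs (f s) < 1"
proof -
 have 1: "- 1 < f r" "f r < 1" using assms(3) by auto
 obtain X :: real where X: "X : \<rat>" "tanh X < f r" using tanh_rat[of "- 1" "f r"] 1 by auto
 obtain Y :: real where Y: "Y : \<rat>" "f r < tanh Y" using tanh_rat[of "f r" 1] 1 by auto
 obtain i j where "rpt i = (X, r)" "rpt j = (Y, r)" using rpt(4)[OF X(1) assms(2)] rpt(4)[OF Y(1) assms(2)] by blast
 hence "tval (x i) s <= f s" "f s <= tval (x j) s" using assms(1,4) X Y by (auto simp: sandwich_def)
 thus ?thesis using x_real[of i s] x_real[of j s] by linarith
qed

text \<open>Skeleton paths on both sides of the common position have merged before \<open>s\<close>,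
  so everything between them coincides. The bounds \<open>a\<close> and \<open>b\<close> force the
  substitute \<open>x l\<close> to start close to that position.\<close>

lemma sandwich_squeeze:
 assumes f: "sandwich f r" and r: "r : \<rat>" "rt i < r" "f r = tval (x i) r" and ab: "a < f r" "f r < b" and s: "r < s"
 obtains l where "rt l = r" "a < tanh (rx l)" "tanh (rx l) < b" "f s = tval (x l) s" "tval (x i) s = tval (x l) s"
proof -
 obtain s' where s': "s' : \<rat>" "r < s'" "s' < s" using Rats_dense_in_real[OF s] by auto
 have "squeezed x" using good by (simp add: good_def)
 then obtain j k where jk: "rt j = r" "rt k = r" "tanh (rx j) < f r" "f r < tanh (rx k)" "tval (x j) s' = tval (x k) s'" unfolding squeezed_def r(3) using r s' by blast
 have e: "tval (x j) s = tval (x k) s" using x_ordered_rat[OF s'(1), of j k s] x_ordered_rat[OF s'(1), of k j s] jk s' by auto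
 have "abs (f r) < 1" unfolding r(3) by (rule x_real)
 then obtain X where X: "X : \<rat>" "max a (tanh (rx j)) < tanh X" "tanh X < f r" using tanh_rat[of "max a (tanh (rx j))" "f r"] ab jk by (auto simp: abs_less_iff)
 obtain l where l: "rpt l = (X, r)" using rpt(4)[OF X(1) r(1)] by blast
 have "sandwich (tval (x i)) r" by (rule K0_sandwich[OF x_K0]) (use r x_start in simp)
 hence "tval (x j) s <= f s" "f s <= tval (x k) s" "tval (x j) s <= tval (x i) s" "tval (x i) s <= tval (x k) s" using f jk s r(3) by (auto simp: sandwich_def)
 moreover have "tanh X < tanh (rx k)" using X(3) jk(4) by linarith
 moreover from this have "tval (x j) s <= tval (x l) s" "tval (x l) s <= tval (x k) s"
  using x_ordered[of j r l s] x_ordered[of l r k s] x_pos[of j] x_pos[of k] x_pos[of l] jk X l s by auto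
 ultimately show ?thesis using that[of l] l X ab e by auto
qed

lemma sandwich_follow:
 assumes "sandwich f r" "r : \<rat>" "rt i < r" "f r = tval (x i) r" "r <= s"
 shows "f s = tval (x i) s"
proof (cases "r = s")
 case False
 with assms(5) have "r < s" by simp
 from sandwich_squeeze[OF assms(1-4) _ _ this, of "f r - 1" "f r + 1"] show ?thesis by force
qed (use assms in simp)

text \<open>The approximating paths, eventually confined at the intermediate time \<open>r1\<close>,
  take at \<open>r\<close> only the finitely many values allowed by \<open>fin_vals\<close>. A
  convergent sequence with values in a finite set reaches its limit.\<close>

lemma K0_value:
 assumes q: "q : K0" "st q < ereal r0" and r: "r0 : \<rat>" "r : \<rat>" "r0 < r" and re: "abs (tval q r0) < 1"
 obtains i where "rt i < r" "tval q r = tval (x i) r"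
proof -
 obtain r1 where r1: "r1 : \<rat>" "r0 < r1" "r1 < r" using Rats_dense_in_real[OF r(3)] by auto
 have re1: "abs (tval q r1) < 1" using sandwich_real[OF K0_sandwich[OF q(1)] r(1) re] q(2) r1 by (simp add: less_imp_le)
 have "\<forall>\<^sub>F y in at_top. abs (tval q r1) < tanh (y :: real)" by (rule order_tendstoD(1)[OF tanh_real_at_top re1])
 then obtain y0 where "!!y. y0 <= y ==> (abs (tval q r1)) < tanh y" by (auto simp: eventually_at_top_linorder)
 moreover obtain A :: nat where "y0 <= real A" using real_arch_simple by blast
 ultimately have A: "abs (tval q r1) < tanh (real A)" by blast
 have "fin_vals x" using good by (simp add: good_def)
 then obtain N where N: "!!i. rt i = r1 ==> (abs (rx i)) <= real A ==> EX j<=N. tval (x i) r = tval (x j) r" unfolding fin_vals_def using r1 r by meson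
 define F where "F = (%j. tval (x j) r) ` {..N}"
 obtain k where k: "(%n. x (k n)) ----> q" using K0_seq[OF q(1)] .
 have "Psi (st q) < Psi (ereal r1)" using q(2) r1 unfolding Psi_less by (metis less_ereal.simps(1) less_trans)
 note ev1 = order_tendstoD(2)[OF start_tendsto[OF k] this] and ev2 = order_tendstoD(2)[OF tendsto_rabs[OF tval_tendsto[OF k tendsto_const]] A]
 \<comment> \<open>Removing the other possible values leaves an open neighbourhood of the
   limit.\<close>
 have "open (- (F - {tval q r}))" by (intro open_Compl finite_imp_closed) (simp add: F_def)
 hence "\<forall>\<^sub>F n in sequentially. tval (x (k n)) r : - (F - {tval q r})" by (rule topological_tendstoD[OF tval_tendsto[OF k tendsto_const]]) simp
 with ev1 ev2 have "\<forall>\<^sub>F n in sequentially. rt (k n) < r & tval q r = tval (x (k n)) r"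
 proof eventually_elim
  case (elim n)
  hence rk: "rt (k n) < r1" by (simp add: x_start Psi_less)
  have "- tanh (real A) < tval (x (k n)) r1" "tval (x (k n)) r1 < tanh (real A)" using elim(2) by (auto simp: abs_less_iff)
  from sandwich_squeeze[OF K0_sandwich[OF x_K0] r1(1) rk refl this r1(3)] rk
  obtain l where l: "rt l = r1" "tanh (- real A) < tanh (rx l)" "tanh (rx l) < tanh (real A)" "tval (x (k n)) r = tval (x l) r" by (auto simp: x_start)
  hence "abs (rx l) <= real A" by (simp add: abs_le_iff del: tanh_minus)
  from N[OF l(1) this] l(4) have "tval (x (k n)) r : F" by (auto simp: F_def)
  thus ?case using elim(3) rk r1 by auto
 qed
 then obtain n where "rt (k n) < r" "tval q r = tval (x (k n)) r" using eventually_happens'[OF sequentially_bot] by blast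
 thus ?thesis using that by blast
qed

lemma K0_equi:
 assumes "0 < e"
 shows "EX d>0. ALL q:K0. ALL s s'. abs s <= L & abs s' <= L & abs (s - s') < d --> (abs (tval q s - tval q s')) <= e"
proof -
 obtain k where k: "1 / real (Suc k) < e / 2" using nat_approx_posE[of "e / 2"] assms by auto
 obtain M :: nat where M: "L + 1 <= real M" using real_arch_simple by blast
 have "equi x" using good by (simp add: good_def)
 then obtain m where m: "!!i s s'. s : \<rat> ==> s' : \<rat> ==> (abs s) <= real M ==> (abs s') <= real M ==> (abs (s - s')) < 1 / real (Suc m) ==>
  abs (tval (x i) s - tval (x i) s') <= 1 / real (Suc k)" unfolding equi_def by meson
 have near: "EX q:\<rat>. dist q s < c & dist (tval (x i) q) (tval (x i) s) < e / 4" if "0 < c" for c s i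
 proof -
  obtain b where b: "0 < b" "!!q. dist q s < b ==> dist (tval (x i) q) (tval (x i) s) < e / 4"
   using continuous_tval[of "x i", unfolded continuous_on_iff, rule_format, of s "e / 4"] assms by auto
  have "s < s + min b c" using b(1) \<open>0 < c\<close> by simp
  from Rats_dense_in_real[OF this] obtain q where "q : \<rat>" "s < q" "q < s + min b c" by blast
  thus ?thesis using b(2)[of q] by (intro bexI[of _ q]) (auto simp: dist_real_def)
 qed
 \<comment> \<open>A third of the modulus leaves room for moving both times to nearby
   rationals.\<close>
 define d where "d = 1 / real (Suc m) / 3"
 have d: "0 < d" "d < 1" and d3: "1 / real (Suc m) = 3 * d" by (auto simp: d_def divide_less_eq field_simps)
 have main: "abs (tval (x i) s - tval (x i) s') <= e" if s: "abs s <= L" "abs s' <= L" "abs (s - s') < d" for i s s'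
 proof -
  obtain q q' where q: "q : \<rat>" "dist q s < d" "dist (tval (x i) q) (tval (x i) s) < e / 4"
   and q': "q' : \<rat>" "dist q' s' < d" "dist (tval (x i) q') (tval (x i) s') < e / 4" using near[OF d(1), of s i] near[OF d(1), of s' i] by blast
  have "abs (q - q') < 3 * d" "abs q <= real M" "abs q' <= real M" using q(2) q'(2) s M d(2) unfolding dist_real_def by linarith+
  hence "abs (tval (x i) q - tval (x i) q') <= 1 / real (Suc k)" using q(1) q'(1) by (intro m) (simp_all only: d3)
  thus ?thesis using q(3) q'(3) k unfolding dist_real_def by linarith
 qed
 have "abs (tval q s - tval q s') <= e" if q: "q : K0" and s: "abs s <= L" "abs s' <= L" "abs (s - s') < d" for q s s'
 proof -
  obtain k where k: "(%n. x (k n)) ----> q" using K0_seq[OF q] .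
  show ?thesis by (rule tendsto_upperbound[OF tendsto_rabs[OF tendsto_diff[OF tval_tendsto[OF k tendsto_const] tval_tendsto[OF k tendsto_const]]]])
    (use main[OF s] in simp_all)
 qed
 thus ?thesis using d(1) by blast
qed

lemma K0_compact: "compact K0" unfolding compact_eq_seq_compact_metric seq_compact_def
proof (intro allI impI)
 fix P :: "nat => bw_path" assume P: "ALL n. P n : K0"
 have "EX p k. strict_mono (k :: nat => nat) & (%n. P (k n)) ----> p" by (rule path_subseq) (use K0_equi P in meson)
 then obtain p k where k: "strict_mono (k :: nat => nat)" "(%n. P (k n)) ----> p" by blast
 have "p : K0" by (rule closed_sequentially[OF _ _ k(2)]) (use P in \<open>auto simp: K0_def\<close>)
 thus "EX l:K0. EX r. strict_mono r & (P o r) ----> l" using k by (auto simp: comp_def)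
qed

text \<open>Compactness yields the limit of a subsequence; its start and its values at rational
  times after the start identify it with \<open>p\<close>. If the start is positive infinity no real
  time follows it, and convergence is required at all rational times.\<close>

lemma K0_limit:
 assumes st: "(%n. tanh (rt (k n))) ----> Psi (st p)" and val: "!!s. s : \<rat> ==> st p < ereal s | st p = \<infinity> ==> (%n. tval (x (k n)) s) ----> tval p s"
 shows "p : K0"
proof -
 obtain q l where q: "q : K0" and l: "strict_mono l" "((%n. x (k n)) o l) ----> q"
  using K0_compact[unfolded compact_eq_seq_compact_metric seq_compact_def, rule_format, of "%n. x (k n)"] x_K0 by blast
 have l': "(%n. x (k (l n))) ----> q" using l(2) by (simp add: comp_def)
 have "(%n. tanh (rt (k (l n)))) ----> Psi (st q)" using start_tendsto[OF l'] by (simp add: x_start Psi_def)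
 hence "Psi (st q) = Psi (st p)" using LIMSEQ_unique LIMSEQ_subseq_LIMSEQ[OF st l(1)] by (auto simp: comp_def)
 hence se: "st q = st p" by (simp add: Psi_def tanh_ereal_inject)
 have vr: "tval q s = tval p s" if "s : \<rat>" "st p < ereal s | st p = \<infinity>" for s
  using LIMSEQ_unique[OF tval_tendsto[OF l' tendsto_const]] LIMSEQ_subseq_LIMSEQ[OF val[OF that] l(1)] by (auto simp: comp_def)
 have v: "tval q s = tval p s" if a: "!!r. a < r ==> st p < ereal r | st p = \<infinity>" and s: "a <= s" for a s
 proof -
  have e: "tval q r = tval p r" if "r : \<rat>" "a < r" for r using vr[OF that(1) a[OF that(2)]] .
  have "0 <= tval q s - tval p s" "0 <= tval p s - tval q s" by (rule rat_right[OF _ _ s], intro continuous_intros continuous_tval, simp add: e)+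
  thus ?thesis by simp
 qed
 have "tval q s = tval p s" for s
 proof (cases "EX t>=s. st p = ereal t")
  case True
  then obtain t where t: "st p = ereal t" "s <= t" by blast
  have "tval q t = tval p t" by (rule v[of t]) (simp_all add: t)
  moreover have "pval q s = pval q t" "pval p s = pval p t" using t se by (auto intro: pval_before)
  ultimately show ?thesis by (simp add: tval_def)
 next
  case False
  show ?thesis
  proof (cases "st p")
   case (real t)
   thus ?thesis using False by (intro v[of t]) (auto simp: not_le intro: less_imp_le)
  qed (auto intro: v[of s])
 qed
 thus ?thesis using path_eqI[OF se] q by simp
qed

end

section \<open>Existence\<close>

text \<open>The default keeps the map total and measurable; it is taken with probability 0 under the
  law of the skeleton.\<close>

definition web :: "(nat => bw_path) => bw_path compacts" where "web x = (if good x then cl_set x else fin_set 0 x)"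

definition web_law :: "bw_path compacts measure" where "web_law = distr (skel_law rpt) borel web"

lemma set_web: "good x ==> pts (web x) = K0 x" using K0_compact[of x] set_of_cl_set[of x] by (simp add: web_def K0_def)

lemma web_measurable: "web : borel_measurable paths"
proof -
 have "{x. good x} : sets (PB UNIV)" using predE[OF good_measurable] by (simp add: paths_def space_PiM PiE_UNIV_domain)
 from cl_set_measurable[OF this] K0_compact show ?thesis by (simp add: web_def[abs_def] paths_def K0_def)
qed

text \<open>The given points come first, so their paths are the coalescing paths of the given family
  alone, while the remaining paths still have the law of the skeleton, all on one space.\<close>

definition prepend :: "nat => (nat => real \<times> real) => nat => real \<times> real" where "prepend n z i = (if i < n then z i else rpt (i - n))"

definition tail :: "nat => (nat => real \<times> real) => (nat => real => real) => nat => bw_path" where "tail n z w i = bpath (prepend n z) w (n + i)"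

lemma tail: "tail n z : measurable WS paths" "distr WS paths (tail n z) = skel_law rpt"
proof -
 have m: "(%x i. x (n + i)) : measurable paths paths" using paths_reindex[of "(+) n"] by (simp add: comp_def)
 have t: "tail n z = (%x i. x (n + i)) o bpath (prepend n z)" by (simp add: tail_def fun_eq_iff)
 show "tail n z : measurable WS paths" unfolding t by (rule measurable_comp[OF bpaths_measurable m])
 have "distr WS paths (tail n z) = skel_law (%i. prepend n z (n + i))" unfolding t skel_law_drop[symmetric] skel_law_def distr_distr[OF m bpaths_measurable] ..
 thus "distr WS paths (tail n z) = skel_law rpt" by (simp add: prepend_def)
qed

lemma web_tail: "(%w. web (tail n z w)) : borel_measurable WS" "distr WS borel (%w. web (tail n z w)) = web_law"
 using measurable_compose[OF tail(1) web_measurable] distr_distr[OF web_measurable tail(1), of n z] by (simp_all add: web_law_def tail(2) comp_def)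

lemma AE_good_tail: "AE w in WS. good (tail n z w)" using AE_good unfolding tail(2)[of n z, symmetric]
 by (subst (asm) AE_distr_iff[OF tail(1)]) (use predE[OF good_measurable] in simp_all)

text \<open>Two skeleton paths started shortly before a given point squeeze every path from that point.\<close>

lemma AE_squeeze_point:
 assumes i: "i < n" "z i = (y, t)"
 shows "AE w in WS. EX j k. t - 1 / real (Suc m) < rt j & rt j < t & rt k < t &
  cpath (prepend n z) w (n + j) t < y & y < cpath (prepend n z) w (n + k) t &
  cpath (prepend n z) w (n + j) (t + 1 / real (Suc m)) = cpath (prepend n z) w (n + k) (t + 1 / real (Suc m))"
  (is "AE w in WS. ?P w")
proof (rule AE_approx[OF prob_space_wspace])
 fix e :: real assume e: "0 < e"
 let ?z = "prepend n z" and ?u = "t + 1 / real (Suc m)"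
 \<comment> \<open>Each of the two deviation events costs \<open>96 * c\<close>, and the failure to
   merge costs \<open>c\<close> times the second summand.\<close>
 define C where "C = 192 + 6 / sqrt (pi * (1 / real (Suc m)))"
 have C: "0 < C" unfolding C_def by (intro add_pos_nonneg) auto
 define c where "c = min 1 (e / C)"
 have c: "0 < c" "c <= 1" "c * C <= e" using e C by (auto simp: c_def min_def field_simps)
 obtain X where X: "X : \<rat>" "y - 3 * c < X" "X < y - 2 * c" using Rats_dense_in_real[of "y - 3 * c" "y - 2 * c"] c by auto
 obtain Y where Y: "Y : \<rat>" "y + 2 * c < Y" "Y < y + 3 * c" using Rats_dense_in_real[of "y + 2 * c" "y + 3 * c"] c by auto
 \<comment> \<open>A lead time \<open>h\<close> of at most \<open>c ^ 3\<close> makes a deviation by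
   \<open>c\<close> improbable: the bound \<open>96 * h ^ 2 / c ^ 4\<close> is then at most
   \<open>96 * c\<close>.\<close>
 have "0 < min (1 / real (Suc m)) (c ^ 3)" using c by simp
 hence "t - min (1 / real (Suc m)) (c ^ 3) < t" by linarith
 from Rats_dense_in_real[OF this] obtain r where r: "r : \<rat>" "t - min (1 / real (Suc m)) (c ^ 3) < r" "r < t" by blast
 obtain j k where jk: "rpt j = (X, r)" "rpt k = (Y, r)" using rpt(4)[OF X(1) r(1)] rpt(4)[OF Y(1) r(1)] by blast
 have zz: "?z (n + j) = (X, r)" "?z (n + k) = (Y, r)" by (simp_all add: prepend_def jk)
 define h where "h = t - r"
 have h: "0 < h" "h <= c ^ 3" "h < 1 / real (Suc m)" using r by (auto simp: h_def)
 have small: "6 * h\<^sup>2 / (c / 2) ^ 4 <= 96 * c"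
 proof -
  have "h\<^sup>2 <= (c ^ 3)\<^sup>2" using h by (intro power_mono) auto
  also have "... <= c * c ^ 4" using c power_decreasing[of 5 6 c] by (simp add: power_mult[symmetric] power_Suc[symmetric] del: power_Suc)
  finally show ?thesis using c by (simp add: field_simps power_divide)
 qed
 obtain A where A: "A : sets WS" "measure WS A <= 96 * c" "!!w. w : space WS - A ==> (abs (cpath ?z w (n + j) t - X)) <= c"
  using path_deviation[OF h(1), of "c / 2" ?z "n + j"] c small h by (fastforce simp: zz h_def)
 obtain B where B: "B : sets WS" "measure WS B <= 96 * c" "!!w. w : space WS - B ==> (abs (cpath ?z w (n + k) t - Y)) <= c"
  using path_deviation[OF h(1), of "c / 2" ?z "n + k"] c small h by (fastforce simp: zz h_def)
 define N where "N = {w:space WS. cpath ?z w (n + j) ?u ~= cpath ?z w (n + k) ?u}"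
 have XY: "X <= Y" and ru: "r < ?u" using X Y c r by (auto intro: less_trans[of _ t])
 have N: "N : sets WS" unfolding N_def by (rule pair_event(1)[where z="?z" and i="n + j" and j="n + k", OF zz XY ru])
 have "measure WS N <= (Y - X) / sqrt (pi * (?u - r))" unfolding N_def by (rule pair_event(3)[where z="?z" and i="n + j" and j="n + k", OF zz XY ru])
 also have "... <= 6 * c / sqrt (pi * (1 / real (Suc m)))" using X Y r XY by (intro frac_le real_sqrt_le_mono mult_left_mono) simp_all
 finally have Ne: "measure WS N <= 6 * c / sqrt (pi * (1 / real (Suc m)))" .
 have "measure WS (A Un B Un N) <= measure WS A + measure WS B + measure WS N" using measure_Un_le[OF sets.Un[OF A(1) B(1)] N] measure_Un_le[OF A(1) B(1)] by linarith
 also have "... <= c * C" using A(2) B(2) Ne by (simp add: C_def algebra_simps)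
 finally have "measure WS (A Un B Un N) <= e" using c by simp
 moreover have "?P w" if "w : space WS - (A Un B Un N)" for w using A(3)[of w] B(3)[of w] that X Y r by (intro exI[of _ j] exI[of _ k]) (auto simp: jk N_def abs_le_iff)
 ultimately show "EX A:sets WS. measure WS A <= e & (ALL w:space WS - A. ?P w)" using A(1) B(1) N by (intro bexI[of _ "A Un B Un N"]) auto
qed

text \<open>Any path from the point, whether built or found in the closure, agrees with the skeleton
  path \<open>j m\<close> after \<open>t + 1 / Suc m\<close>. Letting \<open>m\<close> grow gives
  uniqueness; the same skeleton paths converge to the built one, which puts it into the
  closure.\<close>

lemma AE_path_in_web:
 assumes i: "i < n"
 shows "AE w in WS. bpath (prepend n z) w i : K0 (tail n z w) & (ALL q:K0 (tail n z w). starts_at q (z i) --> q = bpath (prepend n z) w i)"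
proof -
 obtain y t where zi: "z i = (y, t)" by (cases "z i")
 let ?z = "prepend n z"
 have "AE w in WS. ALL m. EX j k. t - 1 / real (Suc m) < rt j & rt j < t & rt k < t &
  cpath ?z w (n + j) t < y & y < cpath ?z w (n + k) t & cpath ?z w (n + j) (t + 1 / real (Suc m)) = cpath ?z w (n + k) (t + 1 / real (Suc m))"
  using AE_squeeze_point[where z=z and n=n, OF i zi] by (simp add: AE_all_countable)
 with AE_good_tail[of n z] AE_space[of WS] show ?thesis
 proof eventually_elim
  case (elim w)
  let ?x = "tail n z w" and ?p = "bpath ?z w i" and ?v = "cpath ?z w"
  note w = elim(2) and g = elim(1)
  obtain j k where jk: "!!m. t - 1 / real (Suc m) < rt (j m)" "!!m. rt (j m) < t" "!!m. rt (k m) < t"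
   "!!m. ?v (n + j m) t < y" "!!m. y < ?v (n + k m) t" "!!m. ?v (n + j m) (t + 1 / real (Suc m)) = ?v (n + k m) (t + 1 / real (Suc m))" using elim(3) by metis
  have zz: "?z i = (y, t)" "?z (n + l) = rpt l" for l using i by (simp_all add: prepend_def zi)
  have nc: "?v a s <= ?v b s" if "snd (?z a) <= t" "snd (?z b) <= t" "?v a t <= ?v b t" "t <= s" for a b s
   by (rule coal_noncrossing[OF coal_cpath[OF w, of ?z "Suc (max a b)"] _ _ that]) auto
  have x: "tval (?x l) s = tanh (?v (n + l) s)" if "rt l <= s" for l s using that by (simp add: tail_def bpath_vals[OF w] zz max_absorb1)
  have p: "st ?p = ereal t" "tval ?p t = tanh y" and ps: "!!s. t <= s ==> tval ?p s = tanh (?v i s)"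
   using cpath_start[OF w, of ?z i] by (simp_all add: bpath_vals[OF w] zz max_absorb1)
  have vp: "?v i t = y" using cpath_start[OF w, of ?z i] by (simp add: zz)
  have q_eq: "tval q s = tval (?x (j m)) s" if q: "q : K0 ?x & st q <= ereal t & tval q t = tanh y | q = ?p" and s: "t + 1 / real (Suc m) <= s" for q m s
  proof -
   have ts: "t <= s" using s by (rule order_trans[rotated]) simp
   have e: "?v (n + j m) s = ?v (n + k m) s" by (rule mergingD[OF coalD(2)[OF coal_cpath[OF w, of ?z "Suc (max (n + j m) (n + k m))"]] _ _ _ _ jk(6) s])
     (use jk(2,3)[of m] in \<open>auto simp: zz intro: order_trans[of _ t]\<close>)
   have lt: "tval (?x (j m)) t < tanh y" "tanh y < tval (?x (k m)) t" using jk(2-5)[of m] by (simp_all add: x)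
   have "tval (?x (j m)) s <= tval q s & tval q s <= tval (?x (k m)) s"
   proof (cases "q = ?p")
    case True
    have "?v (n + j m) s <= ?v i s" "?v i s <= ?v (n + k m) s" using nc[of "n + j m" i s] nc[of i "n + k m" s] jk(2-5)[of m] vp ts by (simp_all add: zz)
    thus ?thesis using True ps[OF ts] x[of "j m" s] x[of "k m" s] jk(2,3)[of m] ts by simp
   next
    case False
    thus ?thesis using K0_ordered[OF g, of q t "j m" 1 s] K0_ordered[OF g, of q t "k m" "- 1" s] q jk(2,3)[of m] lt ts by simp
   qed
   thus ?thesis using e x[of "j m" s] x[of "k m" s] jk(2,3)[of m] ts by simp
  qed
  have late: "\<forall>\<^sub>F m in sequentially. t + 1 / real (Suc m) <= s" if "t < s" for s
  proof -
   have "(%m. t + 1 / real (Suc m)) ----> t + 0" by (intro tendsto_intros LIMSEQ_Suc[OF lim_1_over_n])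
   from order_tendstoD(2)[OF this, of s] that show ?thesis by (auto elim: eventually_mono)
  qed
  have "?p : K0 ?x"
  proof (rule K0_limit[OF g, of j])
   have "(%m. t - 1 / real (Suc m)) ----> t - 0" by (intro tendsto_intros LIMSEQ_Suc[OF lim_1_over_n])
   hence l: "(%m. t - 1 / real (Suc m)) ----> t" by (simp only: diff_0_right)
   have "(%m. rt (j m)) ----> t" by (rule tendsto_sandwich[OF always_eventually always_eventually l tendsto_const]; intro allI less_imp_le jk)
   thus "(%m. tanh (rt (j m))) ----> Psi (st ?p)" unfolding p(1) Psi_def by (auto intro: tendsto_tanh)
   fix s assume "st ?p < ereal s | st ?p = \<infinity>"
   hence "t < s" by (simp add: p)
   show "(%m. tval (?x (j m)) s) ----> tval ?p s" by (rule tendsto_eventually, rule eventually_mono[OF late[OF \<open>t < s\<close>]]) (simp add: q_eq)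
  qed
  moreover have "q = ?p" if q: "q : K0 ?x" "starts_at q (z i)" for q
  proof (rule path_eqI)
   have st: "st q = ereal t" "pval q t = ereal y" using q(2) by (simp_all add: zi starts_at_iff)
   hence qt: "tval q t = tanh y" by (simp add: tval_def)
   show "st q = st ?p" by (simp add: st p)
   fix s show "tval q s = tval ?p s"
   proof (cases "t < s")
    case True
    obtain m where "t + 1 / real (Suc m) <= s" using eventually_happens'[OF sequentially_bot late[OF True]] by blast
    thus ?thesis using q_eq[of q m s] q_eq[of ?p m s] q st qt by simp
   next
    case False
    hence "pval q s = pval q t" "pval ?p s = pval ?p t" using pval_before[of s q t] pval_before[of s ?p t] st p by simp_all
    thus ?thesis using qt p(2) by (simp add: tval_def)
   qed
  qed
  ultimately show ?case by blast
 qed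
qed

lemma ex1_start_measurable: "{K. \<exists>!p. p : pts K & starts_at p z} : sets borel"
proof -
 let ?S = "{p. starts_at p z}"
 have "(\<exists>!p. p : A & starts_at p z) <-> A Int ?S ~= {} & \<not> (EX p:A Int ?S. EX q:A Int ?S. p ~= q)" (is "?L <-> ?R") for A
 proof
  assume ?R
  hence ne: "A Int ?S ~= {}" and un: "\<not> (EX p:A Int ?S. EX q:A Int ?S. p ~= q)" by (rule conjunct1, rule conjunct2)
  from ne obtain p where p: "p : A Int ?S" by blast
  show ?L by (rule ex1I[of _ p]) (use p un in auto)
 qed (elim ex1E, blast)
 hence "{K. \<exists>!p. p : pts K & starts_at p z} = {K. pts K Int ?S ~= {}} -
   {K. EX p:pts K Int ?S. EX q:pts K Int ?S. p ~= q}" by (simp only: set_diff_eq mem_Collect_eq)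
 thus ?thesis by (simp only:) (intro sets.Diff hits_borel two_points_borel closed_starts_at)
qed

text \<open>For each finite family of points the web is realized as \<open>web (tail n z w)\<close>
  on the space that also carries the coalescing paths from these points, and almost surely the
  selected paths are the built ones.\<close>

lemma web_law_fdds: "coalescing_fdds web_law (%K. K)" unfolding coalescing_fdds_def
proof (intro allI impI conjI)
 fix n and z :: "nat => real \<times> real"
 note wm = web_tail(1)[of n z]
 let ?z = "prepend n z" and ?H = "%K. \<lambda>i\<in>{..<n}. path_from K (z i)"
 have all: "AE w in WS. ALL i:{..<n}. bpath ?z w i : K0 (tail n z w) & (ALL q:K0 (tail n z w). starts_at q (z i) --> q = bpath ?z w i)"
  by (rule AE_finite_allI) (use AE_path_in_web in auto)
 have "AE w in WS. ALL i<n. bpath ?z w i : pts (web (tail n z w)) & starts_at (bpath ?z w i) (z i) &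
   (ALL q. q : pts (web (tail n z w)) & starts_at q (z i) --> q = bpath ?z w i)" using all AE_good_tail[of n z] AE_space[of WS]
 proof eventually_elim
  case (elim w)
  have "starts_at (bpath ?z w i) (z i)" if "i < n" for i
   using that cpath_start[OF elim(3), of ?z i] by (cases "z i") (simp add: starts_at_iff bpath_vals[OF elim(3)] prepend_def)
  thus ?case using elim(1) set_web[OF elim(2)] by auto
 qed
 hence u: "AE w in WS. ALL i<n. (\<exists>!p. p : pts (web (tail n z w)) & starts_at p (z i)) & path_from (web (tail n z w)) (z i) = bpath ?z w i"
 proof eventually_elim
  case (elim w)
  show ?case
  proof (intro allI impI)
   fix i assume "i < n"
   hence "\<exists>!p. p : pts (web (tail n z w)) & starts_at p (z i)" "(THE p. p : pts (web (tail n z w)) & starts_at p (z i)) = bpath ?z w i"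
    using elim by (blast, blast intro: the_equality)
   thus "(\<exists>!p. p : pts (web (tail n z w)) & starts_at p (z i)) & path_from (web (tail n z w)) (z i) = bpath ?z w i" unfolding path_from_def by simp
  qed
 qed
 have "{K:space borel. ALL i:{..<n}. \<exists>!p. p : pts K & starts_at p (z i)} : sets borel"
  by (rule sets.sets_Collect_finite_All) (use ex1_start_measurable in \<open>simp_all only: space_borel UNIV_I simp_thms finite_lessThan\<close>)
 hence B: "{K:space borel. ALL i<n. \<exists>!p. p : pts K & starts_at p (z i)} : sets borel" by (simp only: Ball_def lessThan_iff)
 show "AE K in web_law. ALL i<n. \<exists>!p. p : pts K & starts_at p (z i)" unfolding web_tail(2)[of n z, symmetric]
  by (subst AE_distr_iff[OF wm B], rule eventually_mono[OF u], intro allI impI, drule spec, drule mp, assumption, erule conjE, assumption)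
 have Hm: "?H : measurable borel (PB {..<n})" by (intro measurable_restrict path_from_measurable)
 have "distr web_law (PB {..<n}) ?H = distr WS (PB {..<n}) (%w. ?H (web (tail n z w)))"
  unfolding web_tail(2)[of n z, symmetric] by (subst distr_distr[OF Hm wm]) (simp add: comp_def)
 also have "... = distr WS (PB {..<n}) (%w. \<lambda>i\<in>{..<n}. bpath ?z w i)"
 proof (rule distr_cong_AE[OF refl refl])
  show "AE w in WS. ?H (web (tail n z w)) = (\<lambda>i\<in>{..<n}. bpath ?z w i)" using u by eventually_elim (simp cong: restrict_cong)
 qed (intro measurable_compose[OF wm Hm] measurable_restrict bpath_measurable)+
 also have "... = distr WS (PB {..<n}) (%w. \<lambda>i\<in>{..<n}. bpath z w i)" by (intro distr_cong refl restrict_ext bpath_prefix) (auto simp: prepend_def)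
 finally show "EX (N :: (nat => real => real) measure) P. coalescing_BMs N n z P & distr web_law (PB {..<n}) ?H =
   distr N (PB {..<n}) (%w. \<lambda>i\<in>{..<n}. P i w)" by - (rule exI[of _ WS], rule exI[of _ "%i w. bpath z w i"], rule conjI[OF coalescing_BMs_wspace])
qed

section \<open>Expected number of touched points of the web\<close>

lemma count_le:
 assumes "!!F. finite F ==> F \<subseteq> Y ==> of_nat (card F) <= (c :: ennreal)"
 shows "cnt Y <= c"
proof (cases "finite Y")
 case False
 have "of_nat n <= c" for n using infinite_arbitrarily_large[OF False, of n] assms by metis
 hence "(SUP n. of_nat n :: ennreal) <= c" by (rule SUP_least)
 thus ?thesis by (simp add: ennreal_SUP_of_nat_eq_top top_unique)
qed (use assms[of Y] in simp)

text \<open>A path touching the window at \<open>t0\<close> is still in the enlarged window at a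
  slightly later rational time \<open>r k\<close>; a skeleton path started there has the same value
  at \<open>t0 + t\<close>. So every finite set of touched points is eventually counted in the
  slices.\<close>

lemma eta_le_liminf:
 assumes g: "good x" and t: "0 < t" and h: "0 < h" and r: "r ----> t0" "!!k. r k : \<rat>" "!!k. t0 < r k"
 shows "eta t0 t a b (web x) <= liminf (%k. cnt ((%i. tval (x i) (t0 + t)) ` slice (r k) (a - h) (b + h)))"
proof -
 let ?T = "t0 + t"
 have hit: "\<forall>\<^sub>F k in sequentially. tanh y : (%i. tval (x i) ?T) ` slice (r k) (a - h) (b + h)"
  if y: "y : touched t0 ?T a b (K0 x)" for y
 proof -
  obtain q y0 where q: "q : K0 x" "st q <= ereal t0" "pval q ?T = ereal y" "a <= y0" "y0 <= b" "pval q t0 = ereal y0" using y by (auto simp: touched_def)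
  have v: "tval q ?T = tanh y" "tval q t0 = tanh y0" using q by (simp_all add: tval_def)
  have "(%k. tval q (r k)) ----> tval q t0" by (rule tval_tendsto[OF tendsto_const r(1)])
  hence "\<forall>\<^sub>F k in sequentially. tanh (a - h) < tval q (r k)" "\<forall>\<^sub>F k in sequentially. tval q (r k) < tanh (b + h)" "\<forall>\<^sub>F k in sequentially. r k < ?T"
   using q h t r(1) v by (auto elim!: order_tendstoD)
  thus ?thesis
  proof eventually_elim
   case (elim k)
   have "abs (tval q t0) < 1" using tanh_real_bounds'[of y0] by (simp add: v abs_less_iff)
   hence "open {s. abs (tval q s) < 1}" "t0 : {s. abs (tval q s) < 1}" by (auto intro!: open_Collect_less continuous_intros continuous_tval)
   then obtain d where d: "0 < d" "!!s. dist s t0 < d ==> (abs (tval q s)) < 1" unfolding open_dist by blast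
   \<comment> \<open>An intermediate rational time at which the path has started and is finite, as
     \<open>K0_value\<close> requires.\<close>
   have "t0 < min (r k) (t0 + d)" using r(3) d by simp
   from Rats_dense_in_real[OF this] obtain r0 where r0: "r0 : \<rat>" "t0 < r0" "r0 < min (r k) (t0 + d)" by blast
   have q0: "st q < ereal r0" "st q <= ereal (r k)" using q(2) r0 r(3)[of k] by (auto intro: le_less_trans order_trans)
   obtain i where i: "rt i < r k" "tval q (r k) = tval (x i) (r k)" using K0_value[OF g q(1) q0(1) r0(1) r(2)[of k]] r0 d(2)[of r0] by (auto simp: dist_real_def)
   from sandwich_squeeze[OF g K0_sandwich[OF g q(1) q0(2)] r(2) i elim]
   obtain l where "rt l = r k" "tanh (a - h) < tanh (rx l)" "tanh (rx l) < tanh (b + h)" "tval q ?T = tval (x l) ?T" by blast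
   thus ?case unfolding slice_def v(1)[symmetric] by (intro image_eqI[of _ _ l]) auto
  qed
 qed
 show ?thesis unfolding eta_eq_touched[OF less_imp_le[OF t]] set_web[OF g]
 proof (rule count_le)
  fix F assume F: "finite F" "F \<subseteq> touched t0 ?T a b (K0 x)"
  have "\<forall>\<^sub>F k in sequentially. ALL y:F. tanh y : (%i. tval (x i) ?T) ` slice (r k) (a - h) (b + h)" using F hit by (intro eventually_ball_finite) auto
  hence "\<forall>\<^sub>F k in sequentially. of_nat (card F) <= cnt ((%i. tval (x i) ?T) ` slice (r k) (a - h) (b + h))"
  proof eventually_elim
   case (elim k)
   have "of_nat (card F) = cnt (tanh ` F)" using F(1) by (simp add: card_image inj_on_def)
   also have "... <= cnt ((%i. tval (x i) ?T) ` slice (r k) (a - h) (b + h))" using elim by (intro emeasure_mono) auto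
   finally show ?case .
  qed
  thus "of_nat (card F) <= liminf (%k. cnt ((%i. tval (x i) ?T) ` slice (r k) (a - h) (b + h)))" by (rule Liminf_bounded)
 qed
qed

text \<open>Fatou along rational times tending to \<open>t0\<close> from above, then
  \<open>h\<close> to 0; the enlargement by \<open>h\<close> allows for the movement of a path
  between \<open>t0\<close> and \<open>r k\<close>.\<close>

lemma web_eta_le:
 assumes t: "0 < t" and ab: "a <= b"
 shows "(nn_integral web_law (%K. eta t0 t a b K)) <= ennreal (1 + (b - a) / sqrt (pi * t))"
proof -
 have em: "eta t0 t a b : borel_measurable borel" using t by (intro eta_measurable) simp
 have "EX r. r : \<rat> & t0 < r & r < t0 + t / real (Suc (Suc k))" for k using Rats_dense_in_real[of t0 "t0 + t / real (Suc (Suc k))"] t by auto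
 then obtain r where r: "!!k. r k : \<rat>" "!!k. t0 < r k" "!!k. r k < t0 + t / real (Suc (Suc k))" by metis
 have rl: "r ----> t0"
 proof (rule tendsto_sandwich[OF always_eventually always_eventually tendsto_const])
  have "(%k. t0 + t * (1 / real (Suc (Suc k)))) ----> t0 + t * 0" by (intro tendsto_intros LIMSEQ_Suc[OF LIMSEQ_Suc[OF lim_1_over_n]])
  thus "(%k. t0 + t / real (Suc (Suc k))) ----> t0" by simp
 qed (use r in \<open>auto intro: less_imp_le\<close>)
 have rT: "r k < t0 + t" for k proof -
  have "t / real (Suc (Suc k)) <= t" using t by (simp add: divide_le_eq)
  thus ?thesis using r(3)[of k] by linarith
 qed
 have bound: "(nn_integral web_law (%K. eta t0 t a b K)) <= ennreal (1 + (b - a + 2 * h) / sqrt (pi * t))" if h: "0 < h" for h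
 proof -
  let ?c = "%k x. cnt ((%i. tval (x i) (t0 + t)) ` slice (r k) (a - h) (b + h))"
  have "(nn_integral web_law (%K. eta t0 t a b K)) = (nn_integral (skel_law rpt) (%x. eta t0 t a b (web x)))"
   unfolding web_law_def using em web_measurable by (intro nn_integral_distr) (simp_all add: measurable_cong_sets[OF sets_skel_law refl])
  also have "... = (nn_integral WS (%w. eta t0 t a b (web (bpath rpt w))))" unfolding skel_law_def
   by (intro nn_integral_distr bpaths_measurable) (simp only: measurable_cong_sets[OF sets_distr refl] measurable_compose[OF web_measurable em])
  also have "... <= (nn_integral WS (%w. liminf (%k. ?c k (bpath rpt w))))"
   using AE_good_bpath by (intro nn_integral_mono_AE) (auto elim!: eventually_mono intro: eta_le_liminf[OF _ t h rl r(1,2)])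
  also have "... <= liminf (%k. nn_integral WS (%w. ?c k (bpath rpt w)))" by (intro nn_integral_liminf measurable_compose[OF bpaths_measurable count_image_measurable])
  also have "... <= liminf (%k. ennreal (1 + (b + h - (a - h)) / sqrt (pi * (t0 + t - r k))))"
   using ab h by (intro Liminf_mono always_eventually allI expected_count rT) auto
  also have "... = ennreal (1 + (b + h - (a - h)) / sqrt (pi * (t0 + t - t0)))"
   by (intro lim_imp_Liminf trivial_limit_sequentially tendsto_ennrealI tendsto_intros rl) (use t in simp)
  finally show ?thesis by (simp add: algebra_simps)
 qed
 have "(%k. ennreal (1 + (b - a + 2 * (1 / real (Suc k))) / sqrt (pi * t))) ----> ennreal (1 + (b - a + 2 * 0) / sqrt (pi * t))"
  by (intro tendsto_ennrealI tendsto_intros LIMSEQ_Suc[OF lim_1_over_n]) (use t in simp)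
 hence "(nn_integral web_law (%K. eta t0 t a b K)) <= ennreal (1 + (b - a + 2 * 0) / sqrt (pi * t))" by (rule LIMSEQ_le_const) (intro exI allI impI bound, simp)
 thus ?thesis by simp
qed

lemma card_mono_steps:
 fixes f :: "nat => real"
 assumes "!!k. k < M ==> f k <= f (Suc k)"
 shows "1 + (SUM k<M. if f k ~= f (Suc k) then 1 else 0) <= card (f ` {..M})" using assms
proof (induction M)
 case (Suc M)
 have le: "f k <= f M" if "k <= M" for k using that by (induction k rule: inc_induct) (use Suc.prems in \<open>auto intro: order_trans less_SucI\<close>)
 have "f (Suc M) ~: f ` {..M}" if "f M ~= f (Suc M)" using le that Suc.prems[of M] by force
 moreover have "insert (f M) (f ` {..M}) = f ` {..M}" by auto
 ultimately show ?case using Suc by (cases "f M = f (Suc M)") (auto simp: atMost_Suc)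
qed simp

text \<open>Start \<open>Suc M\<close> equally spaced paths in the window. As they do not cross, the
  number of positions is one plus the number of unmerged neighbours. As \<open>M\<close> grows, the
  exponential factor lost in the Gaussian lower bound tends to 1.\<close>

lemma web_eta_ge:
 assumes t: "0 < t" and ab: "a <= b"
 shows "ennreal (1 + (b - a) / sqrt (pi * t)) <= (nn_integral web_law (%K. eta t0 t a b K))"
proof -
 have em: "eta t0 t a b : borel_measurable borel" using t by (intro eta_measurable) simp
 let ?T = "t0 + t"
 have main: "ennreal (1 + (b - a) / sqrt (pi * t) * exp (- ((b - a) / real M)\<^sup>2 / (4 * t))) <= (nn_integral web_law (%K. eta t0 t a b K))" if M: "0 < M" for M :: nat
 proof -
  define d where "d = (b - a) / real M"
  define z where "z k = (a + real k * d, t0)" for k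
  let ?z = "prepend (Suc M) z"
  have d: "0 <= d" using ab by (simp add: d_def)
  have zz: "?z k = (a + real k * d, t0)" if "k <= M" for k using that by (simp add: prepend_def z_def)
  define D where "D k = {w:space WS. cpath ?z w k ?T ~= cpath ?z w (Suc k) ?T}" for k
  have D: "D k : sets WS" "measure WS (D k) = measure (gauss (2 * t)) {-d<..d}" if "k < M" for k
  proof -
   have "a + real k * d <= a + real (Suc k) * d" "t0 < ?T" using d t by (simp_all add: algebra_simps)
   note pe = pair_event[where z="?z" and i=k and j="Suc k", OF zz zz this]
   show "D k : sets WS" "measure WS (D k) = measure (gauss (2 * t)) {-d<..d}" unfolding D_def using pe(1,2) that by (simp_all add: algebra_simps)
  qed
  have "AE w in WS. ALL i:{..M}. bpath ?z w i : K0 (tail (Suc M) z w)"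
   by (rule AE_finite_allI) (use AE_path_in_web[of _ "Suc M" z] in \<open>auto elim!: eventually_mono\<close>)
  with AE_good_tail[of "Suc M" z] AE_space[of WS]
  have AE: "AE w in WS. 1 + (SUM k<M. indicator (D k) w) <= eta t0 t a b (web (tail (Suc M) z w))"
  proof eventually_elim
   case (elim w)
   let ?f = "%k. cpath ?z w k ?T"
   have st: "cpath ?z w k t0 = a + real k * d" if "k <= M" for k using cpath_start[OF elim(2), of ?z k] zz[OF that] by simp
   have "?f ` {..M} \<subseteq> touched t0 ?T a b (K0 (tail (Suc M) z w))"
   proof clarsimp
    fix k assume k: "k <= M"
    have "real k * d <= real M * d" by (rule mult_right_mono) (use k d in simp_all)
    also have "... = b - a" using M by (simp add: d_def)
    finally show "?f k : touched t0 ?T a b (K0 (tail (Suc M) z w))" unfolding touched_def using elim(3) k zz[OF k] t d st[OF k]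
     by (intro CollectI bexI[of _ "bpath ?z w k"] conjI bexI[of _ "a + real k * d"]) (auto simp: bpath_vals[OF elim(2)] max_absorb1)
   qed
   hence "cnt (?f ` {..M}) <= eta t0 t a b (web (tail (Suc M) z w))" unfolding eta_eq_touched[OF less_imp_le[OF t]] set_web[OF elim(1)] by (intro emeasure_mono) auto
   moreover have "1 + (SUM k<M. if ?f k ~= ?f (Suc k) then 1 else 0) <= card (?f ` {..M})"
   proof (rule card_mono_steps)
    fix k assume "k < M"
    thus "?f k <= ?f (Suc k)"
     by - (rule coal_noncrossing[OF coal_cpath[OF elim(2), of ?z "Suc (Suc k)"], of k "Suc k" t0]; use zz st t d in \<open>simp add: algebra_simps\<close>)
   qed
   hence "of_nat (1 + (SUM k<M. if ?f k ~= ?f (Suc k) then 1 else 0)) <= (of_nat (card (?f ` {..M})) :: ennreal)" by (rule of_nat_mono)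
   moreover have "of_nat (1 + (SUM k<M. if ?f k ~= ?f (Suc k) then 1 else 0)) = (1 + (SUM k<M. indicator (D k) w) :: ennreal)"
    unfolding of_nat_add of_nat_sum of_nat_1 using elim(2) by (intro arg_cong[where f="(+) 1"] sum.cong refl) (simp add: D_def)
   ultimately show ?case by simp
  qed
  have "ennreal (1 + (b - a) / sqrt (pi * t) * exp (- d\<^sup>2 / (4 * t))) <= ennreal (1 + real M * measure (gauss (2 * t)) {-d<..d})"
  proof (intro ennreal_leI add_left_mono)
   have s: "sqrt (2 * pi * (2 * t)) = 2 * sqrt (pi * t)" using real_sqrt_mult[of 4 "pi * t"] by (simp add: mult_ac)
   have "d / sqrt (pi * t) * exp (- d\<^sup>2 / (4 * t)) <= measure (gauss (2 * t)) {-d<..d}"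
    using gauss_interval(2)[of "2 * t" d] t d unfolding s by (simp only: mult_divide_mult_cancel_left) simp
   from mult_left_mono[OF this, of "real M"] show "(b - a) / sqrt (pi * t) * exp (- d\<^sup>2 / (4 * t)) <= real M * measure (gauss (2 * t)) {-d<..d}"
    using M by (simp add: d_def)
  qed
  also have "... = 1 + (SUM k<M. emeasure WS (D k))" using D(2) by (simp add: W.emeasure_eq_measure ennreal_mult ennreal_of_nat_eq_real_of_nat)
  also have "... = (nn_integral WS (%w. 1 + (SUM k<M. indicator (D k) w)))"
  proof (subst nn_integral_add)
   have "(nn_integral WS (%w. (SUM k<M. indicator (D k) w))) = (SUM k<M. emeasure WS (D k))" by (subst nn_integral_sum) (use D(1) in auto)
   thus "1 + (SUM k<M. emeasure WS (D k)) = (nn_integral WS (%w. 1)) + (nn_integral WS (%w. (SUM k<M. indicator (D k) w)))" by (simp add: W.emeasure_space_1)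
  qed (use D(1) in \<open>auto intro!: borel_measurable_sum\<close>)
  also have "... <= (nn_integral WS (%w. eta t0 t a b (web (tail (Suc M) z w))))" by (rule nn_integral_mono_AE[OF AE])
  also have "... = (nn_integral web_law (%K. eta t0 t a b K))"
   unfolding web_tail(2)[of "Suc M" z, symmetric] by (rule nn_integral_distr[OF web_tail(1), symmetric]) (simp add: em)
  finally show ?thesis by (simp add: d_def)
 qed
 have "(%M. ennreal (1 + (b - a) / sqrt (pi * t) * exp (- ((b - a) * (1 / real (Suc M)))\<^sup>2 / (4 * t)))) ---->
  ennreal (1 + (b - a) / sqrt (pi * t) * exp (- ((b - a) * 0)\<^sup>2 / (4 * t)))" by (intro tendsto_ennrealI tendsto_intros LIMSEQ_Suc[OF lim_1_over_n]) (use t in simp)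
 hence l: "(%M. ennreal (1 + (b - a) / sqrt (pi * t) * exp (- ((b - a) / real (Suc M))\<^sup>2 / (4 * t)))) ----> ennreal (1 + (b - a) / sqrt (pi * t))" by simp
 show ?thesis by (rule LIMSEQ_le_const2[OF l]) (use main in \<open>auto simp del: of_nat_Suc\<close>)
qed

section \<open>Uniqueness\<close>

lemma tval_real:
 assumes "abs (tval p s) < 1"
 obtains y where "pval p s = ereal y" "tval p s = tanh y" using assms by (cases "pval p s") (auto simp: tval_def)

text \<open>Rational deadlines above \<open>t\<close>: starting times chosen anywhere between
  \<open>t\<close> and \<open>T n\<close> converge to \<open>t\<close>, so the constructions below
  keep that freedom.\<close>

lemma times_above:
 assumes "t < (\<infinity> :: ereal)"
 obtains T :: "nat => real" where "!!n. T n : \<rat>" "!!n. t < ereal (T n)" "!!r. (!!n. t < ereal (r n)) ==> (!!n. r n <= T n) ==> (%n. tanh (r n)) ----> Psi t"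
proof -
 have "EX U :: nat => real. (ALL n. t < ereal (U n)) & (%n. tanh (U n)) ----> Psi t"
 proof (cases t)
  case (real S)
  have "(%n. S + 1 / real (Suc n)) ----> S + 0" by (intro tendsto_intros LIMSEQ_Suc[OF lim_1_over_n])
  thus ?thesis using real by (intro exI[of _ "%n. S + 1 / real (Suc n)"]) (auto simp: Psi_def intro: tendsto_tanh)
 next
  case MInf
  have "(%n. tanh (- real n)) ----> - 1" by (rule filterlim_compose[OF tanh_real_at_bot]) (simp add: filterlim_uminus_at_bot filterlim_real_sequentially)
  thus ?thesis using MInf by (intro exI[of _ "%n. - real n"]) (simp add: Psi_def)
 qed (use assms in simp)
 then obtain U where U: "!!n. t < ereal (U n)" "(%n. tanh (U n)) ----> Psi t" by blast
 have "EX T:\<rat>. t < ereal T & T < U n" for n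
 proof -
  obtain c where "t < ereal c" "c < U n" using ereal_dense2[OF U(1)[of n]] by auto
  thus ?thesis using Rats_dense_in_real[of c "U n"] by (meson less_trans less_ereal.simps(1))
 qed
 then obtain T where T: "!!n. T n : \<rat> & t < ereal (T n) & T n < U n" by metis
 have lim: "(%n. tanh (r n)) ----> Psi t" if "!!n. t < ereal (r n)" "!!n. r n <= T n" for r
 proof (rule tendsto_sandwich[OF always_eventually always_eventually tendsto_const U(2)]; intro allI)
  show "Psi t <= tanh (r n)" for n using that(1)[of n] Psi_less[of t "ereal (r n)"] by (simp add: Psi_def)
  show "tanh (r n) <= tanh (U n)" for n using that(2)[of n] T[of n] by simp
 qed
 show ?thesis by (rule that[of T]) (use T in simp, use T in simp, rule lim)
qed

context
 fixes x :: "nat => bw_path"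
 assumes good: "good x"
begin

text \<open>A skeleton path started at \<open>r\<close> is inserted strictly between
  \<open>x d\<close> and \<open>f\<close>, which reduces the case of an earlier start to
  \<open>sandwich\<close>.\<close>

lemma sandwich_ordered:
 assumes f: "sandwich x f r" "r : \<rat>" and d: "rt d <= r" and c: "c = 1 | c = - 1" and lt: "c * tval (x d) r < c * f r" and fr: "abs (f r) <= 1" and s: "r <= s"
 shows "c * tval (x d) s <= c * f s"
proof -
 note xr = x_real[OF good, of d r]
 obtain X where X: "X : \<rat>" "c * tval (x d) r < c * tanh X" "c * tanh X < c * f r"
 proof (cases "c = 1")
  case True
  hence "tval (x d) r < f r" "- 1 < f r" "tval (x d) r < 1" using lt xr by (auto simp: abs_less_iff)
  from tanh_rat[OF this] show ?thesis using that True by auto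
 next
  case False
  hence "f r < tval (x d) r" "- 1 < tval (x d) r" "f r < 1" using lt xr c by (auto simp: abs_less_iff)
  from tanh_rat[OF this] show ?thesis using that False c by auto
 qed
 obtain l where l: "rpt l = (X, r)" using rpt(4)[OF X(1) f(2)] by blast
 have "tval (x l) r = tanh X" using x_pos[OF good, of l] l by simp
 moreover have "tanh X < f r ==> tval (x l) s <= f s" "f r < tanh X ==> f s <= tval (x l) s" using f(1) l s unfolding sandwich_def[OF good] by (metis fst_conv snd_conv)+
 ultimately show ?thesis using c X x_ordered[OF good, of d r l s] x_ordered[OF good, of l r d s] l d s by auto
qed

lemma x_unbounded:
 assumes "q : \<rat>" "r : \<rat>" "q < r" "c = 1 | c = - 1"
 obtains k where "rt k = q" "tanh (real M) < c * tval (x k) r"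
proof -
 have "unbounded x" using good by (simp add: good_def)
 then obtain j k where "rt j = q" "rt k = q" "tval (x j) r < tanh (- real M)" "tanh (real M) < tval (x k) r" unfolding unbounded_def using assms(1-3) by blast
 thus ?thesis using that[of j] that[of k] assms(4) by auto
qed

context
 fixes K :: "bw_path set" and p :: bw_path
 assumes touch: "!!r s a b. r : \<rat> ==> s : \<rat> ==> r < s ==> a : \<rat> ==> b : \<rat> ==> a <= b ==> touched r s a b K \<subseteq> touched r s a b (K0 x)"
  and p: "p : K"
begin

text \<open>For each single pair of times the larger set touches nothing new. So some member of the
  closure shares the value of \<open>p\<close> at \<open>s\<close> and is near \<open>p\<close> at
  \<open>r\<close>; it may be a different one for another pair of times.\<close>

lemma touch_path:
 assumes r: "r : \<rat>" "s : \<rat>" "r < s" "st p <= ereal r" "abs (tval p s) < 1" and c: "c < tval p r" "tval p r < c'" "- 1 < tval p r" "tval p r < 1"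
 obtains q where "q : K0 x" "st q <= ereal r" "c < tval q r" "tval q r < c'" "abs (tval q r) < 1" "tval q s = tval p s"
proof -
 obtain a where a: "a : \<rat>" "c < tanh a" "tanh a < tval p r" using tanh_rat[of c "tval p r"] c by auto
 obtain b where b: "b : \<rat>" "tval p r < tanh b" "tanh b < c'" using tanh_rat[of "tval p r" c'] c by auto
 have "abs (tval p r) < 1" using c by (simp add: abs_less_iff)
 then obtain y where y: "pval p r = ereal y" "tval p r = tanh y" by (rule tval_real)
 obtain w where w: "pval p s = ereal w" "tval p s = tanh w" using tval_real[OF r(5)] .
 have "w : touched r s a b K" unfolding touched_def using p r(4) w y a b by auto
 moreover have "a <= b" using a b y by simp
 ultimately have "w : touched r s a b (K0 x)" using touch[OF r(1-3) a(1) b(1)] by blast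
 then obtain q y' where q: "q : K0 x" "st q <= ereal r" "pval q s = ereal w" "a <= y'" "y' <= b" "pval q r = ereal y'" by (auto simp: touched_def)
 hence "tval q r = tanh y'" "tval q s = tanh w" by (simp_all add: tval_def)
 moreover have "c < tanh y'" "tanh y' < c'" "abs (tanh y') < 1"
  using q(4,5) a(2) b(3) tanh_real_le_iff[of a y'] tanh_real_le_iff[of y' b] tanh_real_bounds'[of y'] by (linarith, linarith, simp add: abs_less_iff)
 ultimately show ?thesis using that[of q] q(1,2) w by simp
qed

lemma touch_ordered:
 assumes r: "r : \<rat>" "s : \<rat>" "r < s" "st p <= ereal r" "abs (tval p r) < 1" "abs (tval p s) < 1" and d: "rt d = r"
 shows "tanh (rx d) < tval p r ==> tval (x d) s <= tval p s" "tval p r < tanh (rx d) ==> tval p s <= tval (x d) s"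
proof -
 have pos: "tval (x d) r = tanh (rx d)" using x_pos[OF good, of d] d by simp
 have pr: "- 1 < tval p r" "tval p r < 1" using r(5) by auto
 show "tval (x d) s <= tval p s" if lt: "tanh (rx d) < tval p r"
 proof -
  \<comment> \<open>The bound 2 exceeds every compressed value, leaving only the lower side of the
    window.\<close>
  obtain q where "q : K0 x" "st q <= ereal r" "tanh (rx d) < tval q r" "tval q s = tval p s" using touch_path[OF r(1-4,6) lt, of 2] pr by auto
  thus ?thesis using K0_sandwich[OF good, of q r] d r(3) unfolding sandwich_def[OF good] by (metis less_imp_le)
 qed
 show "tval p s <= tval (x d) s" if lt: "tval p r < tanh (rx d)"
 proof -
  obtain q where "q : K0 x" "st q <= ereal r" "tval q r < tanh (rx d)" "tval q s = tval p s" using touch_path[OF r(1-4,6) _ lt, of "- 2"] pr by auto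
  thus ?thesis using K0_sandwich[OF good, of q r] d r(3) unfolding sandwich_def[OF good] by (metis less_imp_le)
 qed
qed

text \<open>The order relation is available only between finite values. Up to the first infinite
  time it confines \<open>p\<close> between two skeleton paths, whose finite values exclude an
  infinite limit.\<close>

lemma touch_real:
 assumes r: "r : \<rat>" "st p <= ereal r" "abs (tval p r) < 1" and s: "r <= s"
 shows "abs (tval p s) < 1"
proof (rule ccontr)
 assume no: "\<not> (abs (tval p s)) < 1"
 define S where "S = {u:{r..s}. 1 <= abs (tval p u)}"
 have "closed ({r..s} Int {u. 1 <= abs (tval p u)})" by (intro closed_Int closed_Collect_le continuous_intros continuous_tval)
 hence cl: "closed S" by (simp add: S_def Int_def)
 have S: "s : S" "bdd_below S" using no s by (auto simp: S_def intro: bdd_belowI)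
 define u where "u = Inf S"
 have u: "u : S" "!!u'. u' : S ==> u <= u'" using closed_contains_Inf[OF _ S(2) cl] S cInf_lower[OF _ S(2)] by (auto simp: u_def)
 have ru: "r < u" using u(1) r(3) by (auto simp: S_def less_le)
 have pr: "- 1 < tval p r" "tval p r < 1" using r(3) by auto
 obtain X :: real where X: "X : \<rat>" "tanh X < tval p r" using tanh_rat[of "- 1" "tval p r"] pr by auto
 obtain Y :: real where Y: "Y : \<rat>" "tval p r < tanh Y" using tanh_rat[of "tval p r" 1] pr by auto
 obtain i j where ij: "rpt i = (X, r)" "rpt j = (Y, r)" using rpt(4)[OF X(1) r(1)] rpt(4)[OF Y(1) r(1)] by blast
 have "tval (x i) v <= tval p v & tval p v <= tval (x j) v" if "v : \<rat>" "r < v" "v < u" for v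
 proof -
  have "v ~: S" using u(2)[of v] that by auto
  hence "abs (tval p v) < 1" using that u(1) by (auto simp: S_def)
  thus ?thesis using touch_ordered[OF r(1) that(1,2) r(2,3)] ij X Y by auto
 qed
 hence Q: "{v:\<rat>. r < v & v < u} \<subseteq> {v. tval (x i) v <= tval p v} Int {v. tval p v <= tval (x j) v}" by auto
 have "closed ({v. tval (x i) v <= tval p v} Int {v. tval p v <= tval (x j) v})" by (intro closed_Int closed_Collect_le continuous_tval)
 moreover have "u : closure {v:\<rat>. r < v & v < u}" unfolding closure_approachable
 proof (intro allI impI)
  fix e :: real assume "0 < e"
  hence "max r (u - e) < u" using ru by simp
  from Rats_dense_in_real[OF this] obtain v where "v : \<rat>" "max r (u - e) < v" "v < u" by blast
  thus "EX v:{v:\<rat>. r < v & v < u}. dist v u < e" by (intro bexI[of _ v]) (auto simp: dist_real_def)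
 qed
 ultimately have "tval (x i) u <= tval p u" "tval p u <= tval (x j) u" using closure_minimal[OF Q] by auto
 thus False using u(1) x_real[OF good, of i u] x_real[OF good, of j u] by (auto simp: S_def)
qed

lemma touch_sandwich:
 assumes r: "r : \<rat>" "st p <= ereal r" "abs (tval p r) < 1"
 shows "sandwich x (tval p) r" unfolding sandwich_def[OF good]
proof (intro allI impI conjI)
 fix d s assume d: "rt d = r" and s: "r <= s"
 note t = touch_ordered[OF r(1) _ _ r(2,3) touch_real[OF r] d]
 have "0 <= tval p s - tval (x d) s" if "tanh (rx d) < tval p r" by (rule rat_right[OF _ _ s], intro continuous_intros continuous_tval) (use t that in auto)
 thus "tanh (rx d) < tval p r ==> tval (x d) s <= tval p s" by simp
 have "0 <= tval (x d) s - tval p s" if "tval p r < tanh (rx d)" by (rule rat_right[OF _ _ s], intro continuous_intros continuous_tval) (use t that in auto)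
 thus "tval p r < tanh (rx d) ==> tval p s <= tval (x d) s" by simp
qed

text \<open>A member of the closure that agrees with \<open>p\<close> at \<open>r\<close> has there
  the value of a skeleton path, hence so does \<open>p\<close>. From then on the sandwich property
  makes \<open>p\<close> follow the skeleton.\<close>

lemma touch_follow:
 assumes r: "r0 : \<rat>" "r : \<rat>" "s : \<rat>" "r0 < r" "r < s" and st: "st p <= ereal r0" and re: "abs (tval p r0) < 1"
 obtains l where "rt l = r" "!!s'. s <= s' ==> tval p s' = tval (x l) s'"
proof -
 have st': "st p <= ereal r" using st r(4) by (simp add: order_trans[OF st])
 have re': "abs (tval p r) < 1" by (rule touch_real[OF r(1) st re]) (use r in simp)
 obtain q where q: "q : K0 x" "st q <= ereal r0" "abs (tval q r0) < 1" "tval q r = tval p r"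
  using touch_path[OF r(1,2,4) st re', of "- 2" 2] re by (auto simp: abs_less_iff)
 obtain r1 where r1: "r1 : \<rat>" "r0 < r1" "r1 < r" using Rats_dense_in_real[OF r(4)] by blast
 have "st q < ereal r1" using q(2) r1(2) by (simp add: le_less_trans)
 moreover have "abs (tval q r1) < 1" by (rule sandwich_real[OF good K0_sandwich[OF good q(1,2)] r(1) q(3)]) (use r1 in simp)
 ultimately obtain i where i: "rt i < r" "tval p r = tval (x i) r" using K0_value[OF good q(1) _ r1(1) r(2) r1(3)] q(4) by metis
 note sw = touch_sandwich[OF r(2) st' re']
 obtain l where l: "rt l = r" "tval (x i) s = tval (x l) s" using sandwich_squeeze[OF good sw r(2) i _ _ r(5), of "tval p r - 1" "tval p r + 1"] by auto
 have "tval p s' = tval (x l) s'" if "s <= s'" for s' using sandwich_follow[OF good sw r(2) i, of s'] that r l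
   x_ordered_rat[OF good r(3), of i l s'] x_ordered_rat[OF good r(3), of l i s'] i(1) by simp
 thus ?thesis using that[OF l(1)] by blast
qed

text \<open>A path at an infinite value is barred from returning by skeleton paths started far out.\<close>

lemma touch_infinite:
 assumes c: "st p <= ereal c" "1 <= abs (tval p c)" and s: "s : \<rat>" "c < s"
 shows "1 <= abs (tval p s)"
proof (rule ccontr)
 assume no: "\<not> 1 <= abs (tval p s)"
 define S where "S = {u:{c..s}. 1 <= abs (tval p u)}"
 have "closed ({c..s} Int {u. 1 <= abs (tval p u)})" by (intro closed_Int closed_Collect_le continuous_intros continuous_tval)
 hence cl: "closed S" by (simp add: S_def Int_def)
 have S: "c : S" "bdd_above S" using c s by (auto simp: S_def intro: bdd_aboveI)
 \<comment> \<open>The last time up to \<open>s\<close> at an infinite value; \<open>g\<close> below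
   is the sign of that value.\<close>
 define u where "u = Sup S"
 have u: "u : S" "!!u'. u' : S ==> u' <= u" using closed_contains_Sup[OF _ S(2) cl] S cSup_upper[OF _ S(2)] by (auto simp: u_def)
 have us: "c <= u" "u < s" using u(1) no by (auto simp: S_def less_le)
 define g where "g = tval p u"
 have g: "g = 1 | g = - 1" using u(1) abs_tval_le[of p u] by (auto simp: S_def g_def abs_le_iff split: abs_split)
 have "\<forall>\<^sub>F y in at_top. abs (tval p s) < tanh (y :: real)" by (rule order_tendstoD(1)[OF tanh_real_at_top]) (use no in simp)
 then obtain y0 where y0: "!!y. y0 <= y ==> (abs (tval p s)) < tanh y" by (auto simp: eventually_at_top_linorder)
 obtain M :: nat where "y0 <= real M" using real_arch_simple by blast
 hence M: "abs (tval p s) < tanh (real M)" by (rule y0)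
 \<comment> \<open>The barrier starts before \<open>c\<close> and lies at \<open>s\<close> on the
   side of the infinite value that \<open>p\<close> has left. Just after \<open>u\<close> it is
   still on the other side of \<open>p\<close>, and order is preserved from there on.\<close>
 obtain r' where r': "r' : \<rat>" "r' < c" using Rats_dense_in_real[of "c - 1" c] by auto
 have "r' < s" using r'(2) s(2) by simp
 from x_unbounded[OF r'(1) s(1) this g] obtain d where d: "rt d = r'" "tanh (real M) < g * tval (x d) s" .
 have "open {v. g * tval (x d) v < g * tval p v}" by (intro open_Collect_less continuous_intros continuous_tval)
 moreover have "g * tval (x d) u < g * tval p u" using g x_real[OF good, of d u] unfolding g_def[symmetric] by (auto simp: abs_less_iff)
 ultimately obtain e where e: "0 < e" "!!v. dist v u < e ==> g * tval (x d) v < g * tval p v" unfolding open_dist by blast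
 have "u < min s (u + e)" using us e by simp
 from Rats_dense_in_real[OF this] obtain r where r: "r : \<rat>" "u < r" "r < min s (u + e)" by blast
 have "r ~: S" using u(2)[of r] r by auto
 hence re: "abs (tval p r) < 1" using r us by (auto simp: S_def)
 have "st p <= ereal r" using c(1) us r by (auto intro: order_trans)
 from sandwich_ordered[OF touch_sandwich[OF r(1) this re] r(1) _ g e(2), of s] r re d(1) r'(2) us
 have "g * tval (x d) s <= g * tval p s" by (simp add: dist_real_def)
 thus False using d(2) M g by auto
qed

text \<open>Of two skeleton paths with a common start the higher one stays higher, so one path can
  serve finitely many times at once. The sign \<open>c\<close> selects the side.\<close>

lemma x_high:
 assumes "finite Q" "Q \<subseteq> \<rat> Int {r<..}" "r : \<rat>" and c: "c = 1 | c = - 1"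
 shows "EX k. rt k = r & (ALL q:Q. tanh (real M) < c * tval (x k) q)" using assms(1,2)
proof (induction Q)
 case empty
 obtain k where "rpt k = (0, r)" using rpt(4)[of 0 r] assms(3) by auto
 thus ?case by (intro exI[of _ k]) simp
next
 case (insert q Q)
 then obtain k where k: "rt k = r" "!!q. q : Q ==> tanh (real M) < c * tval (x k) q" by auto
 obtain l where l: "rt l = r" "tanh (real M) < c * tval (x l) q" using x_unbounded[OF assms(3) _ _ c, of q M] insert.prems by auto
 have le: "c * tval (x a) s <= c * tval (x b) s" if "c * tval (x a) r <= c * tval (x b) r" "rt a = r" "rt b = r" "s : insert q Q" for a b s
 proof -
  have "r <= s" using insert.prems that(4) by (auto intro: less_imp_le)
  thus ?thesis using that c x_ordered_rat[OF good assms(3), of a b s] x_ordered_rat[OF good assms(3), of b a s] by auto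
 qed
 show ?case
 proof (cases "c * tval (x k) r <= c * tval (x l) r")
  case True
  have "tanh (real M) < c * tval (x l) q'" if "q' : Q" for q' using k(2)[OF that] le[OF True k(1) l(1), of q'] that by simp
  thus ?thesis using l by auto
 next
  case False
  hence "tanh (real M) < c * tval (x k) q" using l(2) le[OF _ l(1) k(1), of q] by simp
  thus ?thesis using k by auto
 qed
qed

text \<open>The path is a limit of skeleton paths whose starts tend to its own. Three cases: it
  starts at positive infinity, it has finite values arbitrarily soon after its start, or it stays at
  one infinite value.\<close>

lemma touch_K0: "p : K0 x"
proof (cases "st p = \<infinity>")
 case True
 \<comment> \<open>A path that starts at positive infinity is constant in real time; skeleton paths
   started at time \<open>n\<close> near its position approximate it.\<close>
 have const: "tval p s = tval p 0" for s using True pval_before[of s p 0] by (simp add: tval_def)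
 have "EX k. rt k = real n & abs (tanh (rx k) - tval p 0) < 1 / real (Suc n)" for n
 proof -
  have "tval p 0 - 1 / real (Suc n) < tval p 0 + 1 / real (Suc n)" "- 1 < tval p 0 + 1 / real (Suc n)" "tval p 0 - 1 / real (Suc n) < 1"
   using abs_tval_le[of p 0] divide_pos_pos[of 1 "real (Suc n)"] unfolding abs_le_iff by linarith+
  from tanh_rat[OF this] obtain X where "X : \<rat>" "tval p 0 - 1 / real (Suc n) < tanh X" "tanh X < tval p 0 + 1 / real (Suc n)" .
  moreover from this obtain k where "rpt k = (X, real n)" using rpt(4)[of X "real n"] by auto
  ultimately show ?thesis by (intro exI[of _ k]) (auto simp: abs_less_iff)
 qed
 then obtain k where k: "!!n. rt (k n) = real n" "!!n. abs (tanh (rx (k n)) - tval p 0) < 1 / real (Suc n)" by metis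
 show ?thesis
 proof (rule K0_limit[OF good, of k])
  have "(%n. tanh (real n)) ----> 1" by (rule filterlim_compose[OF tanh_real_at_top filterlim_real_sequentially])
  thus "(%n. tanh (rt (k n))) ----> Psi (st p)" by (simp add: k True Psi_def)
  fix s
  have "(%n. tanh (rx (k n)) - tval p 0) ----> 0"
   by (rule Lim_null_comparison[OF _ LIMSEQ_Suc[OF lim_1_over_n]]) (use k(2) in \<open>auto intro!: always_eventually less_imp_le\<close>)
  hence "(%n. tanh (rx (k n))) ----> tval p s" unfolding const[of s] by (simp add: LIM_zero_iff)
  moreover have "\<forall>\<^sub>F n in sequentially. tanh (rx (k n)) = tval (x (k n)) s" using eventually_ge_at_top[of "nat \<lceil>s\<rceil>"]
  proof eventually_elim
   case (elim n)
   hence "pval (x (k n)) s = pval (x (k n)) (rt (k n))" by (intro pval_before) (auto simp: x_start[OF good] k)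
   thus ?case using x_pos[OF good, of "k n"] by (simp add: tval_def)
  qed
  ultimately show "(%n. tval (x (k n)) s) ----> tval p s" by (rule Lim_transform_eventually)
 qed
next
 case False
 hence fin: "st p < \<infinity>" by simp
 obtain T :: "nat => real" where T: "!!n. T n : \<rat>" "!!n. st p < ereal (T n)"
  "!!r. (!!n. st p < ereal (r n)) ==> (!!n. r n <= T n) ==> (%n. tanh (r n)) ----> Psi (st p)" using times_above[OF fin] by metis
 have between: "EX r:\<rat>. st p < ereal r & r < c" if c: "st p < ereal c" for c
 proof -
  obtain c' where c': "st p < ereal c'" "c' < c" using ereal_dense2[OF c] by auto
  from Rats_dense_in_real[OF c'(2)] obtain r where "r : \<rat>" "c' < r" "r < c" by blast
  thus ?thesis using c'(1) by (intro bexI[of _ r]) (auto intro: less_trans)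
 qed
 have T_late: "\<forall>\<^sub>F n in sequentially. T n < s" if "st p < ereal s" for s
 proof -
  have "(%n. tanh (T n)) ----> Psi (st p)" by (rule T(3)[OF T(2)]) simp
  from order_tendstoD(2)[OF this, of "tanh s"] show ?thesis using that Psi_less[of "st p" "ereal s"] by (simp add: Psi_def)
 qed
 show ?thesis
 proof (cases "ALL n. EX r:\<rat>. st p < ereal r & r < T n & abs (tval p r) < 1")
  case True
  \<comment> \<open>A finite value just after the start makes the path follow the skeleton, so one
    skeleton path agrees with it from \<open>T n\<close> on.\<close>
  have "EX k. st p < ereal (rt k) & rt k < T n & (ALL s'>=T n. tval p s' = tval (x k) s')" for n
  proof -
   obtain r0 where r0: "r0 : \<rat>" "st p < ereal r0" "r0 < T n" "abs (tval p r0) < 1" using True by blast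
   from Rats_dense_in_real[OF r0(3)] obtain r where r: "r : \<rat>" "r0 < r" "r < T n" by blast
   obtain l where "rt l = r" "!!s'. T n <= s' ==> tval p s' = tval (x l) s'" using touch_follow[OF r0(1) r(1) T(1) r(2,3) _ r0(4)] r0(2) by (metis less_imp_le)
   thus ?thesis using r r0(2) by (intro exI[of _ l]) (auto intro: less_trans)
  qed
  then obtain k where k: "!!n. st p < ereal (rt (k n))" "!!n. rt (k n) < T n" "!!n s'. T n <= s' ==> tval p s' = tval (x (k n)) s'" by metis
  show ?thesis
  proof (rule K0_limit[OF good T(3)[OF k(1)]])
   fix s assume "st p < ereal s | st p = \<infinity>"
   hence s: "st p < ereal s" using fin by auto
   have "\<forall>\<^sub>F n in sequentially. T n < s" by (rule T_late[OF s])
   thus "(%n. tval (x (k n)) s) ----> tval p s" by (intro tendsto_eventually) (auto elim!: eventually_mono intro!: k(3)[symmetric] less_imp_le)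
  qed (use k(2) in \<open>simp add: less_imp_le\<close>)
 next
  case False
  then obtain n0 where n0: "!!r. r : \<rat> ==> st p < ereal r ==> r < T n0 ==> 1 <= abs (tval p r)" by (meson not_le)
  \<comment> \<open>Infinite values shortly after the start persist by
    \<open>touch_infinite\<close>.\<close>
  have inf: "1 <= abs (tval p s)" if s: "s : \<rat>" "st p < ereal s" for s
  proof -
   have "st p < ereal (min s (T n0))" using s T(2)[of n0] by (simp add: min_def)
   from between[OF this] obtain c where "c : \<rat>" "st p < ereal c" "c < min s (T n0)" by blast
   thus ?thesis using n0[of c] by (intro touch_infinite[of c s]) (use s in \<open>auto intro: less_imp_le\<close>)
  qed
  have infr: "1 <= abs (tval p s)" if s: "st p < ereal s" for s
  proof -
   obtain a where a: "st p < ereal a" "a < s" using between[OF s] by blast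
   have b: "0 <= abs (tval p q) - 1" if "q : \<rat>" "a < q" for q unfolding diff_ge_0_iff_ge by (rule inf[OF that(1) less_trans[OF a(1)]]) (simp add: that)
   have "0 <= abs (tval p s) - 1" by (rule rat_right[OF _ b less_imp_le[OF a(2)]]) (intro continuous_intros continuous_tval)
   thus ?thesis by simp
  qed
  define g where "g = tval p (T 0)"
  have one: "tval p s = 1 | tval p s = - 1" if "st p < ereal s" for s using infr[OF that] abs_tval_le[of p s] by (auto simp: abs_le_iff split: abs_split)
  have g: "g = 1 | g = - 1" unfolding g_def by (rule one[OF T(2)])
  \<comment> \<open>A change of sign would pass through 0.\<close>
  have const: "tval p s = g" if s: "st p < ereal s" for s
  proof (rule ccontr)
   let ?I = "{min s (T 0)..max s (T 0)}"
   assume "tval p s ~= g"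
   hence "min (tval p s) g <= 0" "0 <= max (tval p s) g" using one[OF s] g by auto
   moreover have "connected (tval p ` ?I)" by (intro connected_continuous_image continuous_on_subset[OF continuous_tval]) auto
   moreover have "min (tval p s) g : tval p ` ?I" "max (tval p s) g : tval p ` ?I" by (auto simp: min_def max_def g_def)
   ultimately have "0 : tval p ` ?I" by (rule connectedD_interval[rotated 3])
   then obtain u where "u : ?I" "tval p u = 0" by auto
   moreover from this have "st p < ereal u" using s T(2)[of 0] by (auto simp: min_def intro: less_le_trans split: if_splits)
   ultimately show False using infr[of u] by simp
  qed
  \<comment> \<open>The first \<open>n\<close> rationals are treated at stage \<open>n\<close>, so
    each rational time after the start is eventually covered.\<close>
  have "EX k. st p < ereal (rt k) & rt k < T n & (ALL i<n. rt k < from_nat_into \<rat> i --> tanh (real n) < g * tval (x k) (from_nat_into \<rat> i))" for n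
  proof -
   obtain r where r: "r : \<rat>" "st p < ereal r" "r < T n" using between[OF T(2)] by blast
   let ?Q = "{q : from_nat_into \<rat> ` {..<n}. r < q}"
   have "?Q \<subseteq> \<rat> Int {r<..}" using from_nat_into[of "\<rat> :: real set"] by auto
   from x_high[OF _ this r(1) g, of n] obtain k where "rt k = r" "ALL q:?Q. tanh (real n) < g * tval (x k) q" by auto
   thus ?thesis using r by (intro exI[of _ k]) auto
  qed
  then obtain k where k: "!!n. st p < ereal (rt (k n))" "!!n. rt (k n) < T n"
   "!!n i. i < n ==> rt (k n) < from_nat_into \<rat> i ==> tanh (real n) < g * tval (x (k n)) (from_nat_into \<rat> i)" by metis
  show ?thesis
  proof (rule K0_limit[OF good T(3)[OF k(1)]])
   fix s assume sr: "s : \<rat>" and "st p < ereal s | st p = \<infinity>"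
   hence s: "st p < ereal s" using fin by auto
   obtain i where i: "s = from_nat_into \<rat> i" using from_nat_into_surj[OF countable_rat sr] by metis
   have lo: "\<forall>\<^sub>F n in sequentially. tanh (real n) <= g * tval (x (k n)) s" using T_late[OF s] eventually_gt_at_top[of i]
   proof eventually_elim
    case (elim n)
    have "rt (k n) < from_nat_into \<rat> i" using k(2)[of n] elim(1) i by simp
    from k(3)[OF elim(2) this] show ?case by (simp add: i)
   qed
   have lim: "(%n. tanh (real n)) ----> 1" by (rule filterlim_compose[OF tanh_real_at_top filterlim_real_sequentially])
   have hi: "\<forall>\<^sub>F n in sequentially. g * tval (x (k n)) s <= 1"
    using g x_real[OF good, of _ s] by (intro always_eventually allI) (auto simp: abs_less_iff intro: less_imp_le)
   have "(%n. g * tval (x (k n)) s) ----> 1" by (rule tendsto_sandwich[OF lo hi lim tendsto_const])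
   from tendsto_mult_left[OF this, of g] show "(%n. tval (x (k n)) s) ----> tval p s" using g by (auto simp: const[OF s])
  qed (use k(2) in \<open>simp add: less_imp_le\<close>)
 qed
qed

end

end

section \<open>Identification of the law\<close>

lemma web_law: "prob_space web_law" "sets web_law = sets borel" "space web_law = UNIV"
 using prob_space.prob_space_distr[OF prob_space_skel_law, of web rpt borel] web_measurable by (simp_all add: web_law_def measurable_cong_sets[OF sets_skel_law refl])

lemma web_law_eta:
 assumes "0 < t" "a <= b"
 shows "(nn_integral web_law (%K. eta t0 t a b K)) = ennreal (1 + (b - a) / sqrt (pi * t))" using web_eta_le[OF assms] web_eta_ge[OF assms] by (rule antisym)

text \<open>Finite prefixes determine the law; for these the hypothesis on finite-dimensional
  distributions applies because \<open>rpt\<close> is injective, and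
  \<open>coalescing_BMs_law\<close> transports the result to the canonical space.\<close>

lemma skeleton_law:
 assumes W: "W : borel_measurable L" and fdd: "coalescing_fdds L W" and L: "prob_space L"
 shows "(%w i. path_from (W w) (rpt i)) : measurable L paths" (is "?x : _") and "distr L paths (%w i. path_from (W w) (rpt i)) = skel_law rpt"
proof -
 have co: "(%w. path_from (W w) z) : borel_measurable L" for z by (rule measurable_compose[OF W path_from_measurable])
 thus m: "?x : measurable L paths" unfolding paths_def by (intro measurable_vec)
 show "distr L paths ?x = skel_law rpt"
 proof (rule paths_law_eqI)
  fix n and A :: "nat => bw_path set" assume A: "!!i. A i : sets borel"
  note B = prefix_event[of A n, OF A]
  have C: "PiE {..<n} A : sets (PB {..<n})" by (intro sets_PiM_I_finite) (use A in auto)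
  have "inj_on rpt {..<n}" using rpt(1) by (rule inj_on_subset) simp
  then obtain N :: "(nat => real => real) measure" and P where "coalescing_BMs N n rpt P"
   "distr L (PB {..<n}) (%w. \<lambda>i\<in>{..<n}. ?x w i) = distr N (PB {..<n}) (%w. \<lambda>i\<in>{..<n}. P i w)" using fdd unfolding coalescing_fdds_def by blast
  hence eq: "distr L (PB {..<n}) (%w. \<lambda>i\<in>{..<n}. ?x w i) =
   distr WS (PB {..<n}) (%w. \<lambda>i\<in>{..<n}. bpath rpt w i)" using coalescing_BMs_law by metis
  have d: "emeasure (distr M (PB {..<n}) (%w. \<lambda>i\<in>{..<n}. y w i)) (PiE {..<n} A) = emeasure (distr M paths y) {x. ALL i<n. x i : A i}"
   if y: "y : measurable M paths" for M and y :: "_ => nat => bw_path"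
  proof -
   have "(%w. \<lambda>i\<in>{..<n}. y w i) : measurable M (PB {..<n})" by (intro measurable_restrict measurable_compose[OF y paths_coord])
   note e = emeasure_distr[OF this C]
   show ?thesis unfolding e emeasure_distr[OF y B] by (rule arg_cong[where f="emeasure M"]) (simp add: vimage_def restrict_PiE_iff Pi_iff Ball_def)
  qed
  show "emeasure (distr L paths ?x) {x. ALL i<n. x i : A i} = emeasure (skel_law rpt) {x. ALL i<n. x i : A i}"
   unfolding skel_law_def d[OF m, symmetric] d[OF bpaths_measurable, symmetric] eq ..
 qed (simp_all add: prob_space_skel_law prob_space.prob_space_distr[OF L m])
qed

text \<open>The skeleton of \<open>W\<close> generates a web inside \<open>W\<close>. As the expected counts agree, \<open>W\<close> touches
 nothing else, and this leaves no room for further paths.\<close>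

lemma web_unique:
 assumes W: "W : borel_measurable M" and fdd: "coalescing_fdds M W" and M: "prob_space M"
  and eta: "!!t0 t a b. 0 < t ==> a <= b ==> (nn_integral M (%w. eta t0 t a b (W w))) = ennreal (1 + (b - a) / sqrt (pi * t))"
 shows "distr M borel W = web_law"
proof -
 define x where "x w i = path_from (W w) (rpt i)" for w i
 have m: "x : measurable M paths" and law: "distr M paths x = skel_law rpt" using skeleton_law[OF W fdd M] by (simp_all add: x_def[abs_def])
 have wm: "(%w. web (x w)) : borel_measurable M" by (rule measurable_compose[OF m web_measurable])
 have wl: "web_law = distr M borel (%w. web (x w))" unfolding web_law_def law[symmetric] distr_distr[OF web_measurable m] by (simp add: comp_def)
 have AEg: "AE w in M. good (x w)" using AE_good unfolding law[symmetric] by (subst (asm) AE_distr_iff[OF m]) (use predE[OF good_measurable] in simp_all)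
 have AEi: "AE w in M. x w i : pts (W w)" for i
 proof -
  have "AE w in M. ALL j<Suc i. \<exists>!p. p : pts (W w) & starts_at p (rpt j)"
   using fdd inj_on_subset[OF rpt(1), of "{..<Suc i}"] unfolding coalescing_fdds_def by blast
  thus ?thesis
  proof eventually_elim
   case (elim w)
   hence e: "\<exists>!p. p : pts (W w) & starts_at p (rpt i)" by simp
   from theI'[OF this] show ?case by (simp only: x_def path_from_def if_P[OF e])
  qed
 qed
 have "AE w in M. ALL i. x w i : pts (W w)" unfolding AE_all_countable using AEi ..
 with AEg have sub: "AE w in M. good (x w) & K0 (x w) \<subseteq> pts (W w)"
 proof eventually_elim
  case (elim w)
  have "closed (pts (W w))" using set_of_compacts[of "W w"] by (simp add: compact_imp_closed)
  from closure_minimal[OF _ this, of "range (x w)"] show ?case using elim by (simp add: K0_def image_subset_iff)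
 qed
 have touched: "AE w in M. r < s & a <= b --> touched r s a b (pts (W w)) \<subseteq> touched r s a b (K0 (x w))" for r s a b :: real
 proof (cases "r < s & a <= b")
  case True
  let ?e = "eta r (s - r) a b"
  have t: "0 < s - r" "a <= b" using True by auto
  note em = eta_measurable[OF less_imp_le[OF t(1)], of r a b]
  have i1: "(nn_integral M (%w. ?e (web (x w)))) = ennreal (1 + (b - a) / sqrt (pi * (s - r)))"
   using web_law_eta[OF t, of r] unfolding wl by (subst (asm) nn_integral_distr[OF wm]) (simp_all add: em)
  have le: "AE w in M. ?e (web (x w)) <= ?e (W w)" using sub
  proof eventually_elim
   case (elim w)
   hence "touched r s a b (K0 (x w)) \<subseteq> touched r s a b (pts (W w))" unfolding touched_def by blast
   hence "cnt (touched r s a b (K0 (x w))) <= cnt (touched r s a b (pts (W w)))" by (intro emeasure_mono) auto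
   thus ?case by (simp add: eta_eq_touched[OF less_imp_le[OF t(1)]] set_web[OF conjunct1[OF elim]])
  qed
  have fin: "AE w in M. ?e (W w) ~= \<infinity>" by (intro nn_integral_PInf_AE measurable_compose[OF W em]) (simp add: eta[OF t])
  have mem: "(%w. ?e (W w)) : borel_measurable M" "(%w. ?e (web (x w))) : borel_measurable M" by (intro measurable_compose[OF W em] measurable_compose[OF wm em])+
  \<comment> \<open>Ordered variables with equal finite expectations agree almost surely; for finite
    counts of nested sets this means equality of the sets.\<close>
  have "(nn_integral M (%w. ?e (W w) - ?e (web (x w)))) = 0" by (subst nn_integral_diff[OF mem _ le]) (simp_all add: i1 eta[OF t])
  hence "AE w in M. ?e (W w) - ?e (web (x w)) = 0" using mem by (subst (asm) nn_integral_0_iff_AE) simp_all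
  with sub fin le show ?thesis
  proof eventually_elim
   case (elim w)
   let ?T = "touched r s a b (K0 (x w))" and ?S = "touched r s a b (pts (W w))"
   have e: "?e (W w) = cnt ?S" "?e (web (x w)) = cnt ?T" by (simp_all add: eta_eq_touched[OF less_imp_le[OF t(1)]] set_web[OF conjunct1[OF elim(1)]])
   have S: "finite ?S" using elim e(1) by (intro ccontr[of "finite ?S"]) (simp add: emeasure_count_space_infinite)
   have TS: "?T \<subseteq> ?S" using conjunct2[OF elim(1)] unfolding touched_def by blast
   hence T: "finite ?T" using S by (rule finite_subset)
   have "?e (W w) <= ?e (web (x w))" using elim(4) by (rule ennreal_minus_eq_0)
   hence "card ?S <= card ?T" using S T by (simp add: e emeasure_count_space_finite)
   thus ?case using card_seteq[OF S TS] by simp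
  qed
 qed (auto intro!: always_eventually)
 \<comment> \<open>Countably many rational parameters share one exceptional set.\<close>
 have "AE w in M. ALL r:\<rat>. ALL s:\<rat>. ALL a:\<rat>. ALL b:\<rat>. r < s & a <= b --> touched r s a b (pts (W w)) \<subseteq> touched r s a b (K0 (x w))"
  by (intro AE_ball_countable[THEN iffD2] ballI countable_rat touched)
 with sub have "AE w in M. W w = web (x w)"
 proof eventually_elim
  case (elim w)
  have "p : K0 (x w)" if "p : pts (W w)" for p by (rule touch_K0[OF conjunct1[OF elim(1)] _ that]) (use elim(2) in blast)
  hence "pts (W w) = pts (web (x w))" using elim(1) by (auto simp: set_web)
  thus ?case by (simp add: set_of_compacts_inject)
 qed
 from distr_cong_AE[OF refl refl this W wm] show ?thesis by (simp add: wl)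
qed

theorem theorem1p1:
  shows "\<exists>!\<mu> :: bw_path compacts measure. prob_space \<mu> \<and> sets \<mu> = sets borel \<and>
    (\<exists>(\<Omega> :: bw_path compacts measure) W.
       prob_space \<Omega> \<and> W \<in> borel_measurable \<Omega> \<and> distr \<Omega> borel W = \<mu> \<and>
       coalescing_fdds \<Omega> W \<and>
       (\<forall>t0 t a b :: real. 0 < t \<and> a \<le> b \<longrightarrow>
          (\<integral>\<^sup>+ \<omega>. eta t0 t a b (W \<omega>) \<partial>\<Omega>) = ennreal (1 + (b - a) / sqrt (pi * t))))"
proof (rule ex1I[of _ web_law], goal_cases)
 case 1
 \<comment> \<open>The law itself serves as the sample space, with the identity as random
   variable.\<close>
 have "(\<lambda>K. K) \<in> borel_measurable web_law" "distr web_law borel (\<lambda>K. K) = web_law"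
  using web_law(2) by (simp_all add: measurable_def distr_id2)
 thus ?case using web_law(1,2) web_law_fdds web_law_eta by blast
next
 case (2 \<mu>)
 thus ?case using web_unique by blast
qed

end
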